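(* Let $s\in(0,1]$, $0\le\gamma\le s$, and $1<p\le q\le \frac{np}{n-(s-\gamma)p}$, where $(s-\gamma)p<n$. Let $\Omega\subset\mathbb{R}^n$ be a bounded John domain, and let $\phi$ be a positive increasing function on $(0,\infty)$ with $\phi(2t)\le C\phi(t)$ for all $t>0$ and some constant $C$, such that $w_\phi\in L^1_{\mathrm{loc}}(\Omega)$. Put $\Phi(t)=\phi(t)^{p/q}$. Let $w$ be a doubling weight and $v$ a weight, and let $\tau\in(0,1)$. If $f\in W^{s,p}_\tau(\Omega)$ and $(w,v)\in A^{s-\gamma,r}_{q,p}(\Omega)$ for some $r>1$, then $$\inf_{c\in\mathbb{R}}\|f-c\|_{L^q(\Omega,\,w_\phi w)}\lesssim [f]_{W^{s,p}_\tau(\Omega,\,w_{\Phi,\gamma p}v)},$$ where the implicit constant is independent of $f$. Moreover, when $s<1$, the right-hand side can be replaced by $[f]_{W^{s,p}_\tau(\Omega,\,v_{\Phi,\gamma p}v)}$.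
   Context: Notation: $d(x)=\inf_{y\in\partial\Omega}|x-y|$ is the distance to the boundary of $\Omega$; $\ell(Q)$ is the sidelength of a cube $Q$ (sides parallel to the axes); $p'=p/(p-1)$; $-\!\!\!\!\!\int_Q g=\frac1{|Q|}\int_Q g\,dx$. A weight is a nonnegative locally integrable function; $w$ is doubling if $\int_{2Q}w\le C\int_Q w$ for all cubes $Q$. $\|g\|_{L^q(\Omega,u)}=\left(\int_\Omega|g|^q u\,dx\right)^{1/q}$. Improving weights: $w_\phi(x)=\phi(d(x))$, $\;w_{\Phi,\gamma p}(x)=d(x)^{\gamma p}\,\Phi(d(x))$, and $v_{\Phi,\gamma p}(x,y)=\min_{z\in\{x,y\}} d(z)^{\gamma p}\,\Phi(d(z))$. Seminorms: for $0<s<1$ and a weight $u$, $$[f]_{W^{s,p}_\tau(\Omega,u)}=\left(\int_\Omega\int_{\Omega\cap B(y,\tau d(y))}\frac{|f(x)-f(y)|^p}{|x-y|^{n+sp}}\,u(y)\,dx\,dy\right)^{1/p},$$ and $[f]_{W^{s,p}_\tau(\Omega,v_{\Phi,\gamma p}v)}$ is the same expression with $u(y)$ replaced by $v_{\Phi,\gamma p}(x,y)\,v(y)$. For $s=1$ (and any $\tau$), $[f]_{W^{1,p}_\tau(\Omega,u)}=\left(\int_\Omega|\nabla f|^p u\,dx\right)^{1/p}$. $W^{s,p}_\tau(\Omega)$ is the space of functions $f\in L^p(\Omega)$ for which the unweighted seminorm ($u\equiv1$) is finite. Weight class: $(w,v)\in A^{\alpha,r}_{q,p}(\Omega)$ means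 $$[w,v]_{A^{\alpha,r}_{q,p}(\Omega)}:=\sup_Q \ell(Q)^{\alpha}|Q|^{\frac1q-\frac1p}\left(-\!\!\!\!\!\!\int_Q w^r\right)^{\frac1{qr}}\left(-\!\!\!\!\!\!\int_Q v^{1-p'}\right)^{\frac1{p'}}<\infty,$$ the supremum being over all cubes $Q\subset\Omega$. John domain: $\Omega$ is a bounded John domain if it is bounded and there are $x_0\in\Omega$ and $C\ge1$ such that every $x\in\Omega$ can be joined to $x_0$ by a rectifiable curve $\kappa:[0,l]\to\Omega$ parametrized by arc length, $\kappa(0)=x$, $\kappa(l)=x_0$, with $d(\kappa(t))\ge t/C$ for all $t$. For bounded domains this is equivalent to being a Boman chain domain: there exist $\sigma,N\ge1$ and a covering $\mathcal{W}$ of $\Omega$ by cubes such that (B1) $\sum_{Q\in\mathcal{W}}\chi_{\sigma Q}\le N\chi_\Omega$ on $\mathbb{R}^n$; (B2) there is a central cube $Q_0\in\mathcal{W}$ which can be connected with every $Q\in\mathcal{W}$ by a finite chain $Q_0,Q_1,\dots,Q_{k}=Q$ ($k=k(Q)$) of cubes from $\mathcal{W}$ with $Q\subset NQ_j$ for $j=0,\dots,k$, and such that $Q_j\cap Q_{j+1}$ contains a cube $R_j$ with $Q_j\cup Q_{j+1}\subset NR_j$. *)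

theory Defs
  imports "HOL-Analysis.Analysis"
begin

definition bdist :: "(real ^ 'n) set \<Rightarrow> real ^ 'n \<Rightarrow> real" where
  "bdist \<Omega> x = infdist x (frontier \<Omega>)"

(* Powers on [0,\<infinity>]. Unlike real powr, a negative power of 0 is \<infinity>; this matters for
   the averages of v^(1-p') where v vanishes. *)
definition epowr :: "ennreal \<Rightarrow> real \<Rightarrow> ennreal" (infixr \<open>epowr\<close> 80) where
  "x epowr a =
     (if a = 0 then 1
      else if (x = 0 \<and> a < 0) \<or> (x = \<infinity> \<and> a > 0) then \<infinity>
      else ennreal (enn2real x powr a))"


subsection \<open>Cubes and weights\<close>

(* closed axis-parallel cube with centre c and sidelength l *)
definition cube :: "real ^ 'n \<Rightarrow> real \<Rightarrow> (real ^ 'n) set" where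
  "cube c l = cbox (c - vec (l / 2)) (c + vec (l / 2))"

definition locally_integrable_on ::
    "(real ^ 'n \<Rightarrow> 'b::euclidean_space) \<Rightarrow> (real ^ 'n) set \<Rightarrow> bool"
    (infixr \<open>locally'_integrable'_on\<close> 46) where
  "f locally_integrable_on S \<longleftrightarrow>
     (\<forall>K. compact K \<and> K \<subseteq> S \<longrightarrow> f absolutely_integrable_on K)"

definition weight_on :: "(real ^ 'n) set \<Rightarrow> (real ^ 'n \<Rightarrow> real) \<Rightarrow> bool" where
  "weight_on S u \<longleftrightarrow> (\<forall>x\<in>S. 0 \<le> u x) \<and> u locally_integrable_on S"

definition doubling :: "(real ^ 'n \<Rightarrow> real) \<Rightarrow> bool" where
  "doubling w \<longleftrightarrow>
     (\<exists>C::real. \<forall>c. \<forall>l>0.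
        (\<integral>\<^sup>+x\<in>cube c (2 * l). ennreal (w x) \<partial>lebesgue)
          \<le> ennreal C * (\<integral>\<^sup>+x\<in>cube c l. ennreal (w x) \<partial>lebesgue))"

definition average :: "(real ^ 'n) set \<Rightarrow> (real ^ 'n \<Rightarrow> ennreal) \<Rightarrow> ennreal" where
  "average Q g = (\<integral>\<^sup>+x\<in>Q. g x \<partial>lebesgue) / emeasure lebesgue Q"

definition conj_exponent :: "real \<Rightarrow> real" where
  "conj_exponent p = p / (p - 1)"

definition A_const ::
    "(real ^ 'n) set \<Rightarrow> real \<Rightarrow> real \<Rightarrow> real \<Rightarrow> real \<Rightarrow>
      (real ^ 'n \<Rightarrow> real) \<Rightarrow> (real ^ 'n \<Rightarrow> real) \<Rightarrow> ennreal" where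
  "A_const \<Omega> \<alpha> r q p w v =
     (SUP (c, l) \<in> {(c, l). 0 < l \<and> cube c l \<subseteq> \<Omega>}.
        ennreal (l powr \<alpha>)
        * emeasure lebesgue (cube c l) epowr (1 / q - 1 / p)
        * (average (cube c l) (\<lambda>x. ennreal (w x) epowr r)) epowr (1 / (q * r))
        * (average (cube c l) (\<lambda>x. ennreal (v x) epowr (1 - conj_exponent p)))
            epowr (1 / conj_exponent p))"

definition A_class ::
    "(real ^ 'n) set \<Rightarrow> real \<Rightarrow> real \<Rightarrow> real \<Rightarrow> real \<Rightarrow>
      ((real ^ 'n \<Rightarrow> real) \<times> (real ^ 'n \<Rightarrow> real)) set" where
  "A_class \<Omega> \<alpha> r q p = {(w, v). A_const \<Omega> \<alpha> r q p w v < \<infinity>}"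

definition w_imp :: "(real ^ 'n) set \<Rightarrow> (real \<Rightarrow> real) \<Rightarrow> real ^ 'n \<Rightarrow> real" where
  "w_imp \<Omega> \<phi> x = \<phi> (bdist \<Omega> x)"

definition w_imp_pow ::
    "(real ^ 'n) set \<Rightarrow> (real \<Rightarrow> real) \<Rightarrow> real \<Rightarrow> real ^ 'n \<Rightarrow> real" where
  "w_imp_pow \<Omega> \<Phi> a x = bdist \<Omega> x powr a * \<Phi> (bdist \<Omega> x)"

definition v_imp_pow ::
    "(real ^ 'n) set \<Rightarrow> (real \<Rightarrow> real) \<Rightarrow> real \<Rightarrow> real ^ 'n \<Rightarrow> real ^ 'n \<Rightarrow> real" where
  "v_imp_pow \<Omega> \<Phi> a x y = (MIN z\<in>{x, y}. bdist \<Omega> z powr a * \<Phi> (bdist \<Omega> z))"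


subsection \<open>John domains\<close>

definition curve_length :: "(real \<Rightarrow> real ^ 'n) \<Rightarrow> real \<Rightarrow> real \<Rightarrow> ennreal" where
  "curve_length \<kappa> a b =
     (SUP ts \<in> {ts. sorted ts \<and> set ts \<subseteq> {a..b}}.
        ennreal (\<Sum>i<length ts - 1. dist (\<kappa> (ts ! i)) (\<kappa> (ts ! Suc i))))"

(* finiteness of the length (rectifiability) is part of the last clause *)
definition arc_length_curve :: "real \<Rightarrow> (real \<Rightarrow> real ^ 'n) \<Rightarrow> bool" where
  "arc_length_curve l \<kappa> \<longleftrightarrow>
     0 \<le> l \<and> continuous_on {0..l} \<kappa> \<and> (\<forall>t\<in>{0..l}. curve_length \<kappa> 0 t = ennreal t)"

definition bounded_John_domain :: "(real ^ 'n) set \<Rightarrow> bool" where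
  "bounded_John_domain \<Omega> \<longleftrightarrow>
     open \<Omega> \<and> connected \<Omega> \<and> bounded \<Omega> \<and>
     (\<exists>x0\<in>\<Omega>. \<exists>C\<ge>1. \<forall>x\<in>\<Omega>. \<exists>l \<kappa>.
        arc_length_curve l \<kappa> \<and> \<kappa> ` {0..l} \<subseteq> \<Omega> \<and> \<kappa> 0 = x \<and> \<kappa> l = x0 \<and>
        (\<forall>t\<in>{0..l}. bdist \<Omega> (\<kappa> t) \<ge> t / C))"


subsection \<open>Weak gradients\<close>

definition pderiv_at :: "'n \<Rightarrow> (real ^ 'n \<Rightarrow> real) \<Rightarrow> real ^ 'n \<Rightarrow> real" where
  "pderiv_at i \<eta> x = frechet_derivative \<eta> (at x) (axis i 1)"

primrec C_k :: "nat \<Rightarrow> (real ^ 'n \<Rightarrow> real) \<Rightarrow> bool" where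
  "C_k 0 \<eta> \<longleftrightarrow> continuous_on UNIV \<eta>"
| "C_k (Suc k) \<eta> \<longleftrightarrow> \<eta> differentiable_on UNIV \<and> (\<forall>i. C_k k (pderiv_at i \<eta>))"

definition test_function_on :: "(real ^ 'n) set \<Rightarrow> (real ^ 'n \<Rightarrow> real) \<Rightarrow> bool" where
  "test_function_on \<Omega> \<eta> \<longleftrightarrow>
     (\<forall>k. C_k k \<eta>) \<and> compact (closure {x. \<eta> x \<noteq> 0}) \<and> closure {x. \<eta> x \<noteq> 0} \<subseteq> \<Omega>"

definition is_weak_gradient ::
    "(real ^ 'n) set \<Rightarrow> (real ^ 'n \<Rightarrow> real) \<Rightarrow> (real ^ 'n \<Rightarrow> real ^ 'n) \<Rightarrow> bool" where
  "is_weak_gradient \<Omega> f g \<longleftrightarrow>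
     f locally_integrable_on \<Omega> \<and> g locally_integrable_on \<Omega> \<and>
     (\<forall>\<eta>. test_function_on \<Omega> \<eta> \<longrightarrow>
        (\<forall>i. (LINT x:\<Omega>|lebesgue. f x * pderiv_at i \<eta> x)
              = - (LINT x:\<Omega>|lebesgue. g x $ i * \<eta> x)))"

(* Weak gradients on an open set are unique up to null sets, so integrals over \<Omega>
   do not depend on the choice. *)
definition weak_gradient ::
    "(real ^ 'n) set \<Rightarrow> (real ^ 'n \<Rightarrow> real) \<Rightarrow> real ^ 'n \<Rightarrow> real ^ 'n" where
  "weak_gradient \<Omega> f = (SOME g. is_weak_gradient \<Omega> f g)"


subsection \<open>Norms and seminorms, with values in [0,\<infinity>]\<close>

definition Lp_norm ::
    "real \<Rightarrow> (real ^ 'n) set \<Rightarrow> (real ^ 'n \<Rightarrow> real) \<Rightarrow> (real ^ 'n \<Rightarrow> real) \<Rightarrow> ennreal" where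
  "Lp_norm q \<Omega> u g = (\<integral>\<^sup>+x\<in>\<Omega>. ennreal (\<bar>g x\<bar> powr q * u x) \<partial>lebesgue) epowr (1 / q)"

definition Lp_space :: "real \<Rightarrow> (real ^ 'n) set \<Rightarrow> (real ^ 'n \<Rightarrow> real) set" where
  "Lp_space p \<Omega> = {f \<in> borel_measurable (lebesgue_on \<Omega>). Lp_norm p \<Omega> (\<lambda>x. 1) f < \<infinity>}"

definition frac_seminorm ::
    "real \<Rightarrow> real \<Rightarrow> real \<Rightarrow> (real ^ 'n) set \<Rightarrow> (real ^ 'n \<Rightarrow> real ^ 'n \<Rightarrow> real) \<Rightarrow>
      (real ^ 'n \<Rightarrow> real) \<Rightarrow> ennreal" where
  "frac_seminorm s p \<tau> \<Omega> U f =
     (\<integral>\<^sup>+y\<in>\<Omega>. (\<integral>\<^sup>+x\<in>\<Omega> \<inter> ball y (\<tau> * bdist \<Omega> y).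
         ennreal (\<bar>f x - f y\<bar> powr p / norm (x - y) powr (real CARD('n) + s * p) * U x y)
       \<partial>lebesgue) \<partial>lebesgue) epowr (1 / p)"

definition grad_seminorm ::
    "real \<Rightarrow> (real ^ 'n) set \<Rightarrow> (real ^ 'n \<Rightarrow> real) \<Rightarrow> (real ^ 'n \<Rightarrow> real) \<Rightarrow> ennreal" where
  "grad_seminorm p \<Omega> u f =
     (if \<exists>g. is_weak_gradient \<Omega> f g
      then (\<integral>\<^sup>+x\<in>\<Omega>. ennreal (norm (weak_gradient \<Omega> f x) powr p * u x) \<partial>lebesgue) epowr (1 / p)
      else \<infinity>)"

definition W_seminorm ::
    "real \<Rightarrow> real \<Rightarrow> real \<Rightarrow> (real ^ 'n) set \<Rightarrow> (real ^ 'n \<Rightarrow> real) \<Rightarrow>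
      (real ^ 'n \<Rightarrow> real) \<Rightarrow> ennreal" where
  "W_seminorm s p \<tau> \<Omega> u f =
     (if s = 1 then grad_seminorm p \<Omega> u f else frac_seminorm s p \<tau> \<Omega> (\<lambda>x y. u y) f)"

definition W_space :: "real \<Rightarrow> real \<Rightarrow> real \<Rightarrow> (real ^ 'n) set \<Rightarrow> (real ^ 'n \<Rightarrow> real) set" where
  "W_space s p \<tau> \<Omega> = {f \<in> Lp_space p \<Omega>. W_seminorm s p \<tau> \<Omega> (\<lambda>x. 1) f < \<infinity>}"

end

theory Submission
  imports Defs
begin

text \<open>
  On a single cube \<open>Q\<close>, let \<open>c\<close> be a median of \<open>f\<close>. The level set \<open>{f - c \<ge> 2\<^sup>k}\<close> is covered up to a null set
  by the maximal dyadic subcubes \<open>D\<close> of which it fills more than a fixed small part. Either at least half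
  of \<open>D\<close> lies below the level \<open>2\<^sup>k\<^sup>-\<^sup>1\<close>, and then an elementary inequality on \<open>D\<close>, Hoelder's inequality for \<open>v\<close> and
  the weight condition bound \<open>2\<^sup>k\<^sup>q w(D)\<close> by the energy of \<open>f\<close> between the two levels (on \<open>D\<close>); or \<open>D\<close> is one of few cubes
  inside a stopping cube of the preceding level and is absorbed, which is where \<open>r > 1\<close> is used. The
  energies of different levels add up and \<open>q \<ge> p\<close>, so summation over \<open>k\<close> gives the strong estimate
  \<open>(\<integral>\<^sub>Q |f - c|\<^sup>q w)\<^sup>1\<^sup>/\<^sup>q \<lesssim> \<ell>(Q)\<^sup>\<gamma> (\<integral>\<^sub>Q \<rho>)\<^sup>1\<^sup>/\<^sup>p\<close>, where \<open>\<rho>\<close> is the energy density; neither maximal functions nor fractional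
  integrals occur.

  For the domain, take cells of size comparable to the distance \<open>d\<close> to the boundary. Following its John
  curve until \<open>d\<close> has doubled, each cell gets a parent, and along the chain of cubes in between the constants
  \<open>c\<close> change by a quantity controlled by the local estimate and the doubling of \<open>w\<close>. The descendants of a
  cell lie in a fixed multiple of it and \<open>\<phi>\<close> is increasing, so the weights \<open>\<phi>(d) w(cell)\<close> satisfy a Carleson condition on
  this tree, and a Hardy inequality on the tree sums the oscillations from the root to all cells.
\<close>

subsection \<open>Hoelder inequalities\<close>

text \<open>The weight \<open>w\<close> is merely doubling, so no A_infinity property says that a
  set of small Lebesgue measure has small \<open>w\<close>-mass. The exponent r > 1 supplies a
  substitute: the set function |D|^(1 - 1/r) (integral of w^r over D)^(1/r) dominates w(D), is what
  the two-weight condition bounds, and its sum over disjoint subcubes gains a positive power of the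
  fraction of the cube that they fill. The stopping threshold is chosen so that this gain beats the
  factor 2^q lost between consecutive levels. Absorption requires finite sums; therefore depth and
  levels stay truncated until the end. Passing through levels 2^k is the truncation method of
  Maz'ya: a level sees only the energy of its own band, and t^(q/p) is superadditive, over disjoint
  cubes as well as over levels. On a cell the factor \<ell>^\<gamma> of the cube estimate is
  comparable to d^\<gamma>, and the exponent p/q in \<Phi> is the one that the power q/p of the
  energy turns back into \<phi>.\<close>

lemma nn_integral_Holder:
  fixes f g :: "'a \<Rightarrow> real"
  assumes [measurable]: "f \<in> borel_measurable M" "g \<in> borel_measurable M"
    and nonneg: "\<And>x. 0 \<le> f x" "\<And>x. 0 \<le> g x" and p: "1 < p"
    and A: "(\<integral>\<^sup>+x. ennreal (f x powr p) \<partial>M) \<le> ennreal A" "0 \<le> A"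
    and B: "(\<integral>\<^sup>+x. ennreal (g x powr conj_exponent p) \<partial>M) \<le> ennreal B" "0 \<le> B"
  shows "(\<integral>\<^sup>+x. ennreal (f x * g x) \<partial>M) \<le> ennreal (A powr (1 / p) * B powr (1 - 1 / p))"
proof -
  define p' where "p' = conj_exponent p"
  have p': "1 < p'" "1 / p + 1 / p' = 1" "1 / p' = 1 - 1 / p"
    using p by (auto simp: p'_def conj_exponent_def field_simps)
  show ?thesis
  proof (cases "A = 0 \<or> B = 0")
    case True
    have "AE x in M. f x * g x = 0"
      using True
    proof
      assume "A = 0"
      then have "AE x in M. ennreal (f x powr p) = 0"
        using A by (auto simp: nn_integral_0_iff_AE)
      then show ?thesis by eventually_elim (use p in auto)
    next
      assume "B = 0"
      then have "AE x in M. ennreal (g x powr p') = 0"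
        using B by (auto simp: nn_integral_0_iff_AE p'_def)
      then show ?thesis by eventually_elim (use p' in auto)
    qed
    then have "(\<integral>\<^sup>+x. ennreal (f x * g x) \<partial>M) = (\<integral>\<^sup>+x. 0 \<partial>M)"
      by (intro nn_integral_cong_AE) auto
    then show ?thesis by simp
  next
    case False
    then have pos: "0 < A" "0 < B" using A B by auto
    \<comment> \<open>Young's inequality is applied to \<open>f x / a\<close> and
      \<open>g x / b\<close>. The normalisation uses the upper bounds \<open>A\<close> and
      \<open>B\<close>, not the integrals themselves, so a vanishing bound had to be split off
      beforehand.\<close>
    define a b where "a = A powr (1 / p)" and "b = B powr (1 - 1 / p)"
    have ab: "0 < a" "0 < b" "a powr p = A" "b powr p' = B"
      using pos p p'(1) by (auto simp: a_def b_def powr_powr simp flip: p'(3))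
    have young: "f x * g x \<le> (a * b) * (f x powr p / (p * A) + g x powr p' / (p' * B))" for x
    proof -
      have "(f x / a) * (g x / b) \<le> (f x / a) powr p / p + (g x / b) powr p' / p'"
        by (rule Youngs_inequality) (use p p' nonneg ab in auto)
      also have "\<dots> = f x powr p / (p * A) + g x powr p' / (p' * B)"
        using nonneg ab by (simp add: powr_divide mult.commute)
      finally show ?thesis using ab by (simp add: field_simps)
    qed
    have "(\<integral>\<^sup>+x. ennreal (f x * g x) \<partial>M) \<le>
      (\<integral>\<^sup>+x. ennreal (a * b / (p * A)) * ennreal (f x powr p) + ennreal (a * b / (p' * B)) * ennreal (g x powr p') \<partial>M)"
    proof (rule nn_integral_mono)
      fix x
      show "ennreal (f x * g x) \<le> ennreal (a * b / (p * A)) * ennreal (f x powr p) + ennreal (a * b / (p' * B)) * ennreal (g x powr p')"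
        using young[of x] p p' pos ab by (simp flip: ennreal_mult'' ennreal_plus add: field_simps)
    qed
    also have "\<dots> = ennreal (a * b / (p * A)) * (\<integral>\<^sup>+x. ennreal (f x powr p) \<partial>M)
        + ennreal (a * b / (p' * B)) * (\<integral>\<^sup>+x. ennreal (g x powr p') \<partial>M)"
      by (simp add: nn_integral_add nn_integral_cmult)
    also have "\<dots> \<le> ennreal (a * b / (p * A)) * ennreal A + ennreal (a * b / (p' * B)) * ennreal B"
      by (intro add_mono mult_left_mono) (use A B in \<open>auto simp: p'_def\<close>)
    also have "\<dots> = ennreal (a * b * (1 / p + 1 / p'))"
      using p p'(1) pos ab by (simp flip: ennreal_mult'' ennreal_plus add: field_simps)
    finally show ?thesis using p' by (simp add: a_def b_def)
  qed
qed

text \<open>Hoelder for counting measure, in the exponents in which it meets \<open>Wr\<close>: the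
  first factor will carry Lebesgue measures of cubes, the second the integrals of \<open>w\<close>
  to the power \<open>r\<close>.\<close>

lemma sum_Holder:
  fixes f g :: "'a \<Rightarrow> real"
  assumes "finite I" and nonneg: "\<And>x. x \<in> I \<Longrightarrow> 0 \<le> f x" "\<And>x. x \<in> I \<Longrightarrow> 0 \<le> g x" and r: "1 < r"
  shows "(\<Sum>x\<in>I. f x powr (1 - 1 / r) * g x powr (1 / r))
    \<le> (\<Sum>x\<in>I. f x) powr (1 - 1 / r) * (\<Sum>x\<in>I. g x) powr (1 / r)"
proof -
  define f' g' where "f' x = (if x \<in> I then f x powr (1 - 1 / r) else 0)"
    and "g' x = (if x \<in> I then g x powr (1 / r) else 0)" for x
  have c: "(1 - 1 / r) * conj_exponent r = 1" using r by (auto simp: conj_exponent_def field_simps)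
  have *: "g' x powr r = g x" "f' x powr conj_exponent r = f x"
    if "x \<in> I" for x
    using that nonneg[OF that] r c by (auto simp: f'_def g'_def powr_powr)
  have nn: "0 \<le> f' x" "0 \<le> g' x" for x by (auto simp: f'_def g'_def)
  have "(\<integral>\<^sup>+x. ennreal (g' x * f' x) \<partial>count_space I)
    \<le> ennreal ((\<Sum>x\<in>I. g x) powr (1 / r) * (\<Sum>x\<in>I. f x) powr (1 - 1 / r))"
    by (rule nn_integral_Holder)
      (use assms in \<open>auto simp: nn_integral_count_space_finite * sum_nonneg nn\<close>)
  moreover have "(\<integral>\<^sup>+x. ennreal (g' x * f' x) \<partial>count_space I) = ennreal (\<Sum>x\<in>I. f x powr (1 - 1 / r) * g x powr (1 / r))"
    using assms by (subst nn_integral_count_space_finite) (auto simp: sum_ennreal f'_def g'_def mult.commute intro!: sum.cong)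
  ultimately show ?thesis by (simp add: mult.commute)
qed

text \<open>Each \<open>f x\<close> is at most the total S, so its power is at most
  \<open>f x\<close> times S^(a-1). With a = q / p this is where p \<le> q enters: powers of the
  energies of disjoint sets add up to at most the power of the whole energy.\<close>

lemma sum_powr_le_powr_sum:
  fixes f :: "'a \<Rightarrow> real"
  assumes "finite I" "\<And>x. x \<in> I \<Longrightarrow> 0 \<le> f x" "1 \<le> a"
  shows "(\<Sum>x\<in>I. f x powr a) \<le> (\<Sum>x\<in>I. f x) powr a"
proof -
  define S where "S = (\<Sum>x\<in>I. f x)"
  have le: "f x \<le> S" if "x \<in> I" for x unfolding S_def using assms that by (intro member_le_sum) auto
  have S0: "0 \<le> S" unfolding S_def using assms by (intro sum_nonneg)
  have "f x powr a \<le> f x * S powr (a - 1)" if "x \<in> I" for x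
  proof -
    have "f x powr a = f x * f x powr (a - 1)" using assms(2)[OF that] by (cases "f x = 0") (auto simp: powr_mult_base)
    also have "\<dots> \<le> f x * S powr (a - 1)" using assms that le by (intro mult_left_mono powr_mono2) auto
    finally show ?thesis .
  qed
  then have "(\<Sum>x\<in>I. f x powr a) \<le> (\<Sum>x\<in>I. f x * S powr (a - 1))" by (rule sum_mono)
  also have "\<dots> = S * S powr (a - 1)" by (simp add: S_def sum_distrib_right)
  also have "\<dots> = S powr a" using S0 by (cases "S = 0") (auto simp: powr_mult_base)
  finally show ?thesis by (simp add: S_def)
qed

lemma sigma_finite_lebesgue: "sigma_finite_measure (lebesgue :: 'a::euclidean_space measure)"
proof
  obtain A :: "'a set set" where "countable A" "A \<subseteq> sets lborel" "\<Union>A = space lborel" "\<forall>a\<in>A. emeasure lborel a \<noteq> \<infinity>"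
    using lborel.sigma_finite_countable by blast
  then show "\<exists>A::'a set set. countable A \<and> A \<subseteq> sets lebesgue \<and> \<Union> A = space lebesgue \<and> (\<forall>a\<in>A. emeasure lebesgue a \<noteq> \<infinity>)"
    by (intro exI[of _ A]) (auto simp: emeasure_completion)
qed

subsection \<open>Dyadic cubes\<close>

text \<open>Half-open, so that the cubes of one dyadic generation partition their parent exactly.
  The weight class speaks of closed cubes; these contain the half-open ones and have the same
  measure.\<close>

definition hcube :: "real ^ 'n \<Rightarrow> real \<Rightarrow> (real ^ 'n) set" where
  "hcube a l = {y. \<forall>i. a $ i \<le> y $ i \<and> y $ i < a $ i + l}"

lemma hcube_subset_cbox: "hcube a l \<subseteq> cbox a (a + vec l)"
  by (auto simp: hcube_def mem_box_cart less_imp_le)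

lemma box_subset_hcube: "box a (a + vec l) \<subseteq> hcube a l"
  by (auto simp: hcube_def mem_box_cart less_imp_le)

lemma sets_hcube [measurable]: "hcube a l \<in> sets borel"
proof -
  have "hcube a l = (\<Inter>i. {y. a $ i \<le> y $ i} \<inter> {y. y $ i < a $ i + l})"
    by (auto simp: hcube_def)
  also have "\<dots> \<in> sets borel"
    using closed_halfspace_component_ge_cart open_halfspace_component_lt_cart
    by (intro sets.finite_INT sets.Int borel_closed borel_open) auto
  finally show ?thesis .
qed

lemma sets_lebesgue_hcube [measurable, simp]: "hcube a l \<in> sets lebesgue"
  using sets_hcube by (metis sets_completionI_sets sets_lborel)

lemma emeasure_cbox_vec:
  fixes a :: "real ^ 'n"
  assumes "0 \<le> l"
  shows "emeasure lebesgue (cbox a (a + vec l)) = ennreal (l ^ CARD('n))"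
proof -
  have "emeasure lborel (cbox a (a + vec l)) = ennreal (\<Prod>b\<in>Basis. (a + vec l - a) \<bullet> b)"
    using assms by (intro emeasure_lborel_cbox) (auto simp: Basis_vec_def inner_axis)
  also have "(\<Prod>b\<in>Basis. (a + vec l - a) \<bullet> b) = (\<Prod>b\<in>(Basis :: (real ^ 'n) set). l)"
    by (intro prod.cong refl) (auto simp: Basis_vec_def inner_axis)
  finally show ?thesis by simp
qed

lemma emeasure_hcube:
  fixes a :: "real ^ 'n"
  assumes "0 \<le> l"
  shows "emeasure lebesgue (hcube a l) = ennreal (l ^ CARD('n))"
proof (rule antisym)
  show "emeasure lebesgue (hcube a l) \<le> ennreal (l ^ CARD('n))"
    using emeasure_mono[OF hcube_subset_cbox, of a l lebesgue] emeasure_cbox_vec[OF assms, of a] by simp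
  have "emeasure lebesgue (cbox a (a + vec l)) = emeasure lebesgue (box a (a + vec l))"
    by (simp add: emeasure_lborel_cbox_eq emeasure_lborel_box_eq)
  then show "ennreal (l ^ CARD('n)) \<le> emeasure lebesgue (hcube a l)"
    using emeasure_mono[OF box_subset_hcube, of a l lebesgue] emeasure_cbox_vec[OF assms, of a] by simp
qed

lemma lmeasurable_hcube [simp]: "hcube a l \<in> lmeasurable"
  by (rule lmeasurable_cbox[THEN fmeasurableI2, OF hcube_subset_cbox]) simp

lemma measure_hcube:
  fixes a :: "real ^ 'n"
  shows "0 \<le> l \<Longrightarrow> measure lebesgue (hcube a l) = l ^ CARD('n)"
  unfolding measure_def by (subst emeasure_hcube) simp_all


text \<open>A dyadic cube is named by any point \<open>x\<close> in it: two points lie in the same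
  cube iff their rescaled coordinates have equal floors. Disjointness and nesting thus become
  statements about equality of floors.\<close>

definition dyadic :: "real ^ 'n \<Rightarrow> real \<Rightarrow> nat \<Rightarrow> real ^ 'n \<Rightarrow> (real ^ 'n) set" where
  "dyadic a l j x = {y. \<forall>i. \<lfloor>2 ^ j * (y $ i - a $ i) / l\<rfloor> = \<lfloor>2 ^ j * (x $ i - a $ i) / l\<rfloor>}"

lemma dyadic_refl [simp]: "x \<in> dyadic a l j x" by (simp add: dyadic_def)

lemma dyadic_eq: "y \<in> dyadic a l j x \<Longrightarrow> dyadic a l j y = dyadic a l j x"
  by (auto simp: dyadic_def)

lemma dyadic_Suc_subset: "dyadic a l (Suc j) x \<subseteq> dyadic a l j x"
proof -
  have *: "\<lfloor>t\<rfloor> = \<lfloor>2 * t\<rfloor> div 2" for t :: real by linarith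
  have "\<lfloor>2 ^ j * s / l\<rfloor> = \<lfloor>2 ^ Suc j * s / l\<rfloor> div 2" for s
    using *[of "2 ^ j * s / l"] by (simp add: mult.assoc)
  then show ?thesis unfolding dyadic_def by (auto simp del: power_Suc)
qed

lemma dyadic_antimono: "i \<le> j \<Longrightarrow> dyadic a l j x \<subseteq> dyadic a l i x"
  by (induction rule: dec_induct) (use dyadic_Suc_subset in blast)+

lemma dyadic_eq_hcube:
  assumes l: "0 < l"
  shows "dyadic a l j x = hcube (\<chi> i. a $ i + l / 2 ^ j * \<lfloor>2 ^ j * (x $ i - a $ i) / l\<rfloor>) (l / 2 ^ j)"
proof -
  have "\<lfloor>2 ^ j * (y - c) / l\<rfloor> = m \<longleftrightarrow> c + l / 2 ^ j * m \<le> y \<and> y < c + l / 2 ^ j * m + l / 2 ^ j"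
    for y c and m :: int
    using l by (auto simp: floor_eq_iff field_simps)
  then show ?thesis by (simp only: dyadic_def hcube_def vec_lambda_beta)
qed

lemma dyadic_0:
  assumes l: "0 < l" and "x \<in> hcube a l"
  shows "dyadic a l 0 x = hcube a l"
proof -
  have "\<lfloor>(x $ i - a $ i) / l\<rfloor> = 0" for i
    using assms by (auto simp: hcube_def floor_eq_iff field_simps)
  then show ?thesis using l by (subst dyadic_eq_hcube) (simp_all add: hcube_def)
qed

lemma dyadic_subset:
  assumes l: "0 < l" and "x \<in> hcube a l"
  shows "dyadic a l j x \<subseteq> hcube a l"
  using dyadic_0[OF assms] dyadic_antimono[of 0 j a l x] by simp

lemma measure_dyadic:
  fixes a :: "real ^ 'n"
  assumes "0 < l"
  shows "measure lebesgue (dyadic a l j x) = (l / 2 ^ j) ^ CARD('n)"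
  unfolding dyadic_eq_hcube[OF assms] using assms by (intro measure_hcube) simp

definition dyadics :: "real ^ 'n \<Rightarrow> real \<Rightarrow> nat \<Rightarrow> (real ^ 'n) set set" where
  "dyadics a l j = dyadic a l j ` hcube a l"

text \<open>The bound on the depth makes the family finite. Hence every selected cube lies in a
  maximal one, and all sums in the absorption argument are finite; the depth tends to infinity only
  in \<open>sum_levels_le\<close>.\<close>

definition dyadics_upto :: "real ^ 'n \<Rightarrow> real \<Rightarrow> nat \<Rightarrow> (real ^ 'n) set set" where
  "dyadics_upto a l m = (\<Union>j\<le>m. dyadics a l j)"

lemma finite_dyadics:
  fixes a :: "real ^ 'n"
  assumes l: "0 < l"
  shows "finite (dyadics a l j)"
proof -
  let ?f = "\<lambda>m :: 'n \<Rightarrow> int. {y :: real ^ 'n. \<forall>i. \<lfloor>2 ^ j * (y $ i - a $ i) / l\<rfloor> = m i}"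
  have "dyadic a l j x \<in> ?f ` (PiE UNIV (\<lambda>_. {0..<2 ^ j}))" if "x \<in> hcube a l" for x
  proof
    show "(\<lambda>i. \<lfloor>2 ^ j * (x $ i - a $ i) / l\<rfloor>) \<in> (PiE UNIV (\<lambda>_. {0..<2 ^ j}))"
    proof -
      have "0 \<le> x $ i - a $ i" "x $ i - a $ i < l" for i using that by (auto simp: hcube_def algebra_simps)
      then have "0 \<le> 2 ^ j * (x $ i - a $ i) / l" "2 ^ j * (x $ i - a $ i) / l < 2 ^ j" for i
        using l by (auto simp: divide_less_eq)
      then show ?thesis by (auto simp: floor_less_iff)
    qed
  qed (simp add: dyadic_def)
  then have "dyadics a l j \<subseteq> ?f ` (PiE UNIV (\<lambda>_. {0..<2 ^ j}))" by (auto simp: dyadics_def)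
  then show ?thesis by (rule finite_subset) (intro finite_imageI finite_PiE, auto)
qed

lemma finite_dyadics_upto: "0 < l \<Longrightarrow> finite (dyadics_upto a l m)"
  by (simp add: dyadics_upto_def finite_dyadics)

lemma dyadics_upto_mono: "m \<le> m' \<Longrightarrow> dyadics_upto a l m \<subseteq> dyadics_upto a l m'"
  unfolding dyadics_upto_def by (intro UN_mono) auto

lemma dyadics_upto_hcube:
  assumes "0 < l" "D \<in> dyadics_upto a l m"
  obtains b \<rho> where "D = hcube b \<rho>" "0 < \<rho>" "\<rho> \<le> l" "D \<subseteq> hcube a l"
proof -
  obtain j x where D: "D = dyadic a l j x" "x \<in> hcube a l"
    using assms by (auto simp: dyadics_upto_def dyadics_def)
  have "l / 2 ^ j \<le> l" using assms by (simp add: field_simps)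
  then show ?thesis using that[of _ "l / 2 ^ j"] dyadic_eq_hcube[of l a j x] dyadic_subset[of l x a j] assms D by auto
qed

lemma dyadics_upto_nested:
  assumes "0 < l" "D \<in> dyadics_upto a l m" "D' \<in> dyadics_upto a l m" "D \<inter> D' \<noteq> {}"
  shows "D \<subseteq> D' \<or> D' \<subseteq> D"
proof -
  obtain j x i y where D: "D = dyadic a l j x" "D' = dyadic a l i y"
    using assms by (auto simp: dyadics_upto_def dyadics_def)
  obtain z where "z \<in> D" "z \<in> D'" using assms by auto
  then have "D = dyadic a l j z" "D' = dyadic a l i z" using D by (auto dest: dyadic_eq)
  then show ?thesis using dyadic_antimono[of i j a l z] dyadic_antimono[of j i a l z] by (cases "i \<le> j") auto
qed

lemma hcube_mem_dyadics_upto: "0 < l \<Longrightarrow> hcube a l \<in> dyadics_upto a l m"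
  using dyadic_0[of l a a] by (force simp: dyadics_upto_def dyadics_def hcube_def)

text \<open>The parent is what maximality speaks about: a maximal selected cube other than the whole
  cube has a parent that was not selected and is only 2^n times as large.\<close>

lemma dyadics_upto_parent:
  fixes a :: "real ^ 'n"
  assumes l: "0 < l" and D: "D \<in> dyadics_upto a l m" "D \<noteq> hcube a l"
  obtains P where "P \<in> dyadics_upto a l m" "D \<subset> P" "measure lebesgue P = 2 ^ CARD('n) * measure lebesgue D"
proof -
  obtain j x where jx: "D = dyadic a l j x" "x \<in> hcube a l" "j \<le> m"
    using assms by (auto simp: dyadics_upto_def dyadics_def)
  obtain i where i: "j = Suc i" using jx D dyadic_0[OF l, of x a] by (cases j) auto
  define P where "P = dyadic a l i x"
  have mP: "measure lebesgue P = 2 ^ CARD('n) * measure lebesgue D"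
    unfolding P_def jx i measure_dyadic[OF l] by (simp flip: power_mult_distrib)
  have "0 < measure lebesgue D" using l unfolding jx measure_dyadic[OF l] by simp
  then have "1 * measure lebesgue D < 2 ^ CARD('n) * measure lebesgue D"
    by (intro mult_strict_right_mono one_less_power) auto
  then have "D \<noteq> P" using mP by auto
  moreover have "D \<subseteq> P" unfolding P_def jx i by (rule dyadic_Suc_subset)
  moreover have "P \<in> dyadics_upto a l m"
    using jx i by (auto simp: P_def dyadics_upto_def dyadics_def intro!: bexI[of _ i])
  ultimately show ?thesis using that mP by blast
qed

lemma sum_measure_disjoint_le:
  assumes "finite F" "disjoint F" "\<And>D. D \<in> F \<Longrightarrow> D \<in> sets M" "\<And>D. D \<in> F \<Longrightarrow> D \<subseteq> S" "S \<in> fmeasurable M"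
  shows "(\<Sum>D\<in>F. measure M D) \<le> measure M S"
proof -
  have "(\<Sum>D\<in>F. measure M D) = measure M (\<Union>F)"
    using assms by (intro measure_Union'[symmetric] fmeasurableI2[OF assms(5)])
      (auto simp: disjoint_def pairwise_def disjnt_def)
  also have "\<dots> \<le> measure M S"
    using assms by (intro measure_mono_fmeasurable) auto
  finally show ?thesis .
qed

lemma dyadic_in_open:
  fixes a :: "real ^ 'n"
  assumes l: "0 < l" and "open T" "x \<in> T"
  shows "\<exists>j. dyadic a l j x \<subseteq> T"
proof -
  obtain e where e: "0 < e" "ball x e \<subseteq> T" using assms open_contains_ball by blast
  obtain j where j: "real CARD('n) * l / e < 2 ^ j" using real_arch_pow[of 2] by auto
  have "dist x y < e" if "y \<in> dyadic a l j x" for y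
  proof -
    have "\<bar>x $ i - y $ i\<bar> \<le> l / 2 ^ j" for i
      using that dyadic_refl[of x a l j] unfolding dyadic_eq_hcube[OF l, of a j x] hcube_def
      by (auto dest!: spec[of _ i])
    then have "norm (x - y) \<le> (\<Sum>i\<in>(UNIV::'n set). l / 2 ^ j)"
      by (intro order_trans[OF norm_le_l1_cart] sum_mono) auto
    also have "\<dots> = real CARD('n) * l / 2 ^ j" by simp
    also have "\<dots> < e" using j e by (simp add: field_simps)
    finally show ?thesis by (simp add: dist_norm)
  qed
  then show ?thesis using e by (intro exI[of _ j]) (auto simp: subset_iff)
qed

text \<open>A weak form of the density theorem, proved without maximal functions. Enclose the
  exceptional set Z in an open T of nearly the same measure and fill T with dyadic cubes meeting Z.
  Each contains at most the fraction \<open>\<epsilon>\<close> of E, hence of Z, so |Z| \<le>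
  \<epsilon> |T|, and \<open>\<epsilon>\<close> < 1 leaves only |Z| = 0.\<close>

lemma dyadic_density:
  fixes a :: "real ^ 'n"
  assumes l: "0 < l" and E: "E \<in> sets lebesgue" "E \<subseteq> hcube a l" and \<epsilon>: "0 \<le> \<epsilon>" "\<epsilon> < 1"
  shows "negligible {x \<in> E. \<forall>j. measure lebesgue (dyadic a l j x \<inter> E) \<le> \<epsilon> * measure lebesgue (dyadic a l j x)}"
    (is "negligible ?Z")
proof -
  define Z where "Z = ?Z"
  define U where "U j = \<Union>{D \<in> dyadics a l j. \<not> measure lebesgue (D \<inter> E) \<le> \<epsilon> * measure lebesgue D}" for j
  have leb: "D \<in> sets lebesgue" "D \<subseteq> hcube a l" if "D \<in> dyadics a l j" for D j
    using that l dyadic_subset[OF l] by (auto simp: dyadics_def dyadic_eq_hcube)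
  have Uleb: "U j \<in> sets lebesgue" for j
    unfolding U_def using finite_dyadics[OF l, of a j] leb(1) by (intro sets.finite_Union) auto
  have "x \<in> U j \<longleftrightarrow> \<not> measure lebesgue (dyadic a l j x \<inter> E) \<le> \<epsilon> * measure lebesgue (dyadic a l j x)"
    if "x \<in> E" for x j
  proof
    assume "x \<in> U j"
    then obtain y where y: "x \<in> dyadic a l j y" "\<not> measure lebesgue (dyadic a l j y \<inter> E) \<le> \<epsilon> * measure lebesgue (dyadic a l j y)"
      by (auto simp: U_def dyadics_def)
    then show "\<not> measure lebesgue (dyadic a l j x \<inter> E) \<le> \<epsilon> * measure lebesgue (dyadic a l j x)"
      using dyadic_eq[OF y(1)] by simp
  next
    assume "\<not> measure lebesgue (dyadic a l j x \<inter> E) \<le> \<epsilon> * measure lebesgue (dyadic a l j x)"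
    then show "x \<in> U j" unfolding U_def dyadics_def using that E dyadic_refl by blast
  qed
  then have ZU: "Z = E - (\<Union>j. U j)" unfolding Z_def by blast
  have Z: "Z \<in> sets lebesgue" unfolding ZU using Uleb E by auto
  have ZE: "Z \<subseteq> hcube a l" using E by (auto simp: Z_def)
  have Zl: "Z \<in> lmeasurable"
    by (rule fmeasurableI2[OF lmeasurable_hcube[of a l]]) (use Z ZE in auto)
  have "measure lebesgue Z \<le> \<epsilon> * (measure lebesgue Z + e)" if e: "0 < e" for e
  proof -
    obtain T where T: "open T" "Z \<subseteq> T" and TZ: "T - Z \<in> lmeasurable" "emeasure lebesgue (T - Z) < ennreal e"
      by (rule sets_lebesgue_outer_open[OF Z e])
    have T_eq: "T = Z \<union> (T - Z)" using T by blast
    have Tl: "T \<in> lmeasurable" using fmeasurable.Un[OF Zl TZ(1)] unfolding T_eq[symmetric] .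
    have "measure lebesgue T = measure lebesgue Z + measure lebesgue (T - Z)"
      using measure_Un2[OF Zl Tl] unfolding Un_absorb1[OF T(2)] .
    also have "measure lebesgue (T - Z) \<le> e"
      using TZ e emeasure_eq_measure2[OF TZ(1)] by (simp add: ennreal_less_iff less_imp_le)
    finally have Te: "measure lebesgue T \<le> measure lebesgue Z + e" by simp
    \<comment> \<open>Cubes of one generation inside T that meet Z. They are disjoint, and the
      portions of Z which they cover increase with \<open>j\<close> and exhaust Z, because the cubes
      around a point of the open set T eventually lie in T.\<close>
    define F where "F j = {D \<in> dyadics a l j. D \<subseteq> T \<and> D \<inter> Z \<noteq> {}}" for j
    have finF: "finite (F j)" for j unfolding F_def using finite_dyadics[OF l, of a j] by auto
    have F: "measure lebesgue (Z \<inter> \<Union>(F j)) \<le> \<epsilon> * measure lebesgue T" for j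
    proof -
      have disj: "disjoint (F j)"
      proof (rule disjointI)
        fix D D' assume "D \<in> F j" "D' \<in> F j" "D \<noteq> D'"
        then obtain x y where "D = dyadic a l j x" "D' = dyadic a l j y" by (auto simp: F_def dyadics_def)
        with \<open>D \<noteq> D'\<close> show "D \<inter> D' = {}" using dyadic_eq[of _ a l j] by (metis disjoint_iff)
      qed
      have "measure lebesgue (Z \<inter> \<Union>(F j)) \<le> (\<Sum>D\<in>F j. measure lebesgue (Z \<inter> D))"
        unfolding Int_Union using finF leb Zl Z by (intro measure_UNION_le) (auto simp: F_def)
      also have "\<dots> \<le> (\<Sum>D\<in>F j. \<epsilon> * measure lebesgue D)"
      proof (rule sum_mono)
        fix D assume "D \<in> F j"
        then obtain x z where D: "D = dyadic a l j x" "x \<in> hcube a l" "z \<in> D" "z \<in> Z"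
          by (auto simp: F_def dyadics_def)
        \<comment> \<open>Renaming the cube by its point \<open>z\<close> of Z makes the density
          bound defining Z available for it.\<close>
        then have Dz: "D = dyadic a l j z" using dyadic_eq by blast
        have DE: "D \<inter> E \<in> lmeasurable" using leb[of D j] D E
          by (intro fmeasurableI2[OF lmeasurable_hcube[of a l]]) (auto simp: dyadics_def)
        have "measure lebesgue (Z \<inter> D) \<le> measure lebesgue (D \<inter> E)"
          using leb[of D j] D Z by (intro measure_mono_fmeasurable DE) (auto simp: dyadics_def Z_def)
        also have "\<dots> \<le> \<epsilon> * measure lebesgue D" using D(4) Dz by (auto simp: Z_def)
        finally show "measure lebesgue (Z \<inter> D) \<le> \<epsilon> * measure lebesgue D" .
      qed
      also have "\<dots> = \<epsilon> * (\<Sum>D\<in>F j. measure lebesgue D)" by (simp add: sum_distrib_left)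
      also have "\<dots> \<le> \<epsilon> * measure lebesgue T"
        using finF disj Tl leb \<epsilon> by (intro mult_left_mono sum_measure_disjoint_le) (auto simp: F_def)
      finally show ?thesis .
    qed
    have mono: "incseq (\<lambda>j. Z \<inter> \<Union>(F j))"
    proof (rule incseq_SucI, rule subsetI)
      fix j z assume "z \<in> Z \<inter> \<Union>(F j)"
      then obtain x where x: "z \<in> Z" "z \<in> dyadic a l j x" "dyadic a l j x \<subseteq> T" by (auto simp: F_def dyadics_def)
      have "dyadic a l (Suc j) z \<subseteq> T" using x dyadic_eq[OF x(2)] dyadic_Suc_subset[of a l j z] by auto
      then show "z \<in> Z \<inter> \<Union>(F (Suc j))"
        using x ZE dyadic_refl[of z a l "Suc j"] unfolding F_def dyadics_def by blast
    qed
    have un: "(\<Union>j. Z \<inter> \<Union>(F j)) = Z"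
    proof (intro antisym subsetI)
      fix z assume z: "z \<in> Z"
      then obtain j where "dyadic a l j z \<subseteq> T" using dyadic_in_open[OF l T(1), of z a] T by blast
      then show "z \<in> (\<Union>j. Z \<inter> \<Union>(F j))"
        using z ZE dyadic_refl[of z a l j] unfolding F_def dyadics_def by blast
    qed auto
    have "(\<lambda>j. measure lebesgue (Z \<inter> \<Union>(F j))) \<longlonglongrightarrow> measure lebesgue (\<Union>j. Z \<inter> \<Union>(F j))"
    proof (rule Lim_measure_incseq[OF _ mono])
      show "range (\<lambda>j. Z \<inter> \<Union>(F j)) \<subseteq> sets lebesgue"
        using Z finF leb by (auto simp: F_def intro!: sets.Int sets.finite_Union)
      show "emeasure lebesgue (\<Union>j. Z \<inter> \<Union>(F j)) \<noteq> \<infinity>"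
        unfolding un using Zl by (auto simp: fmeasurable_def)
    qed
    then have "measure lebesgue Z \<le> \<epsilon> * measure lebesgue T"
      unfolding un by (rule LIMSEQ_le_const2) (use F in auto)
    also have "\<dots> \<le> \<epsilon> * (measure lebesgue Z + e)" using Te \<epsilon> by (intro mult_left_mono) auto
    finally show ?thesis .
  qed
  note le = this
  have *: "measure lebesgue Z * (1 - \<epsilon>) \<le> \<epsilon> * e" if "0 < e" for e
    using le[OF that] by (simp add: algebra_simps)
  have "measure lebesgue Z * (1 - \<epsilon>) \<le> 0"
  proof (rule field_le_epsilon)
    fix e :: real assume "0 < e"
    then show "measure lebesgue Z * (1 - \<epsilon>) \<le> 0 + e"
      using *[of e] mult_right_mono[of \<epsilon> 1 e] \<epsilon> by linarith
  qed
  then have "measure lebesgue Z = 0"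
    using \<epsilon> measure_nonneg[of lebesgue Z] by (simp add: mult_le_0_iff antisym)
  then show ?thesis using Zl negligible_iff_measure unfolding Z_def by blast
qed

subsection \<open>Stopping cubes and level sets\<close>

lemma sum_UN_le_sum_sum:
  fixes f :: "'a \<Rightarrow> real"
  assumes "finite I" "\<And>i. i \<in> I \<Longrightarrow> finite (B i)" "\<And>x. 0 \<le> f x"
  shows "sum f (\<Union>i\<in>I. B i) \<le> (\<Sum>i\<in>I. sum f (B i))"
  using assms(1,2)
proof (induction I rule: finite_induct)
  case (insert i I)
  have "sum f (\<Union>j\<in>insert i I. B j) \<le> sum f (B i) + sum f (\<Union>j\<in>I. B j)"
    using insert assms(3) by (simp add: sum_Un sum_nonneg)
  then show ?case using insert by auto
qed simp

text \<open>In the application \<open>E k\<close> is the set where h \<ge> 2^k, \<open>N\<close> has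
  density w^r, \<open>\<mu> k\<close> is the energy between two levels and t = q / p. The bound on
  \<open>E k\<close> by half of the cube comes from the median. Assumption \<open>good\<close> is
  the local inequality on a cube that meets \<open>E k\<close> noticeably while at least half of it
  avoids \<open>E (k - 1)\<close>.\<close>

locale stopping_cubes =
  fixes a :: "real ^ 'n" and l r t q \<epsilon> H :: real
    and N :: "(real ^ 'n) measure" and \<mu> :: "int \<Rightarrow> (real ^ 'n) measure" and E :: "int \<Rightarrow> (real ^ 'n) set"
  assumes l: "0 < l" and r: "1 < r" and t: "1 \<le> t" and q: "0 < q" and H: "0 \<le> H"
    and \<epsilon>: "0 < \<epsilon>" "\<epsilon> \<le> 1 / 2" "2 powr q * (2 * 2 ^ CARD('n) * \<epsilon>) powr (1 - 1 / r) \<le> 1 / 2"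
    and N: "sets N = sets lebesgue" "hcube a l \<in> fmeasurable N"
    and \<mu>: "\<And>k. sets (\<mu> k) = sets lebesgue" "\<And>k. hcube a l \<in> fmeasurable (\<mu> k)"
    and E: "\<And>k. E k \<in> sets lebesgue" "\<And>k. E k \<subseteq> hcube a l" "\<And>k. E k \<subseteq> E (k - 1)"
      "\<And>k. measure lebesgue (E k) \<le> measure lebesgue (hcube a l) / 2"
    and good: "\<And>m D k. D \<in> dyadics_upto a l m \<Longrightarrow> \<epsilon> * measure lebesgue D < measure lebesgue (D \<inter> E k) \<Longrightarrow>
      measure lebesgue (D \<inter> E (k - 1)) \<le> measure lebesgue D / 2 \<Longrightarrow>
      2 powr (k * q) * (measure lebesgue D powr (1 - 1 / r) * measure N D powr (1 / r)) \<le> H * measure (\<mu> k) D powr t"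
begin

text \<open>Hoelder's upper bound for w(D). It is carried instead of w(D) itself, because the factor
  |D|^(1 - 1/r) turns smallness in Lebesgue measure into smallness of the sum.\<close>

definition Wr :: "(real ^ 'n) set \<Rightarrow> real" where
  "Wr D = measure lebesgue D powr (1 - 1 / r) * measure N D powr (1 / r)"

definition big :: "int \<Rightarrow> (real ^ 'n) set \<Rightarrow> bool" where
  "big k D \<longleftrightarrow> \<epsilon> * measure lebesgue D < measure lebesgue (D \<inter> E k)"

definition max_big :: "nat \<Rightarrow> int \<Rightarrow> (real ^ 'n) set set" where
  "max_big m k = {D \<in> dyadics_upto a l m. big k D \<and> (\<forall>D'\<in>dyadics_upto a l m. D \<subset> D' \<longrightarrow> \<not> big k D')}"

lemma Wr_nonneg: "0 \<le> Wr D" by (simp add: Wr_def)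

lemma dyadics_sets: "D \<in> dyadics_upto a l m \<Longrightarrow> D \<in> sets lebesgue \<and> D \<subseteq> hcube a l \<and> D \<in> lmeasurable \<and> 0 < measure lebesgue D"
  by (elim dyadics_upto_hcube[OF l]) (auto simp: measure_hcube simp del: measure_completion)

lemma Int_E: "D \<in> sets lebesgue \<Longrightarrow> D \<inter> E k \<in> lmeasurable"
  by (rule fmeasurableI2[OF lmeasurable_hcube[of a l]]) (use E in auto)

lemma finite_max_big: "finite (max_big m k)"
  unfolding max_big_def using finite_dyadics_upto[OF l, of a m] by auto

lemma max_big_disjoint: "disjoint (max_big m k)"
proof (rule disjointI)
  fix D D' assume "D \<in> max_big m k" "D' \<in> max_big m k" "D \<noteq> D'"
  then show "D \<inter> D' = {}"
    using dyadics_upto_nested[OF l, of D a m D'] by (auto simp: max_big_def)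
qed

lemma big_subset_max_big:
  assumes "D \<in> dyadics_upto a l m" "big k D"
  obtains D' where "D' \<in> max_big m k" "D \<subseteq> D'"
proof -
  let ?S = "{D' \<in> dyadics_upto a l m. big k D'}"
  have "finite ?S" using finite_dyadics_upto[OF l, of a m] by auto
  moreover have "D \<in> ?S" using assms by auto
  ultimately obtain M where M: "M \<in> ?S" "D \<subseteq> M" "\<forall>b\<in>?S. M \<subseteq> b \<longrightarrow> M = b"
    using finite_has_maximal2[of ?S D] by (auto simp: eq_commute)
  then have "M \<in> max_big m k" by (auto simp: max_big_def)
  then show ?thesis using that M by blast
qed

text \<open>The total Lebesgue measure of the family survives as a factor with the positive exponent
  1 - 1/r. For a family that fills little of S this factor is the gain that makes absorption
  possible.\<close>

lemma sum_Wr_le: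
  assumes F: "finite F" "disjoint F" "\<And>D. D \<in> F \<Longrightarrow> D \<in> sets lebesgue" "\<And>D. D \<in> F \<Longrightarrow> D \<subseteq> S"
    and S: "S \<subseteq> hcube a l" "S \<in> sets lebesgue"
  shows "(\<Sum>D\<in>F. Wr D) \<le> (\<Sum>D\<in>F. measure lebesgue D) powr (1 - 1 / r) * measure N S powr (1 / r)"
proof -
  have "(\<Sum>D\<in>F. Wr D) \<le> (\<Sum>D\<in>F. measure lebesgue D) powr (1 - 1 / r) * (\<Sum>D\<in>F. measure N D) powr (1 / r)"
    unfolding Wr_def by (rule sum_Holder) (use F r in auto)
  also have "\<dots> \<le> (\<Sum>D\<in>F. measure lebesgue D) powr (1 - 1 / r) * measure N S powr (1 / r)"
    using F S r N by (intro mult_left_mono powr_mono2 sum_measure_disjoint_le sum_nonneg)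
      (auto intro!: fmeasurableI2[OF N(2)])
  finally show ?thesis .
qed

lemma sum_Wr_max_big_le: "(\<Sum>D\<in>max_big m k. Wr D) \<le> Wr (hcube a l)"
proof -
  have sub: "D \<in> sets lebesgue \<and> D \<subseteq> hcube a l" if "D \<in> max_big m k" for D
    using that dyadics_sets by (auto simp: max_big_def)
  have "(\<Sum>D\<in>max_big m k. Wr D) \<le> (\<Sum>D\<in>max_big m k. measure lebesgue D) powr (1 - 1 / r) * measure N (hcube a l) powr (1 / r)"
    by (rule sum_Wr_le) (use sub in \<open>auto simp: finite_max_big max_big_disjoint\<close>)
  also have "\<dots> \<le> Wr (hcube a l)"
    unfolding Wr_def using sub r
    by (intro mult_right_mono powr_mono2 sum_measure_disjoint_le sum_nonneg finite_max_big max_big_disjoint) auto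
  finally show ?thesis .
qed

definition X :: "nat \<Rightarrow> int \<Rightarrow> real" where
  "X m k = 2 powr (k * q) * (\<Sum>D\<in>max_big m k. Wr D)"

definition mt :: "int \<Rightarrow> real" where
  "mt k = measure (\<mu> k) (hcube a l) powr t"

text \<open>A selected cube is bad if it is already half filled by the next lower level set. Bad cubes lie in
  selected cubes of that level, of which they fill only a small part by maximality.\<close>

lemma bad_sum_le:
  assumes P: "P \<in> max_big m (k - 1)"
  defines "B \<equiv> {D \<in> max_big m k. measure lebesgue D / 2 < measure lebesgue (D \<inter> E (k - 1)) \<and> D \<subseteq> P}"
  shows "2 powr (k * q) * (\<Sum>D\<in>B. Wr D)
    \<le> 1 / 2 * (2 powr (real_of_int (k - 1) * q) * Wr P) + (if P = hcube a l then 2 powr q * H * mt (k - 1) else 0)"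
proof -
  have Pd: "P \<in> dyadics_upto a l m" "big (k - 1) P" using P by (auto simp: max_big_def)
  note Ps = dyadics_sets[OF Pd(1)]
  have B: "finite B" "disjoint B" "\<And>D. D \<in> B \<Longrightarrow> D \<in> sets lebesgue \<and> D \<subseteq> P"
  proof -
    show "finite B" unfolding B_def using finite_max_big[of m k] by auto
    show "disjoint B" using max_big_disjoint[of m k] by (auto simp: B_def disjoint_def)
    show "D \<in> sets lebesgue \<and> D \<subseteq> P" if "D \<in> B" for D
      using that dyadics_sets[of D m] by (auto simp: B_def max_big_def)
  qed
  have kq: "2 powr (k * q) = 2 powr q * 2 powr (real_of_int (k - 1) * q)"
    by (simp add: algebra_simps flip: powr_add)
  have sumB: "(\<Sum>D\<in>B. Wr D) \<le> (\<Sum>D\<in>B. measure lebesgue D) powr (1 - 1 / r) * measure N P powr (1 / r)"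
    using B Ps by (intro sum_Wr_le) auto
  show ?thesis
  proof (cases "P = hcube a l")
    case True
    have "(\<Sum>D\<in>B. Wr D) \<le> Wr P"
      unfolding Wr_def[of P] using B Ps r
      by (intro order_trans[OF sumB] mult_right_mono powr_mono2 sum_measure_disjoint_le sum_nonneg) auto
    then have "2 powr (k * q) * (\<Sum>D\<in>B. Wr D) \<le> 2 powr q * (2 powr (real_of_int (k - 1) * q) * Wr P)"
      unfolding kq by (simp add: mult.assoc mult_left_mono)
    \<comment> \<open>The whole cube has no parent to compare with. It is, however, good for the
      level k - 1, since \<open>E (k - 2)\<close> fills at most half of it, so its contribution is
      bounded by energy directly.\<close>
    also have "2 powr (real_of_int (k - 1) * q) * Wr P \<le> H * mt (k - 1)"
    proof -
      have "P \<inter> E (k - 1 - 1) = E (k - 1 - 1)" using True E by auto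
      then show ?thesis
        using good[OF Pd(1), of "k - 1"] Pd(2) True E(4)[of "k - 1 - 1"]
        by (simp add: Wr_def mt_def big_def del: measure_completion)
    qed
    finally have "2 powr (k * q) * (\<Sum>D\<in>B. Wr D) \<le> 2 powr q * H * mt (k - 1)" by (simp add: mult.assoc)
    moreover have "0 \<le> 1 / 2 * (2 powr (real_of_int (k - 1) * q) * Wr P)" using Wr_nonneg[of P] by simp
    ultimately show ?thesis using True by simp
  next
    case False
    then obtain R where R: "R \<in> dyadics_upto a l m" "P \<subset> R" "measure lebesgue R = 2 ^ CARD('n) * measure lebesgue P"
      by (rule dyadics_upto_parent[OF l Pd(1)])
    have Rs: "R \<in> sets lebesgue" using dyadics_sets[OF R(1)] by simp
    \<comment> \<open>By maximality of P its parent R contains little of \<open>E (k - 1)\<close>.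
      Every bad cube in P is at least half filled by that set, so together they have measure at most
      2 \<epsilon> |R|, and |R| = 2^n |P|.\<close>
    have "\<not> big (k - 1) R" using P R by (auto simp: max_big_def)
    then have RE: "measure lebesgue (R \<inter> E (k - 1)) \<le> \<epsilon> * (2 ^ CARD('n) * measure lebesgue P)"
      using R(3) by (simp add: big_def)
    have "(\<Sum>D\<in>B. measure lebesgue D) \<le> (\<Sum>D\<in>B. 2 * measure lebesgue (D \<inter> E (k - 1)))"
      by (rule sum_mono) (auto simp: B_def)
    also have "\<dots> = 2 * (\<Sum>D\<in>B. measure lebesgue (D \<inter> E (k - 1)))" by (simp add: sum_distrib_left)
    also have "(\<Sum>D\<in>B. measure lebesgue (D \<inter> E (k - 1))) = measure lebesgue (\<Union>D\<in>B. D \<inter> E (k - 1))"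
      using B Int_E by (intro measure_UNION'[symmetric]) (auto simp: disjoint_def pairwise_def disjnt_def)
    also have "\<dots> \<le> measure lebesgue (R \<inter> E (k - 1))"
    proof (rule measure_mono_fmeasurable)
      show "(\<Union>D\<in>B. D \<inter> E (k - 1)) \<subseteq> R \<inter> E (k - 1)" using B(3) R(2) by blast
      show "(\<Union>D\<in>B. D \<inter> E (k - 1)) \<in> sets lebesgue" using B E by (intro sets.finite_UN) auto
    qed (rule Int_E[OF Rs])
    also note RE
    finally have "(\<Sum>D\<in>B. measure lebesgue D) \<le> 2 * 2 ^ CARD('n) * \<epsilon> * measure lebesgue P" by (simp add: algebra_simps)
    then have "(\<Sum>D\<in>B. measure lebesgue D) powr (1 - 1 / r) \<le> (2 * 2 ^ CARD('n) * \<epsilon> * measure lebesgue P) powr (1 - 1 / r)"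
      using r by (intro powr_mono2 sum_nonneg) auto
    also have "\<dots> = (2 * 2 ^ CARD('n) * \<epsilon>) powr (1 - 1 / r) * measure lebesgue P powr (1 - 1 / r)"
      using \<epsilon> by (intro powr_mult)
    finally have "(\<Sum>D\<in>B. Wr D) \<le> (2 * 2 ^ CARD('n) * \<epsilon>) powr (1 - 1 / r) * Wr P"
      unfolding Wr_def[of P] by (intro order_trans[OF sumB]) (simp add: mult_right_mono flip: mult.assoc)
    then have "2 powr (k * q) * (\<Sum>D\<in>B. Wr D) \<le> 2 powr (k * q) * ((2 * 2 ^ CARD('n) * \<epsilon>) powr (1 - 1 / r) * Wr P)"
      by (intro mult_left_mono) auto
    also have "\<dots> = (2 powr q * (2 * 2 ^ CARD('n) * \<epsilon>) powr (1 - 1 / r)) * (2 powr (real_of_int (k - 1) * q) * Wr P)"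
      unfolding kq by (simp add: algebra_simps)
    \<comment> \<open>The third condition on \<open>\<epsilon>\<close> is used here: the gain from
      the small filling outweighs the factor 2^q between the levels k - 1 and k.\<close>
    also have "\<dots> \<le> 1 / 2 * (2 powr (real_of_int (k - 1) * q) * Wr P)"
      using \<epsilon> Wr_nonneg by (intro mult_right_mono) auto
    finally show ?thesis using False by simp
  qed
qed

text \<open>Good cubes of level k are paid for by the energy of that level, and superadditivity of
  t-th powers adds them up. Bad cubes are grouped by the selected cube of level k - 1 that contains
  them; this yields half of the preceding \<open>X\<close>, and a term in \<open>mt (k - 1)\<close>
  from the whole cube.\<close>

lemma X_le: "X m k \<le> H * mt k + 2 powr q * H * mt (k - 1) + 1 / 2 * X m (k - 1)"
proof -
  define G where "G = {D \<in> max_big m k. measure lebesgue (D \<inter> E (k - 1)) \<le> measure lebesgue D / 2}"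
  define B where "B P = {D \<in> max_big m k. measure lebesgue D / 2 < measure lebesgue (D \<inter> E (k - 1)) \<and> D \<subseteq> P}" for P
  have fin: "finite G" "\<And>P. finite (B P)" using finite_max_big[of m k] by (auto simp: G_def B_def)
  have sub: "D \<in> sets lebesgue \<and> D \<subseteq> hcube a l" if "D \<in> max_big m k" for D
    using that dyadics_sets by (auto simp: max_big_def)
  have "max_big m k \<subseteq> G \<union> (\<Union>P\<in>max_big m (k - 1). B P)"
  proof
    fix D assume D: "D \<in> max_big m k"
    then have Dd: "D \<in> dyadics_upto a l m" by (simp add: max_big_def)
    show "D \<in> G \<union> (\<Union>P\<in>max_big m (k - 1). B P)"
    proof (cases "measure lebesgue D / 2 < measure lebesgue (D \<inter> E (k - 1))")
      case True
      \<comment> \<open>This is the reason for \<epsilon> \<le> 1/2: a cube more than half filled by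
        \<open>E (k - 1)\<close> is big for that level and therefore lies in a maximal one.\<close>
      have "\<epsilon> * measure lebesgue D \<le> 1 / 2 * measure lebesgue D"
        using \<epsilon> by (intro mult_right_mono) auto
      then have "big (k - 1) D" using True unfolding big_def by linarith
      then obtain P where "P \<in> max_big m (k - 1)" "D \<subseteq> P" by (rule big_subset_max_big[OF Dd])
      then show ?thesis using True D by (auto simp: B_def)
    qed (use D in \<open>auto simp: G_def\<close>)
  qed
  then have "(\<Sum>D\<in>max_big m k. Wr D) \<le> (\<Sum>D\<in>G \<union> (\<Union>P\<in>max_big m (k - 1). B P). Wr D)"
    using fin finite_max_big[of m "k - 1"] Wr_nonneg by (intro sum_mono2) auto
  also have "\<dots> \<le> (\<Sum>D\<in>G. Wr D) + (\<Sum>D\<in>(\<Union>P\<in>max_big m (k - 1). B P). Wr D)"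
    using fin finite_max_big[of m "k - 1"] Wr_nonneg by (simp add: sum_Un sum_nonneg)
  also have "(\<Sum>D\<in>(\<Union>P\<in>max_big m (k - 1). B P). Wr D) \<le> (\<Sum>P\<in>max_big m (k - 1). \<Sum>D\<in>B P. Wr D)"
    using fin finite_max_big[of m "k - 1"] Wr_nonneg
    by (intro sum_UN_le_sum_sum)
  finally have "X m k \<le> 2 powr (k * q) * ((\<Sum>D\<in>G. Wr D) + (\<Sum>P\<in>max_big m (k - 1). \<Sum>D\<in>B P. Wr D))"
    unfolding X_def by (intro mult_left_mono) auto
  also have "\<dots> = (\<Sum>D\<in>G. 2 powr (k * q) * Wr D) + (\<Sum>P\<in>max_big m (k - 1). 2 powr (k * q) * (\<Sum>D\<in>B P. Wr D))"
    by (simp add: distrib_left sum_distrib_left)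
  also have "(\<Sum>D\<in>G. 2 powr (k * q) * Wr D) \<le> H * mt k"
  proof -
    have "(\<Sum>D\<in>G. 2 powr (k * q) * Wr D) \<le> (\<Sum>D\<in>G. H * measure (\<mu> k) D powr t)"
      unfolding Wr_def by (intro sum_mono good[of _ m]) (auto simp: G_def max_big_def big_def)
    also have "\<dots> = H * (\<Sum>D\<in>G. measure (\<mu> k) D powr t)" by (simp add: sum_distrib_left)
    also have "(\<Sum>D\<in>G. measure (\<mu> k) D powr t) \<le> (\<Sum>D\<in>G. measure (\<mu> k) D) powr t"
      using fin t by (intro sum_powr_le_powr_sum) auto
    also have "(\<Sum>D\<in>G. measure (\<mu> k) D) powr t \<le> mt k"
      unfolding mt_def using fin t \<mu> max_big_disjoint[of m k] sub
      by (intro powr_mono2 sum_measure_disjoint_le sum_nonneg) (auto simp: G_def disjoint_def)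
    finally show ?thesis using H by (simp add: mult_left_mono)
  qed
  also have "(\<Sum>P\<in>max_big m (k - 1). 2 powr (k * q) * (\<Sum>D\<in>B P. Wr D))
    \<le> (\<Sum>P\<in>max_big m (k - 1). 1 / 2 * (2 powr (real_of_int (k - 1) * q) * Wr P) + (if P = hcube a l then 2 powr q * H * mt (k - 1) else 0))"
    unfolding B_def by (intro sum_mono bad_sum_le)
  also have "\<dots> = 1 / 2 * X m (k - 1) + (\<Sum>P\<in>max_big m (k - 1). if P = hcube a l then 2 powr q * H * mt (k - 1) else 0)"
    by (simp add: X_def sum.distrib sum_distrib_left)
  also have "(\<Sum>P\<in>max_big m (k - 1). if P = hcube a l then 2 powr q * H * mt (k - 1) else 0) \<le> 2 powr q * H * mt (k - 1)"
    using H by (simp add: sum.delta' finite_max_big mt_def)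
  finally show ?thesis by simp
qed


lemma X_nonneg: "0 \<le> X m k" by (simp add: X_def sum_nonneg Wr_nonneg)

text \<open>Summing the recursion puts half of the same finite sum on the right, where it is
  absorbed. Only the level just below the range is left over; it is bounded trivially by its power
  of two times \<open>Wr\<close> of the whole cube.\<close>

lemma sum_X_le:
  assumes T: "\<And>K. finite K \<Longrightarrow> (\<Sum>k\<in>K. measure (\<mu> k) (hcube a l)) \<le> T" and K: "0 \<le> K"
  shows "(\<Sum>k=-K..K. X m k) \<le> 2 * (1 + 2 powr q) * H * T powr t + 2 powr (- (K + 1) * q) * Wr (hcube a l)"
proof -
  have mt: "(\<Sum>k\<in>J. mt k) \<le> T powr t" if "finite J" for J
    unfolding mt_def using that t T[OF that] 
    by (intro order_trans[OF sum_powr_le_powr_sum] powr_mono2 sum_nonneg) auto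
  have shift: "(\<Sum>k=-K..K. h (k - 1)) = (\<Sum>k=-K-1..K-1. h k)" for h :: "int \<Rightarrow> real"
    by (rule sum.reindex_bij_witness[of _ "\<lambda>k. k + 1" "\<lambda>k. k - 1"]) auto
  have "(\<Sum>k=-K-1..K-1. X m k) \<le> (\<Sum>k=-K-1..K. X m k)" by (intro sum_mono2 X_nonneg) auto
  also have "{-K-1..K} = insert (-K-1) {-K..K}" using K by auto
  finally have shiftX: "(\<Sum>k=-K-1..K-1. X m k) \<le> X m (-K-1) + (\<Sum>k=-K..K. X m k)" by simp
  have X0: "X m (-K-1) \<le> 2 powr (- (K + 1) * q) * Wr (hcube a l)"
    unfolding X_def by (intro mult_mono sum_Wr_max_big_le) (auto simp: sum_nonneg Wr_nonneg)
  have "(\<Sum>k=-K..K. X m k) \<le> (\<Sum>k=-K..K. H * mt k + 2 powr q * H * mt (k - 1) + 1 / 2 * X m (k - 1))"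
    by (intro sum_mono X_le)
  also have "\<dots> = H * (\<Sum>k=-K..K. mt k) + 2 powr q * H * (\<Sum>k=-K-1..K-1. mt k) + 1 / 2 * (\<Sum>k=-K-1..K-1. X m k)"
    by (simp add: sum.distrib sum_distrib_left flip: shift)
  also have "\<dots> \<le> H * T powr t + 2 powr q * H * T powr t + 1 / 2 * (X m (-K-1) + (\<Sum>k=-K..K. X m k))"
    using H by (intro add_mono mult_left_mono mt shiftX) auto
  finally show ?thesis using X0 by (simp add: algebra_simps)
qed

text \<open>Two limits in this order: the depth m tends to infinity, where the density lemma shows
  that the selected cubes cover \<open>E k\<close> up to a null set; then the range of levels grows,
  and the remainder of \<open>sum_X_le\<close> disappears.\<close>

lemma sum_levels_le:
  fixes V :: "(real ^ 'n) measure"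
  assumes T: "\<And>K. finite K \<Longrightarrow> (\<Sum>k\<in>K. measure (\<mu> k) (hcube a l)) \<le> T"
    and V: "sets V = sets lebesgue" "hcube a l \<in> fmeasurable V"
      "\<And>m D. D \<in> dyadics_upto a l m \<Longrightarrow> measure V D \<le> Wr D" "null_sets lebesgue \<subseteq> null_sets V"
  shows "(\<Sum>k=-K..K. 2 powr (k * q) * measure V (E k)) \<le> 2 * (1 + 2 powr q) * H * T powr t"
proof -
  define U where "U m k = \<Union>(max_big m k)" for m k
  have sub: "D \<in> sets lebesgue \<and> D \<subseteq> hcube a l" if "D \<in> max_big m k" for D m k
    using that dyadics_sets by (auto simp: max_big_def)
  have U_sets: "U m k \<in> sets lebesgue" "U m k \<subseteq> hcube a l" for m k
    unfolding U_def using sub finite_max_big by (auto intro!: sets.finite_Union)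
  have U_alt: "U m k = \<Union>{D \<in> dyadics_upto a l m. big k D}" for m k
  proof
    show "U m k \<subseteq> \<Union>{D \<in> dyadics_upto a l m. big k D}" by (auto simp: U_def max_big_def)
    show "\<Union>{D \<in> dyadics_upto a l m. big k D} \<subseteq> U m k"
    proof
      fix x assume "x \<in> \<Union>{D \<in> dyadics_upto a l m. big k D}"
      then obtain D where D: "D \<in> dyadics_upto a l m" "big k D" "x \<in> D" by blast
      from big_subset_max_big[OF D(1,2)] D(3) show "x \<in> U m k" unfolding U_def by blast
    qed
  qed
  have U_mono: "U m k \<subseteq> U (Suc m) k" for m k
    unfolding U_alt using dyadics_upto_mono[of m "Suc m" a l] by auto
  have VU: "2 powr (k * q) * measure V (U m k) \<le> X m k" for m k
  proof -
    have "measure V (U m k) \<le> (\<Sum>D\<in>max_big m k. measure V D)"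
      unfolding U_def using sub V finite_max_big by (intro measure_Union_le) auto
    also have "\<dots> \<le> (\<Sum>D\<in>max_big m k. Wr D)"
      using V by (intro sum_mono) (auto simp: max_big_def)
    finally show ?thesis unfolding X_def by (intro mult_left_mono) auto
  qed
  \<comment> \<open>A point of \<open>E k\<close> in no selected cube of any depth has dyadic
    density at most \<open>\<epsilon>\<close> in all cubes around it. Such points form a null set,
    for \<open>V\<close> as well by absolute continuity.\<close>
  have VE: "measure V (E k) \<le> measure V (\<Union>m. U m k)" for k
  proof -
    define Z where "Z = {x \<in> E k. \<forall>j. measure lebesgue (dyadic a l j x \<inter> E k) \<le> \<epsilon> * measure lebesgue (dyadic a l j x)}"
    have "negligible Z"
      unfolding Z_def by (rule dyadic_density) (use l E \<epsilon> in auto)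
    then have Z: "Z \<in> null_sets V" using V negligible_iff_null_sets by blast
    have "E k \<subseteq> (\<Union>m. U m k) \<union> Z"
    proof
      fix x assume x: "x \<in> E k"
      show "x \<in> (\<Union>m. U m k) \<union> Z"
      proof (cases "x \<in> Z")
        case False
        then obtain j where "big k (dyadic a l j x)" using x by (auto simp: Z_def big_def not_le)
        moreover have "dyadic a l j x \<in> dyadics_upto a l j" using x E(2) by (auto simp: dyadics_upto_def dyadics_def)
        ultimately have "x \<in> U j k" unfolding U_alt using dyadic_refl by blast
        then show ?thesis by auto
      qed auto
    qed
    moreover have fm: "(\<Union>m. U m k) \<in> fmeasurable V"
      by (rule fmeasurableI2[OF V(2)]) (use U_sets V(1) in \<open>blast, auto\<close>)
    moreover have Zf: "Z \<in> fmeasurable V" using Z by (auto simp: fmeasurable_def null_sets_def)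
    ultimately have "measure V (E k) \<le> measure V ((\<Union>m. U m k) \<union> Z)"
      using E V by (intro measure_mono_fmeasurable fmeasurable.Un) auto
    also have "\<dots> \<le> measure V (\<Union>m. U m k) + measure V Z"
      using fm Zf by (intro measure_Un_le) (auto simp: fmeasurable_def)
    also have "measure V Z = 0" using Z by (simp add: measure_def null_sets_def)
    finally show ?thesis by simp
  qed
  have lim: "(\<lambda>m. measure V (U m k)) \<longlonglongrightarrow> measure V (\<Union>m. U m k)" for k
  proof (rule Lim_measure_incseq)
    show "range (\<lambda>m. U m k) \<subseteq> sets V" using U_sets V by auto
    show "incseq (\<lambda>m. U m k)" using U_mono by (intro incseq_SucI)
    have "(\<Union>m. U m k) \<in> fmeasurable V"
      by (rule fmeasurableI2[OF V(2)]) (use U_sets V(1) in \<open>blast, auto\<close>)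
    then show "emeasure V (\<Union>m. U m k) \<noteq> \<infinity>" by (auto simp: fmeasurable_def)
  qed
  define C where "C = 2 * (1 + 2 powr q) * H * T powr t"
  \<comment> \<open>The recursion is summed over the larger range -L..L. The remainder depends on L
    alone, so it can tend to 0 while the left-hand side stays fixed.\<close>
  have bound: "(\<Sum>k=-K..K. 2 powr (k * q) * measure V (E k)) \<le> C + 2 powr (real_of_int (- (L + 1)) * q) * Wr (hcube a l)"
    if L: "K \<le> L" "0 \<le> L" for L
  proof -
    have "(\<Sum>k=-K..K. 2 powr (k * q) * measure V (E k)) \<le> (\<Sum>k=-K..K. 2 powr (k * q) * measure V (\<Union>m. U m k))"
      by (intro sum_mono mult_left_mono VE) auto
    also have "\<dots> \<le> C + 2 powr (real_of_int (- (L + 1)) * q) * Wr (hcube a l)"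
    proof (rule LIMSEQ_le_const2)
      show "(\<lambda>m. \<Sum>k=-K..K. 2 powr (k * q) * measure V (U m k)) \<longlonglongrightarrow> (\<Sum>k=-K..K. 2 powr (k * q) * measure V (\<Union>m. U m k))"
        by (intro tendsto_sum tendsto_mult tendsto_const lim)
      have "(\<Sum>k=-K..K. 2 powr (k * q) * measure V (U m k)) \<le> C + 2 powr (real_of_int (- (L + 1)) * q) * Wr (hcube a l)" for m
      proof -
        have "(\<Sum>k=-K..K. 2 powr (k * q) * measure V (U m k)) \<le> (\<Sum>k=-K..K. X m k)" by (intro sum_mono VU)
        also have "\<dots> \<le> (\<Sum>k=-L..L. X m k)" using L by (intro sum_mono2 X_nonneg) auto
        also have "\<dots> \<le> C + 2 powr (real_of_int (- (L + 1)) * q) * Wr (hcube a l)"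
          unfolding C_def using sum_X_le[OF T L(2), of m] by simp
        finally show ?thesis .
      qed
      then show "\<exists>N. \<forall>m\<ge>N. (\<Sum>k=-K..K. 2 powr (k * q) * measure V (U m k)) \<le> C + 2 powr (real_of_int (- (L + 1)) * q) * Wr (hcube a l)"
        by blast
    qed
    finally show ?thesis .
  qed
  have "(\<lambda>n. C + 2 powr (- (real_of_int (int n) + 1) * q) * Wr (hcube a l)) \<longlonglongrightarrow> C + 0 * Wr (hcube a l)"
  proof (intro tendsto_intros)
    have "(\<lambda>n. (2 powr (- q)) ^ n * 2 powr (- q)) \<longlonglongrightarrow> 0 * 2 powr (- q)"
      using q by (intro tendsto_mult LIMSEQ_realpow_zero tendsto_const) (auto simp: powr_less_one)
    moreover have "(2 powr (- q)) ^ n * 2 powr (- q) = 2 powr (- (real_of_int (int n) + 1) * q)" for n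
    proof -
      have "(2 powr (- q)) ^ n = (2 powr (- q)) powr real n" by (simp add: powr_realpow)
      then show ?thesis by (simp add: powr_powr algebra_simps flip: powr_add)
    qed
    ultimately show "(\<lambda>n. 2 powr (- (real_of_int (int n) + 1) * q)) \<longlonglongrightarrow> 0" by simp
  qed
  then have "(\<Sum>k=-K..K. 2 powr (k * q) * measure V (E k)) \<le> C + 0 * Wr (hcube a l)"
  proof (rule LIMSEQ_le_const)
    show "\<exists>N. \<forall>n\<ge>N. (\<Sum>k=-K..K. 2 powr (k * q) * measure V (E k))
      \<le> C + 2 powr (- (real_of_int (int n) + 1) * q) * Wr (hcube a l)"
    proof (intro exI allI impI)
      fix n assume "nat K \<le> n"
      then show "(\<Sum>k=-K..K. 2 powr (k * q) * measure V (E k))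
        \<le> C + 2 powr (- (real_of_int (int n) + 1) * q) * Wr (hcube a l)"
        using bound[of "int n"] by simp
    qed
  qed
  then show ?thesis by (simp add: C_def)
qed

end

text \<open>The second entry of the minimum solves 2^q (2 2^n \<epsilon>)^(1 - 1/r) = 1/2 for
  \<open>\<epsilon>\<close>; the factor 2 stands for half-filled cubes and 2^n for the passage to
  the parent.\<close>

definition stop_eps :: "nat \<Rightarrow> real \<Rightarrow> real \<Rightarrow> real" where
  "stop_eps n q r = min (1 / 2) ((1 / (2 * 2 powr q)) powr (1 / (1 - 1 / r)) / (2 * 2 ^ n))"

lemma stop_eps:
  assumes "1 < r"
  shows "0 < stop_eps n q r" "stop_eps n q r \<le> 1 / 2"
    "2 powr q * (2 * 2 ^ n * stop_eps n q r) powr (1 - 1 / r) \<le> 1 / 2"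
proof -
  show pos: "0 < stop_eps n q r" by (simp add: stop_eps_def)
  show "stop_eps n q r \<le> 1 / 2" by (simp add: stop_eps_def)
  have r: "0 < 1 - 1 / r" using assms by simp
  define z where "z = (1 / (2 * 2 powr q)) powr (1 / (1 - 1 / r))"
  have "stop_eps n q r \<le> z / (2 * 2 ^ n)" by (simp add: stop_eps_def z_def)
  then have "2 * 2 ^ n * stop_eps n q r \<le> z" by (simp add: field_simps)
  then have "(2 * 2 ^ n * stop_eps n q r) powr (1 - 1 / r) \<le> z powr (1 - 1 / r)"
    using pos r by (intro powr_mono2) auto
  also have "\<dots> = 1 / (2 * 2 powr q)"
  proof -
    have "1 / u * u = 1" if "0 < u" for u :: real using that by simp
    from this[OF r] show ?thesis by (simp only: z_def powr_powr) simp
  qed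
  finally have "2 powr q * (2 * 2 ^ n * stop_eps n q r) powr (1 - 1 / r) \<le> 2 powr q * (1 / (2 * 2 powr q))"
    by (intro mult_left_mono) auto
  then show "2 powr q * (2 * 2 ^ n * stop_eps n q r) powr (1 - 1 / r) \<le> 1 / 2" by simp
qed

lemma measure_density_eq:
  assumes "g \<in> borel_measurable M" "A \<in> sets M"
  shows "measure (density M g) A = enn2real (\<integral>\<^sup>+x\<in>A. g x \<partial>M)"
  using assms by (simp add: measure_def emeasure_density)

lemma fmeasurable_density_iff:
  assumes "g \<in> borel_measurable M" "A \<in> sets M"
  shows "A \<in> fmeasurable (density M g) \<longleftrightarrow> (\<integral>\<^sup>+x\<in>A. g x \<partial>M) < \<infinity>"
  using assms by (simp add: fmeasurable_def emeasure_density)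

text \<open>Here \<open>\<sigma> D\<close> stands for the dual quantity (integral of v^(1-p') over
  D)^(1 - 1/p). It occurs on the right of the local inequality \<open>PI\<close> and on the left of
  the two-weight condition \<open>A\<close>; multiplying the two eliminates it and leaves
  \<delta>^\<gamma> \<le> \<ell>^\<gamma>. The result is the assumption \<open>good\<close> with H =
  (C K \<ell>^\<gamma>)^q.\<close>

lemma level_set_estimate:
  fixes a :: "real ^ 'n" and h w :: "real ^ 'n \<Rightarrow> real" and \<rho> :: "int \<Rightarrow> real ^ 'n \<Rightarrow> ennreal"
    and \<sigma> :: "(real ^ 'n) set \<Rightarrow> real"
  assumes l: "0 < l" and pq: "1 < p" "p \<le> q" and r: "1 < r" and \<gamma>: "0 \<le> \<gamma>" and K: "0 \<le> K" "0 \<le> C"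
    and w[measurable]: "w \<in> borel_measurable lebesgue" and w0: "\<And>x. 0 \<le> w x"
    and wr: "(\<integral>\<^sup>+x\<in>hcube a l. ennreal (w x powr r) \<partial>lebesgue) < \<infinity>"
    and h[measurable]: "h \<in> borel_measurable lebesgue" and h0: "\<And>x. 0 \<le> h x"
    and half: "measure lebesgue {x \<in> hcube a l. 0 < h x} \<le> measure lebesgue (hcube a l) / 2"
    and \<rho>[measurable]: "\<And>k. \<rho> k \<in> borel_measurable lebesgue" and T: "0 \<le> T"
    and T_le: "\<And>J. finite J \<Longrightarrow> (\<Sum>k\<in>J. \<integral>\<^sup>+x\<in>hcube a l. \<rho> k x \<partial>lebesgue) \<le> ennreal T"
    and \<sigma>: "\<And>D. 0 \<le> \<sigma> D"
    and A: "\<And>b \<delta>. 0 < \<delta> \<Longrightarrow> hcube b \<delta> \<subseteq> hcube a l \<Longrightarrow>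
      \<delta> powr (s - \<gamma>) * (measure lebesgue (hcube b \<delta>) powr (1 - 1 / r)
        * enn2real (\<integral>\<^sup>+x\<in>hcube b \<delta>. ennreal (w x powr r) \<partial>lebesgue) powr (1 / r)) powr (1 / q) * \<sigma> (hcube b \<delta>)
      \<le> K * \<delta> ^ CARD('n)"
    and PI: "\<And>b \<delta> k. 0 < \<delta> \<Longrightarrow> hcube b \<delta> \<subseteq> hcube a l \<Longrightarrow>
      stop_eps CARD('n) q r * measure lebesgue (hcube b \<delta>) < measure lebesgue {x \<in> hcube b \<delta>. 2 powr real_of_int k \<le> h x} \<Longrightarrow>
      measure lebesgue {x \<in> hcube b \<delta>. 2 powr real_of_int (k - 1) \<le> h x} \<le> measure lebesgue (hcube b \<delta>) / 2 \<Longrightarrow>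
      2 powr real_of_int k \<le> C * \<delta> powr (s - CARD('n)) * \<sigma> (hcube b \<delta>) * enn2real (\<integral>\<^sup>+x\<in>hcube b \<delta>. \<rho> k x \<partial>lebesgue) powr (1 / p)"
  shows "(\<integral>\<^sup>+x\<in>hcube a l. ennreal (h x powr q * w x) \<partial>lebesgue)
    \<le> ennreal (2 powr q * (2 * (1 + 2 powr q) * (C * K * l powr \<gamma>) powr q * T powr (q / p)))"
proof -
  define N where "N = density lebesgue (\<lambda>x. ennreal (w x powr r))"
  define V where "V = density lebesgue (\<lambda>x. ennreal (w x))"
  define \<mu> where "\<mu> k = density lebesgue (\<rho> k)" for k
  define E where "E k = {x \<in> hcube a l. 2 powr real_of_int k \<le> h x}" for k
  define H where "H = (C * K * l powr \<gamma>) powr q"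
  have q0: "0 < q" using pq by simp
  have rho_fin: "(\<integral>\<^sup>+x\<in>hcube a l. \<rho> k x \<partial>lebesgue) \<le> ennreal T" for k
    using T_le[of "{k}"] by simp
  have fin_sub: "(\<integral>\<^sup>+x\<in>D. g x \<partial>lebesgue) \<le> (\<integral>\<^sup>+x\<in>hcube a l. g x \<partial>lebesgue)" if "D \<subseteq> hcube a l" for g and D
    using that by (intro nn_integral_mono) (auto simp: indicator_def)
  have sets_D: "D \<in> sets lebesgue" "D \<subseteq> hcube a l" if "D \<in> dyadics_upto a l m" for D m
    by (rule dyadics_upto_hcube[OF l that]; simp)+
  have Eleb: "E k \<in> sets lebesgue" for k
  proof -
    have "E k = hcube a l \<inter> (h -` {2 powr real_of_int k..} \<inter> space lebesgue)" by (auto simp: E_def)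
    then show ?thesis by (simp add: measurable_sets[OF h])
  qed
  interpret stopping_cubes a l r "q / p" q "stop_eps CARD('n) q r" H N \<mu> E
  proof
    show "0 < l" "1 < r" "0 < q" "1 \<le> q / p" "0 \<le> H" using l r pq by (auto simp: H_def)
    show "0 < stop_eps CARD('n) q r" "stop_eps CARD('n) q r \<le> 1 / 2"
      "2 powr q * (2 * 2 ^ CARD('n) * stop_eps CARD('n) q r) powr (1 - 1 / r) \<le> 1 / 2"
      using stop_eps[OF r] by auto
    show "sets N = sets lebesgue" "hcube a l \<in> fmeasurable N"
      unfolding N_def using wr by (auto simp: fmeasurable_density_iff)
    show "sets (\<mu> k) = sets lebesgue" "hcube a l \<in> fmeasurable (\<mu> k)" for k
      unfolding \<mu>_def using order.strict_trans1[OF rho_fin[of k] ennreal_less_top] by (auto simp: fmeasurable_density_iff)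
    show "E k \<in> sets lebesgue" for k by (rule Eleb)
    show "E k \<subseteq> hcube a l" for k by (auto simp: E_def)
    show "E k \<subseteq> E (k - 1)" for k
    proof -
      have "2 powr real_of_int (k - 1) \<le> 2 powr real_of_int k" by (intro powr_mono) auto
      then show ?thesis unfolding E_def by (blast intro: order_trans)
    qed
    show "measure lebesgue (E k) \<le> measure lebesgue (hcube a l) / 2" for k
    proof -
      have "measure lebesgue (E k) \<le> measure lebesgue {x \<in> hcube a l. 0 < h x}"
      proof (rule measure_mono_fmeasurable[OF _ Eleb])
        have "{x \<in> hcube a l. 0 < h x} = hcube a l \<inter> (h -` {0<..} \<inter> space lebesgue)" by auto
        then have "{x \<in> hcube a l. 0 < h x} \<in> sets lebesgue" by (simp add: measurable_sets[OF h])
        then show "{x \<in> hcube a l. 0 < h x} \<in> lmeasurable"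
          by (rule fmeasurableI2[OF lmeasurable_hcube, rotated]) auto
        show "E k \<subseteq> {x \<in> hcube a l. 0 < h x}"
          unfolding E_def by (auto intro: order.strict_trans2[rotated])
      qed
      then show ?thesis using half by simp
    qed
    fix m D k assume D: "D \<in> dyadics_upto a l m"
      and big: "stop_eps CARD('n) q r * measure lebesgue D < measure lebesgue (D \<inter> E k)"
      and small: "measure lebesgue (D \<inter> E (k - 1)) \<le> measure lebesgue D / 2"
    obtain b \<delta> where b: "D = hcube b \<delta>" "0 < \<delta>" "\<delta> \<le> l" "D \<subseteq> hcube a l"
      by (rule dyadics_upto_hcube[OF l D])
    define Wq where "Wq = measure lebesgue D powr (1 - 1 / r) * measure N D powr (1 / r)"
    define M where "M = measure (\<mu> k) D"
    have DE: "D \<inter> E k = {x \<in> D. 2 powr real_of_int k \<le> h x}" for k using b by (auto simp: E_def)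
    have N_D: "measure N D = enn2real (\<integral>\<^sup>+x\<in>D. ennreal (w x powr r) \<partial>lebesgue)"
      unfolding N_def using b by (intro measure_density_eq) auto
    have M_D: "M = enn2real (\<integral>\<^sup>+x\<in>D. \<rho> k x \<partial>lebesgue)"
      unfolding M_def \<mu>_def using b by (intro measure_density_eq) auto
    have 1: "2 powr k \<le> C * \<delta> powr (s - CARD('n)) * \<sigma> D * M powr (1 / p)"
      using PI[of \<delta> b k] big small b(2,4) unfolding M_D DE b(1)[symmetric] by blast
    have 2: "\<delta> powr (s - \<gamma>) * Wq powr (1 / q) * \<sigma> D \<le> K * \<delta> ^ CARD('n)"
      using A[of \<delta> b] b(2,4) unfolding Wq_def N_D b(1)[symmetric] by blast
    have Wq: "0 \<le> Wq" "0 \<le> M" by (simp_all add: Wq_def M_def)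
    \<comment> \<open>The power of \<open>\<delta>\<close> in \<open>1\<close> is split as
      \<delta>^(\<gamma>-n) \<delta>^(s-\<gamma>), so that the left-hand side of \<open>2\<close>
      appears as a factor and \<open>\<sigma> D\<close> can be eliminated.\<close>
    have "2 powr k * Wq powr (1 / q) \<le> (C * \<delta> powr (s - CARD('n)) * \<sigma> D * M powr (1 / p)) * Wq powr (1 / q)"
      by (intro mult_right_mono 1) auto
    also have "\<dots> = C * M powr (1 / p) * \<delta> powr (\<gamma> - CARD('n)) * (\<delta> powr (s - \<gamma>) * Wq powr (1 / q) * \<sigma> D)"
    proof -
      have "\<delta> powr (s - CARD('n)) = \<delta> powr (\<gamma> - CARD('n)) * \<delta> powr (s - \<gamma>)"
        by (simp flip: powr_add)
      then show ?thesis by (simp add: algebra_simps)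
    qed
    also have "\<dots> \<le> C * M powr (1 / p) * \<delta> powr (\<gamma> - CARD('n)) * (K * \<delta> ^ CARD('n))"
      using K by (intro mult_left_mono 2) auto
    also have "\<dots> = C * K * \<delta> powr \<gamma> * M powr (1 / p)"
    proof -
      have "\<delta> powr (\<gamma> - CARD('n)) * \<delta> ^ CARD('n) = \<delta> powr \<gamma>"
        using b by (simp flip: powr_realpow powr_add)
      then show ?thesis by (metis mult.assoc mult.commute)
    qed
    also have "\<dots> \<le> C * K * l powr \<gamma> * M powr (1 / p)"
      using K b \<gamma> by (intro mult_right_mono mult_left_mono powr_mono2) auto
    finally have "(2 powr k * Wq powr (1 / q)) powr q \<le> (C * K * l powr \<gamma> * M powr (1 / p)) powr q"
      using q0 by (intro powr_mono2) auto
    moreover have "(2 powr k * Wq powr (1 / q)) powr q = 2 powr (k * q) * Wq"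
      using q0 Wq by (simp add: powr_mult powr_powr)
    moreover have "(C * K * l powr \<gamma> * M powr (1 / p)) powr q = H * M powr (q / p)"
      using K Wq unfolding H_def by (subst powr_mult) (auto simp: powr_powr)
    ultimately show "2 powr (k * q) * (measure lebesgue D powr (1 - 1 / r) * measure N D powr (1 / r)) \<le> H * measure (\<mu> k) D powr (q / p)"
      by (simp add: Wq_def M_def)
  qed
  \<comment> \<open>Hoelder with exponent \<open>r\<close> for \<open>w\<close> times the constant 1
    on D. This is what allows \<open>Wr\<close> to replace the mass of \<open>w\<close>.\<close>
  have VW: "(\<integral>\<^sup>+x\<in>D. ennreal (w x) \<partial>lebesgue) \<le> ennreal (Wr D)" if D: "D \<in> dyadics_upto a l m" for D m
  proof -
    note D' = sets_D[OF D]
    have Dm: "D \<in> lmeasurable" using dyadics_sets[OF D] by simp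
    have fin: "(\<integral>\<^sup>+x\<in>D. ennreal (w x powr r) \<partial>lebesgue) < \<infinity>"
      using fin_sub[OF D'(2)] wr by (rule order.strict_trans1)
    have meas[measurable]: "D \<in> sets lebesgue" by fact
    have eq1: "ennreal ((w x * indicator D x) powr r) = ennreal (w x powr r) * indicator D x" for x
      using r by (auto simp: indicator_def)
    have eq2: "ennreal (indicator D x powr conj_exponent r) = indicator D x" for x
      using r by (auto simp: indicator_def conj_exponent_def)
    have "(\<integral>\<^sup>+x. ennreal ((w x * indicator D x) * indicator D x) \<partial>lebesgue)
      \<le> ennreal (measure N D powr (1 / r) * measure lebesgue D powr (1 - 1 / r))"
    proof (rule nn_integral_Holder)
      show "(\<integral>\<^sup>+x. ennreal ((w x * indicator D x) powr r) \<partial>lebesgue) \<le> ennreal (measure N D)"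
        unfolding eq1 N_def using fin by (simp add: measure_density_eq less_top)
      show "(\<integral>\<^sup>+x. ennreal (indicator D x powr conj_exponent r) \<partial>lebesgue) \<le> ennreal (measure lebesgue D)"
        unfolding eq2 using Dm by (simp add: emeasure_eq_measure2)
    qed (use r w0 in \<open>auto intro: borel_measurable_times\<close>)
    moreover have "ennreal ((w x * indicator D x) * indicator D x) = ennreal (w x) * indicator D x" for x
      by (auto simp: indicator_def)
    ultimately show ?thesis by (simp add: Wr_def mult.commute)
  qed
  have Qd: "hcube a l \<in> dyadics_upto a l 0" by (rule hcube_mem_dyadics_upto[OF l])
  have Vfin: "hcube a l \<in> fmeasurable V"
    unfolding V_def using order.strict_trans1[OF VW[OF Qd] ennreal_less_top] by (subst fmeasurable_density_iff) auto
  have sum_le: "(\<Sum>k=-n..n. 2 powr (k * q) * measure V (E k)) \<le> 2 * (1 + 2 powr q) * H * T powr (q / p)" for n :: int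
  proof (rule sum_levels_le)
    fix J :: "int set" assume "finite J"
    have "ennreal (\<Sum>k\<in>J. measure (\<mu> k) (hcube a l)) = (\<Sum>k\<in>J. emeasure (\<mu> k) (hcube a l))"
      using \<mu> by (subst sum_ennreal[symmetric]) (auto intro!: sum.cong simp: emeasure_eq_measure2)
    also have "\<dots> \<le> ennreal T" using T_le[OF \<open>finite J\<close>] by (simp add: \<mu>_def emeasure_density)
    finally show "(\<Sum>k\<in>J. measure (\<mu> k) (hcube a l)) \<le> T" using T by simp
  next
    show "measure V D \<le> Wr D" if "D \<in> dyadics_upto a l m" for m D
      using VW[OF that] sets_D[OF that] Wr_nonneg[of D] unfolding V_def
      by (subst measure_density_eq) (auto intro: enn2real_leI)
    show "null_sets lebesgue \<subseteq> null_sets V"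
      unfolding V_def using absolutely_continuousI_density[of "\<lambda>x. ennreal (w x)" lebesgue] by (simp add: absolutely_continuous_def)
  qed (use Vfin in \<open>auto simp: V_def\<close>)
  define B where "B = 2 * (1 + 2 powr q) * H * T powr (q / p)"
  have B0: "0 \<le> B" by (simp add: B_def H_def)
  \<comment> \<open>Truncated dyadic layer sums. They increase with \<open>n\<close>, so monotone
    convergence passes from the bound on finitely many levels to the full integral.\<close>
  define g where "g n x = (\<Sum>k=-int n..int n. ennreal (2 powr (k * q)) * (ennreal (w x) * indicator (E k) x))" for n x
  have [measurable]: "E k \<in> sets lebesgue" for k by (rule Eleb)
  have g_int: "(\<integral>\<^sup>+x. g n x \<partial>lebesgue) \<le> ennreal B" for n
  proof -
    have "(\<integral>\<^sup>+x. g n x \<partial>lebesgue) = (\<Sum>k=-int n..int n. ennreal (2 powr (k * q)) * (\<integral>\<^sup>+x\<in>E k. ennreal (w x) \<partial>lebesgue))"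
      unfolding g_def by (simp add: nn_integral_sum nn_integral_cmult)
    also have "\<dots> = (\<Sum>k=-int n..int n. ennreal (2 powr (k * q) * measure V (E k)))"
    proof (intro sum.cong refl)
      fix k
      have "E k \<in> fmeasurable V" by (rule fmeasurableI2[OF Vfin]) (use E in \<open>auto simp: V_def\<close>)
      then have "(\<integral>\<^sup>+x\<in>E k. ennreal (w x) \<partial>lebesgue) = ennreal (measure V (E k))"
        by (simp add: V_def emeasure_density flip: emeasure_eq_measure2)
      then show "ennreal (2 powr (k * q)) * (\<integral>\<^sup>+x\<in>E k. ennreal (w x) \<partial>lebesgue) = ennreal (2 powr (k * q) * measure V (E k))"
        by (simp add: ennreal_mult)
    qed
    also have "\<dots> = ennreal (\<Sum>k=-int n..int n. 2 powr (k * q) * measure V (E k))"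
      by (rule sum_ennreal) auto
    also have "\<dots> \<le> ennreal B" unfolding B_def by (intro ennreal_leI sum_le)
    finally show ?thesis .
  qed
  have inc: "incseq g"
    unfolding g_def by (intro incseq_SucI le_funI sum_mono2) auto
  have "(\<integral>\<^sup>+x. (SUP n. g n x) \<partial>lebesgue) = (SUP n. \<integral>\<^sup>+x. g n x \<partial>lebesgue)"
    by (rule nn_integral_monotone_convergence_SUP[OF inc]) (unfold g_def[abs_def], measurable)
  also have "\<dots> \<le> ennreal B" by (rule SUP_least) (rule g_int)
  finally have SUP_le: "(\<integral>\<^sup>+x. (SUP n. g n x) \<partial>lebesgue) \<le> ennreal B" .
  have pw: "ennreal (h x powr q * w x) * indicator (hcube a l) x \<le> ennreal (2 powr q) * (SUP n. g n x)" for x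
  proof (cases "x \<in> hcube a l \<and> 0 < h x")
    case True
    \<comment> \<open>A single term of the layer sum suffices: 2^k \<le> h x < 2^(k+1) bounds h^q by
      2^q 2^(k q). This is the source of the outer factor 2^q.\<close>
    define k where "k = \<lfloor>log 2 (h x)\<rfloor>"
    have "2 powr real_of_int k \<le> h x" using True by (simp add: k_def flip: le_log_iff)
    then have xE: "x \<in> E k" using True by (simp add: E_def)
    have "h x < 2 powr (real_of_int k + 1)" using True by (simp add: k_def flip: log_less_iff)
    then have "h x powr q \<le> (2 powr (real_of_int k + 1)) powr q"
      using q0 True by (intro powr_mono2) auto
    also have "\<dots> = 2 powr q * 2 powr (k * q)" by (simp add: powr_powr algebra_simps flip: powr_add)
    finally have "h x powr q * w x \<le> 2 powr q * (2 powr (k * q) * w x)"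
      using w0[of x] by (simp add: mult_right_mono flip: mult.assoc)
    then have "ennreal (h x powr q * w x) \<le> ennreal (2 powr q) * (ennreal (2 powr (k * q)) * ennreal (w x))"
      using w0[of x] by (simp add: ennreal_leI flip: ennreal_mult)
    also have "ennreal (2 powr (k * q)) * ennreal (w x) = ennreal (2 powr (k * q)) * (ennreal (w x) * indicator (E k) x)"
      using xE by simp
    also have "\<dots> \<le> g (nat \<bar>k\<bar>) x"
      unfolding g_def by (rule member_le_sum) auto
    also have "\<dots> \<le> (SUP n. g n x)" by (rule SUP_upper) auto
    finally show ?thesis using True by (simp add: mult_left_mono)
  next
    case False
    then have "x \<notin> hcube a l \<or> h x = 0" using h0[of x] by auto
    then show ?thesis by auto
  qed
  have "(\<integral>\<^sup>+x\<in>hcube a l. ennreal (h x powr q * w x) \<partial>lebesgue) \<le> (\<integral>\<^sup>+x. ennreal (2 powr q) * (SUP n. g n x) \<partial>lebesgue)"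
    by (intro nn_integral_mono pw)
  also have "\<dots> = ennreal (2 powr q) * (\<integral>\<^sup>+x. (SUP n. g n x) \<partial>lebesgue)"
    by (intro nn_integral_cmult) (simp add: g_def)
  also have "\<dots> \<le> ennreal (2 powr q) * ennreal B" by (intro mult_left_mono SUP_le) auto
  also have "\<dots> = ennreal (2 powr q * B)" using B0 by (simp add: ennreal_mult)
  finally show ?thesis by (simp add: B_def H_def mult.assoc)
qed

subsection \<open>The two-weight condition on a single cube\<close>

lemma epowr_ennreal:
  assumes "0 \<le> y" "0 < a \<or> 0 < y"
  shows "ennreal y epowr a = ennreal (y powr a)"
  using assms by (auto simp: epowr_def ennreal_eq_0_iff)

lemma epowr_ennreal_neg:
  assumes "a < 0"
  shows "ennreal y epowr a = (if y \<le> 0 then \<infinity> else ennreal (y powr a))"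
  using assms by (auto simp: epowr_def ennreal_eq_0_iff)

lemma epowr_eq_top_iff: "0 < a \<Longrightarrow> x epowr a = top \<longleftrightarrow> x = top"
  by (auto simp: epowr_def)

lemma epowr_eq_0_iff: "0 < a \<Longrightarrow> x epowr a = 0 \<longleftrightarrow> x = 0"
  by (cases x) (auto simp: epowr_def ennreal_eq_0_iff)

lemma conj_exponent:
  assumes "1 < p"
  shows "1 - conj_exponent p < 0" "1 / conj_exponent p = 1 - 1 / p" "- (1 / p) * conj_exponent p = 1 - conj_exponent p"
    "0 < conj_exponent p"
  using assms by (auto simp: conj_exponent_def field_simps)

lemma borel_measurable_epowr_neg [measurable]:
  assumes [measurable]: "v \<in> borel_measurable M" and "a < 0"
  shows "(\<lambda>x. ennreal (v x) epowr a) \<in> borel_measurable M"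
  unfolding epowr_ennreal_neg[OF assms(2)] by measurable

text \<open>Write \<psi> as \<psi> v^(1/p) times v^(-1/p); the p'-th power of the second factor is
  v^(1-p'). A finite integral of the latter is what prevents \<open>v\<close> from vanishing on a
  set of positive measure.\<close>

lemma nn_integral_weight_Holder:
  fixes v \<psi> :: "'a \<Rightarrow> real"
  assumes v[measurable]: "v \<in> borel_measurable M" and \<psi>[measurable]: "\<psi> \<in> borel_measurable M" "D \<in> sets M"
    and nonneg: "\<And>x. 0 \<le> v x" "\<And>x. 0 \<le> \<psi> x" and p: "1 < p"
    and S: "(\<integral>\<^sup>+x\<in>D. ennreal (v x) epowr (1 - conj_exponent p) \<partial>M) \<le> ennreal S" "0 \<le> S"
    and A: "(\<integral>\<^sup>+x\<in>D. ennreal (\<psi> x powr p * v x) \<partial>M) \<le> ennreal A" "0 \<le> A"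
  shows "(\<integral>\<^sup>+x\<in>D. ennreal (\<psi> x) \<partial>M) \<le> ennreal (A powr (1 / p) * S powr (1 - 1 / p))"
proof -
  note ce = conj_exponent[OF p]
  define f where "f x = \<psi> x * v x powr (1 / p) * indicator D x" for x
  define g where "g x = v x powr (- (1 / p)) * indicator D x" for x
  have [measurable]: "f \<in> borel_measurable M" "g \<in> borel_measurable M"
    unfolding f_def g_def by measurable
  \<comment> \<open>With 0 to a negative power being infinite, finiteness of the dual integral means
    v > 0 almost everywhere in D, so \<open>v\<close> may be divided out.\<close>
  have "AE x in M. ennreal (v x) epowr (1 - conj_exponent p) * indicator D x \<noteq> \<infinity>"
    using S ce by (intro nn_integral_PInf_AE) (auto simp: top_unique)
  then have pos: "AE x in M. x \<in> D \<longrightarrow> 0 < v x"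
    by eventually_elim (use ce in \<open>auto simp: epowr_ennreal_neg split: if_splits\<close>)
  have "(\<integral>\<^sup>+x\<in>D. ennreal (\<psi> x) \<partial>M) = (\<integral>\<^sup>+x. ennreal (f x * g x) \<partial>M)"
  proof (rule nn_integral_cong_AE)
    show "AE x in M. ennreal (\<psi> x) * indicator D x = ennreal (f x * g x)"
      using pos by eventually_elim (auto simp: f_def g_def indicator_def powr_minus mult.assoc)
  qed
  also have "\<dots> \<le> ennreal (A powr (1 / p) * S powr (1 - 1 / p))"
  proof (rule nn_integral_Holder)
    have "ennreal (f x powr p) = ennreal (\<psi> x powr p * v x) * indicator D x" for x
      using p nonneg[of x] by (auto simp: f_def indicator_def powr_mult powr_powr)
    then show "(\<integral>\<^sup>+x. ennreal (f x powr p) \<partial>M) \<le> ennreal A"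
      using A by simp
    have "ennreal (g x powr conj_exponent p) \<le> ennreal (v x) epowr (1 - conj_exponent p) * indicator D x" for x
      using ce nonneg[of x] by (auto simp: g_def indicator_def powr_powr epowr_ennreal_neg)
    then show "(\<integral>\<^sup>+x. ennreal (g x powr conj_exponent p) \<partial>M) \<le> ennreal S"
      by (intro order_trans[OF nn_integral_mono S(1)])
  qed (use nonneg p S A in \<open>auto simp: f_def g_def\<close>)
  finally show ?thesis .
qed

lemma hcube_subset_imp_cbox_subset:
  assumes "0 < \<delta>" "hcube b \<delta> \<subseteq> hcube a l"
  shows "cbox b (b + vec \<delta>) \<subseteq> cbox a (a + vec l)"
proof -
  have "a $ i \<le> b $ i \<and> b $ i + \<delta> \<le> a $ i + l" for i
  proof -
    have "b \<in> hcube b \<delta>" using assms by (simp add: hcube_def)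
    then have "b \<in> hcube a l" using assms by auto
    then have 1: "a $ i \<le> b $ i" "b $ i < a $ i + l" by (auto simp: hcube_def)
    have "b $ i + \<delta> \<le> a $ i + l"
    proof (rule ccontr)
      assume "\<not> ?thesis"
      \<comment> \<open>If the small cube stuck out in direction \<open>i\<close>, moving
        \<open>b\<close> in that coordinate onto the missing upper face of the large cube would stay
        in the small cube but leave the large one.\<close>
      then have "(\<chi> j. if j = i then a $ i + l else b $ j) \<in> hcube b \<delta>"
        using assms 1 by (auto simp: hcube_def)
      then have "(\<chi> j. if j = i then a $ i + l else b $ j) \<in> hcube a l" using assms by auto
      then show False by (auto simp: hcube_def dest!: spec[of _ i])
    qed
    then show ?thesis using 1 by simp
  qed
  note le = this
  show ?thesis
  proof (rule subsetI)
    fix y assume y: "y \<in> cbox b (b + vec \<delta>)"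
    have "a $ i \<le> y $ i \<and> y $ i \<le> a $ i + l" for i
      using le[of i] y by (auto simp: mem_box_cart dest!: spec[of _ i])
    then show "y \<in> cbox a (a + vec l)" by (simp add: mem_box_cart)
  qed
qed

lemma cube_corner: "cube (b + vec (\<delta> / 2)) \<delta> = cbox b (b + vec \<delta>)"
proof -
  have "b + vec (\<delta> / 2) + vec (\<delta> / 2) = b + vec \<delta>" by (simp add: vec_eq_iff)
  then show ?thesis by (simp only: cube_def add_diff_cancel_right')
qed

lemma A_const_cube:
  fixes \<Omega> :: "(real ^ 'n) set"
  assumes K: "A_const \<Omega> \<alpha> r q p w v \<le> ennreal K" and sub: "cbox b (b + vec \<delta>) \<subseteq> \<Omega>" and \<delta>: "0 < \<delta>"
  defines "Q \<equiv> cbox b (b + vec \<delta>)"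
  shows "ennreal (\<delta> powr \<alpha>) * emeasure lebesgue Q epowr (1 / q - 1 / p)
        * (average Q (\<lambda>x. ennreal (w x) epowr r)) epowr (1 / (q * r))
        * (average Q (\<lambda>x. ennreal (v x) epowr (1 - conj_exponent p))) epowr (1 / conj_exponent p) \<le> ennreal K"
proof (rule order_trans[OF _ K])
  show "ennreal (\<delta> powr \<alpha>) * emeasure lebesgue Q epowr (1 / q - 1 / p)
        * (average Q (\<lambda>x. ennreal (w x) epowr r)) epowr (1 / (q * r))
        * (average Q (\<lambda>x. ennreal (v x) epowr (1 - conj_exponent p))) epowr (1 / conj_exponent p) \<le> A_const \<Omega> \<alpha> r q p w v"
    unfolding A_const_def Q_def
    by (rule SUP_upper2[of "(b + vec (\<delta> / 2), \<delta>)"]) (use sub \<delta> in \<open>auto simp: cube_corner\<close>)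
qed

text \<open>In [0,\<infinity>] the product of 0 and \<infinity> is 0, so a finite product does not
  bound its factors. The dual factor is never 0, because \<open>v\<close> is real-valued; hence the
  integral of w^r is finite, and if it is nonzero, then the dual integral is finite too. If it
  vanishes, the weighted inequality on the cube is trivial.\<close>

lemma A_const_dichotomy:
  fixes \<Omega> :: "(real ^ 'n) set"
  assumes K: "A_const \<Omega> \<alpha> r q p w v \<le> ennreal K" and sub: "cbox b (b + vec \<delta>) \<subseteq> \<Omega>" and \<delta>: "0 < \<delta>"
    and v[measurable]: "v \<in> borel_measurable lebesgue"
    and exps: "1 < p" "0 < q" "1 < r"
  shows "(\<integral>\<^sup>+x\<in>cbox b (b + vec \<delta>). ennreal (w x) epowr r \<partial>lebesgue) = 0 \<or>
    (\<integral>\<^sup>+x\<in>cbox b (b + vec \<delta>). ennreal (w x) epowr r \<partial>lebesgue) < \<infinity> \<and>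
    (\<integral>\<^sup>+x\<in>cbox b (b + vec \<delta>). ennreal (v x) epowr (1 - conj_exponent p) \<partial>lebesgue) < \<infinity>"
    (is "?N = 0 \<or> ?N < \<infinity> \<and> ?S < \<infinity>")
proof -
  define Q where "Q = cbox b (b + vec \<delta>)"
  define m where "m = \<delta> ^ CARD('n)"
  have m: "0 < m" using \<delta> by (simp add: m_def)
  have mQ: "emeasure lebesgue Q = ennreal m" using \<delta> emeasure_cbox_vec[of \<delta> b] by (simp add: Q_def m_def)
  define e3 e4 where "e3 = (average Q (\<lambda>x. ennreal (w x) epowr r)) epowr (1 / (q * r))"
    and "e4 = (average Q (\<lambda>x. ennreal (v x) epowr (1 - conj_exponent p))) epowr (1 / conj_exponent p)"
  note ce = conj_exponent[OF exps(1)]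
  have "ennreal (\<delta> powr \<alpha>) * ennreal (m powr (1 / q - 1 / p)) * e3 * e4 \<le> ennreal K"
    using A_const_cube[OF K sub \<delta>] m unfolding e3_def e4_def Q_def[symmetric] mQ
    by (subst (asm) epowr_ennreal) auto
  then have fin: "ennreal (\<delta> powr \<alpha> * m powr (1 / q - 1 / p)) * e3 * e4 < \<infinity>"
    by (simp add: ennreal_mult) (use ennreal_less_top order.strict_trans1 in blast)
  have pos: "0 < \<delta> powr \<alpha> * m powr (1 / q - 1 / p)" using \<delta> m by simp
  have e3: "e3 = \<infinity> \<longleftrightarrow> ?N = \<infinity>" "e3 = 0 \<longleftrightarrow> ?N = 0"
    unfolding e3_def using exps m
    by (auto simp: epowr_eq_top_iff epowr_eq_0_iff average_def mQ ennreal_divide_eq_top_iff ennreal_divide_eq_0_iff Q_def[symmetric])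
  have e4: "e4 = \<infinity> \<longleftrightarrow> ?S = \<infinity>" "e4 = 0 \<longleftrightarrow> ?S = 0"
    unfolding e4_def using divide_pos_pos[OF zero_less_one ce(4)] m
    by (auto simp: epowr_eq_top_iff epowr_eq_0_iff average_def mQ ennreal_divide_eq_top_iff ennreal_divide_eq_0_iff Q_def[symmetric])
  have S0: "?S \<noteq> 0"
  proof
    assume S0: "?S = 0"
    have "(\<lambda>x. ennreal (v x) epowr (1 - conj_exponent p) * indicator Q x) \<in> borel_measurable lebesgue"
      using ce(1) by (intro borel_measurable_times_ennreal borel_measurable_epowr_neg v borel_measurable_indicator) (auto simp: Q_def)
    with S0 have "AE x in lebesgue. ennreal (v x) epowr (1 - conj_exponent p) * indicator Q x = 0"
      by (subst (asm) nn_integral_0_iff_AE) (auto simp: Q_def)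
    then have "AE x in lebesgue. x \<notin> Q"
      by eventually_elim (use ce in \<open>auto simp: epowr_ennreal_neg split: if_splits\<close>)
    then have "emeasure lebesgue Q = 0"
      by (subst (asm) AE_iff_measurable[of Q]) (auto simp: Q_def)
    then show False using mQ m by simp
  qed
  show ?thesis
  proof (cases "?N = 0")
    case False
    have "?S \<noteq> \<infinity>"
    proof
      assume "?S = \<infinity>"
      then have "e4 = \<infinity>" "e3 \<noteq> 0" using e3 e4 False by auto
      then show False using fin pos \<delta> m by (auto simp: ennreal_mult_top)
    qed
    moreover have "?N \<noteq> \<infinity>"
    proof
      assume "?N = \<infinity>"
      then have "e3 = \<infinity>" "e4 \<noteq> 0" using e3 e4 S0 by auto
      then show False using fin pos \<delta> m by (auto simp: ennreal_mult_top ennreal_top_mult)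
    qed
    ultimately show ?thesis by (simp add: less_top)
  qed simp
qed

text \<open>With both integrals finite the condition becomes an inequality of reals. The averages
  contribute negative powers of |Q|; regrouping them with |Q|^(1/q - 1/p) leaves |Q| itself on the
  right and the expression \<open>Wr\<close> on the left.\<close>

lemma A_const_real:
  fixes \<Omega> :: "(real ^ 'n) set"
  assumes K: "A_const \<Omega> \<alpha> r q p w v \<le> ennreal K" "0 \<le> K" and sub: "cbox b (b + vec \<delta>) \<subseteq> \<Omega>" and \<delta>: "0 < \<delta>"
    and exps: "1 < p" "0 < q" "1 < r"
    and N: "(\<integral>\<^sup>+x\<in>cbox b (b + vec \<delta>). ennreal (w x) epowr r \<partial>lebesgue) = ennreal N" "0 \<le> N"
    and S: "(\<integral>\<^sup>+x\<in>cbox b (b + vec \<delta>). ennreal (v x) epowr (1 - conj_exponent p) \<partial>lebesgue) = ennreal S" "0 \<le> S"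
  shows "\<delta> powr \<alpha> * ((\<delta> ^ CARD('n)) powr (1 - 1 / r) * N powr (1 / r)) powr (1 / q) * S powr (1 - 1 / p) \<le> K * \<delta> ^ CARD('n)"
proof -
  define m where "m = \<delta> ^ CARD('n)"
  have m: "0 < m" using \<delta> by (simp add: m_def)
  define Q where "Q = cbox b (b + vec \<delta>)"
  have mQ: "emeasure lebesgue Q = ennreal m" using \<delta> emeasure_cbox_vec[of \<delta> b] by (simp add: Q_def m_def)
  note ce = conj_exponent[OF exps(1)]
  have avN: "average Q (\<lambda>x. ennreal (w x) epowr r) = ennreal (N / m)"
    and avS: "average Q (\<lambda>x. ennreal (v x) epowr (1 - conj_exponent p)) = ennreal (S / m)"
    unfolding average_def mQ using N S m by (simp_all add: Q_def divide_ennreal)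
  have "ennreal (\<delta> powr \<alpha>) * ennreal (m powr (1 / q - 1 / p)) * ennreal ((N / m) powr (1 / (q * r))) * ennreal ((S / m) powr (1 - 1 / p)) \<le> ennreal K"
    using A_const_cube[OF K(1) sub \<delta>] unfolding Q_def[symmetric] mQ avN avS ce(2)
    using m N S exps by (simp add: epowr_ennreal)
  then have le: "\<delta> powr \<alpha> * m powr (1 / q - 1 / p) * (N / m) powr (1 / (q * r)) * (S / m) powr (1 - 1 / p) \<le> K"
    using K(2) by (simp flip: ennreal_mult)
  have "\<delta> powr \<alpha> * (m powr (1 - 1 / r) * N powr (1 / r)) powr (1 / q) * S powr (1 - 1 / p)
    = \<delta> powr \<alpha> * m powr (1 / q - 1 / p) * (N / m) powr (1 / (q * r)) * (S / m) powr (1 - 1 / p) * m"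
  proof -
    have "(m powr (1 - 1 / r) * N powr (1 / r)) powr (1 / q) = m powr ((1 - 1 / r) / q) * N powr (1 / (q * r))"
      using N m by (simp add: powr_mult powr_powr mult.commute)
    moreover have "(N / m) powr (1 / (q * r)) = N powr (1 / (q * r)) * m powr (- (1 / (q * r)))"
      unfolding powr_minus_divide using N m by (subst powr_divide) auto
    moreover have "(S / m) powr (1 - 1 / p) = S powr (1 - 1 / p) * m powr (- (1 - 1 / p))"
      unfolding powr_minus_divide using S m by (subst powr_divide) auto
    moreover have "m powr ((1 - 1 / r) / q) = m powr (1 / q - 1 / p) * m powr (- (1 / (q * r))) * m powr (- (1 - 1 / p)) * m powr 1"
    proof -
      \<comment> \<open>The bookkeeping of the powers of \<open>m\<close>: the factor outside the
        averages, the average of w^r, the dual average, and the one power moved to the right-hand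
        side.\<close>
      have "(1 - 1 / r) / q = (1 / q - 1 / p) + (- (1 / (q * r))) + (- (1 - 1 / p)) + 1"
        using exps by (simp add: field_simps)
      then show ?thesis by (simp only: powr_add)
    qed
    ultimately show ?thesis using m by simp
  qed
  also have "\<dots> \<le> K * m" using le m by (intro mult_right_mono) auto
  finally show ?thesis by (simp add: m_def)
qed

section \<open>Medians, and the level estimate under the two-weight condition\<close>

text \<open>Take for c the infimum of all t with F t \<ge> |Q|/2. Continuity of the measure from
  above at c gives F c \<ge> |Q|/2, which bounds the part above c; exhausting the part below c by
  smaller levels bounds it by |Q|/2.\<close>

lemma median_exists:
  fixes f :: "real ^ 'n \<Rightarrow> real" and Q :: "(real ^ 'n) set"
  assumes f[measurable]: "f \<in> borel_measurable lebesgue" and Q: "Q \<in> lmeasurable" "0 < measure lebesgue Q"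
  shows "\<exists>c. measure lebesgue {x \<in> Q. c < f x} \<le> measure lebesgue Q / 2
    \<and> measure lebesgue {x \<in> Q. f x < c} \<le> measure lebesgue Q / 2"
proof -
  define F where "F t = measure lebesgue {x \<in> Q. f x \<le> t}" for t
  define m where "m = measure lebesgue Q"
  have Qs[measurable]: "Q \<in> sets lebesgue" using Q by auto
  have sub: "{x \<in> Q. P x} \<in> lmeasurable" if "{x \<in> Q. P x} \<in> sets lebesgue" for P
    by (rule fmeasurableI2[OF Q(1) _ that]) auto
  have meas: "{x \<in> Q. f x \<le> t} \<in> sets lebesgue" "{x \<in> Q. t < f x} \<in> sets lebesgue" "{x \<in> Q. f x < t} \<in> sets lebesgue" for t
  proof -
    have "{x \<in> Q. f x \<le> t} = Q \<inter> (f -` {..t} \<inter> space lebesgue)" "{x \<in> Q. t < f x} = Q \<inter> (f -` {t<..} \<inter> space lebesgue)"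
      "{x \<in> Q. f x < t} = Q \<inter> (f -` {..<t} \<inter> space lebesgue)" by auto
    then show "{x \<in> Q. f x \<le> t} \<in> sets lebesgue" "{x \<in> Q. t < f x} \<in> sets lebesgue" "{x \<in> Q. f x < t} \<in> sets lebesgue"
      using Qs by (simp_all add: measurable_sets[OF f])
  qed
  note lm = sub[OF meas(1)] sub[OF meas(2)] sub[OF meas(3)]
  have F_mono: "F s \<le> F t" if "s \<le> t" for s t
    unfolding F_def using that by (intro measure_mono_fmeasurable lm meas) auto
  have F_top: "(\<lambda>n. F (real n)) \<longlonglongrightarrow> m"
  proof -
    have "(\<lambda>n. measure lebesgue {x \<in> Q. f x \<le> real n}) \<longlonglongrightarrow> measure lebesgue (\<Union>n. {x \<in> Q. f x \<le> real n})"
    proof (rule Lim_measure_incseq)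
      have *: "(\<Union>n. {x \<in> Q. f x \<le> real n}) = Q" using real_arch_simple by auto
      show "emeasure lebesgue (\<Union>n. {x \<in> Q. f x \<le> real n}) \<noteq> \<infinity>"
        unfolding * using Q by (auto simp: fmeasurable_def)
    qed (use meas in \<open>auto simp: incseq_def\<close>)
    moreover have "(\<Union>n. {x \<in> Q. f x \<le> real n}) = Q" using real_arch_simple by auto
    ultimately show ?thesis by (simp add: F_def m_def)
  qed
  have F_bot: "(\<lambda>n. F (- real n)) \<longlonglongrightarrow> 0"
  proof -
    have *: "(\<Inter>n. {x \<in> Q. f x \<le> - real n}) = {}"
    proof -
      have "\<exists>n. \<not> f x \<le> - real n" for x using reals_Archimedean2[of "- f x"] by (auto simp: not_le) (metis minus_less_iff)
      then show ?thesis by blast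
    qed
    have "(\<lambda>n. measure lebesgue {x \<in> Q. f x \<le> - real n}) \<longlonglongrightarrow> measure lebesgue (\<Inter>n. {x \<in> Q. f x \<le> - real n})"
    proof (rule Lim_measure_decseq)
      show "emeasure lebesgue {x \<in> Q. f x \<le> - real i} \<noteq> \<infinity>" for i using fmeasurableD2[OF lm(1)] by (simp only: infinity_ennreal_def not_False_eq_True)
    qed (use meas in \<open>auto simp: decseq_def\<close>)
    then show ?thesis by (simp add: * F_def)
  qed
  define S where "S = {t. m / 2 \<le> F t}"
  have m: "0 < m" using Q by (simp add: m_def)
  have "eventually (\<lambda>n. m / 2 < F (real n)) sequentially"
    using F_top m by (intro order_tendstoD) auto
  then obtain n1 where n1: "real n1 \<in> S" unfolding S_def by (auto simp: eventually_sequentially intro: less_imp_le)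
  have "eventually (\<lambda>n. F (- real n) < m / 2) sequentially"
    using F_bot m by (intro order_tendstoD) auto
  then obtain n2 where n2: "F (- real n2) < m / 2" by (auto simp: eventually_sequentially)
  have low: "- real n2 \<le> t" if "t \<in> S" for t
    using that n2 F_mono[of t "- real n2"] by (force simp: S_def)
  have bdd: "bdd_below S" using low by (meson bdd_belowI)
  define c where "c = Inf S"
  have above: "m / 2 \<le> F t" if t: "c < t" for t
  proof -
    obtain u where "u \<in> S" "u < t" using t n1 bdd unfolding c_def by (metis cInf_less_iff empty_iff)
    then show ?thesis using F_mono[of u t] by (auto simp: S_def)
  qed
  have below: "F t < m / 2" if "t < c" for t
  proof (rule ccontr)
    assume "\<not> ?thesis"
    then have "Inf S \<le> t" by (intro cInf_lower[OF _ bdd]) (auto simp: S_def)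
    then show False using that by (simp add: c_def)
  qed
  have "m / 2 \<le> F c"
  proof -
    have "(\<lambda>n. measure lebesgue {x \<in> Q. f x \<le> c + 1 / real (Suc n)}) \<longlonglongrightarrow> measure lebesgue (\<Inter>n. {x \<in> Q. f x \<le> c + 1 / real (Suc n)})"
    proof (rule Lim_measure_decseq)
      show "emeasure lebesgue {x \<in> Q. f x \<le> c + 1 / real (Suc i)} \<noteq> \<infinity>" for i using fmeasurableD2[OF lm(1)] by (simp only: infinity_ennreal_def not_False_eq_True)
      show "decseq (\<lambda>n. {x \<in> Q. f x \<le> c + 1 / real (Suc n)})"
      proof (rule decseq_SucI, rule subsetI)
        fix n x assume "x \<in> {x \<in> Q. f x \<le> c + 1 / real (Suc (Suc n))}"
        moreover have "1 / real (Suc (Suc n)) \<le> 1 / real (Suc n)" by (intro divide_left_mono) auto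
        ultimately show "x \<in> {x \<in> Q. f x \<le> c + 1 / real (Suc n)}" by auto
      qed
    qed (use meas in auto)
    moreover have "(\<Inter>n. {x \<in> Q. f x \<le> c + 1 / real (Suc n)}) = {x \<in> Q. f x \<le> c}"
    proof (intro antisym subsetI)
      fix x assume x: "x \<in> (\<Inter>n. {x \<in> Q. f x \<le> c + 1 / real (Suc n)})"
      have "f x \<le> c + e" if e: "0 < e" for e
      proof -
        obtain n where "inverse (real (Suc n)) < e" using reals_Archimedean[OF e] by auto
        then show ?thesis using x by (auto simp: inverse_eq_divide dest!: spec[of _ n])
      qed
      then show "x \<in> {x \<in> Q. f x \<le> c}" using x by (auto intro: field_le_epsilon)
    qed (auto intro: order_trans)
    ultimately have "(\<lambda>n. F (c + 1 / real (Suc n))) \<longlonglongrightarrow> F c" by (simp only: F_def)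
    then show ?thesis by (rule LIMSEQ_le_const) (intro exI allI impI above, simp)
  qed
  moreover have "measure lebesgue {x \<in> Q. c < f x} + F c = m"
  proof -
    have "{x \<in> Q. c < f x} \<union> {x \<in> Q. f x \<le> c} = Q" by auto
    moreover have "measure lebesgue ({x \<in> Q. c < f x} \<union> {x \<in> Q. f x \<le> c}) = measure lebesgue {x \<in> Q. c < f x} + measure lebesgue {x \<in> Q. f x \<le> c}"
      using lm[THEN fmeasurableD2] meas by (intro measure_Union) (auto simp del: emeasure_completion)
    ultimately show ?thesis by (simp add: F_def m_def)
  qed
  moreover have "measure lebesgue {x \<in> Q. f x < c} \<le> m / 2"
  proof -
    have "(\<lambda>n. measure lebesgue {x \<in> Q. f x \<le> c - 1 / real (Suc n)}) \<longlonglongrightarrow> measure lebesgue (\<Union>n. {x \<in> Q. f x \<le> c - 1 / real (Suc n)})"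
    proof (rule Lim_measure_incseq)
      have "(\<Union>n. {x \<in> Q. f x \<le> c - 1 / real (Suc n)}) \<in> lmeasurable"
        by (rule fmeasurableI2[OF Q(1)]) (use meas in auto)
      then show "emeasure lebesgue (\<Union>n. {x \<in> Q. f x \<le> c - 1 / real (Suc n)}) \<noteq> \<infinity>" by (auto simp: fmeasurable_def)
      show "incseq (\<lambda>n. {x \<in> Q. f x \<le> c - 1 / real (Suc n)})"
      proof (rule incseq_SucI, rule subsetI)
        fix n x assume "x \<in> {x \<in> Q. f x \<le> c - 1 / real (Suc n)}"
        moreover have "1 / real (Suc (Suc n)) \<le> 1 / real (Suc n)" by (intro divide_left_mono) auto
        ultimately show "x \<in> {x \<in> Q. f x \<le> c - 1 / real (Suc (Suc n))}" by auto
      qed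
    qed (use meas in auto)
    moreover have "(\<Union>n. {x \<in> Q. f x \<le> c - 1 / real (Suc n)}) = {x \<in> Q. f x < c}"
    proof (intro antisym subsetI)
      fix x assume x: "x \<in> {x \<in> Q. f x < c}"
      then have "0 < c - f x" by simp
      then obtain n where "inverse (real (Suc n)) < c - f x" using reals_Archimedean by blast
      then have "f x \<le> c - 1 / real (Suc n)" by (simp add: inverse_eq_divide)
      then show "x \<in> (\<Union>n. {x \<in> Q. f x \<le> c - 1 / real (Suc n)})" using x by blast
    next
      fix x assume "x \<in> (\<Union>n. {x \<in> Q. f x \<le> c - 1 / real (Suc n)})"
      then obtain n where "x \<in> Q" "f x \<le> c - 1 / real (Suc n)" by auto
      moreover have "0 < 1 / real (Suc n)" by simp
      ultimately show "x \<in> {x \<in> Q. f x < c}" unfolding mem_Collect_eq by linarith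
    qed
    ultimately have "(\<lambda>n. F (c - 1 / real (Suc n))) \<longlonglongrightarrow> measure lebesgue {x \<in> Q. f x < c}" by (simp only: F_def)
    then show ?thesis by (rule LIMSEQ_le_const2) (intro exI allI impI less_imp_le below, simp)
  qed
  ultimately show ?thesis by (intro exI[of _ c]) (auto simp: m_def)
qed

text \<open>If w^r has integral 0 on the cube, the left-hand side is 0. Otherwise all integrals are
  finite there and on all subcubes, so that the real form of the weight condition applies to each.
  Half-open and closed cubes are matched by monotonicity of the integrals.\<close>

lemma cube_level_estimate:
  fixes \<Omega> :: "(real ^ 'n) set" and h w v :: "real ^ 'n \<Rightarrow> real" and \<rho> :: "int \<Rightarrow> real ^ 'n \<Rightarrow> ennreal"
  assumes l: "0 < l" and sub: "cbox a (a + vec l) \<subseteq> \<Omega>"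
    and exps: "1 < p" "p \<le> q" "1 < r" "0 \<le> \<gamma>" and K: "A_const \<Omega> (s - \<gamma>) r q p w v \<le> ennreal K" "0 \<le> K" "0 \<le> C"
    and w[measurable]: "w \<in> borel_measurable lebesgue" and w0: "\<And>x. 0 \<le> w x"
    and v[measurable]: "v \<in> borel_measurable lebesgue"
    and h[measurable]: "h \<in> borel_measurable lebesgue" and h0: "\<And>x. 0 \<le> h x"
    and half: "measure lebesgue {x \<in> hcube a l. 0 < h x} \<le> measure lebesgue (hcube a l) / 2"
    and \<rho>: "\<And>k. \<rho> k \<in> borel_measurable lebesgue" and T: "0 \<le> T"
    and T_le: "\<And>J. finite J \<Longrightarrow> (\<Sum>k\<in>J. \<integral>\<^sup>+x\<in>hcube a l. \<rho> k x \<partial>lebesgue) \<le> ennreal T"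
    and PI: "\<And>b \<delta> k S. 0 < \<delta> \<Longrightarrow> hcube b \<delta> \<subseteq> hcube a l \<Longrightarrow>
      (\<integral>\<^sup>+x\<in>hcube b \<delta>. ennreal (v x) epowr (1 - conj_exponent p) \<partial>lebesgue) \<le> ennreal S \<Longrightarrow> 0 \<le> S \<Longrightarrow>
      stop_eps CARD('n) q r * measure lebesgue (hcube b \<delta>) < measure lebesgue {x \<in> hcube b \<delta>. 2 powr real_of_int k \<le> h x} \<Longrightarrow>
      measure lebesgue {x \<in> hcube b \<delta>. 2 powr real_of_int (k - 1) \<le> h x} \<le> measure lebesgue (hcube b \<delta>) / 2 \<Longrightarrow>
      2 powr real_of_int k \<le> C * \<delta> powr (s - CARD('n)) * S powr (1 - 1 / p) * enn2real (\<integral>\<^sup>+x\<in>hcube b \<delta>. \<rho> k x \<partial>lebesgue) powr (1 / p)"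
  shows "(\<integral>\<^sup>+x\<in>hcube a l. ennreal (h x powr q * w x) \<partial>lebesgue)
    \<le> ennreal (2 powr q * (2 * (1 + 2 powr q) * (C * K * l powr \<gamma>) powr q * T powr (q / p)))"
proof -
  define N where "N b \<delta> = (\<integral>\<^sup>+x\<in>cbox b (b + vec \<delta>). ennreal (w x powr r) \<partial>lebesgue)" for b \<delta>
  define S where "S b \<delta> = (\<integral>\<^sup>+x\<in>cbox b (b + vec \<delta>). ennreal (v x) epowr (1 - conj_exponent p) \<partial>lebesgue)" for b \<delta>
  have q: "0 < q" using exps by simp
  have wr: "ennreal (w x) epowr r = ennreal (w x powr r)" for x using w0[of x] exps by (intro epowr_ennreal) auto
  have mono: "(\<integral>\<^sup>+x\<in>A. g x \<partial>lebesgue) \<le> (\<integral>\<^sup>+x\<in>B. g x \<partial>lebesgue)" if "A \<subseteq> B" for g and A B :: "(real ^ 'n) set"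
    using that by (intro nn_integral_mono) (auto simp: indicator_def)
  consider "N a l = 0" | "N a l < \<infinity>" "S a l < \<infinity>"
    using A_const_dichotomy[OF K(1) sub l v exps(1) q exps(3)] unfolding wr N_def S_def by blast
  then show ?thesis
  proof cases
    case 1
    have "AE x in lebesgue. ennreal (w x powr r) * indicator (cbox a (a + vec l)) x = 0"
    proof -
      have "(\<lambda>x. ennreal (w x powr r) * indicator (cbox a (a + vec l)) x) \<in> borel_measurable lebesgue"
        by (intro borel_measurable_times_ennreal borel_measurable_indicator measurable_compose[OF _ measurable_ennreal]
            powr_real_measurable w borel_measurable_const) auto
      then show ?thesis using 1 unfolding N_def by (subst (asm) nn_integral_0_iff_AE)
    qed
    then have "AE x in lebesgue. ennreal (h x powr q * w x) * indicator (hcube a l) x = 0"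
      by eventually_elim (use hcube_subset_cbox[of a l] w0 in \<open>auto simp: indicator_def split: if_splits\<close>)
    then have "(\<integral>\<^sup>+x\<in>hcube a l. ennreal (h x powr q * w x) \<partial>lebesgue) = (\<integral>\<^sup>+x. 0 \<partial>(lebesgue :: (real ^ 'n) measure))"
      by (rule nn_integral_cong_AE)
    then show ?thesis by simp
  next
    case 2
    define \<sigma> where "\<sigma> D = enn2real (\<integral>\<^sup>+x\<in>D. ennreal (v x) epowr (1 - conj_exponent p) \<partial>lebesgue) powr (1 - 1 / p)" for D
    have fin: "N b \<delta> < \<infinity>" "S b \<delta> < \<infinity>" "cbox b (b + vec \<delta>) \<subseteq> \<Omega>"
      if "0 < \<delta>" "hcube b \<delta> \<subseteq> hcube a l" for b \<delta>
    proof -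
      have *: "cbox b (b + vec \<delta>) \<subseteq> cbox a (a + vec l)" by (rule hcube_subset_imp_cbox_subset[OF that])
      show "N b \<delta> < \<infinity>" using mono[OF *] 2(1) unfolding N_def by (rule order.strict_trans1)
      show "S b \<delta> < \<infinity>" using mono[OF *] 2(2) unfolding S_def by (rule order.strict_trans1)
      show "cbox b (b + vec \<delta>) \<subseteq> \<Omega>" using * sub by blast
    qed
    have le_half: "(\<integral>\<^sup>+x\<in>hcube b \<delta>. ennreal (w x powr r) \<partial>lebesgue) \<le> N b \<delta>"
      "(\<integral>\<^sup>+x\<in>hcube b \<delta>. ennreal (v x) epowr (1 - conj_exponent p) \<partial>lebesgue) \<le> S b \<delta>" for b \<delta>
      unfolding N_def S_def by (intro mono hcube_subset_cbox)+
    show ?thesis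
    proof (rule level_set_estimate[where \<sigma> = \<sigma> and \<rho> = \<rho> and s = s])
      show "(\<integral>\<^sup>+x\<in>hcube a l. ennreal (w x powr r) \<partial>lebesgue) < \<infinity>"
        using le_half(1)[of a l] 2(1) by (rule order.strict_trans1)
      show "0 \<le> \<sigma> D" for D by (simp add: \<sigma>_def)
    next
      fix b \<delta> assume \<delta>: "0 < \<delta>" "hcube b \<delta> \<subseteq> hcube a l"
      note f = fin[OF \<delta>]
      have "\<delta> powr (s - \<gamma>) * ((\<delta> ^ CARD('n)) powr (1 - 1 / r) * enn2real (N b \<delta>) powr (1 / r)) powr (1 / q) * enn2real (S b \<delta>) powr (1 - 1 / p) \<le> K * \<delta> ^ CARD('n)"
        using f(1,2) by (intro A_const_real[OF K(1,2) f(3) \<delta>(1) exps(1) q exps(3)]) (auto simp: wr N_def S_def)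
      moreover have "\<delta> powr (s - \<gamma>) * (measure lebesgue (hcube b \<delta>) powr (1 - 1 / r)
          * enn2real (\<integral>\<^sup>+x\<in>hcube b \<delta>. ennreal (w x powr r) \<partial>lebesgue) powr (1 / r)) powr (1 / q) * \<sigma> (hcube b \<delta>)
        \<le> \<delta> powr (s - \<gamma>) * ((\<delta> ^ CARD('n)) powr (1 - 1 / r) * enn2real (N b \<delta>) powr (1 / r)) powr (1 / q) * enn2real (S b \<delta>) powr (1 - 1 / p)"
        unfolding \<sigma>_def measure_hcube[OF less_imp_le[OF \<delta>(1)]] using exps q f le_half[of b \<delta>]
        by (intro mult_mono mult_left_mono powr_mono2 enn2real_mono) (auto intro!: mult_nonneg_nonneg)
      ultimately show "\<delta> powr (s - \<gamma>) * (measure lebesgue (hcube b \<delta>) powr (1 - 1 / r)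
          * enn2real (\<integral>\<^sup>+x\<in>hcube b \<delta>. ennreal (w x powr r) \<partial>lebesgue) powr (1 / r)) powr (1 / q) * \<sigma> (hcube b \<delta>)
        \<le> K * \<delta> ^ CARD('n)" by (rule order_trans[rotated])
    next
      fix b \<delta> k assume \<delta>: "0 < \<delta>" "hcube b \<delta> \<subseteq> hcube a l"
        and 1: "stop_eps CARD('n) q r * measure lebesgue (hcube b \<delta>) < measure lebesgue {x \<in> hcube b \<delta>. 2 powr real_of_int k \<le> h x}"
        and 2: "measure lebesgue {x \<in> hcube b \<delta>. 2 powr real_of_int (k - 1) \<le> h x} \<le> measure lebesgue (hcube b \<delta>) / 2"
      have "(\<integral>\<^sup>+x\<in>hcube b \<delta>. ennreal (v x) epowr (1 - conj_exponent p) \<partial>lebesgue) < \<infinity>"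
        using le_half(2)[of b \<delta>] fin(2)[OF \<delta>] by (rule order.strict_trans1)
      then show "2 powr real_of_int k \<le> C * \<delta> powr (s - CARD('n)) * \<sigma> (hcube b \<delta>) * enn2real (\<integral>\<^sup>+x\<in>hcube b \<delta>. \<rho> k x \<partial>lebesgue) powr (1 / p)"
        unfolding \<sigma>_def using PI[OF \<delta> _ _ 1 2, of "enn2real (\<integral>\<^sup>+x\<in>hcube b \<delta>. ennreal (v x) epowr (1 - conj_exponent p) \<partial>lebesgue)"] by simp
    qed (fact l exps K w w0 h h0 half \<rho> T T_le)+
  qed
qed

subsection \<open>Fractional estimate on a cube\<close>

lemma ident_borel_measurable_lebesgue: "(\<lambda>x. x) \<in> borel_measurable (lebesgue :: 'a::euclidean_space measure)"
  by (intro measurable_completion) simp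

lemma norm_diff_measurable_pair_lebesgue:
  "(\<lambda>z. norm (snd z - fst z)) \<in> borel_measurable (lebesgue \<Otimes>\<^sub>M (lebesgue :: 'a::euclidean_space measure))"
proof -
  have [measurable]: "fst \<in> borel_measurable ((lebesgue :: 'a measure) \<Otimes>\<^sub>M (lebesgue :: 'a measure))"
    "snd \<in> borel_measurable ((lebesgue :: 'a measure) \<Otimes>\<^sub>M (lebesgue :: 'a measure))"
    by (rule measurable_compose[OF measurable_fst ident_borel_measurable_lebesgue]
        measurable_compose[OF measurable_snd ident_borel_measurable_lebesgue])+
  show ?thesis by measurable
qed

lemma sum_powr2_atLeastAtMost_int:
  fixes m M :: int
  assumes "m \<le> M"
  shows "(\<Sum>k=m..M. 2 powr real_of_int (k - 1)) = 2 powr real_of_int M - 2 powr real_of_int (m - 1)"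
  using assms
proof (induction M rule: int_ge_induct)
  case base
  have "2 powr real_of_int m = 2 * 2 powr (real_of_int m - 1)" by (simp add: powr_diff)
  then show ?case by simp
next
  case (step M)
  have "{m..M + 1} = insert (M + 1) {m..M}" using step.hyps by auto
  moreover have "2 powr (real_of_int M + 1) = 2 * 2 powr real_of_int M" by (simp add: powr_add)
  ultimately show ?case using step.IH by simp
qed

text \<open>The bands \<open>[2\<^sup>k\<^sup>-\<^sup>1, 2\<^sup>k]\<close> that fit between \<open>s\<close> and \<open>t\<close> are disjoint.\<close>

lemma sum_bands_le:
  fixes J :: "int set"
  assumes "finite J" "1 \<le> p" and J: "\<And>k. k \<in> J \<Longrightarrow> s < 2 powr real_of_int (k - 1) \<and> 2 powr real_of_int k \<le> t"
  shows "(\<Sum>k\<in>J. (2 powr real_of_int (k - 1)) powr p) \<le> \<bar>t - s\<bar> powr p"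
proof (cases "J = {}")
  case False
  have "(\<Sum>k\<in>J. (2 powr real_of_int (k - 1)) powr p) \<le> (\<Sum>k\<in>J. 2 powr real_of_int (k - 1)) powr p"
    using assms by (intro sum_powr_le_powr_sum) auto
  also have "\<dots> \<le> \<bar>t - s\<bar> powr p"
  proof (rule powr_mono2)
    have "(\<Sum>k\<in>J. 2 powr real_of_int (k - 1)) \<le> (\<Sum>k=Min J..Max J. 2 powr real_of_int (k - 1))"
      using assms by (intro sum_mono2) auto
    also have "\<dots> = 2 powr real_of_int (Max J) - 2 powr real_of_int (Min J - 1)"
      using assms False by (intro sum_powr2_atLeastAtMost_int) simp
    also have "\<dots> \<le> \<bar>t - s\<bar>"
      using J[OF Max_in[OF assms(1) False]] J[OF Min_in[OF assms(1) False]] by linarith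
    finally show "(\<Sum>k\<in>J. 2 powr real_of_int (k - 1)) \<le> \<bar>t - s\<bar>" .
  qed (use assms in \<open>auto intro: sum_nonneg\<close>)
  finally show ?thesis .
qed (use assms in auto)

lemma hcube_norm_diff_le:
  fixes x y :: "real ^ 'n"
  assumes "x \<in> hcube b \<delta>" "y \<in> hcube b \<delta>"
  shows "norm (x - y) \<le> real CARD('n) * \<delta>"
proof -
  have "\<bar>(x - y) $ i\<bar> \<le> \<delta>" for i
    using assms by (auto simp: hcube_def dest!: spec[of _ i])
  then have "norm (x - y) \<le> (\<Sum>i\<in>(UNIV::'n set). \<delta>)"
    by (intro order_trans[OF norm_le_l1_cart] sum_mono)
  then show ?thesis by simp
qed

definition frac_kernel :: "real \<Rightarrow> real \<Rightarrow> (real ^ 'n \<Rightarrow> real) \<Rightarrow> real ^ 'n \<Rightarrow> real ^ 'n \<Rightarrow> real" where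
  "frac_kernel s p f x y = \<bar>f x - f y\<bar> powr p / norm (x - y) powr (real CARD('n) + s * p)"

text \<open>For y above the level 2^k and x below 2^(k-1), both in a cube D of side \<delta>, the
  kernel is at least 2^((k-1)p) (n \<delta>)^(-(n+sp)). Since the low set fills half of D, the
  energy of the band controls the \<open>v\<close>-mass of the high set, and Hoelder turns this into
  its Lebesgue measure, which exceeds \<epsilon> |D|. In \<open>C\<close> the factor 2 / \<epsilon>
  comes from this fraction and from 2^k = 2 2^(k-1), the factor 2^(1/p) from the half of D, and the
  power of n from the bound n \<delta> for distances in D.\<close>

lemma cube_frac_one_sided:
  fixes \<Omega> :: "(real ^ 'n) set" and f w v :: "real ^ 'n \<Rightarrow> real"
    and p q r s :: real
  defines "C \<equiv> 2 / stop_eps CARD('n) q r * 2 powr (1 / p) * real CARD('n) powr (real CARD('n) / p + s)"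
  assumes l: "0 < l" and sub: "cbox a (a + vec l) \<subseteq> \<Omega>"
    and exps: "1 < p" "p \<le> q" "1 < r" "0 \<le> \<gamma>" "0 < s" and K: "A_const \<Omega> (s - \<gamma>) r q p w v \<le> ennreal K" "0 \<le> K"
    and w[measurable]: "w \<in> borel_measurable lebesgue" and w0: "\<And>x. 0 \<le> w x"
    and v[measurable]: "v \<in> borel_measurable lebesgue" and v0: "\<And>x. 0 \<le> v x"
    and f[measurable]: "f \<in> borel_measurable lebesgue"
    and half: "measure lebesgue {x \<in> hcube a l. c < f x} \<le> measure lebesgue (hcube a l) / 2"
    and T: "0 \<le> T" "(\<integral>\<^sup>+y\<in>hcube a l. ennreal (v y) * (\<integral>\<^sup>+x\<in>hcube a l. ennreal (frac_kernel s p f x y) \<partial>lebesgue) \<partial>lebesgue) \<le> ennreal T"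
  shows "(\<integral>\<^sup>+x\<in>hcube a l. ennreal (max 0 (f x - c) powr q * w x) \<partial>lebesgue)
    \<le> ennreal (2 powr q * (2 * (1 + 2 powr q) * (C * K * l powr \<gamma>) powr q * T powr (q / p)))"
proof -
  interpret leb: sigma_finite_measure "lebesgue :: (real ^ 'n) measure" by (rule sigma_finite_lebesgue)
  define Q where "Q = hcube a l"
  define h where "h x = max 0 (f x - c)" for x
  have h_meas[measurable]: "h \<in> borel_measurable lebesgue" unfolding h_def by measurable
  define up where "up k = {y \<in> Q. 2 powr real_of_int k \<le> h y}" for k :: int
  define lo where "lo k = {x \<in> Q. h x < 2 powr real_of_int (k - 1)}" for k :: int
  have Qs[measurable]: "Q \<in> sets lebesgue" by (simp add: Q_def)
  have up_s[measurable]: "up k \<in> sets lebesgue" and lo_s[measurable]: "lo k \<in> sets lebesgue" for k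
  proof -
    have "up k = Q \<inter> (h -` {2 powr real_of_int k..} \<inter> space lebesgue)" "lo k = Q \<inter> (h -` {..<2 powr real_of_int (k - 1)} \<inter> space lebesgue)"
      by (auto simp: up_def lo_def)
    then show "up k \<in> sets lebesgue" "lo k \<in> sets lebesgue" using measurable_sets[OF h_meas] Qs by simp_all
  qed
  define e where "e = real CARD('n) + s * p"
  have e: "0 < e" using exps by (simp add: e_def add_pos_pos)
  \<comment> \<open>Only pairs that jump across the whole band count: y above 2^k, x below 2^(k-1).
    The weight stands at y, the point in the high set.\<close>
  define \<rho> where "\<rho> k y = ennreal (v y) * indicator (up k) y * (\<integral>\<^sup>+x. ennreal ((2 powr real_of_int (k - 1)) powr p / norm (x - y) powr e) * indicator (lo k) x \<partial>lebesgue)" for k y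
  have ker_meas: "(\<lambda>y. \<integral>\<^sup>+x. ennreal (t / norm (x - y) powr e) * indicator A x \<partial>lebesgue) \<in> borel_measurable lebesgue"
    if [measurable]: "A \<in> sets lebesgue" for A :: "(real ^ 'n) set" and t
  proof (rule leb.borel_measurable_nn_integral)
    note norm_diff_measurable_pair_lebesgue[measurable]
    have "(\<lambda>z. ennreal (t / norm (snd z - fst z) powr e) * indicator A (snd z)) \<in> borel_measurable (lebesgue \<Otimes>\<^sub>M lebesgue)"
      by measurable
    then show "(\<lambda>(y, x). ennreal (t / norm (x - y) powr e) * indicator A x) \<in> borel_measurable (lebesgue \<Otimes>\<^sub>M lebesgue)"
      by (simp add: split_beta')
  qed
  have kx: "(\<lambda>x. ennreal (t / norm (x - y) powr e) * indicator A x) \<in> borel_measurable lebesgue"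
    if "A \<in> sets lebesgue" for A :: "(real ^ 'n) set" and t y
  proof -
    have "(\<lambda>x. norm (x - y)) \<in> borel_measurable lebesgue" by (intro measurable_completion) measurable
    then show ?thesis using that
      by (intro borel_measurable_times_ennreal borel_measurable_indicator measurable_compose[OF _ measurable_ennreal]
          borel_measurable_divide powr_real_measurable borel_measurable_const)
  qed
  have \<rho>_meas: "\<rho> k \<in> borel_measurable lebesgue" for k
    unfolding \<rho>_def
    by (intro borel_measurable_times_ennreal borel_measurable_indicator ker_meas up_s lo_s measurable_compose[OF v measurable_ennreal])
  \<comment> \<open>For a fixed pair the bands crossed lie disjointly between h x and h y, so their
    p-th powers sum to at most the kernel numerator. Summing over the levels thus costs no
    constant.\<close>
  have \<rho>_sum: "(\<Sum>k\<in>J. \<rho> k y) \<le> ennreal (v y) * (\<integral>\<^sup>+x\<in>Q. ennreal (frac_kernel s p f x y) \<partial>lebesgue)" if J: "finite J" for J y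
  proof -
    have "(\<Sum>k\<in>J. \<rho> k y) = ennreal (v y) * (\<Sum>k\<in>J. indicator (up k) y * (\<integral>\<^sup>+x. ennreal ((2 powr real_of_int (k - 1)) powr p / norm (x - y) powr e) * indicator (lo k) x \<partial>lebesgue))"
      by (simp add: \<rho>_def sum_distrib_left mult.assoc)
    also have "(\<Sum>k\<in>J. indicator (up k) y * (\<integral>\<^sup>+x. ennreal ((2 powr real_of_int (k - 1)) powr p / norm (x - y) powr e) * indicator (lo k) x \<partial>lebesgue))
      = (\<integral>\<^sup>+x. (\<Sum>k\<in>J. indicator (up k) y * (ennreal ((2 powr real_of_int (k - 1)) powr p / norm (x - y) powr e) * indicator (lo k) x)) \<partial>lebesgue)"
      by (subst nn_integral_sum, intro borel_measurable_times_ennreal[OF borel_measurable_const] kx lo_s,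
          intro sum.cong refl nn_integral_cmult[symmetric] kx lo_s)
    also have "\<dots> \<le> (\<integral>\<^sup>+x\<in>Q. ennreal (frac_kernel s p f x y) \<partial>lebesgue)"
    proof (rule nn_integral_mono)
      fix x
      define J' where "J' = {k \<in> J. y \<in> up k \<and> x \<in> lo k}"
      have J': "finite J'" "J' \<subseteq> J" using J by (auto simp: J'_def)
      have "(\<Sum>k\<in>J. indicator (up k) y * (ennreal ((2 powr real_of_int (k - 1)) powr p / norm (x - y) powr e) * indicator (lo k) x))
        = (\<Sum>k\<in>J'. ennreal ((2 powr real_of_int (k - 1)) powr p / norm (x - y) powr e))"
        using J J'(2) by (intro sum.mono_neutral_cong_right) (auto simp: J'_def indicator_def)
      also have "\<dots> = ennreal ((\<Sum>k\<in>J'. (2 powr real_of_int (k - 1)) powr p) / norm (x - y) powr e)"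
        by (simp add: sum_ennreal sum_divide_distrib)
      also have "\<dots> \<le> ennreal (frac_kernel s p f x y) * indicator Q x"
      proof (cases "J' = {}")
        case False
        then have "x \<in> Q" by (auto simp: J'_def lo_def)
        have "(\<Sum>k\<in>J'. (2 powr real_of_int (k - 1)) powr p) \<le> \<bar>h y - h x\<bar> powr p"
          using exps J' by (intro sum_bands_le) (auto simp: J'_def up_def lo_def)
        also have "\<dots> \<le> \<bar>f x - f y\<bar> powr p" using exps by (intro powr_mono2) (auto simp: h_def)
        finally show ?thesis using \<open>x \<in> Q\<close> by (simp add: frac_kernel_def e_def divide_right_mono ennreal_leI)
      qed simp
      finally show "(\<Sum>k\<in>J. indicator (up k) y * (ennreal ((2 powr real_of_int (k - 1)) powr p / norm (x - y) powr e) * indicator (lo k) x))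
        \<le> ennreal (frac_kernel s p f x y) * indicator Q x" .
    qed
    finally show ?thesis by (simp add: mult_left_mono)
  qed
  have T_le: "(\<Sum>k\<in>J. \<integral>\<^sup>+y\<in>Q. \<rho> k y \<partial>lebesgue) \<le> ennreal T" if J: "finite J" for J
  proof -
    have "(\<Sum>k\<in>J. \<integral>\<^sup>+y\<in>Q. \<rho> k y \<partial>lebesgue) = (\<integral>\<^sup>+y\<in>Q. (\<Sum>k\<in>J. \<rho> k y) \<partial>lebesgue)"
      using \<rho>_meas by (subst nn_integral_sum[symmetric]) (auto simp: sum_distrib_right)
    also have "\<dots> \<le> (\<integral>\<^sup>+y\<in>Q. ennreal (v y) * (\<integral>\<^sup>+x\<in>Q. ennreal (frac_kernel s p f x y) \<partial>lebesgue) \<partial>lebesgue)"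
      by (intro nn_integral_mono mult_right_mono \<rho>_sum J) auto
    also have "\<dots> \<le> ennreal T" using T by (simp add: Q_def)
    finally show ?thesis .
  qed
  define \<epsilon> where "\<epsilon> = stop_eps CARD('n) q r"
  have \<epsilon>: "0 < \<epsilon>" using stop_eps[OF exps(3)] by (simp add: \<epsilon>_def)
  have C0: "0 \<le> C" unfolding C_def using \<epsilon> by (simp add: \<epsilon>_def)
  have half': "measure lebesgue {x \<in> hcube a l. 0 < h x} \<le> measure lebesgue (hcube a l) / 2"
  proof -
    have "0 < h x \<longleftrightarrow> c < f x" for x by (auto simp: h_def)
    then show ?thesis using half by simp
  qed
  have "(\<integral>\<^sup>+x\<in>hcube a l. ennreal (h x powr q * w x) \<partial>lebesgue)
    \<le> ennreal (2 powr q * (2 * (1 + 2 powr q) * (C * K * l powr \<gamma>) powr q * T powr (q / p)))"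
  proof (rule cube_level_estimate[OF l sub exps(1-4) K C0 w w0 v h_meas _ half' \<rho>_meas T(1)])
    show "0 \<le> h x" for x by (simp add: h_def)
    show "(\<Sum>k\<in>J. \<integral>\<^sup>+y\<in>hcube a l. \<rho> k y \<partial>lebesgue) \<le> ennreal T" if "finite J" for J
      using T_le[OF that] by (simp add: Q_def)
    fix b \<delta> k S
    assume \<delta>: "0 < \<delta>" and DQ: "hcube b \<delta> \<subseteq> hcube a l"
      and S: "(\<integral>\<^sup>+x\<in>hcube b \<delta>. ennreal (v x) epowr (1 - conj_exponent p) \<partial>lebesgue) \<le> ennreal S" "0 \<le> S"
      and big: "stop_eps CARD('n) q r * measure lebesgue (hcube b \<delta>) < measure lebesgue {x \<in> hcube b \<delta>. 2 powr real_of_int k \<le> h x}"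
      and small: "measure lebesgue {x \<in> hcube b \<delta>. 2 powr real_of_int (k - 1) \<le> h x} \<le> measure lebesgue (hcube b \<delta>) / 2"
    define D where "D = hcube b \<delta>"
    define m where "m = measure lebesgue D"
    have m: "m = \<delta> ^ CARD('n)" "0 < m" using \<delta> by (simp_all add: m_def D_def measure_hcube del: measure_completion)
    have Dl: "D \<in> lmeasurable" and Ds[measurable]: "D \<in> sets lebesgue" by (auto simp: D_def)
    define A B where "A = D \<inter> lo k" and "B = D \<inter> up k"
    have AB[measurable]: "A \<in> sets lebesgue" "B \<in> sets lebesgue" by (auto simp: A_def B_def)
    have ABl: "A \<in> lmeasurable" "B \<in> lmeasurable" by (auto intro!: fmeasurableI2[OF Dl] simp: A_def B_def)
    have B_eq: "B = {x \<in> D. 2 powr real_of_int k \<le> h x}" using DQ by (auto simp: B_def up_def D_def Q_def)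
    have A_eq: "D - A = {x \<in> D. 2 powr real_of_int (k - 1) \<le> h x}" using DQ by (auto simp: A_def lo_def D_def Q_def)
    have mB: "\<epsilon> * m < measure lebesgue B" using big unfolding D_def[symmetric] m_def[symmetric] B_eq \<epsilon>_def .
    have "measure lebesgue (D - A) \<le> m / 2" using small unfolding D_def[symmetric] m_def[symmetric] A_eq .
    moreover have "measure lebesgue (D - A) = m - measure lebesgue A"
      unfolding m_def using Dl ABl by (intro measurable_measure_Diff) (auto simp: A_def)
    ultimately have mA: "m / 2 \<le> measure lebesgue A" by simp
    \<comment> \<open>The minimum of the kernel over pairs crossing the band, times the lower bound
      |D|/2 for the measure of the low set.\<close>
    define \<kappa> where "\<kappa> = m / 2 * (2 powr real_of_int (k - 1)) powr p / (real CARD('n) * \<delta>) powr e"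
    have \<kappa>: "0 < \<kappa>" using m \<delta> by (simp add: \<kappa>_def)
    have \<rho>_ge: "ennreal \<kappa> * (ennreal (v y) * indicator B y) \<le> \<rho> k y * indicator D y" for y
    proof (cases "y \<in> B")
      case True
      define t where "t = (2 powr real_of_int (k - 1)) powr p / (real CARD('n) * \<delta>) powr e"
      have "ennreal \<kappa> \<le> ennreal t * emeasure lebesgue A"
      proof -
        have "\<kappa> = t * (m / 2)" by (simp add: \<kappa>_def t_def mult.commute)
        also have "\<dots> \<le> t * measure lebesgue A" using mA by (intro mult_left_mono) (auto simp: t_def)
        finally show ?thesis
          unfolding emeasure_eq_measure2[OF ABl(1)] by (subst ennreal_mult[symmetric]) (auto simp: t_def intro: ennreal_leI)
      qed
      also have "\<dots> = (\<integral>\<^sup>+x. ennreal t * indicator A x \<partial>lebesgue)" by (simp add: nn_integral_cmult)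
      also have "\<dots> \<le> (\<integral>\<^sup>+x. ennreal ((2 powr real_of_int (k - 1)) powr p / norm (x - y) powr e) * indicator (lo k) x \<partial>lebesgue)"
      proof (rule nn_integral_mono)
        fix x
        show "ennreal t * indicator A x \<le> ennreal ((2 powr real_of_int (k - 1)) powr p / norm (x - y) powr e) * indicator (lo k) x"
        proof (cases "x \<in> A")
          case xA: True
          have "2 powr real_of_int (k - 1) \<le> 2 powr real_of_int k" by (intro powr_mono) auto
          moreover have "h x < 2 powr real_of_int (k - 1)" using xA by (simp only: A_def lo_def Int_iff mem_Collect_eq)
          moreover have "2 powr real_of_int k \<le> h y" using True by (simp only: B_def up_def Int_iff mem_Collect_eq)
          ultimately have "h x < h y" by linarith
          then have "x \<noteq> y" by auto
          moreover have "norm (x - y) \<le> real CARD('n) * \<delta>"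
            using xA True by (intro hcube_norm_diff_le) (auto simp: A_def B_def D_def)
          ultimately have "t \<le> (2 powr real_of_int (k - 1)) powr p / norm (x - y) powr e"
            unfolding t_def using e \<delta> by (intro divide_left_mono powr_mono2 mult_pos_pos) auto
          then show ?thesis using xA by (simp add: A_def ennreal_leI)
        qed simp
      qed
      finally show ?thesis
        unfolding \<rho>_def using True mult_left_mono[of "ennreal \<kappa>" _ "ennreal (v y)"]
        by (simp add: B_def mult.commute[of "ennreal \<kappa>" "ennreal (v y)"])
    qed simp
    define M where "M = enn2real (\<integral>\<^sup>+x\<in>D. \<rho> k x \<partial>lebesgue)"
    have "(\<integral>\<^sup>+x\<in>D. \<rho> k x \<partial>lebesgue) \<le> (\<integral>\<^sup>+x\<in>Q. \<rho> k x \<partial>lebesgue)"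
      using DQ by (intro nn_integral_mono) (auto simp: D_def Q_def indicator_def)
    also have "\<dots> \<le> ennreal T" using T_le[of "{k}"] by simp
    finally have M: "(\<integral>\<^sup>+x\<in>D. \<rho> k x \<partial>lebesgue) = ennreal M" "0 \<le> M"
      unfolding M_def by (auto simp: ennreal_enn2real_if top_unique)
    have "ennreal \<kappa> * (\<integral>\<^sup>+y. ennreal (v y) * indicator B y \<partial>lebesgue) \<le> ennreal M"
      unfolding M(1)[symmetric] by (subst nn_integral_cmult[symmetric]) (auto intro!: nn_integral_mono \<rho>_ge)
    then have "ennreal (1 / \<kappa>) * (ennreal \<kappa> * (\<integral>\<^sup>+y. ennreal (v y) * indicator B y \<partial>lebesgue)) \<le> ennreal (1 / \<kappa>) * ennreal M"
      by (intro mult_left_mono) auto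
    then have vB: "(\<integral>\<^sup>+y. ennreal (v y) * indicator B y \<partial>lebesgue) \<le> ennreal (M / \<kappa>)"
      using \<kappa> M(2) by (simp flip: ennreal_mult mult.assoc)
    have "(\<integral>\<^sup>+x\<in>D. ennreal (indicator B x) \<partial>lebesgue) \<le> ennreal ((M / \<kappa>) powr (1 / p) * S powr (1 - 1 / p))"
    proof (rule nn_integral_weight_Holder[OF v _ Ds v0 _ exps(1) _ S(2)])
      have "ennreal (indicator B x powr p * v x) * indicator D x = ennreal (v x) * indicator B x" for x
        using exps by (auto simp: indicator_def B_def)
      then show "(\<integral>\<^sup>+x\<in>D. ennreal (indicator B x powr p * v x) \<partial>lebesgue) \<le> ennreal (M / \<kappa>)" using vB by simp
    qed (use S \<kappa> M in \<open>auto simp: D_def\<close>)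
    moreover have "ennreal (indicator B x) * indicator D x = indicator B x" for x by (auto simp: indicator_def B_def)
    ultimately have "ennreal (measure lebesgue B) \<le> ennreal ((M / \<kappa>) powr (1 / p) * S powr (1 - 1 / p))"
      using ABl by (simp add: emeasure_eq_measure2)
    then have "measure lebesgue B \<le> (M / \<kappa>) powr (1 / p) * S powr (1 - 1 / p)" by (subst (asm) ennreal_le_iff) auto
    with mB have main: "\<epsilon> * m \<le> (M / \<kappa>) powr (1 / p) * S powr (1 - 1 / p)" by linarith
    define u where "u = \<kappa> powr (1 / p)"
    have u: "u = (1 / 2) powr (1 / p) * m powr (1 / p) * 2 powr real_of_int (k - 1) / (real CARD('n) * \<delta>) powr (real CARD('n) / p + s)"
    proof -
      have "e * (1 / p) = real CARD('n) / p + s" using exps by (simp add: e_def field_simps)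
      moreover have "m / 2 * (2 powr real_of_int (k - 1)) powr p / (real CARD('n) * \<delta>) powr e
        = (1 / 2) * m * (2 powr real_of_int (k - 1)) powr p / (real CARD('n) * \<delta>) powr e" by simp
      ultimately show ?thesis
        unfolding u_def \<kappa>_def using m \<delta> exps by (simp only: powr_divide powr_mult powr_powr) simp
    qed
    have u0: "0 < u" using \<kappa> by (simp add: u_def)
    have "\<epsilon> * m * u \<le> M powr (1 / p) * S powr (1 - 1 / p)"
    proof -
      have "(M / \<kappa>) powr (1 / p) = M powr (1 / p) / u" using \<kappa> M by (simp add: powr_divide u_def)
      then have "\<epsilon> * m * u \<le> (M powr (1 / p) / u * S powr (1 - 1 / p)) * u"
        using main u0 by (intro mult_right_mono) auto
      then show ?thesis using u0 by simp
    qed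
    \<comment> \<open>Multiplication by the reciprocal of everything except 2^k: the left-hand side
      becomes 2^k, and the powers of \<open>\<delta>\<close> on the right collect to \<delta>^(s -
      n).\<close>
    then have main2: "\<epsilon> * m * u * (2 / \<epsilon> * 2 powr (1 / p) * (real CARD('n) * \<delta>) powr (real CARD('n) / p + s) * m powr (- (1 + 1 / p)))
      \<le> M powr (1 / p) * S powr (1 - 1 / p) * (2 / \<epsilon> * 2 powr (1 / p) * (real CARD('n) * \<delta>) powr (real CARD('n) / p + s) * m powr (- (1 + 1 / p)))"
      using \<epsilon> by (intro mult_right_mono) auto
    have two: "2 powr real_of_int k = 2 * 2 powr real_of_int (k - 1)" by (simp add: powr_diff)
    have half2: "(1 / 2 :: real) powr (1 / p) * 2 powr (1 / p) = 1"
      by (simp flip: powr_mult)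
    have mm: "m * m powr (1 / p) * m powr (- (1 + 1 / p)) = 1"
    proof -
      have "m = m powr 1" using m by simp
      then have "m * m powr (1 / p) * m powr (- (1 + 1 / p)) = m powr (1 + 1 / p + - (1 + 1 / p))"
        by (metis powr_add)
      then show ?thesis using m(2) by simp
    qed
    have lhs: "\<epsilon> * m * u * (2 / \<epsilon> * 2 powr (1 / p) * (real CARD('n) * \<delta>) powr (real CARD('n) / p + s) * m powr (- (1 + 1 / p)))
      = 2 powr real_of_int k"
    proof -
      define z where "z = (real CARD('n) * \<delta>) powr (real CARD('n) / p + s)"
      have z: "0 < z" using \<delta> by (simp add: z_def)
      have gen: "e * m * (h * x * y / z) * (2 / e * t * z * w) = (h * t) * (m * x * w) * (2 * y)"
        if "e \<noteq> 0" "z \<noteq> 0" for e m h x y z t w :: real using that by (simp add: field_simps)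
      show ?thesis unfolding u z_def[symmetric] using \<epsilon> z
        by (subst gen) (simp_all only: half2 mm two[symmetric] mult_1 less_imp_neq[THEN not_sym] not_False_eq_True)
    qed
    have rhs: "2 / \<epsilon> * 2 powr (1 / p) * (real CARD('n) * \<delta>) powr (real CARD('n) / p + s) * m powr (- (1 + 1 / p)) = C * \<delta> powr (s - CARD('n))"
    proof -
      have "m powr (- (1 + 1 / p)) = \<delta> powr (real CARD('n) * (- (1 + 1 / p)))"
        using \<delta> by (simp add: m powr_powr flip: powr_realpow)
      then have "(real CARD('n) * \<delta>) powr (real CARD('n) / p + s) * m powr (- (1 + 1 / p))
        = real CARD('n) powr (real CARD('n) / p + s) * \<delta> powr ((real CARD('n) / p + s) + real CARD('n) * (- (1 + 1 / p)))"
        using \<delta> by (simp add: powr_mult flip: powr_add)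
      also have "(real CARD('n) / p + s) + real CARD('n) * (- (1 + 1 / p)) = s - CARD('n)"
        using exps by (simp add: field_simps)
      finally show ?thesis by (simp add: C_def \<epsilon>_def mult.assoc)
    qed
    show "2 powr real_of_int k \<le> C * \<delta> powr (s - CARD('n)) * S powr (1 - 1 / p) * enn2real (\<integral>\<^sup>+x\<in>hcube b \<delta>. \<rho> k x \<partial>lebesgue) powr (1 / p)"
      using main2[unfolded lhs, unfolded rhs] unfolding M_def[symmetric] D_def[symmetric] by (simp add: mult_ac)
  qed
  then show ?thesis by (simp add: h_def)
qed

subsection \<open>Bump functions\<close>

text \<open>The usual flat function exp(-c/t). The powers of t in the denominator are included
  because differentiation produces them: the derivative is a combination of two members of the
  family. The parameter c will tend to 0.\<close>

definition flat_exp :: "real \<Rightarrow> nat \<Rightarrow> real \<Rightarrow> real" where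
  "flat_exp c k t = (if 0 < t then exp (- c / t) / t ^ k else 0)"

text \<open>Raise u \<le> exp u, taken at u = c / (t m), to the power m.\<close>

lemma flat_exp_le:
  assumes c: "0 < c" and t: "0 < t" and m: "0 < m"
  shows "exp (- c / t) \<le> (real m / c) ^ m * t ^ m"
proof -
  have "(c / t / real m) ^ m \<le> exp (c / t / real m) ^ m"
  proof (rule power_mono)
    show "c / t / real m \<le> exp (c / t / real m)" using exp_ge_add_one_self[of "c / t / real m"] by linarith
  qed (use assms in auto)
  also have "\<dots> = exp (c / t)" using m by (simp flip: exp_of_nat_mult)
  finally have "1 / exp (c / t) \<le> 1 / (c / t / real m) ^ m"
    using assms by (intro divide_left_mono) auto
  then show ?thesis using assms by (simp add: exp_minus field_simps power_mult_distrib)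
qed

lemma flat_exp_deriv:
  assumes c: "0 < c"
  shows "(flat_exp c k has_real_derivative (c * flat_exp c (k + 2) t - real k * flat_exp c (k + 1) t)) (at t)"
proof -
  consider "0 < t" | "t < 0" | "t = 0" by linarith
  then show ?thesis
  proof cases
    case 1
    have "((\<lambda>t. exp (- c / t) / t ^ k) has_real_derivative
        (exp (- c / t) * (c / t\<^sup>2) * t ^ k - exp (- c / t) * (real k * t ^ (k - 1))) / (t ^ k * t ^ k)) (at t)"
      using 1 by (auto intro!: derivative_eq_intros simp: power2_eq_square)
    also have "(exp (- c / t) * (c / t\<^sup>2) * t ^ k - exp (- c / t) * (real k * t ^ (k - 1))) / (t ^ k * t ^ k)
      = c * flat_exp c (k + 2) t - real k * flat_exp c (k + 1) t"
      using 1 by (cases k) (auto simp: flat_exp_def field_simps power2_eq_square power_add)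
    finally show ?thesis
      by (rule has_field_derivative_transform_within_open[of _ _ _ "{0<..}"]) (use 1 in \<open>auto simp: flat_exp_def\<close>)
  next
    case 2
    have "((\<lambda>t. 0) has_real_derivative 0) (at t)" by simp
    then have "(flat_exp c k has_real_derivative 0) (at t)"
      by (rule has_field_derivative_transform_within_open[of _ _ _ "{..<0}"]) (use 2 in \<open>auto simp: flat_exp_def\<close>)
    then show ?thesis using 2 by (simp add: flat_exp_def)
  next
    case 3
    \<comment> \<open>Of the m = k + 2 powers, k cancel the denominator, one pays for the difference
      quotient, and the last makes the quotient tend to 0.\<close>
    define m where "m = k + 2"
    define B where "B = (real m / c) ^ m"
    have B: "0 \<le> B" using c by (simp add: B_def)
    have "((\<lambda>x. (flat_exp c k x - flat_exp c k 0) / (x - 0)) \<longlongrightarrow> 0) (at 0)"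
    proof (rule Lim_null_comparison)
      have "norm ((flat_exp c k x - flat_exp c k 0) / (x - 0)) \<le> B * \<bar>x\<bar>" for x
      proof (cases "0 < x")
        case True
        have "exp (- c / x) \<le> B * x ^ m" unfolding B_def by (rule flat_exp_le[OF c True]) (simp add: m_def)
        then have "exp (- c / x) / x ^ k / x \<le> B * x ^ m / x ^ k / x" using True by (intro divide_right_mono) auto
        also have "\<dots> = B * x" using True by (simp add: m_def power_add power2_eq_square)
        finally show ?thesis using True by (simp add: flat_exp_def)
      qed (use B in \<open>auto simp: flat_exp_def mult_nonneg_nonpos\<close>)
      then show "\<forall>\<^sub>F x in at 0. norm ((flat_exp c k x - flat_exp c k 0) / (x - 0)) \<le> B * \<bar>x\<bar>"
        by (intro always_eventually allI)
      have "((\<lambda>x. B * \<bar>x\<bar>) \<longlongrightarrow> B * \<bar>0\<bar>) (at (0::real))" by (intro tendsto_intros)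
      then show "((\<lambda>x. B * \<bar>x\<bar>) \<longlongrightarrow> 0) (at (0::real))" by simp
    qed
    then have "(flat_exp c k has_real_derivative 0) (at 0)"
      by (simp add: has_field_derivative_iff)
    then show ?thesis using 3 by (simp add: flat_exp_def)
  qed
qed

text \<open>An algebra of functions chosen to be closed under partial derivatives. Differentiability
  to every order then follows by induction on the order alone, and it contains all the test
  functions that occur.\<close>

inductive smooth_alg :: "(real ^ 'n::finite \<Rightarrow> real) \<Rightarrow> bool" where
  const: "smooth_alg (\<lambda>_. r)"
| base: "0 < c \<Longrightarrow> smooth_alg (\<lambda>x. flat_exp c k (u * x $ i + b))"
| add: "smooth_alg f \<Longrightarrow> smooth_alg g \<Longrightarrow> smooth_alg (\<lambda>x. f x + g x)"
| mult: "smooth_alg f \<Longrightarrow> smooth_alg g \<Longrightarrow> smooth_alg (\<lambda>x. f x * g x)"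

lemma smooth_alg_derivative:
  fixes f :: "real ^ 'n::finite \<Rightarrow> real"
  assumes "smooth_alg f"
  shows "(\<forall>x. f differentiable (at x)) \<and> (\<forall>i. smooth_alg (pderiv_at i f))"
  using assms
proof (induction rule: smooth_alg.induct)
  case (const r)
  have "pderiv_at i (\<lambda>_. r) = (\<lambda>_. 0)" for i :: 'n
    by (auto simp: pderiv_at_def fun_eq_iff)
  then show ?case by (auto intro: smooth_alg.const)
next
  case (base c k u j b)
  define D where "D t = c * flat_exp c (k + 2) t - real k * flat_exp c (k + 1) t" for t
  have der: "((\<lambda>x. flat_exp c k (u * x $ j + b)) has_derivative (\<lambda>h. D (u * x $ j + b) * (u * h $ j))) (at x)" for x :: "real ^ 'n"
  proof -
    have "(flat_exp c k has_derivative (\<lambda>h. D (u * x $ j + b) * h)) (at (u * x $ j + b))"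
      using flat_exp_deriv[OF base] by (simp add: has_field_derivative_def D_def mult_commute_abs)
    moreover have "((\<lambda>x. u * x $ j + b) has_derivative (\<lambda>h. u * h $ j)) (at x)"
      by (auto intro!: derivative_eq_intros bounded_linear.has_derivative[OF bounded_linear_vec_nth])
    ultimately show ?thesis by (rule has_derivative_compose[rotated])
  qed
  have pd: "pderiv_at i (\<lambda>x. flat_exp c k (u * x $ j + b))
    = (\<lambda>x. (u * (axis i 1 :: real ^ 'n) $ j) * (c * flat_exp c (k + 2) (u * x $ j + b) + (- real k) * flat_exp c (k + 1) (u * x $ j + b)))" for i :: 'n
    using frechet_derivative_at[OF der, symmetric] by (auto simp: pderiv_at_def fun_eq_iff D_def)
  have "smooth_alg (pderiv_at i (\<lambda>x. flat_exp c k (u * x $ j + b)))" for i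
    unfolding pd by (intro smooth_alg.mult smooth_alg.const smooth_alg.add smooth_alg.base base)
  then show ?case using der by (auto simp: differentiable_def)
next
  case (add f g)
  have fd: "(f has_derivative frechet_derivative f (at x)) (at x)" "(g has_derivative frechet_derivative g (at x)) (at x)" for x
    using add by (auto simp: frechet_derivative_works)
  have der: "((\<lambda>x. f x + g x) has_derivative (\<lambda>h. frechet_derivative f (at x) h + frechet_derivative g (at x) h)) (at x)" for x
    by (intro has_derivative_add fd)
  have "pderiv_at i (\<lambda>x. f x + g x) = (\<lambda>x. pderiv_at i f x + pderiv_at i g x)" for i
    using frechet_derivative_at[OF der, symmetric] by (auto simp: pderiv_at_def fun_eq_iff)
  then show ?case using der add by (auto simp: differentiable_def intro!: smooth_alg.intros)
next
  case (mult f g)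
  have fd: "(f has_derivative frechet_derivative f (at x)) (at x)" "(g has_derivative frechet_derivative g (at x)) (at x)" for x
    using mult by (auto simp: frechet_derivative_works)
  have der: "((\<lambda>x. f x * g x) has_derivative (\<lambda>h. f x * frechet_derivative g (at x) h + frechet_derivative f (at x) h * g x)) (at x)" for x
    by (intro has_derivative_mult fd)
  have "pderiv_at i (\<lambda>x. f x * g x) = (\<lambda>x. f x * pderiv_at i g x + pderiv_at i f x * g x)" for i
    using frechet_derivative_at[OF der, symmetric] by (auto simp: pderiv_at_def fun_eq_iff)
  then show ?case using der mult by (auto simp: differentiable_def intro!: smooth_alg.intros)
qed

lemma smooth_alg_C_k: "smooth_alg f \<Longrightarrow> C_k k f"
proof (induction k arbitrary: f)
  case 0
  then show ?case using smooth_alg_derivative[of f]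
    by (auto intro!: differentiable_imp_continuous_on simp: differentiable_on_def differentiable_at_withinI)
next
  case (Suc k)
  then show ?case using smooth_alg_derivative[of f]
    by (auto simp: differentiable_on_def differentiable_at_withinI)
qed

lemma smooth_alg_prod: "finite I \<Longrightarrow> (\<And>i. i \<in> I \<Longrightarrow> smooth_alg (f i)) \<Longrightarrow> smooth_alg (\<lambda>x. \<Prod>i\<in>I. f i x)"
  by (induction I rule: finite_induct) (auto intro: smooth_alg.intros)

text \<open>With c = 1 / (j + 1) each factor tends to 1 where its argument is positive, so the bumps
  converge to the indicator of the open box while staying below 1. A translate of a bump is the bump
  of the translated box.\<close>

definition box_bump :: "nat \<Rightarrow> real ^ 'n \<Rightarrow> real ^ 'n \<Rightarrow> real ^ 'n \<Rightarrow> real" where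
  "box_bump j a b x = (\<Prod>i\<in>UNIV. flat_exp (1 / real (Suc j)) 0 (x $ i - a $ i) * flat_exp (1 / real (Suc j)) 0 (b $ i - x $ i))"

lemma smooth_alg_box_bump: "smooth_alg (box_bump j a b)"
proof -
  have "smooth_alg (\<lambda>x. \<Prod>i\<in>UNIV. flat_exp (1 / real (Suc j)) 0 (1 * x $ i + (- a $ i)) * flat_exp (1 / real (Suc j)) 0 ((- 1) * x $ i + b $ i))"
    by (intro smooth_alg_prod smooth_alg.mult smooth_alg.base) auto
  then show ?thesis by (simp add: box_bump_def[abs_def] algebra_simps)
qed

lemma box_bump_bounds: "0 \<le> box_bump j a b x" "box_bump j a b x \<le> 1"
proof -
  have *: "0 \<le> flat_exp (1 / real (Suc j)) 0 t" "flat_exp (1 / real (Suc j)) 0 t \<le> 1" for t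
    by (auto simp: flat_exp_def)
  show "0 \<le> box_bump j a b x" unfolding box_bump_def by (intro prod_nonneg mult_nonneg_nonneg ballI *)
  show "box_bump j a b x \<le> 1" unfolding box_bump_def
    by (intro prod_le_1 conjI mult_nonneg_nonneg mult_le_one *)
qed

lemma box_bump_eq_0: "x \<notin> box a b \<Longrightarrow> box_bump j a b x = 0"
  by (auto simp: box_bump_def mem_box_cart flat_exp_def prod_zero_iff)

lemma box_bump_shift: "box_bump j a b (x - h) = box_bump j (a + h) (b + h) x"
  by (simp add: box_bump_def algebra_simps)

lemma box_bump_tendsto: "(\<lambda>j. box_bump j a b x) \<longlonglongrightarrow> indicator (box a b) x"
proof (cases "x \<in> box a b")
  case True
  have *: "(\<lambda>j. flat_exp (1 / real (Suc j)) 0 t) \<longlonglongrightarrow> 1" if "0 < t" for t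
  proof -
    have "(\<lambda>j. exp (- (1 / real (Suc j)) / t)) \<longlonglongrightarrow> exp (- 0 / t)"
      using that by (intro tendsto_intros LIMSEQ_Suc[OF lim_1_over_n]) auto
    then show ?thesis using that by (simp add: flat_exp_def)
  qed
  have "(\<lambda>j. box_bump j a b x) \<longlonglongrightarrow> (\<Prod>i\<in>(UNIV :: 'a set). 1 * 1)"
    unfolding box_bump_def using True by (intro tendsto_prod tendsto_mult *) (auto simp: mem_box_cart)
  then show ?thesis using True by simp
qed (simp add: box_bump_eq_0)

lemma box_bump_test_function:
  assumes "cbox a b \<subseteq> \<Omega>"
  shows "test_function_on \<Omega> (box_bump j a b)"
proof -
  have sub0: "{x. box_bump j a b x \<noteq> 0} \<subseteq> cbox a b"
    using box_bump_eq_0[of _ a b j] box_subset_cbox[of a b] by auto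
  have sub: "closure {x. box_bump j a b x \<noteq> 0} \<subseteq> cbox a b"
    by (rule closure_minimal[OF sub0]) (rule closed_cbox)
  have "compact (closure {x. box_bump j a b x \<noteq> 0})"
    using bounded_subset[OF bounded_cbox sub0] by (simp add: compact_closure)
  then show ?thesis unfolding test_function_on_def
    using smooth_alg_C_k[OF smooth_alg_box_bump] sub assms by blast
qed

subsection \<open>Weak gradients on a cube\<close>

text \<open>Open boxes are stable under intersection and generate the Borel sets, so a Dynkin
  argument spreads vanishing integrals from boxes to all Borel sets. Testing on the sets where the
  function is positive or negative finishes the proof.\<close>

lemma AE_zero_if_box_integrals_zero:
  fixes \<Phi> :: "real ^ 'n \<Rightarrow> real"
  assumes int: "integrable lborel (\<lambda>x. indicator (box c d) x * \<Phi> x)"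
    and zero: "\<And>a b. cbox a b \<subseteq> cbox c d \<Longrightarrow> (LINT x|lborel. indicator (box a b) x * \<Phi> x) = 0"
  shows "AE x in lborel. x \<in> box c d \<longrightarrow> \<Phi> x = 0"
proof -
  define f where "f x = indicator (box c d) x * \<Phi> x" for x
  have f_int: "integrable lborel f" using int by (simp add: f_def[abs_def])
  have set_int: "set_integrable lborel A f" if "A \<in> sets borel" for A
    using that f_int unfolding set_integrable_def by (intro integrable_mult_indicator) auto
  define I where "I A = (LINT x:A|lborel. f x)" for A
  have box_Int: "box a b \<inter> box c d = box (\<chi> i. max (a $ i) (c $ i)) (\<chi> i. min (b $ i) (d $ i))" for a b
    by (auto simp: mem_box_cart set_eq_iff)
  have basic: "I (box a b) = 0" for a b
  proof -
    have "I (box a b) = (LINT x|lborel. indicator (box a b \<inter> box c d) x * \<Phi> x)"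
      unfolding I_def set_lebesgue_integral_def f_def
      by (intro Bochner_Integration.integral_cong refl) (auto simp: indicator_def)
    also have "\<dots> = 0" unfolding box_Int by (rule zero) (auto simp: mem_box_cart)
    finally show ?thesis .
  qed
  have UNIV0: "I UNIV = 0"
  proof -
    have "I UNIV = I (box c d)"
      unfolding I_def set_lebesgue_integral_def f_def
      by (intro Bochner_Integration.integral_cong refl) (auto simp: indicator_def)
    then show ?thesis using basic by simp
  qed
  have all0: "I A = 0" if "A \<in> sigma_sets UNIV (range (\<lambda>(a, b). box a b :: (real ^ 'n) set))" for A
  proof (rule sigma_sets_induct_disjoint[OF _ _ that, where P = "\<lambda>A. I A = 0"])
    show "Int_stable (range (\<lambda>(a, b). box a b :: (real ^ 'n) set))"
    proof (rule Int_stableI)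
      fix A B assume "A \<in> range (\<lambda>(a, b). box a b :: (real ^ 'n) set)" "B \<in> range (\<lambda>(a, b). box a b :: (real ^ 'n) set)"
      then obtain a b a' b' where "A = box a b" "B = box a' b'" by auto
      then have "A \<inter> B = box (\<chi> i. max (a $ i) (a' $ i)) (\<chi> i. min (b $ i) (b' $ i))"
        by (auto simp: mem_box_cart set_eq_iff)
      then show "A \<inter> B \<in> range (\<lambda>(a, b). box a b :: (real ^ 'n) set)" by auto
    qed
    show "I {} = 0" by (simp add: I_def set_lebesgue_integral_def)
    show "I A = 0" if "A \<in> range (\<lambda>(a, b). box a b)" for A using that basic by auto
  next
    fix A assume A: "A \<in> sigma_sets UNIV (range (\<lambda>(a, b). box a b :: (real ^ 'n) set))" "I A = 0"
    then have Ab: "A \<in> sets borel" by (subst borel_eq_box) auto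
    have "(LINT x:A \<union> (UNIV - A)|lborel. f x) = (LINT x:A|lborel. f x) + (LINT x:(UNIV - A)|lborel. f x)"
      using Ab by (intro set_integral_Un set_int) auto
    then show "I (UNIV - A) = 0" using A(2) UNIV0 by (simp add: I_def Un_Diff_cancel)
  next
    fix A :: "nat \<Rightarrow> (real ^ 'n) set"
    assume A: "disjoint_family A" "range A \<subseteq> sigma_sets UNIV (range (\<lambda>(a, b). box a b))" "\<And>i. I (A i) = 0"
    then have Ab: "A i \<in> sets borel" for i by (subst borel_eq_box) auto
    have "(LINT x:(\<Union>i. A i)|lborel. f x) = (\<Sum>i. (LINT x:(A i)|lborel. f x))"
      using A(1) Ab by (intro lebesgue_integral_countable_add set_int) (auto simp: disjoint_family_on_def)
    then show "I (\<Union>i. A i) = 0" using A(3) by (simp add: I_def)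
  qed auto
  have all: "I A = 0" if "A \<in> sets borel" for A
    using all0[of A] that by (subst (asm) borel_eq_box) auto
  have fm[measurable]: "f \<in> borel_measurable borel" using f_int by (simp add: borel_measurable_integrable)
  \<comment> \<open>The choices u = 1 and u = -1 treat the positive and the negative part.\<close>
  have part: "AE x in lborel. indicator {x. 0 < u * f x} x * (u * f x) = 0" for u :: real
  proof -
    have meas: "{x. 0 < u * f x} \<in> sets borel" by measurable
    have i: "integrable lborel (\<lambda>x. indicator {x. 0 < u * f x} x * (u * f x))"
      using integrable_mult_indicator[OF _ integrable_mult_right[OF f_int, of u], of "{x. 0 < u * f x}"] meas by simp
    have "(LINT x|lborel. indicator {x. 0 < u * f x} x * (u * f x)) = u * I {x. 0 < u * f x}"
      unfolding I_def set_lebesgue_integral_def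
      by (subst integral_mult_right_zero[symmetric], rule Bochner_Integration.integral_cong) auto
    also have "\<dots> = 0" using all[OF meas] by simp
    finally show ?thesis
      by (subst (asm) integral_nonneg_eq_0_iff_AE[OF i]) (auto simp: indicator_def)
  qed
  show ?thesis
    using part[of 1] part[of "-1"]
    by eventually_elim (auto simp: f_def indicator_def split: if_splits)
qed

text \<open>The primitive is continuous. Between the last time at which it is at most \<alpha> and
  the first later time at which it is at least \<beta>, its values lie in [\<alpha>,\<beta>], and
  over this interval \<open>G\<close> integrates to at least \<beta> - \<alpha>.\<close>

lemma crossing_integral:
  fixes G :: "real \<Rightarrow> real" and \<phi> :: "real \<Rightarrow> real"
  assumes G: "set_integrable lborel {0..1} G" and Gm[measurable]: "G \<in> borel_measurable borel"
    and \<phi>: "\<And>t. t \<in> {0..1} \<Longrightarrow> \<phi> t = y0 + (LINT u:{0..t}|lborel. G u)"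
    and ends: "\<phi> 0 \<le> \<alpha>" "\<beta> \<le> \<phi> 1" "\<alpha> < \<beta>"
  shows "ennreal (\<beta> - \<alpha>) \<le> (\<integral>\<^sup>+t\<in>{0..1}. ennreal (\<bar>G t\<bar> * indicator {\<alpha>..\<beta>} (\<phi> t)) \<partial>lborel)"
proof -
  have sub_int: "set_integrable lborel {s..t} G" if "0 \<le> s" "t \<le> 1" for s t
    by (rule set_integrable_subset[OF G]) (use that in auto)
  have "G integrable_on {0..1}" using set_borel_integral_eq_integral(1)[OF G] .
  then have "continuous_on {0..1} (\<lambda>t. y0 + integral {0..t} G)"
    by (intro continuous_on_add continuous_on_const indefinite_integral_continuous_1)
  then have cont: "continuous_on {0..1} \<phi>"
  proof (rule continuous_on_eq)
    show "y0 + integral {0..t} G = \<phi> t" if "t \<in> {0..1}" for t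
      using set_borel_integral_eq_integral(2)[OF sub_int[of 0 t]] \<phi>[OF that] that by simp
  qed
  define S where "S = {t \<in> {0..1}. \<phi> t \<le> \<alpha>}"
  have "closed S" unfolding S_def by (intro continuous_on_closed_Collect_le cont continuous_on_const) auto
  then have "compact S" by (auto simp: compact_eq_bounded_closed S_def intro: bounded_subset[of "{0..1::real}"])
  moreover have "S \<noteq> {}" using ends by (auto simp: S_def intro!: exI[of _ 0])
  ultimately obtain t1 where t1: "t1 \<in> S" "\<And>t. t \<in> S \<Longrightarrow> t \<le> t1" using compact_attains_sup[of S] by auto
  define R where "R = {t \<in> {t1..1}. \<beta> \<le> \<phi> t}"
  have t1': "0 \<le> t1" "t1 \<le> 1" "\<phi> t1 \<le> \<alpha>" using t1 by (auto simp: S_def)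
  have "closed R" unfolding R_def
    by (intro continuous_on_closed_Collect_le continuous_on_subset[OF cont] continuous_on_const) (use t1' in auto)
  then have "compact R" using t1' by (auto simp: compact_eq_bounded_closed R_def intro: bounded_subset[of "{0..1::real}"])
  moreover have "R \<noteq> {}" using ends t1' by (auto simp: R_def intro!: exI[of _ 1])
  ultimately obtain t2 where t2: "t2 \<in> R" "\<And>t. t \<in> R \<Longrightarrow> t2 \<le> t" using compact_attains_inf[of R] by auto
  have t2': "t1 \<le> t2" "t2 \<le> 1" "\<beta> \<le> \<phi> t2" using t2 by (auto simp: R_def)
  have mid: "\<phi> t \<in> {\<alpha>..\<beta>}" if "t1 < t" "t < t2" for t
  proof -
    have "t \<notin> S" using t1(2)[of t] that by auto
    moreover have "t \<notin> R" using t2(2)[of t] that by auto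
    ultimately show ?thesis using that t1' t2' by (auto simp: S_def R_def)
  qed
  have un: "{0..t2} = {0..t1} \<union> {t1<..t2}" using t1' t2' by auto
  have int12: "set_integrable lborel {t1<..t2} G"
    by (rule set_integrable_subset[OF G]) (use t1' t2' in auto)
  have "(LINT u:{0..t2}|lborel. G u) = (LINT u:{0..t1}|lborel. G u) + (LINT u:{t1<..t2}|lborel. G u)"
    unfolding un using t1' t2' by (intro set_integral_Un sub_int int12) auto
  then have "\<beta> - \<alpha> \<le> (LINT u:{t1<..t2}|lborel. G u)"
    using \<phi>[of t1] \<phi>[of t2] t1' t2' by simp
  then have "ennreal (\<beta> - \<alpha>) \<le> ennreal (norm (LINT u:{t1<..t2}|lborel. G u))"
    by (intro ennreal_leI) simp
  also have "\<dots> \<le> (\<integral>\<^sup>+u. ennreal (norm (indicator {t1<..t2} u *\<^sub>R G u)) \<partial>lborel)"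
    unfolding set_lebesgue_integral_def
    by (rule integral_norm_bound_ennreal) (use int12 in \<open>simp add: set_integrable_def\<close>)
  also have "\<dots> \<le> (\<integral>\<^sup>+t\<in>{0..1}. ennreal (\<bar>G t\<bar> * indicator {\<alpha>..\<beta>} (\<phi> t)) \<partial>lborel)"
  proof (rule nn_integral_mono_AE)
    have "AE u in lborel. u \<noteq> t2" by (rule AE_lborel_singleton)
    then show "AE u in lborel. ennreal (norm (indicator {t1<..t2} u *\<^sub>R G u)) \<le> ennreal (\<bar>G u\<bar> * indicator {\<alpha>..\<beta>} (\<phi> u)) * indicator {0..1} u"
      by eventually_elim (use mid t1' t2' in \<open>auto simp: indicator_def\<close>)
  qed
  finally show ?thesis .
qed

lemma smooth_alg_line_derivative:
  fixes \<eta> :: "real ^ 'n \<Rightarrow> real"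
  assumes "smooth_alg \<eta>"
  shows "((\<lambda>t. \<eta> (x - t *\<^sub>R h)) has_real_derivative - (\<Sum>i\<in>UNIV. h $ i * pderiv_at i \<eta> (x - t *\<^sub>R h))) (at t)"
proof -
  let ?D = "frechet_derivative \<eta> (at (x - t *\<^sub>R h))"
  have der: "(\<eta> has_derivative ?D) (at (x - t *\<^sub>R h))"
    using smooth_alg_derivative[OF assms] by (simp add: frechet_derivative_works)
  interpret D: bounded_linear ?D by (rule has_derivative_bounded_linear[OF der])
  have inner: "((\<lambda>t. x - t *\<^sub>R h) has_derivative (\<lambda>u. - (u *\<^sub>R h))) (at t)"
    by (auto intro!: derivative_eq_intros)
  have "((\<lambda>t. \<eta> (x - t *\<^sub>R h)) has_derivative (\<lambda>u. ?D (- (u *\<^sub>R h)))) (at t)"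
    by (rule has_derivative_compose[OF inner, of \<eta>, OF der])
  also have "(\<lambda>u. ?D (- (u *\<^sub>R h))) = (\<lambda>u. u * - ?D h)"
    by (simp add: D.neg D.scaleR)
  also have "?D h = (\<Sum>i\<in>UNIV. h $ i * pderiv_at i \<eta> (x - t *\<^sub>R h))"
  proof -
    have "h = (\<Sum>i\<in>UNIV. h $ i *\<^sub>R axis i 1)" using basis_expansion[of h] by (simp add: scalar_mult_eq_scaleR)
    then have "?D h = ?D (\<Sum>i\<in>UNIV. h $ i *\<^sub>R axis i 1)" by simp
    then show ?thesis by (simp add: D.sum D.scaleR pderiv_at_def)
  qed
  finally show ?thesis by (simp only: has_field_derivative_def mult_commute_abs)
qed

lemma smooth_alg_continuous: "smooth_alg f \<Longrightarrow> continuous_on UNIV f"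
  using smooth_alg_C_k[of f 0] by simp

lemma smooth_alg_borel: "smooth_alg f \<Longrightarrow> f \<in> borel_measurable borel"
  by (intro borel_measurable_continuous_onI smooth_alg_continuous)

lemma pderiv_at_shift:
  assumes "smooth_alg \<eta>"
  shows "pderiv_at i (\<lambda>x. \<eta> (x - h)) = (\<lambda>x. pderiv_at i \<eta> (x - h))"
proof
  fix x
  have der: "(\<eta> has_derivative frechet_derivative \<eta> (at (x - h))) (at (x - h))"
    using smooth_alg_derivative[OF assms] by (simp add: frechet_derivative_works)
  have inner: "((\<lambda>x. x - h) has_derivative (\<lambda>u. u)) (at x)" by (auto intro!: derivative_eq_intros)
  have "((\<lambda>x. \<eta> (x - h)) has_derivative frechet_derivative \<eta> (at (x - h))) (at x)"
    by (rule has_derivative_compose[OF inner, of \<eta>, OF der])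
  from frechet_derivative_at[OF this] show "pderiv_at i (\<lambda>x. \<eta> (x - h)) x = pderiv_at i \<eta> (x - h)"
    by (simp add: pderiv_at_def)
qed

lemma pderiv_at_eq_0:
  assumes "open U" "x \<in> U" "\<And>y. y \<in> U \<Longrightarrow> \<eta> y = 0"
  shows "pderiv_at i \<eta> x = 0"
proof -
  have "((\<lambda>y. 0 :: real) has_derivative (\<lambda>h. 0)) (at x)" by simp
  then have "(\<eta> has_derivative (\<lambda>h. 0)) (at x)"
    by (rule has_derivative_transform_within_open[OF _ assms(1,2)]) (use assms in auto)
  from frechet_derivative_at[OF this] show ?thesis by (simp add: pderiv_at_def fun_eq_iff)
qed

lemma smooth_alg_line_FTC:
  fixes \<eta> :: "real ^ 'n \<Rightarrow> real"
  assumes "smooth_alg \<eta>"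
  shows "(LINT t|lborel. indicator {0..1} t * (\<Sum>i\<in>UNIV. h $ i * pderiv_at i \<eta> (x - t *\<^sub>R h))) = \<eta> x - \<eta> (x - h)"
proof -
  define g where "g t = (\<Sum>i\<in>UNIV. h $ i * pderiv_at i \<eta> (x - t *\<^sub>R h))" for t
  have pd: "continuous_on UNIV (pderiv_at i \<eta>)" for i
    using smooth_alg_derivative[OF assms] by (intro smooth_alg_continuous) auto
  have cont: "continuous_on {0..1} g"
    unfolding g_def by (intro continuous_intros continuous_on_compose2[OF pd]) auto
  have "((\<lambda>t. - g t) has_integral (\<eta> (x - 1 *\<^sub>R h) - \<eta> (x - 0 *\<^sub>R h))) {0..1}"
    using smooth_alg_line_derivative[OF assms, of x h] unfolding g_def
    by (intro fundamental_theorem_of_calculus) (auto simp: has_real_derivative_iff_has_vector_derivative[symmetric] intro: has_field_derivative_at_within)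
  from integral_unique[OF this] have "integral {0..1} g = \<eta> x - \<eta> (x - h)" by simp
  moreover have "(LINT t:{0..1}|lborel. g t) = integral {0..1} g"
    by (intro set_borel_integral_eq_integral borel_integrable_atLeastAtMost' cont)
  ultimately show ?thesis by (simp add: set_lebesgue_integral_def g_def)
qed

lemma integral_lborel_shift:
  fixes f :: "'a::euclidean_space \<Rightarrow> real"
  assumes [measurable]: "f \<in> borel_measurable borel"
  shows "(LINT x|lborel. f (c + x)) = (LINT x|lborel. f x)"
  by (subst (2) lborel_distr_plus[symmetric, of c]) (simp add: integral_distr)

lemma integrable_lborel_shift:
  fixes f :: "'a::euclidean_space \<Rightarrow> real"
  assumes [measurable]: "f \<in> borel_measurable borel" and "integrable lborel f"
  shows "integrable lborel (\<lambda>x. f (c + x))"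
proof -
  have "integrable (distr lborel borel ((+) c)) f" using assms by (simp add: lborel_distr_plus)
  then show ?thesis by (simp add: integrable_distr_eq)
qed

lemma nn_integral_lborel_shift:
  fixes f :: "'a::euclidean_space \<Rightarrow> ennreal"
  assumes [measurable]: "f \<in> borel_measurable borel"
  shows "(\<integral>\<^sup>+x. f (c + x) \<partial>lborel) = (\<integral>\<^sup>+x. f x \<partial>lborel)"
  by (subst (2) lborel_distr_plus[symmetric, of c]) (simp add: nn_integral_distr)

lemma integrable_pair_lborelI:
  fixes L :: "real \<times> 'a::euclidean_space \<Rightarrow> real"
  assumes [measurable]: "L \<in> borel_measurable (lborel \<Otimes>\<^sub>M lborel)"
    and bound: "\<And>t. (\<integral>\<^sup>+x. ennreal \<bar>L (t, x)\<bar> \<partial>lborel) \<le> ennreal C * indicator {0..1} t"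
  shows "integrable (lborel \<Otimes>\<^sub>M lborel) L"
proof (rule integrableI_bounded)
  have "(\<integral>\<^sup>+z. ennreal (norm (L z)) \<partial>(lborel \<Otimes>\<^sub>M lborel)) = (\<integral>\<^sup>+t. \<integral>\<^sup>+x. ennreal (norm (L (t, x))) \<partial>lborel \<partial>lborel)"
    by (subst lborel.nn_integral_fst) auto
  also have "\<dots> \<le> (\<integral>\<^sup>+t. ennreal C * indicator {0..1} t \<partial>(lborel :: real measure))"
    using bound by (intro nn_integral_mono) simp
  also have "\<dots> = ennreal C" by (simp add: nn_integral_cmult)
  finally show "(\<integral>\<^sup>+z. ennreal (norm (L z)) \<partial>(lborel \<Otimes>\<^sub>M lborel)) < \<infinity>"
    using ennreal_less_top by (simp add: order.strict_trans1)
qed simp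

lemma cbox_segment:
  fixes x h :: "real ^ 'n"
  assumes "x \<in> cbox A B" "x + h \<in> cbox A B" "0 \<le> t" "t \<le> 1"
  shows "x + t *\<^sub>R h \<in> cbox A B"
proof -
  have "x + t *\<^sub>R h = (1 - t) *\<^sub>R x + t *\<^sub>R (x + h)" by (simp add: algebra_simps)
  then show ?thesis using convexD[OF convex_box(1) assms(1,2), of "1 - t" t] assms(3,4) by simp
qed

text \<open>\<open>F\<close> and \<open>G i\<close> are Borel representatives of the function and of
  its weak partial derivatives, cut off to the box. Fubini and translations are then carried out for
  Borel functions on \<open>lborel\<close> and not on the completed measure.\<close>

locale weak_gradient_cbox =
  fixes \<Omega> :: "(real ^ 'n) set" and f :: "real ^ 'n \<Rightarrow> real" and g :: "real ^ 'n \<Rightarrow> real ^ 'n"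
    and A B :: "real ^ 'n" and F :: "real ^ 'n \<Rightarrow> real" and G :: "'n \<Rightarrow> real ^ 'n \<Rightarrow> real"
  assumes wg: "is_weak_gradient \<Omega> f g" and sub: "cbox A B \<subseteq> \<Omega>"
    and F_meas[measurable]: "F \<in> borel_measurable borel" and F_int: "integrable lborel F"
    and F_ae: "AE x in lborel. indicator (cbox A B) x * f x = F x"
    and f_meas: "(\<lambda>x. indicator (cbox A B) x * f x) \<in> borel_measurable lebesgue"
    and G_meas[measurable]: "\<And>i. G i \<in> borel_measurable borel" and G_int: "\<And>i. integrable lborel (G i)"
    and G_ae: "\<And>i. AE x in lborel. indicator (cbox A B) x * g x $ i = G i x"
    and g_meas: "\<And>i. (\<lambda>x. indicator (cbox A B) x * g x $ i) \<in> borel_measurable lebesgue"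
begin

abbreviation P :: "(real ^ 'n) set" where "P \<equiv> cbox A B"

lemma LINT_eq:
  fixes u U \<beta> :: "real ^ 'n \<Rightarrow> real"
  assumes ae: "AE x in lborel. indicator P x * u x = U x" and um: "(\<lambda>x. indicator P x * u x) \<in> borel_measurable lebesgue"
    and [measurable]: "U \<in> borel_measurable borel" "\<beta> \<in> borel_measurable borel"
    and zero: "\<And>x. x \<notin> P \<Longrightarrow> \<beta> x = 0"
  shows "(LINT x:\<Omega>|lebesgue. u x * \<beta> x) = (LINT x|lborel. U x * \<beta> x)"
proof -
  have \<beta>: "\<beta> \<in> borel_measurable lebesgue" by (rule measurable_completion) simp
  have U: "U \<in> borel_measurable lebesgue" by (rule measurable_completion) simp
  have "(LINT x:\<Omega>|lebesgue. u x * \<beta> x) = (LINT x|lebesgue. (indicator P x * u x) * \<beta> x)"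
    unfolding set_lebesgue_integral_def using sub zero
    by (intro Bochner_Integration.integral_cong refl) (auto simp: indicator_def)
  also have "\<dots> = (LINT x|lebesgue. U x * \<beta> x)"
  proof (rule integral_cong_AE)
    show "(\<lambda>x. indicator P x * u x * \<beta> x) \<in> borel_measurable lebesgue" "(\<lambda>x. U x * \<beta> x) \<in> borel_measurable lebesgue"
      by (intro borel_measurable_times um \<beta> U)+
    show "AE x in lebesgue. indicator P x * u x * \<beta> x = U x * \<beta> x"
      using AE_completion[OF ae] by eventually_elim simp
  qed
  also have "\<dots> = (LINT x|lborel. U x * \<beta> x)" by (rule integral_completion) simp
  finally show ?thesis .
qed

lemma by_parts:
  assumes ab: "cbox a b \<subseteq> P"
  shows "(LINT x|lborel. F x * pderiv_at i (box_bump j a b) x) = - (LINT x|lborel. G i x * box_bump j a b x)"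
proof -
  let ?\<eta> = "box_bump j a b"
  have sm: "smooth_alg ?\<eta>" by (rule smooth_alg_box_bump)
  have [measurable]: "?\<eta> \<in> borel_measurable borel" "pderiv_at i ?\<eta> \<in> borel_measurable borel"
    using sm smooth_alg_derivative[OF sm] by (auto intro: smooth_alg_borel)
  have 0: "?\<eta> x = 0" if "x \<notin> P" for x
    using that ab box_subset_cbox[of a b] by (intro box_bump_eq_0) auto
  have pd0: "pderiv_at i ?\<eta> x = 0" if "x \<notin> P" for x
    by (rule pderiv_at_eq_0[of "- P"]) (use that 0 in \<open>auto simp: open_Compl\<close>)
  have "test_function_on \<Omega> ?\<eta>" by (rule box_bump_test_function) (use ab sub in auto)
  then have "(LINT x:\<Omega>|lebesgue. f x * pderiv_at i ?\<eta> x) = - (LINT x:\<Omega>|lebesgue. g x $ i * ?\<eta> x)"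
    using wg by (auto simp: is_weak_gradient_def)
  then show ?thesis
    using LINT_eq[OF F_ae f_meas F_meas _ pd0] LINT_eq[OF G_ae g_meas G_meas _ 0] by simp
qed

definition Gh :: "real ^ 'n \<Rightarrow> real ^ 'n \<Rightarrow> real" where
  "Gh h x = (\<Sum>i\<in>UNIV. h $ i * G i x)"

lemma Gh_meas [measurable]: "Gh h \<in> borel_measurable borel"
  unfolding Gh_def[abs_def] by measurable

lemma Gh_int: "integrable lborel (Gh h)"
  unfolding Gh_def[abs_def] by (intro Bochner_Integration.integrable_sum integrable_mult_right G_int)

lemma Gh_pair_int: "integrable (lborel \<Otimes>\<^sub>M lborel) (\<lambda>z. indicator {0..1::real} (fst z) * Gh h (snd z + fst z *\<^sub>R h))"
proof (rule integrable_pair_lborelI[where C = "LINT x|lborel. \<bar>Gh h x\<bar>"])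
  fix t :: real
  have "(\<integral>\<^sup>+x. ennreal \<bar>Gh h (x + t *\<^sub>R h)\<bar> \<partial>lborel) = (\<integral>\<^sup>+x. ennreal \<bar>Gh h x\<bar> \<partial>lborel)"
    using nn_integral_lborel_shift[of "\<lambda>x. ennreal \<bar>Gh h x\<bar>" "t *\<^sub>R h"] by (simp add: add.commute)
  also have "\<dots> = ennreal (LINT x|lborel. \<bar>Gh h x\<bar>)"
    by (intro nn_integral_eq_integral integrable_abs Gh_int) auto
  finally show "(\<integral>\<^sup>+x. ennreal \<bar>indicator {0..1} (fst (t, x)) * Gh h (snd (t, x) + fst (t, x) *\<^sub>R h)\<bar> \<partial>lborel)
    \<le> ennreal (LINT x|lborel. \<bar>Gh h x\<bar>) * indicator {0..1} t"
    by (simp add: indicator_def)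
qed measurable

text \<open>The integral of the weak directional derivative along the segment from x to x + h, the
  expected value of F (x + h) - F x.\<close>

definition W :: "real ^ 'n \<Rightarrow> real ^ 'n \<Rightarrow> real" where
  "W h x = (LINT t|lborel. indicator {0..1} t * Gh h (x + t *\<^sub>R h))"

lemma W_int: "integrable lborel (W h)"
  using lborel_pair.integrable_snd[of "\<lambda>t x. indicator {0..1} t * Gh h (x + t *\<^sub>R h)"] Gh_pair_int[of h]
  by (simp add: W_def[abs_def] split_beta')

text \<open>Letting the bumps increase to indicators of boxes turns this identity into
  \<open>F (x + h) - F x = W h x\<close> for almost every \<open>x\<close>, without mollification.\<close>

lemma test_identity:
  assumes ab: "cbox a b \<subseteq> P" and abh: "cbox (a + h) (b + h) \<subseteq> P"
  shows "(LINT x|lborel. (F (x + h) - F x - W h x) * box_bump j a b x) = 0"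
proof (cases "cbox a b = {}")
  case True
  then have "box_bump j a b x = 0" for x using box_subset_cbox[of a b] by (intro box_bump_eq_0) auto
  then show ?thesis by simp
next
  case False
  let ?\<eta> = "box_bump j a b"
  have sm: "smooth_alg ?\<eta>" by (rule smooth_alg_box_bump)
  have \<eta>m[measurable]: "?\<eta> \<in> borel_measurable borel" by (rule smooth_alg_borel[OF sm])
  have pds: "smooth_alg (pderiv_at i ?\<eta>)" for i using smooth_alg_derivative[OF sm] by auto
  have pdm[measurable]: "pderiv_at i ?\<eta> \<in> borel_measurable borel" for i by (rule smooth_alg_borel[OF pds])
  have \<eta>b: "\<bar>?\<eta> x\<bar> \<le> 1" for x using box_bump_bounds[of j a b x] by auto
  \<comment> \<open>Convexity of the box: if the box of the bump and its translate by h lie in P, so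
    do all intermediate translates, and their bumps may be used as test functions.\<close>
  have seg: "cbox (a + t *\<^sub>R h) (b + t *\<^sub>R h) \<subseteq> P" if "0 \<le> t" "t \<le> 1" for t
  proof
    fix y assume y: "y \<in> cbox (a + t *\<^sub>R h) (b + t *\<^sub>R h)"
    have "y - t *\<^sub>R h \<in> cbox a b" using y by (auto simp: mem_box_cart algebra_simps)
    moreover have "y - t *\<^sub>R h + h \<in> cbox (a + h) (b + h)" using y by (auto simp: mem_box_cart algebra_simps)
    ultimately show "y \<in> P" using cbox_segment[of "y - t *\<^sub>R h" A B h t] that ab abh by auto
  qed
  define S where "S x = (\<Sum>i\<in>UNIV. h $ i * pderiv_at i ?\<eta> x)" for x
  have Sm[measurable]: "S \<in> borel_measurable borel" unfolding S_def[abs_def] by measurable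
  obtain M where M: "\<And>x. \<bar>S x\<bar> \<le> M" "0 \<le> M"
  proof -
    have "continuous_on (cbox a b) S"
      unfolding S_def[abs_def] using continuous_on_subset[OF smooth_alg_continuous[OF pds]] by (intro continuous_intros) auto
    then have "bounded (S ` cbox a b)" by (intro compact_imp_bounded compact_continuous_image) auto
    then obtain M where M: "\<And>x. x \<in> cbox a b \<Longrightarrow> \<bar>S x\<bar> \<le> M" by (auto simp: bounded_iff)
    have "S x = 0" if "x \<notin> cbox a b" for x
    proof -
      have "pderiv_at i ?\<eta> x = 0" for i
        by (rule pderiv_at_eq_0[of "- cbox a b"])
          (use that box_bump_eq_0[of _ a b j] box_subset_cbox[of a b] in \<open>auto simp: open_Compl\<close>)
      then show ?thesis by (simp add: S_def)
    qed
    then have "\<bar>S x\<bar> \<le> max M 0" for x using M[of x] by (cases "x \<in> cbox a b") auto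
    then show ?thesis using that[of "max M 0"] by auto
  qed
  define L1 where "L1 z = indicator {0..1::real} (fst z) * (F (snd z) * S (snd z - fst z *\<^sub>R h))" for z
  have L1: "integrable (lborel \<Otimes>\<^sub>M lborel) L1"
  proof (rule integrable_pair_lborelI[where C = "LINT x|lborel. M * \<bar>F x\<bar>"])
    show "L1 \<in> borel_measurable (lborel \<Otimes>\<^sub>M lborel)" unfolding L1_def by measurable
    fix t :: real
    have "(\<integral>\<^sup>+x. ennreal \<bar>L1 (t, x)\<bar> \<partial>lborel) \<le> (\<integral>\<^sup>+x. ennreal (M * \<bar>F x\<bar>) * indicator {0..1} t \<partial>lborel)"
      using M by (intro nn_integral_mono) (auto simp: L1_def indicator_def abs_mult mult.commute[of M] intro!: ennreal_leI mult_left_mono)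
    also have "\<dots> = (\<integral>\<^sup>+x. ennreal (M * \<bar>F x\<bar>) \<partial>lborel) * indicator {0..1} t"
      by (rule nn_integral_multc) measurable
    also have "(\<integral>\<^sup>+x. ennreal (M * \<bar>F x\<bar>) \<partial>lborel) = ennreal (LINT x|lborel. M * \<bar>F x\<bar>)"
      using M F_int by (intro nn_integral_eq_integral) auto
    finally show "(\<integral>\<^sup>+x. ennreal \<bar>L1 (t, x)\<bar> \<partial>lborel) \<le> ennreal (LINT x|lborel. M * \<bar>F x\<bar>) * indicator {0..1} t" .
  qed
  define L2 where "L2 z = indicator {0..1::real} (fst z) * (Gh h (snd z + fst z *\<^sub>R h) * ?\<eta> (snd z))" for z
  have L2: "integrable (lborel \<Otimes>\<^sub>M lborel) L2"
  proof (rule Bochner_Integration.integrable_bound[OF Gh_pair_int[of h]])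
    show "L2 \<in> borel_measurable (lborel \<Otimes>\<^sub>M lborel)" unfolding L2_def by measurable
    show "AE z in lborel \<Otimes>\<^sub>M lborel. norm (L2 z) \<le> norm (indicator {0..1} (fst z) * Gh h (snd z + fst z *\<^sub>R h))"
      using \<eta>b by (intro always_eventually allI) (auto simp: L2_def abs_mult indicator_def intro!: mult_right_le_one_le)
  qed
  have int_mult: "integrable lborel (\<lambda>x. u x * \<beta> x)"
    if "integrable lborel u" "\<beta> \<in> borel_measurable borel" "\<And>x. \<bar>\<beta> x\<bar> \<le> c" for u \<beta> :: "real ^ 'n \<Rightarrow> real" and c
  proof (rule Bochner_Integration.integrable_bound[OF integrable_mult_right[OF that(1), of c]])
    have [measurable]: "u \<in> borel_measurable borel" using that(1) by (simp add: borel_measurable_integrable)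
    show "(\<lambda>x. u x * \<beta> x) \<in> borel_measurable lborel" using that(2) by measurable
    have "0 \<le> c" using that(3)[of 0] by linarith
    then show "AE x in lborel. norm (u x * \<beta> x) \<le> norm (c * u x)"
      using that(3) by (intro always_eventually allI) (auto simp: abs_mult mult.commute[of c] intro!: mult_left_mono order_trans[OF that(3)])
  qed
  \<comment> \<open>Integration by parts against the bump translated by t h. Moving the translation
    onto the other factor leaves the derivative of \<open>F\<close> along h, evaluated at x + t h
    and tested with the original bump.\<close>
  have slice: "(LINT x|lborel. F x * S (x - t *\<^sub>R h)) = - (LINT x|lborel. Gh h (x + t *\<^sub>R h) * ?\<eta> x)" if t: "0 \<le> t" "t \<le> 1" for t
  proof -
    let ?\<eta>t = "box_bump j (a + t *\<^sub>R h) (b + t *\<^sub>R h)"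
    have shift: "?\<eta>t = (\<lambda>x. ?\<eta> (x - t *\<^sub>R h))" by (simp add: box_bump_shift)
    have smt: "smooth_alg ?\<eta>t" by (rule smooth_alg_box_bump)
    have [measurable]: "?\<eta>t \<in> borel_measurable borel" by (rule smooth_alg_borel[OF smt])
    have pd: "pderiv_at i ?\<eta>t = (\<lambda>x. pderiv_at i ?\<eta> (x - t *\<^sub>R h))" for i
      unfolding shift by (rule pderiv_at_shift[OF sm])
    obtain Mi where Mi: "\<And>i x. \<bar>pderiv_at i ?\<eta> x\<bar> \<le> Mi i"
    proof -
      have "\<exists>c. \<forall>x. \<bar>pderiv_at i ?\<eta> x\<bar> \<le> c" for i
      proof -
        have "bounded (pderiv_at i ?\<eta> ` cbox a b)"
          using continuous_on_subset[OF smooth_alg_continuous[OF pds]] by (intro compact_imp_bounded compact_continuous_image) auto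
        then obtain c where c: "\<And>x. x \<in> cbox a b \<Longrightarrow> \<bar>pderiv_at i ?\<eta> x\<bar> \<le> c" by (auto simp: bounded_iff)
        have "pderiv_at i ?\<eta> x = 0" if "x \<notin> cbox a b" for x
          by (rule pderiv_at_eq_0[of "- cbox a b"])
            (use that box_bump_eq_0[of _ a b j] box_subset_cbox[of a b] in \<open>auto simp: open_Compl\<close>)
        then have "\<bar>pderiv_at i ?\<eta> x\<bar> \<le> max c 0" for x using c[of x] by (cases "x \<in> cbox a b") auto
        then show ?thesis by blast
      qed
      then show ?thesis using that by metis
    qed
    have "(LINT x|lborel. F x * S (x - t *\<^sub>R h)) = (LINT x|lborel. (\<Sum>i\<in>UNIV. h $ i * (F x * pderiv_at i ?\<eta>t x)))"
      by (intro Bochner_Integration.integral_cong refl) (simp add: S_def pd sum_distrib_left mult_ac)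
    also have "\<dots> = (\<Sum>i\<in>UNIV. h $ i * (LINT x|lborel. F x * pderiv_at i ?\<eta>t x))"
      using Mi by (subst Bochner_Integration.integral_sum) (auto simp: pd intro!: integrable_mult_right int_mult[OF F_int])
    also have "\<dots> = (\<Sum>i\<in>UNIV. h $ i * - (LINT x|lborel. G i x * ?\<eta>t x))"
      by (simp only: by_parts[OF seg[OF t]])
    also have "\<dots> = - (\<Sum>i\<in>UNIV. h $ i * (LINT x|lborel. G i x * ?\<eta>t x))"
      by (simp add: sum_negf)
    also have "(\<Sum>i\<in>UNIV. h $ i * (LINT x|lborel. G i x * ?\<eta>t x)) = (LINT x|lborel. (\<Sum>i\<in>UNIV. h $ i * (G i x * ?\<eta>t x)))"
      using box_bump_bounds[of j "a + t *\<^sub>R h" "b + t *\<^sub>R h"]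
      by (subst Bochner_Integration.integral_sum) (auto intro!: integrable_mult_right int_mult[OF G_int, where c = 1])
    also have "\<dots> = (LINT x|lborel. Gh h x * ?\<eta> (x - t *\<^sub>R h))"
      by (intro Bochner_Integration.integral_cong refl) (simp add: shift Gh_def sum_distrib_left mult_ac)
    also have "\<dots> = (LINT x|lborel. Gh h (x + t *\<^sub>R h) * ?\<eta> x)"
      using integral_lborel_shift[of "\<lambda>x. Gh h x * ?\<eta> (x - t *\<^sub>R h)" "t *\<^sub>R h"] by (simp add: add.commute)
    finally show ?thesis .
  qed
  have F\<eta>: "integrable lborel (\<lambda>x. F (x + h) * ?\<eta> x)" "integrable lborel (\<lambda>x. F x * ?\<eta> x)"
    "integrable lborel (\<lambda>x. W h x * ?\<eta> x)" "integrable lborel (\<lambda>x. F x * ?\<eta> (x - h))"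
    using integrable_lborel_shift[OF F_meas F_int, of h]
    by (intro int_mult[where c = 1] F_int W_int \<eta>b; simp add: add.commute)+
  have "(LINT x|lborel. (F (x + h) - F x - W h x) * ?\<eta> x)
    = (LINT x|lborel. F (x + h) * ?\<eta> x) - (LINT x|lborel. F x * ?\<eta> x) - (LINT x|lborel. W h x * ?\<eta> x)"
    using F\<eta> by (simp add: left_diff_distrib)
  also have "(LINT x|lborel. F (x + h) * ?\<eta> x) = (LINT x|lborel. F x * ?\<eta> (x - h))"
    using integral_lborel_shift[of "\<lambda>x. F x * ?\<eta> (x - h)" h] by (simp add: add.commute)
  \<comment> \<open>Fubini puts the integral over t outside, \<open>slice\<close> moves the
    derivative onto the bump, and after a second exchange the fundamental theorem along the line
    evaluates the integral over t as a difference of two bumps.\<close>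
  also have "(LINT x|lborel. W h x * ?\<eta> x) = (LINT x|lborel. F x * ?\<eta> (x - h)) - (LINT x|lborel. F x * ?\<eta> x)"
  proof -
    have "(LINT x|lborel. W h x * ?\<eta> x) = (LINT x|lborel. (LINT t|lborel. L2 (t, x)))"
      unfolding W_def L2_def
      by (intro Bochner_Integration.integral_cong refl) (simp flip: integral_mult_left_zero add: mult.assoc)
    also have "\<dots> = (LINT t|lborel. (LINT x|lborel. L2 (t, x)))"
      using lborel_pair.Fubini_integral[of "\<lambda>t x. L2 (t, x)"] L2 by simp
    also have "\<dots> = (LINT t|lborel. indicator {0..1} t * (LINT x|lborel. Gh h (x + t *\<^sub>R h) * ?\<eta> x))"
      by (intro Bochner_Integration.integral_cong refl) (simp add: L2_def)
    also have "\<dots> = (LINT t|lborel. - (indicator {0..1} t * (LINT x|lborel. F x * S (x - t *\<^sub>R h))))"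
      by (intro Bochner_Integration.integral_cong refl) (simp add: slice indicator_def)
    also have "\<dots> = - (LINT t|lborel. (LINT x|lborel. L1 (t, x)))"
      by (simp add: L1_def)
    also have "(LINT t|lborel. (LINT x|lborel. L1 (t, x))) = (LINT x|lborel. (LINT t|lborel. L1 (t, x)))"
      using lborel_pair.Fubini_integral[of "\<lambda>t x. L1 (t, x)"] L1 by simp
    also have "\<dots> = (LINT x|lborel. F x * ?\<eta> x - F x * ?\<eta> (x - h))"
    proof (intro Bochner_Integration.integral_cong refl)
      fix x
      have "(LINT t|lborel. L1 (t, x)) = (LINT t|lborel. F x * (indicator {0..1} t * S (x - t *\<^sub>R h)))"
        by (simp add: L1_def mult_ac)
      also have "\<dots> = F x * (LINT t|lborel. indicator {0..1} t * S (x - t *\<^sub>R h))" by simp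
      also have "\<dots> = F x * (?\<eta> x - ?\<eta> (x - h))"
        using smooth_alg_line_FTC[OF sm, of h x] by (simp add: S_def)
      finally show "(LINT t|lborel. L1 (t, x)) = F x * ?\<eta> x - F x * ?\<eta> (x - h)" by (simp add: right_diff_distrib)
    qed
    also have "\<dots> = (LINT x|lborel. F x * ?\<eta> x) - (LINT x|lborel. F x * ?\<eta> (x - h))"
      using F\<eta> by simp
    finally show ?thesis by simp
  qed
  finally show ?thesis by simp
qed

text \<open>The bumps are bounded by 1 and converge to indicators, so \<open>test_identity\<close>
  gives vanishing integrals over all boxes in \<open>cbox c d\<close>, the set of x with x and x + h
  both in P. Its boundary is a null set.\<close>

lemma AE_shift:
  "AE x in lborel. x \<in> P \<and> x + h \<in> P \<longrightarrow> F (x + h) = F x + W h x"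
proof -
  define c d where "c = (\<chi> i. max (A $ i) (A $ i - h $ i))" and "d = (\<chi> i. min (B $ i) (B $ i - h $ i))"
  have cd: "x \<in> P \<and> x + h \<in> P \<longleftrightarrow> x \<in> cbox c d" for x
    by (auto simp: mem_box_cart c_def d_def) (smt (verit))+
  define \<Phi> where "\<Phi> x = F (x + h) - F x - W h x" for x
  have \<Phi>_int: "integrable lborel \<Phi>"
    unfolding \<Phi>_def[abs_def] using integrable_lborel_shift[OF F_meas F_int, of h]
    by (intro Bochner_Integration.integrable_diff F_int W_int) (simp add: add.commute)
  have \<Phi>m[measurable]: "\<Phi> \<in> borel_measurable borel" using \<Phi>_int by (simp add: borel_measurable_integrable)
  have "AE x in lborel. x \<in> box c d \<longrightarrow> \<Phi> x = 0"
  proof (rule AE_zero_if_box_integrals_zero)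
    show "integrable lborel (\<lambda>x. indicator (box c d) x * \<Phi> x)"
      using integrable_mult_indicator[OF _ \<Phi>_int, of "box c d"] by simp
    fix a b assume ab: "cbox a b \<subseteq> cbox c d"
    have "cbox a b \<subseteq> P" using ab cd by blast
    moreover have "cbox (a + h) (b + h) \<subseteq> P"
    proof
      fix y assume "y \<in> cbox (a + h) (b + h)"
      then have "y - h \<in> cbox a b" by (auto simp: mem_box_cart algebra_simps)
      then show "y \<in> P" using ab cd[of "y - h"] by auto
    qed
    ultimately have z: "(LINT x|lborel. \<Phi> x * box_bump j a b x) = 0" for j
      unfolding \<Phi>_def by (rule test_identity)
    have "(\<lambda>j. LINT x|lborel. \<Phi> x * box_bump j a b x) \<longlonglongrightarrow> (LINT x|lborel. \<Phi> x * indicator (box a b) x)"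
    proof (rule integral_dominated_convergence[where w = "\<lambda>x. \<bar>\<Phi> x\<bar>"])
      show "(\<lambda>x. \<Phi> x * box_bump j a b x) \<in> borel_measurable lborel" for j
        using smooth_alg_borel[OF smooth_alg_box_bump[of j a b]] by measurable
      show "AE x in lborel. (\<lambda>j. \<Phi> x * box_bump j a b x) \<longlonglongrightarrow> \<Phi> x * indicator (box a b) x"
        by (intro always_eventually allI tendsto_mult tendsto_const box_bump_tendsto)
      show "AE x in lborel. norm (\<Phi> x * box_bump j a b x) \<le> \<bar>\<Phi> x\<bar>" for j
        using box_bump_bounds[of j a b] by (intro always_eventually allI) (auto simp: abs_mult intro!: mult_right_le_one_le)
    qed (use \<Phi>_int in auto)
    then have "(LINT x|lborel. \<Phi> x * indicator (box a b) x) = 0" by (simp add: z LIMSEQ_const_iff)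
    then show "(LINT x|lborel. indicator (box a b) x * \<Phi> x) = 0" by (simp add: mult.commute)
  qed
  moreover have "AE x in lborel. x \<notin> cbox c d - box c d"
  proof -
    have "cbox c d - box c d \<in> null_sets lborel"
      using negligible_frontier_interval[of c d] by (simp add: negligible_iff_null_sets null_sets_completion_iff)
    then show ?thesis by (rule AE_not_in)
  qed
  ultimately show ?thesis
    by eventually_elim (use cd in \<open>auto simp: \<Phi>_def\<close>)
qed

end

context weak_gradient_cbox
begin

text \<open>The segment integral with variable end point; it equals \<open>W\<close> for the
  shortened vector \<tau> h. The \<open>if\<close> depends on \<tau>, so the integrand is written as
  a jointly measurable function of \<tau>, x and u.\<close>

definition line_int :: "real ^ 'n \<Rightarrow> real \<Rightarrow> real ^ 'n \<Rightarrow> real" where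
  "line_int h \<tau> x = (LINT u|lborel. (if 0 \<le> u \<and> u \<le> \<tau> then 1 else 0) * Gh h (x + u *\<^sub>R h))"

lemma line_int_meas [measurable]: "(\<lambda>z. line_int h (fst z) (snd z)) \<in> borel_measurable (lborel \<Otimes>\<^sub>M lborel)"
  unfolding line_int_def by (rule lborel.borel_measurable_lebesgue_integral) measurable

lemma line_int_alt: "line_int h \<tau> x = (LINT u:{0..\<tau>}|lborel. Gh h (x + u *\<^sub>R h))"
  unfolding line_int_def set_lebesgue_integral_def
  by (intro Bochner_Integration.integral_cong refl) (auto simp: indicator_def)

lemma W_scale:
  assumes "0 < \<tau>"
  shows "W (\<tau> *\<^sub>R h) x = line_int h \<tau> x"
proof -
  have "line_int h \<tau> x = \<bar>\<tau>\<bar> *\<^sub>R (LINT u|lborel. (if 0 \<le> 0 + \<tau> * u \<and> 0 + \<tau> * u \<le> \<tau> then 1 else 0) * Gh h (x + (0 + \<tau> * u) *\<^sub>R h))"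
    unfolding line_int_def using assms by (intro lborel_integral_real_affine) auto
  also have "\<dots> = (LINT u|lborel. \<tau> * ((if 0 \<le> 0 + \<tau> * u \<and> 0 + \<tau> * u \<le> \<tau> then 1 else 0) * Gh h (x + (0 + \<tau> * u) *\<^sub>R h)))"
    using assms by simp
  also have "\<dots> = W (\<tau> *\<^sub>R h) x"
  proof -
    have "\<tau> * ((if 0 \<le> 0 + \<tau> * u \<and> 0 + \<tau> * u \<le> \<tau> then 1 else 0) * Gh h (x + (0 + \<tau> * u) *\<^sub>R h))
      = indicator {0..1} u * Gh (\<tau> *\<^sub>R h) (x + u *\<^sub>R \<tau> *\<^sub>R h)" for u
    proof -
      have "Gh (\<tau> *\<^sub>R h) y = \<tau> * Gh h y" for y by (simp add: Gh_def sum_distrib_left mult_ac)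
      moreover have "(0 \<le> \<tau> * u \<and> \<tau> * u \<le> \<tau>) \<longleftrightarrow> u \<in> {0..1}"
        using assms by (auto simp: zero_le_mult_iff)
      ultimately show ?thesis by (simp add: indicator_def mult.commute)
    qed
    then show ?thesis by (simp only: W_def)
  qed
  finally show ?thesis ..
qed

text \<open>For each \<tau> the identity for \<tau> h holds off a null set that depends on \<tau>.
  Fubini exchanges the quantifiers: for almost every x it holds for almost every point of the
  segment.\<close>

lemma AE_line:
  "AE x in lborel. AE \<tau> in lborel. x \<in> P \<and> x + h \<in> P \<and> 0 < \<tau> \<and> \<tau> \<le> 1 \<longrightarrow> F (x + \<tau> *\<^sub>R h) = F x + line_int h \<tau> x"
proof -
  define R where "R \<tau> x \<longleftrightarrow> (x \<in> P \<and> x + h \<in> P \<and> 0 < \<tau> \<and> \<tau> \<le> 1 \<longrightarrow> F (x + \<tau> *\<^sub>R h) = F x + line_int h \<tau> x)" for \<tau> x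
  have ae: "AE \<tau> in lborel. AE x in lborel. R \<tau> x"
  proof (rule always_eventually, rule allI)
    fix \<tau> :: real
    show "AE x in lborel. R \<tau> x"
      unfolding R_def
      using AE_shift[of "\<tau> *\<^sub>R h"] by eventually_elim (use W_scale[of \<tau> h] cbox_segment[of _ A B h \<tau>] in auto)
  qed
  have "{z \<in> space (lborel \<Otimes>\<^sub>M lborel). R (fst z) (snd z)} \<in> sets (lborel \<Otimes>\<^sub>M lborel)"
    unfolding R_def by measurable
  from lborel_pair.AE_commute[OF this] ae have "AE x in lborel. AE \<tau> in lborel. R \<tau> x" by simp
  then show ?thesis by (simp only: R_def)
qed

text \<open>Along almost every segment \<open>F\<close> agrees almost everywhere with an absolutely
  continuous function. A segment from below \<alpha> to above \<beta> must therefore pay at least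
  \<beta> - \<alpha> in gradient, and only where \<open>F\<close> has values in the band.\<close>

lemma AE_crossing:
  assumes "\<alpha> < \<beta>"
  shows "AE x in lborel. x \<in> P \<and> x + h \<in> P \<and> F x \<le> \<alpha> \<and> \<beta> \<le> F (x + h) \<longrightarrow>
    ennreal (\<beta> - \<alpha>) \<le> (\<integral>\<^sup>+t\<in>{0..1}. ennreal (\<bar>Gh h (x + t *\<^sub>R h)\<bar> * indicator {\<alpha>..\<beta>} (F (x + t *\<^sub>R h))) \<partial>lborel)"
proof -
  have int: "AE x in lborel. integrable lborel (\<lambda>t. indicator {0..1::real} t * Gh h (x + t *\<^sub>R h))"
    using lborel_pair.AE_integrable_snd[of "\<lambda>t x. indicator {0..1} t * Gh h (x + t *\<^sub>R h)"] Gh_pair_int[of h]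
    by (simp add: split_beta')
  show ?thesis
    using int AE_line[of h] AE_shift[of h]
  proof eventually_elim
    fix x
    assume 1: "integrable lborel (\<lambda>t. indicator {0..1::real} t * Gh h (x + t *\<^sub>R h))"
      and 2: "AE \<tau> in lborel. x \<in> P \<and> x + h \<in> P \<and> 0 < \<tau> \<and> \<tau> \<le> 1 \<longrightarrow> F (x + \<tau> *\<^sub>R h) = F x + line_int h \<tau> x"
      and 3: "x \<in> P \<and> x + h \<in> P \<longrightarrow> F (x + h) = F x + W h x"
    show "x \<in> P \<and> x + h \<in> P \<and> F x \<le> \<alpha> \<and> \<beta> \<le> F (x + h) \<longrightarrow>
      ennreal (\<beta> - \<alpha>) \<le> (\<integral>\<^sup>+t\<in>{0..1}. ennreal (\<bar>Gh h (x + t *\<^sub>R h)\<bar> * indicator {\<alpha>..\<beta>} (F (x + t *\<^sub>R h))) \<partial>lborel)"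
    proof
      assume x: "x \<in> P \<and> x + h \<in> P \<and> F x \<le> \<alpha> \<and> \<beta> \<le> F (x + h)"
      define \<phi> where "\<phi> t = F x + (LINT u:{0..t}|lborel. Gh h (x + u *\<^sub>R h))" for t
      have \<phi>0: "\<phi> 0 = F x"
      proof -
        have "(LINT u:{0..0}|lborel. Gh h (x + u *\<^sub>R h)) = 0"
        proof -
          have "AE u in lborel. indicator {0..0::real} u *\<^sub>R Gh h (x + u *\<^sub>R h) = 0"
            using AE_lborel_singleton[of "0::real"] by eventually_elim (auto simp: indicator_def)
          then show ?thesis unfolding set_lebesgue_integral_def by (rule integral_eq_zero_AE)
        qed
        then show ?thesis by (simp add: \<phi>_def)
      qed
      \<comment> \<open>The end point t = 1 is a single parameter, which an identity for almost
        every t does not reach; the shift identity for h itself supplies it.\<close>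
      have \<phi>1: "\<phi> 1 = F (x + h)"
        using 3 x W_scale[of 1 h x] by (simp add: \<phi>_def line_int_alt)
      have "ennreal (\<beta> - \<alpha>) \<le> (\<integral>\<^sup>+t\<in>{0..1}. ennreal (\<bar>Gh h (x + t *\<^sub>R h)\<bar> * indicator {\<alpha>..\<beta>} (\<phi> t)) \<partial>lborel)"
      proof (rule crossing_integral)
        show "set_integrable lborel {0..1} (\<lambda>t. Gh h (x + t *\<^sub>R h))" using 1 by (simp add: set_integrable_def)
        show "\<phi> 0 \<le> \<alpha>" "\<beta> \<le> \<phi> 1" using x \<phi>0 \<phi>1 by auto
      qed (use assms in \<open>auto simp: \<phi>_def\<close>)
      also have "\<dots> = (\<integral>\<^sup>+t\<in>{0..1}. ennreal (\<bar>Gh h (x + t *\<^sub>R h)\<bar> * indicator {\<alpha>..\<beta>} (F (x + t *\<^sub>R h))) \<partial>lborel)"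
      proof (rule nn_integral_cong_AE)
        have "AE t in lborel. t \<noteq> (0::real)" by (rule AE_lborel_singleton)
        with 2 show "AE t in lborel. ennreal (\<bar>Gh h (x + t *\<^sub>R h)\<bar> * indicator {\<alpha>..\<beta>} (\<phi> t)) * indicator {0..1} t
          = ennreal (\<bar>Gh h (x + t *\<^sub>R h)\<bar> * indicator {\<alpha>..\<beta>} (F (x + t *\<^sub>R h))) * indicator {0..1} t"
          by eventually_elim (use x in \<open>auto simp: indicator_def \<phi>_def line_int_alt\<close>)
      qed
      finally show "ennreal (\<beta> - \<alpha>) \<le> (\<integral>\<^sup>+t\<in>{0..1}. ennreal (\<bar>Gh h (x + t *\<^sub>R h)\<bar> * indicator {\<alpha>..\<beta>} (F (x + t *\<^sub>R h))) \<partial>lborel)" .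
    qed
  qed
qed

definition Gn :: "real ^ 'n \<Rightarrow> real" where "Gn x = norm (\<chi> i. G i x)"

lemma Gn_meas [measurable]: "Gn \<in> borel_measurable borel"
proof -
  have "Gn x = sqrt (\<Sum>i\<in>UNIV. (G i x)\<^sup>2)" for x by (simp add: Gn_def norm_vec_def L2_set_def)
  then have "Gn = (\<lambda>x. sqrt (\<Sum>i\<in>UNIV. (G i x)\<^sup>2))" by auto
  then show ?thesis by simp
qed

lemma Gh_le: "\<bar>Gh h x\<bar> \<le> norm h * Gn x"
  using Cauchy_Schwarz_ineq2[of h "\<chi> i. G i x"] by (simp add: Gh_def Gn_def inner_vec_def)

text \<open>Integrate the crossing inequality over all pairs x, x + h with x in the low set and x +
  h in the high set. The length of h is at most n \<delta>. For fixed h and t, translation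
  invariance turns the integral over x into the integral of |\<nabla>f| over the band in D, and the
  admissible h form a cube of side 2 \<delta>. This takes the place of a Poincare inequality for
  truncations.\<close>

lemma band_estimate:
  assumes D: "hcube b \<delta> \<subseteq> P" "0 < \<delta>" and ab: "\<alpha> < \<beta>"
  shows "ennreal (\<beta> - \<alpha>) * emeasure lborel {x \<in> hcube b \<delta>. F x \<le> \<alpha>} * emeasure lborel {x \<in> hcube b \<delta>. \<beta> \<le> F x}
    \<le> ennreal (real CARD('n) * \<delta> * (2 * \<delta>) ^ CARD('n)) * (\<integral>\<^sup>+x\<in>hcube b \<delta>. ennreal (Gn x * indicator {\<alpha>..\<beta>} (F x)) \<partial>lborel)"
proof -
  define D where "D = hcube b \<delta>"
  have Dm[measurable]: "D \<in> sets borel" by (simp add: D_def)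
  define S R where "S = {x \<in> D. F x \<le> \<alpha>}" and "R = {x \<in> D. \<beta> \<le> F x}"
  have S_eq: "S = D \<inter> {x. F x \<le> \<alpha>}" "R = D \<inter> {x. \<beta> \<le> F x}" by (auto simp: S_def R_def)
  have SR[measurable]: "S \<in> sets borel" "R \<in> sets borel" unfolding S_eq by measurable
  define H :: "(real ^ 'n) set" where "H = cbox (vec (- \<delta>)) (vec \<delta>)"
  have Hm[measurable]: "H \<in> sets borel" by (simp add: H_def)
  have eH: "emeasure lborel H = ennreal ((2 * \<delta>) ^ CARD('n))"
  proof -
    have "(vec \<delta> :: real ^ 'n) = vec (- \<delta>) + vec (2 * \<delta>)" by (simp add: vec_eq_iff)
    then have "H = cbox (vec (- \<delta>)) (vec (- \<delta>) + vec (2 * \<delta>))" by (simp add: H_def)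
    then show ?thesis using emeasure_cbox_vec[of "2 * \<delta>" "vec (- \<delta>) :: real ^ 'n"] D by simp
  qed
  define \<psi> where "\<psi> x = ennreal (Gn x * indicator {\<alpha>..\<beta>} (F x)) * indicator D x" for x
  have \<psi>m[measurable]: "\<psi> \<in> borel_measurable borel" unfolding \<psi>_def[abs_def] by measurable
  have in_H: "h \<in> H \<and> norm h \<le> real CARD('n) * \<delta>" if "x \<in> D" "x + h \<in> D" for x h
  proof
    show "h \<in> H" using that by (auto simp: H_def mem_box_cart D_def hcube_def) (smt (verit))+
    show "norm h \<le> real CARD('n) * \<delta>" using hcube_norm_diff_le[of "x + h" b \<delta> x] that by (simp add: D_def)
  qed
  have segD: "x + t *\<^sub>R h \<in> D" if "x \<in> D" "x + h \<in> D" "0 \<le> t" "t \<le> 1" for x h t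
  proof -
    have "b $ i \<le> x $ i + t * h $ i \<and> x $ i + t * h $ i < b $ i + \<delta>" for i
    proof -
      have 1: "b $ i \<le> x $ i" "x $ i < b $ i + \<delta>" "b $ i \<le> x $ i + h $ i" "x $ i + h $ i < b $ i + \<delta>"
        using that by (auto simp: D_def hcube_def)
      show ?thesis
      proof (cases "0 \<le> h $ i")
        case True
        then have "0 \<le> t * h $ i" "t * h $ i \<le> 1 * h $ i" using that mult_right_mono[of t 1 "h $ i"] by auto
        then show ?thesis using 1 by auto
      next
        case False
        then have "t * h $ i \<le> 0" "1 * h $ i \<le> t * h $ i"
          using that by (auto simp: mult_nonneg_nonpos intro!: mult_right_mono_neg)
        then show ?thesis using 1 by auto
      qed
    qed
    then show ?thesis by (simp add: D_def hcube_def)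
  qed
  \<comment> \<open>One fixed difference h. The cut-off of the band integrand to D costs nothing,
    since the segment between two points of D stays in D.\<close>
  have slice: "(\<integral>\<^sup>+x. ennreal (\<beta> - \<alpha>) * indicator S x * indicator R (x + h) \<partial>lborel)
    \<le> indicator H h * (ennreal (real CARD('n) * \<delta>) * (\<integral>\<^sup>+x. \<psi> x \<partial>lborel))" for h
  proof -
    have "(\<integral>\<^sup>+x. ennreal (\<beta> - \<alpha>) * indicator S x * indicator R (x + h) \<partial>lborel)
      \<le> (\<integral>\<^sup>+x. indicator H h * (ennreal (real CARD('n) * \<delta>) * (\<integral>\<^sup>+t. indicator {0..1} t * \<psi> (x + t *\<^sub>R h) \<partial>lborel)) \<partial>lborel)"
    proof (rule nn_integral_mono_AE)
      show "AE x in lborel. ennreal (\<beta> - \<alpha>) * indicator S x * indicator R (x + h)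
        \<le> indicator H h * (ennreal (real CARD('n) * \<delta>) * (\<integral>\<^sup>+t. indicator {0..1} t * \<psi> (x + t *\<^sub>R h) \<partial>lborel))"
        using AE_crossing[OF ab, of h]
      proof eventually_elim
        fix x
        assume cross: "x \<in> P \<and> x + h \<in> P \<and> F x \<le> \<alpha> \<and> \<beta> \<le> F (x + h) \<longrightarrow>
          ennreal (\<beta> - \<alpha>) \<le> (\<integral>\<^sup>+t\<in>{0..1}. ennreal (\<bar>Gh h (x + t *\<^sub>R h)\<bar> * indicator {\<alpha>..\<beta>} (F (x + t *\<^sub>R h))) \<partial>lborel)"
        show "ennreal (\<beta> - \<alpha>) * indicator S x * indicator R (x + h)
          \<le> indicator H h * (ennreal (real CARD('n) * \<delta>) * (\<integral>\<^sup>+t. indicator {0..1} t * \<psi> (x + t *\<^sub>R h) \<partial>lborel))"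
        proof (cases "x \<in> S \<and> x + h \<in> R")
          case True
          then have xD: "x \<in> D" "x + h \<in> D" by (auto simp: S_def R_def)
          have "ennreal (\<beta> - \<alpha>) \<le> (\<integral>\<^sup>+t\<in>{0..1}. ennreal (\<bar>Gh h (x + t *\<^sub>R h)\<bar> * indicator {\<alpha>..\<beta>} (F (x + t *\<^sub>R h))) \<partial>lborel)"
            using cross True xD D(1) by (auto simp: S_def R_def D_def)
          also have "\<dots> \<le> (\<integral>\<^sup>+t. ennreal (real CARD('n) * \<delta>) * (indicator {0..1} t * \<psi> (x + t *\<^sub>R h)) \<partial>lborel)"
          proof (rule nn_integral_mono)
            fix t :: real
            show "ennreal (\<bar>Gh h (x + t *\<^sub>R h)\<bar> * indicator {\<alpha>..\<beta>} (F (x + t *\<^sub>R h))) * indicator {0..1} t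
              \<le> ennreal (real CARD('n) * \<delta>) * (indicator {0..1} t * \<psi> (x + t *\<^sub>R h))"
            proof (cases "t \<in> {0..1}")
              case t: True
              have "\<bar>Gh h (x + t *\<^sub>R h)\<bar> \<le> (real CARD('n) * \<delta>) * Gn (x + t *\<^sub>R h)"
                using in_H[OF xD] by (intro order_trans[OF Gh_le] mult_right_mono) (auto simp: Gn_def)
              then have "\<bar>Gh h (x + t *\<^sub>R h)\<bar> * indicator {\<alpha>..\<beta>} (F (x + t *\<^sub>R h))
                \<le> (real CARD('n) * \<delta>) * (Gn (x + t *\<^sub>R h) * indicator {\<alpha>..\<beta>} (F (x + t *\<^sub>R h)))"
                by (simp add: indicator_def)
              then show ?thesis using t segD[OF xD] D(2)
                by (simp add: \<psi>_def ennreal_leI Gn_def flip: ennreal_mult)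
            qed simp
          qed
          also have "\<dots> = ennreal (real CARD('n) * \<delta>) * (\<integral>\<^sup>+t. indicator {0..1} t * \<psi> (x + t *\<^sub>R h) \<partial>lborel)"
            by (rule nn_integral_cmult) measurable
          finally show ?thesis using True in_H[OF xD] by simp
        next
          case False
          then show ?thesis by (cases "x \<in> S") auto
        qed
      qed
    qed
    also have "\<dots> = indicator H h * (ennreal (real CARD('n) * \<delta>) * (\<integral>\<^sup>+x. \<integral>\<^sup>+t. indicator {0..1} t * \<psi> (x + t *\<^sub>R h) \<partial>lborel \<partial>lborel))"
      by (subst nn_integral_cmult, measurable, subst nn_integral_cmult, measurable)
    also have "(\<integral>\<^sup>+x. \<integral>\<^sup>+t. indicator {0..1} t * \<psi> (x + t *\<^sub>R h) \<partial>lborel \<partial>lborel)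
      = (\<integral>\<^sup>+t. \<integral>\<^sup>+x. indicator {0..1::real} t * \<psi> (x + t *\<^sub>R h) \<partial>lborel \<partial>lborel)"
      by (rule lborel_pair.Fubini') measurable
    also have "\<dots> = (\<integral>\<^sup>+t. indicator {0..1::real} t * (\<integral>\<^sup>+x. \<psi> x \<partial>lborel) \<partial>lborel)"
    proof (intro nn_integral_cong)
      fix t :: real
      have "(\<integral>\<^sup>+x. \<psi> (x + t *\<^sub>R h) \<partial>lborel) = (\<integral>\<^sup>+x. \<psi> x \<partial>lborel)"
        using nn_integral_lborel_shift[of \<psi> "t *\<^sub>R h"] by (simp add: add.commute)
      moreover have "(\<integral>\<^sup>+x. indicator {0..1::real} t * \<psi> (x + t *\<^sub>R h) \<partial>lborel) = indicator {0..1::real} t * (\<integral>\<^sup>+x. \<psi> (x + t *\<^sub>R h) \<partial>lborel)"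
        by (rule nn_integral_cmult) measurable
      ultimately show "(\<integral>\<^sup>+x. indicator {0..1::real} t * \<psi> (x + t *\<^sub>R h) \<partial>lborel) = indicator {0..1::real} t * (\<integral>\<^sup>+x. \<psi> x \<partial>lborel)"
        by simp
    qed
    also have "\<dots> = (\<integral>\<^sup>+x. \<psi> x \<partial>lborel)" by (simp add: nn_integral_multc)
    finally show ?thesis .
  qed
  \<comment> \<open>The product of the two measures is written as an integral over pairs with second
    point x + h, so that the order of integration can be changed and each h treated by
    \<open>slice\<close>.\<close>
  have "ennreal (\<beta> - \<alpha>) * emeasure lborel S * emeasure lborel R
    = (\<integral>\<^sup>+x. ennreal (\<beta> - \<alpha>) * indicator S x * (\<integral>\<^sup>+h. indicator R (x + h) \<partial>lborel) \<partial>lborel)"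
  proof -
    have "(\<integral>\<^sup>+h. indicator R (x + h) \<partial>lborel) = emeasure lborel R" for x
      using nn_integral_lborel_shift[of "indicator R" x] by simp
    then show ?thesis by (simp add: nn_integral_multc nn_integral_cmult)
  qed
  also have "\<dots> = (\<integral>\<^sup>+x. \<integral>\<^sup>+h. ennreal (\<beta> - \<alpha>) * indicator S x * indicator R (x + h) \<partial>lborel \<partial>lborel)"
  proof (intro nn_integral_cong)
    fix x
    have "(\<lambda>h. indicator R (x + h) :: ennreal) \<in> borel_measurable lborel"
      using measurable_compose[of "\<lambda>h. x + h" lborel borel "indicator R" borel] by simp
    then show "ennreal (\<beta> - \<alpha>) * indicator S x * (\<integral>\<^sup>+h. indicator R (x + h) \<partial>lborel)
      = (\<integral>\<^sup>+h. ennreal (\<beta> - \<alpha>) * indicator S x * indicator R (x + h) \<partial>lborel)"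
      by (rule nn_integral_cmult[symmetric])
  qed
  also have "\<dots> = (\<integral>\<^sup>+h. \<integral>\<^sup>+x. ennreal (\<beta> - \<alpha>) * indicator S x * indicator R (x + h) \<partial>lborel \<partial>lborel)"
    by (rule lborel_pair.Fubini') measurable
  also have "\<dots> \<le> (\<integral>\<^sup>+h. indicator H h * (ennreal (real CARD('n) * \<delta>) * (\<integral>\<^sup>+x. \<psi> x \<partial>lborel)) \<partial>lborel)"
    by (intro nn_integral_mono slice)
  also have "\<dots> = ennreal (real CARD('n) * \<delta> * (2 * \<delta>) ^ CARD('n)) * (\<integral>\<^sup>+x. \<psi> x \<partial>lborel)"
  proof -
    have "ennreal (real CARD('n) * \<delta> * (2 * \<delta>) ^ CARD('n)) = ennreal ((2 * \<delta>) ^ CARD('n)) * ennreal (real CARD('n) * \<delta>)"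
      using D(2) by (subst ennreal_mult[symmetric]) (auto simp: mult.commute)
    then show ?thesis by (subst nn_integral_multc) (simp_all add: eH mult.assoc)
  qed
  finally show ?thesis by (simp add: S_def R_def D_def \<psi>_def)
qed

end

section \<open>Gradient estimate on a cube\<close>

lemma borel_representative:
  fixes u :: "'a::euclidean_space \<Rightarrow> real"
  assumes "integrable lebesgue u"
  obtains U where "U \<in> borel_measurable borel" "integrable lborel U" "AE x in lborel. u x = U x"
proof -
  have um: "u \<in> borel_measurable lebesgue" using assms by (rule borel_measurable_integrable)
  then obtain U where U: "U \<in> borel_measurable lborel" "AE x in lborel. u x = U x"
    using completion_ex_borel_measurable_real by blast
  have Um: "U \<in> borel_measurable lebesgue" by (rule measurable_completion) (rule U(1))
  have "integrable lebesgue U"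
    using assms integrable_cong_AE[OF um Um AE_completion[OF U(2)]] by simp
  then have "integrable lborel U" using U(1) by (simp add: integrable_completion)
  then show ?thesis using that U by simp
qed

text \<open>Consecutive closed bands share an end point, so a value can lie in two of them. This is
  the source of \<open>2 * T\<close> in the gradient estimate.\<close>

lemma card_bands_le_2:
  assumes "finite J"
  shows "(\<Sum>k\<in>J. indicator {c + 2 powr real_of_int (k - 1)..c + 2 powr real_of_int k} y :: ennreal) \<le> 2"
proof -
  define J' where "J' = {k \<in> J. y \<in> {c + 2 powr real_of_int (k - 1)..c + 2 powr real_of_int k}}"
  have fin: "finite J'" using assms by (simp add: J'_def)
  have "(\<Sum>k\<in>J. indicator {c + 2 powr real_of_int (k - 1)..c + 2 powr real_of_int k} y :: ennreal) = (\<Sum>k\<in>J'. 1)"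
    using assms by (intro sum.mono_neutral_cong_right) (auto simp: J'_def)
  also have "\<dots> = of_nat (card J')" by simp
  also have "card J' \<le> 2"
  proof (cases "J' = {}")
    case False
    have "J' \<subseteq> {Min J', Min J' + 1}"
    proof
      fix k assume k: "k \<in> J'"
      have m: "Min J' \<in> J'" "Min J' \<le> k" using fin False k by auto
      have "c + 2 powr real_of_int (k - 1) \<le> y" using k unfolding J'_def mem_Collect_eq atLeastAtMost_iff by blast
      moreover have "y \<le> c + 2 powr real_of_int (Min J')"
      proof -
        have "y \<in> {c + 2 powr real_of_int (i - 1)..c + 2 powr real_of_int i}" if "i \<in> J'" for i using that by (simp add: J'_def)
        from this[OF m(1)] show ?thesis by simp
      qed
      ultimately have "2 powr real_of_int (k - 1) \<le> 2 powr real_of_int (Min J')" by linarith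
      then have "k - 1 \<le> Min J'" by (subst (asm) powr_le_cancel_iff) auto
      then show "k \<in> {Min J', Min J' + 1}" using m by auto
    qed
    then have "card J' \<le> card {Min J', Min J' + 1}" by (intro card_mono) auto
    then show ?thesis by simp
  qed simp
  then have "of_nat (card J') \<le> (of_nat 2 :: ennreal)" by (intro of_nat_mono)
  finally show ?thesis by simp
qed

text \<open>The energy of level k is |g|^p v where f lies in the k-th band. The band estimate with
  \<beta> - \<alpha> = 2^(k-1) and Hoelder for \<open>v\<close> give the local inequality. In
  \<open>C\<close>, n 2^n comes from the band estimate, 4 from the half of D and from 2^k = 2
  2^(k-1), and 1 / \<epsilon> from the part of D above the level.\<close>

lemma cube_grad_one_sided:
  fixes \<Omega> :: "(real ^ 'n) set" and f w v :: "real ^ 'n \<Rightarrow> real" and g :: "real ^ 'n \<Rightarrow> real ^ 'n"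
    and p q r :: real
  defines "C \<equiv> 4 * real CARD('n) * 2 ^ CARD('n) / stop_eps CARD('n) q r"
  assumes l: "0 < l" and sub: "cbox a (a + vec l) \<subseteq> \<Omega>"
    and exps: "1 < p" "p \<le> q" "1 < r" "0 \<le> \<gamma>" and K: "A_const \<Omega> (1 - \<gamma>) r q p w v \<le> ennreal K" "0 \<le> K"
    and w: "w \<in> borel_measurable lebesgue" and w0: "\<And>x. 0 \<le> w x"
    and v[measurable]: "v \<in> borel_measurable lebesgue" and v0: "\<And>x. 0 \<le> v x"
    and f[measurable]: "f \<in> borel_measurable lebesgue"
    and half: "measure lebesgue {x \<in> hcube a l. c < f x} \<le> measure lebesgue (hcube a l) / 2"
    and wg: "is_weak_gradient \<Omega> f g"
    and T: "0 \<le> T" "(\<integral>\<^sup>+x\<in>hcube a l. ennreal (norm (g x) powr p * v x) \<partial>lebesgue) \<le> ennreal T"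
  shows "(\<integral>\<^sup>+x\<in>hcube a l. ennreal (max 0 (f x - c) powr q * w x) \<partial>lebesgue)
    \<le> ennreal (2 powr q * (2 * (1 + 2 powr q) * (C * K * l powr \<gamma>) powr q * (2 * T) powr (q / p)))"
proof -
  define P where "P = cbox a (a + vec l)"
  have Pl[measurable]: "P \<in> sets lebesgue" by (simp add: P_def)
  have QP: "hcube a l \<subseteq> P" unfolding P_def by (rule hcube_subset_cbox)
  have loc: "f locally_integrable_on \<Omega>" "g locally_integrable_on \<Omega>" using wg by (auto simp: is_weak_gradient_def)
  have "f absolutely_integrable_on P" "g absolutely_integrable_on P"
    using loc sub compact_cbox[of a "a + vec l"] unfolding locally_integrable_on_def P_def by blast+
  then have fi: "integrable lebesgue (\<lambda>x. indicator P x * f x)" and gi: "integrable lebesgue (\<lambda>x. indicator P x *\<^sub>R g x)"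
    by (simp_all add: set_integrable_def)
  have gii: "integrable lebesgue (\<lambda>x. indicator P x * g x $ i)" for i
    using integrable_bounded_linear[OF bounded_linear_vec_nth gi, of i] by simp
  obtain F where F: "F \<in> borel_measurable borel" "integrable lborel F" "AE x in lborel. indicator P x * f x = F x"
    by (rule borel_representative[OF fi]) blast
  define G where "G i = (SOME U. U \<in> borel_measurable borel \<and> integrable lborel U \<and> (AE x in lborel. indicator P x * g x $ i = U x))" for i
  have G: "G i \<in> borel_measurable borel" "integrable lborel (G i)" "AE x in lborel. indicator P x * g x $ i = G i x" for i
  proof -
    obtain U where "U \<in> borel_measurable borel" "integrable lborel U" "AE x in lborel. indicator P x * g x $ i = U x"
      by (rule borel_representative[OF gii[of i]])
    then have "\<exists>U. U \<in> borel_measurable borel \<and> integrable lborel U \<and> (AE x in lborel. indicator P x * g x $ i = U x)" by blast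
    from someI_ex[OF this] show "G i \<in> borel_measurable borel" "integrable lborel (G i)" "AE x in lborel. indicator P x * g x $ i = G i x"
      unfolding G_def by blast+
  qed
  interpret wgc: weak_gradient_cbox \<Omega> f g a "a + vec l" F G
    by unfold_locales
      (fact wg sub F[unfolded P_def] G[unfolded P_def] borel_measurable_integrable[OF fi, unfolded P_def]
        borel_measurable_integrable[OF gii, unfolded P_def])+
  define gn where "gn x = norm (indicator P x *\<^sub>R g x)" for x
  have gn[measurable]: "gn \<in> borel_measurable lebesgue"
    unfolding gn_def[abs_def] using borel_measurable_integrable[OF gi] by (intro borel_measurable_norm measurable_compose[OF _ borel_measurable_norm]) 
  have gn0: "0 \<le> gn x" for x by (simp add: gn_def)
  have gnP: "gn x = norm (g x)" if "x \<in> P" for x using that by (simp add: gn_def)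
  have ae: "AE x in lebesgue. x \<in> P \<longrightarrow> F x = f x \<and> wgc.Gn x = gn x"
  proof -
    have "AE x in lborel. \<forall>i. indicator P x * g x $ i = G i x"
      using G(3) by (subst AE_all_countable) auto
    with F(3) have "AE x in lborel. x \<in> P \<longrightarrow> F x = f x \<and> wgc.Gn x = gn x"
    proof eventually_elim
      fix x assume 1: "indicator P x * f x = F x" "\<forall>i. indicator P x * g x $ i = G i x"
      show "x \<in> P \<longrightarrow> F x = f x \<and> wgc.Gn x = gn x"
      proof
        assume "x \<in> P"
        then have "(\<chi> i. G i x) = g x" using 1 by (auto simp: vec_eq_iff)
        then show "F x = f x \<and> wgc.Gn x = gn x" using 1 \<open>x \<in> P\<close> by (simp add: wgc.Gn_def gn_def)
      qed
    qed
    then show ?thesis by (rule AE_completion)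
  qed
  define band where "band k = {c + 2 powr real_of_int (k - 1)..c + 2 powr real_of_int k}" for k
  define \<rho> where "\<rho> k x = ennreal (gn x powr p * v x) * indicator (band k) (f x)" for k x
  have \<rho>_meas: "\<rho> k \<in> borel_measurable lebesgue" for k unfolding \<rho>_def[abs_def] band_def by measurable
  have T_le: "(\<Sum>k\<in>J. \<integral>\<^sup>+x\<in>hcube a l. \<rho> k x \<partial>lebesgue) \<le> ennreal (2 * T)" if J: "finite J" for J
  proof -
    have "(\<Sum>k\<in>J. \<integral>\<^sup>+x\<in>hcube a l. \<rho> k x \<partial>lebesgue) = (\<integral>\<^sup>+x\<in>hcube a l. (\<Sum>k\<in>J. \<rho> k x) \<partial>lebesgue)"
      using \<rho>_meas by (subst nn_integral_sum[symmetric]) (auto simp: sum_distrib_right)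
    also have "\<dots> \<le> (\<integral>\<^sup>+x. 2 * (ennreal (norm (g x) powr p * v x) * indicator (hcube a l) x) \<partial>lebesgue)"
    proof (rule nn_integral_mono)
      fix x
      show "(\<Sum>k\<in>J. \<rho> k x) * indicator (hcube a l) x \<le> 2 * (ennreal (norm (g x) powr p * v x) * indicator (hcube a l) x)"
      proof (cases "x \<in> hcube a l")
        case True
        have "(\<Sum>k\<in>J. \<rho> k x) = ennreal (norm (g x) powr p * v x) * (\<Sum>k\<in>J. indicator (band k) (f x))"
          using True QP gnP[of x] by (auto simp: \<rho>_def sum_distrib_left)
        also have "\<dots> \<le> ennreal (norm (g x) powr p * v x) * 2"
          unfolding band_def by (intro mult_left_mono card_bands_le_2 J) simp
        finally show ?thesis using True by (simp add: mult.commute)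
      qed simp
    qed
    also have "\<dots> = (\<integral>\<^sup>+x. 2 * (ennreal (gn x powr p * v x) * indicator (hcube a l) x) \<partial>lebesgue)"
      using QP gnP by (intro nn_integral_cong) (auto simp: indicator_def)
    also have "\<dots> = 2 * (\<integral>\<^sup>+x\<in>hcube a l. ennreal (gn x powr p * v x) \<partial>lebesgue)"
      by (rule nn_integral_cmult) measurable
    also have "(\<integral>\<^sup>+x\<in>hcube a l. ennreal (gn x powr p * v x) \<partial>lebesgue) = (\<integral>\<^sup>+x\<in>hcube a l. ennreal (norm (g x) powr p * v x) \<partial>lebesgue)"
      using QP gnP by (intro nn_integral_cong) (auto simp: indicator_def)
    also have "2 * \<dots> \<le> 2 * ennreal T" by (intro mult_left_mono T) auto
    also have "\<dots> = ennreal (2 * T)" using T by (simp add: ennreal_mult)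
    finally show ?thesis .
  qed
  define \<epsilon> where "\<epsilon> = stop_eps CARD('n) q r"
  have \<epsilon>: "0 < \<epsilon>" using stop_eps[OF exps(3)] by (simp add: \<epsilon>_def)
  have C0: "0 \<le> C" unfolding C_def using \<epsilon> by (simp add: \<epsilon>_def)
  define h where "h x = max 0 (f x - c)" for x
  have h_meas: "h \<in> borel_measurable lebesgue" unfolding h_def[abs_def] by measurable
  have h_iff: "0 < h x \<longleftrightarrow> c < f x" "2 powr t \<le> h x \<longleftrightarrow> c + 2 powr t \<le> f x" for x t
  proof -
    show "0 < h x \<longleftrightarrow> c < f x" by (auto simp: h_def)
    have "0 < (2 :: real) powr t" by simp
    then show "2 powr t \<le> h x \<longleftrightarrow> c + 2 powr t \<le> f x" unfolding h_def by linarith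
  qed
  have half': "measure lebesgue {x \<in> hcube a l. 0 < h x} \<le> measure lebesgue (hcube a l) / 2"
    using half by (simp only: h_iff)
  have T2: "0 \<le> 2 * T" using T by simp
  have "(\<integral>\<^sup>+x\<in>hcube a l. ennreal (h x powr q * w x) \<partial>lebesgue)
    \<le> ennreal (2 powr q * (2 * (1 + 2 powr q) * (C * K * l powr \<gamma>) powr q * (2 * T) powr (q / p)))"
  proof (rule cube_level_estimate[OF l sub exps(1-4) K C0 w w0 v h_meas _ half' \<rho>_meas T2 T_le])
    show "0 \<le> h x" for x by (simp add: h_def)
    fix b \<delta> k S
    assume \<delta>: "0 < \<delta>" and DQ: "hcube b \<delta> \<subseteq> hcube a l"
      and S: "(\<integral>\<^sup>+x\<in>hcube b \<delta>. ennreal (v x) epowr (1 - conj_exponent p) \<partial>lebesgue) \<le> ennreal S" "0 \<le> S"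
      and big: "stop_eps CARD('n) q r * measure lebesgue (hcube b \<delta>) < measure lebesgue {x \<in> hcube b \<delta>. 2 powr real_of_int k \<le> h x}"
      and small: "measure lebesgue {x \<in> hcube b \<delta>. 2 powr real_of_int (k - 1) \<le> h x} \<le> measure lebesgue (hcube b \<delta>) / 2"
    define D where "D = hcube b \<delta>"
    define m where "m = measure lebesgue D"
    have m: "m = \<delta> ^ CARD('n)" "0 < m" using \<delta> by (simp_all add: m_def D_def measure_hcube del: measure_completion)
    have Dl: "D \<in> lmeasurable" and Ds[measurable]: "D \<in> sets lebesgue" and Db[measurable]: "D \<in> sets borel" by (auto simp: D_def)
    have DP: "D \<subseteq> P" using DQ QP by (auto simp: D_def)
    define \<alpha> \<beta> where "\<alpha> = c + 2 powr real_of_int (k - 1)" and "\<beta> = c + 2 powr real_of_int k"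
    have two: "2 powr real_of_int k = 2 * 2 powr real_of_int (k - 1)" by (simp add: powr_diff)
    have \<alpha>\<beta>: "\<beta> - \<alpha> = 2 powr real_of_int (k - 1)" "\<alpha> < \<beta>" unfolding \<alpha>_def \<beta>_def two by simp_all
    define A B where "A = {x \<in> D. f x \<le> \<alpha>}" and "B = {x \<in> D. \<beta> \<le> f x}"
    have A_eq: "A = D \<inter> (f -` {..\<alpha>} \<inter> space lebesgue)" and B_eq: "B = D \<inter> (f -` {\<beta>..} \<inter> space lebesgue)"
      by (auto simp: A_def B_def)
    have AB: "A \<in> sets lebesgue" "B \<in> sets lebesgue"
      unfolding A_eq B_eq using measurable_sets[OF f] by (auto simp del: space_completion space_lborel)
    have ABl: "A \<in> lmeasurable" "B \<in> lmeasurable"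
      using AB by (auto intro!: fmeasurableI2[OF Dl] simp: A_def B_def)
    have mB: "\<epsilon> * m < measure lebesgue B"
      using big unfolding D_def[symmetric] m_def[symmetric] \<epsilon>_def[symmetric] h_iff \<beta>_def[symmetric] B_def[symmetric] .
    have DA: "{x \<in> D. \<alpha> \<le> f x} \<in> lmeasurable"
    proof -
      have "{x \<in> D. \<alpha> \<le> f x} = D \<inter> (f -` {\<alpha>..} \<inter> space lebesgue)" by auto
      then have "{x \<in> D. \<alpha> \<le> f x} \<in> sets lebesgue" using measurable_sets[OF f] by (auto simp del: space_completion space_lborel)
      then show ?thesis by (auto intro!: fmeasurableI2[OF Dl])
    qed
    have "measure lebesgue (D - A) \<le> measure lebesgue {x \<in> D. \<alpha> \<le> f x}"
      using AB by (intro measure_mono_fmeasurable DA) (auto simp: A_def)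
    also have "\<dots> \<le> m / 2"
      using small unfolding D_def[symmetric] m_def[symmetric] h_iff \<alpha>_def[symmetric] .
    finally have "measure lebesgue (D - A) \<le> m / 2" .
    moreover have "measure lebesgue (D - A) = m - measure lebesgue A"
      unfolding m_def using Dl ABl by (intro measurable_measure_Diff) (auto simp: A_def)
    ultimately have mA: "m / 2 \<le> measure lebesgue A" by simp
    have F_sets: "{x \<in> D. F x \<le> \<alpha>} \<in> sets borel" "{x \<in> D. \<beta> \<le> F x} \<in> sets borel"
    proof -
      have "{x \<in> D. F x \<le> \<alpha>} = D \<inter> {x. F x \<le> \<alpha>}" "{x \<in> D. \<beta> \<le> F x} = D \<inter> {x. \<beta> \<le> F x}" by auto
      then show "{x \<in> D. F x \<le> \<alpha>} \<in> sets borel" "{x \<in> D. \<beta> \<le> F x} \<in> sets borel" by simp_all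
    qed
    \<comment> \<open>The level sets of f and of its Borel representative differ by a null set, so
      the measures known for f may be used in the band estimate for \<open>F\<close>.\<close>
    have eA: "emeasure lborel {x \<in> D. F x \<le> \<alpha>} = ennreal (measure lebesgue A)"
    proof -
      have "emeasure lebesgue {x \<in> D. F x \<le> \<alpha>} = emeasure lebesgue A"
        by (rule emeasure_eq_AE) (use ae DP F_sets AB in \<open>auto simp: A_def elim!: eventually_mono\<close>)
      then show ?thesis using F_sets emeasure_eq_measure2[OF ABl(1)] by simp
    qed
    have eB: "emeasure lborel {x \<in> D. \<beta> \<le> F x} = ennreal (measure lebesgue B)"
    proof -
      have "emeasure lebesgue {x \<in> D. \<beta> \<le> F x} = emeasure lebesgue B"
        by (rule emeasure_eq_AE) (use ae DP F_sets AB in \<open>auto simp: B_def elim!: eventually_mono\<close>)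
      then show ?thesis using F_sets emeasure_eq_measure2[OF ABl(2)] by simp
    qed
    define \<psi> where "\<psi> x = gn x * indicator (band k) (f x)" for x
    have \<psi>m: "\<psi> \<in> borel_measurable lebesgue" unfolding \<psi>_def[abs_def] band_def by measurable
    have \<psi>0: "0 \<le> \<psi> x" for x by (simp add: \<psi>_def gn0)
    define M where "M = enn2real (\<integral>\<^sup>+x\<in>D. \<rho> k x \<partial>lebesgue)"
    have "(\<integral>\<^sup>+x\<in>D. \<rho> k x \<partial>lebesgue) \<le> (\<integral>\<^sup>+x\<in>hcube a l. \<rho> k x \<partial>lebesgue)"
      using DQ by (intro nn_integral_mono) (auto simp: D_def indicator_def)
    also have "\<dots> \<le> ennreal (2 * T)" using T_le[of "{k}"] by simp
    finally have M: "(\<integral>\<^sup>+x\<in>D. \<rho> k x \<partial>lebesgue) = ennreal M" "0 \<le> M"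
      unfolding M_def by (auto simp: ennreal_enn2real_if top_unique)
    define X where "X = M powr (1 / p) * S powr (1 - 1 / p)"
    have X0: "0 \<le> X" by (simp add: X_def)
    have \<psi>_int: "(\<integral>\<^sup>+x\<in>D. ennreal (\<psi> x) \<partial>lebesgue) \<le> ennreal X"
      unfolding X_def
    proof (rule nn_integral_weight_Holder[OF v \<psi>m Ds v0 \<psi>0 exps(1) _ S(2) _ M(2)])
      have "ennreal (\<psi> x powr p * v x) = \<rho> k x" for x
        using exps by (auto simp: \<psi>_def \<rho>_def indicator_def)
      then show "(\<integral>\<^sup>+x\<in>D. ennreal (\<psi> x powr p * v x) \<partial>lebesgue) \<le> ennreal M" using M by simp
    qed (use S in \<open>simp add: D_def\<close>)
    have "(\<integral>\<^sup>+x\<in>D. ennreal (wgc.Gn x * indicator {\<alpha>..\<beta>} (F x)) \<partial>lborel) = (\<integral>\<^sup>+x\<in>D. ennreal (wgc.Gn x * indicator {\<alpha>..\<beta>} (F x)) \<partial>lebesgue)"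
      by (rule nn_integral_completion[symmetric]) (use F(1) in measurable)
    also have "\<dots> = (\<integral>\<^sup>+x\<in>D. ennreal (\<psi> x) \<partial>lebesgue)"
      by (rule nn_integral_cong_AE)
        (use ae DP in \<open>auto simp: indicator_def \<psi>_def band_def \<alpha>_def \<beta>_def elim!: eventually_mono\<close>)
    finally have G_int: "(\<integral>\<^sup>+x\<in>D. ennreal (wgc.Gn x * indicator {\<alpha>..\<beta>} (F x)) \<partial>lborel) \<le> ennreal X"
      using \<psi>_int by simp
    have "ennreal (\<beta> - \<alpha>) * ennreal (measure lebesgue A) * ennreal (measure lebesgue B)
      \<le> ennreal (real CARD('n) * \<delta> * (2 * \<delta>) ^ CARD('n)) * ennreal X"
      using order_trans[OF wgc.band_estimate[of b \<delta> \<alpha> \<beta>] mult_left_mono[OF G_int[unfolded D_def]]] DP \<delta> \<alpha>\<beta>(2)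
      unfolding D_def[symmetric] eA eB P_def by auto
    then have "(\<beta> - \<alpha>) * measure lebesgue A * measure lebesgue B \<le> real CARD('n) * \<delta> * (2 * \<delta>) ^ CARD('n) * X"
      using \<delta> \<alpha>\<beta>(2) X0 by (simp flip: ennreal_mult del: measure_completion)
    moreover have "(\<beta> - \<alpha>) * (m / 2) * (\<epsilon> * m) \<le> (\<beta> - \<alpha>) * measure lebesgue A * measure lebesgue B"
      using mA mB m \<epsilon> \<alpha>\<beta>(2) by (intro mult_mono) (auto simp del: measure_completion)
    ultimately have "(\<beta> - \<alpha>) * (m / 2) * (\<epsilon> * m) \<le> real CARD('n) * \<delta> * (2 ^ CARD('n) * m) * X"
      by (simp add: m power_mult_distrib)
    then have "((\<beta> - \<alpha>) * (m / 2) * (\<epsilon> * m)) * (4 / (\<epsilon> * m * m)) \<le> (real CARD('n) * \<delta> * (2 ^ CARD('n) * m) * X) * (4 / (\<epsilon> * m * m))"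
      using \<epsilon> m by (intro mult_right_mono) auto
    moreover have "((\<beta> - \<alpha>) * (m / 2) * (\<epsilon> * m)) * (4 / (\<epsilon> * m * m)) = 2 powr real_of_int k"
      unfolding \<alpha>\<beta>(1) two using \<epsilon> m(2) by simp
    moreover have "(real CARD('n) * \<delta> * (2 ^ CARD('n) * m) * X) * (4 / (\<epsilon> * m * m)) = C * (\<delta> / m) * X"
      using \<epsilon> m(2) by (simp add: C_def \<epsilon>_def[symmetric])
    moreover have "\<delta> / m = \<delta> powr (1 - real CARD('n))"
      using \<delta> by (simp add: m powr_diff powr_realpow)
    ultimately show "2 powr real_of_int k \<le> C * \<delta> powr (1 - real CARD('n)) * S powr (1 - 1 / p) * enn2real (\<integral>\<^sup>+x\<in>hcube b \<delta>. \<rho> k x \<partial>lebesgue) powr (1 / p)"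
      unfolding M_def[symmetric] D_def[symmetric] X_def by (simp add: mult_ac)
  qed
  then show ?thesis by (simp add: h_def)
qed

subsection \<open>Hardy inequality on a rooted tree\<close>

text \<open>Convexity of the power: its graph lies above the tangent at x. After division by x^q
  this is Young's inequality for y / x and 1.\<close>

lemma powr_diff_le:
  fixes x y q :: real
  assumes "0 \<le> y" "y \<le> x" "1 < q"
  shows "x powr q \<le> y powr q + q * (x - y) * x powr (q - 1)"
proof (cases "x = 0")
  case False
  then have x: "0 < x" using assms by simp
  define t where "t = y / x"
  have t: "0 \<le> t" "y = t * x" using assms x by (auto simp: t_def)
  have "t * 1 \<le> t powr q / q + 1 powr (q / (q - 1)) / (q / (q - 1))"
    by (rule Youngs_inequality) (use assms t in \<open>auto simp: field_simps\<close>)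
  then have "q * t \<le> q * (t powr q / q + (q - 1) / q)" using assms by (intro mult_left_mono) auto
  then have "q * t \<le> t powr q + (q - 1)" using assms by (simp add: distrib_left)
  then have "(q * t) * x powr q \<le> (t powr q + (q - 1)) * x powr q" by (intro mult_right_mono) auto
  moreover have "x powr q = x * x powr (q - 1)" using x by (simp add: powr_mult_base)
  moreover have "y powr q = t powr q * x powr q" using t x by (simp add: powr_mult)
  ultimately show ?thesis using t by (simp add: algebra_simps)
qed (use assms in auto)

text \<open>The hypothesis \<open>shadow\<close> is a Carleson condition; it replaces the maximal function in the usual
  chaining argument.\<close>

lemma tree_hardy:
  fixes b F \<omega> :: "'a \<Rightarrow> real" and par :: "'a \<Rightarrow> 'a" and rt :: 'a and rk :: "'a \<Rightarrow> nat"
  assumes fin: "finite J" and par: "\<And>i. i \<in> J \<Longrightarrow> par i \<in> J" and rt: "par rt = rt" "F rt = 0"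
    and rk: "\<And>i. i \<in> J \<Longrightarrow> i \<noteq> rt \<Longrightarrow> rk (par i) < rk i"
    and F: "\<And>i. i \<in> J \<Longrightarrow> i \<noteq> rt \<Longrightarrow> F i = b i + F (par i)"
    and nonneg: "\<And>i. 0 \<le> b i" "\<And>i. 0 \<le> F i" "\<And>i. 0 \<le> \<omega> i" and q: "1 < q" and C: "0 \<le> C"
    and shadow: "\<And>j. j \<in> J \<Longrightarrow> j \<noteq> rt \<Longrightarrow> (\<Sum>i | i \<in> J \<and> (\<exists>m. (par ^^ m) i = j). \<omega> i) \<le> C * \<omega> j"
  shows "(\<Sum>i\<in>J. \<omega> i * F i powr q) \<le> 2 * (2 * q * C) powr q * (\<Sum>i\<in>J. \<omega> i * b i powr q)"
proof -
  define up where "up i = {j \<in> J. j \<noteq> rt \<and> (\<exists>m. (par ^^ m) i = j)}" for i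
  have fin_up: "finite (up i)" for i using fin by (simp add: up_def)
  have pow_J: "(par ^^ m) i \<in> J" if "i \<in> J" for i m using that par by (induction m) auto
  have rk_pow: "(par ^^ m) i = rt \<or> rk ((par ^^ m) i) \<le> rk i" if "i \<in> J" for i m
  proof (induction m)
    case (Suc m)
    show ?case
    proof (cases "(par ^^ m) i = rt")
      case False
      then have "rk (par ((par ^^ m) i)) < rk ((par ^^ m) i)" using rk pow_J[OF that] by blast
      then show ?thesis using Suc False by auto
    qed (use rt in auto)
  qed simp
  have up_eq: "up i = insert i (up (par i))" "i \<notin> up (par i)" if i: "i \<in> J" "i \<noteq> rt" for i
  proof -
    have "(\<exists>m. (par ^^ m) i = j) \<longleftrightarrow> i = j \<or> (\<exists>m. (par ^^ m) (par i) = j)" for j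
    proof
      assume "\<exists>m. (par ^^ m) i = j"
      then obtain m where m: "(par ^^ m) i = j" by blast
      show "i = j \<or> (\<exists>m. (par ^^ m) (par i) = j)"
      proof (cases m)
        case (Suc k)
        then have "(par ^^ k) (par i) = j" using m by (simp add: funpow_swap1)
        then show ?thesis by blast
      qed (use m in auto)
    next
      assume "i = j \<or> (\<exists>m. (par ^^ m) (par i) = j)"
      then show "\<exists>m. (par ^^ m) i = j"
      proof
        assume "i = j" then show ?thesis by (intro exI[of _ 0]) simp
      next
        assume "\<exists>m. (par ^^ m) (par i) = j"
        then obtain m where "(par ^^ m) (par i) = j" by blast
        then have "(par ^^ Suc m) i = j" by (simp add: funpow_swap1)
        then show ?thesis by blast
      qed
    qed
    then show "up i = insert i (up (par i))" using i by (auto simp: up_def)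
    show "i \<notin> up (par i)"
    proof
      assume "i \<in> up (par i)"
      then obtain m where "(par ^^ m) (par i) = i" by (auto simp: up_def)
      then have "rk i \<le> rk (par i)" using rk_pow[OF par[OF i(1)], of m] i by auto
      then show False using rk[OF i] by simp
    qed
  qed
  \<comment> \<open>The tangent inequality telescoped along the ancestors of i. It trades the q-th
    power of a sum for a sum linear in the increments \<open>b j\<close>, after which the order of
    summation can be changed and each j meets the weight of its descendants.\<close>
  have Fq: "F i powr q \<le> (\<Sum>j\<in>up i. q * b j * F j powr (q - 1))" if "i \<in> J" for i
    using that
  proof (induction "rk i" arbitrary: i rule: less_induct)
    case less
    show ?case
    proof (cases "i = rt")
      case True
      then show ?thesis using rt q nonneg by (auto intro!: sum_nonneg)
    next
      case False
      note i = \<open>i \<in> J\<close> False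
      have "F i powr q \<le> F (par i) powr q + q * (F i - F (par i)) * F i powr (q - 1)"
        using F[OF i] nonneg q by (intro powr_diff_le) auto
      also have "\<dots> \<le> (\<Sum>j\<in>up (par i). q * b j * F j powr (q - 1)) + q * b i * F i powr (q - 1)"
        using less.hyps[OF rk[OF i] par[OF i(1)]] F[OF i] by simp
      also have "\<dots> = (\<Sum>j\<in>up i. q * b j * F j powr (q - 1))"
        unfolding up_eq(1)[OF i] using up_eq(2)[OF i] fin_up by simp
      finally show ?thesis .
    qed
  qed
  define S where "S = (\<Sum>i\<in>J. \<omega> i * F i powr q)"
  have "S \<le> (\<Sum>i\<in>J. \<omega> i * (\<Sum>j\<in>up i. q * b j * F j powr (q - 1)))"
    unfolding S_def by (intro sum_mono mult_left_mono Fq nonneg)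
  also have "\<dots> = (\<Sum>i\<in>J. \<Sum>j\<in>up i. \<omega> i * (q * b j * F j powr (q - 1)))"
    by (simp add: sum_distrib_left)
  also have "\<dots> = (\<Sum>j\<in>{j \<in> J. j \<noteq> rt}. \<Sum>i | i \<in> J \<and> (\<exists>m. (par ^^ m) i = j). \<omega> i * (q * b j * F j powr (q - 1)))"
    unfolding up_def using fin sum.swap_restrict[of J "{j \<in> J. j \<noteq> rt}" "\<lambda>i j. \<omega> i * (q * b j * F j powr (q - 1))" "\<lambda>i j. \<exists>m. (par ^^ m) i = j"]
    by (simp add: conj_assoc)
  also have "\<dots> = (\<Sum>j\<in>{j \<in> J. j \<noteq> rt}. (\<Sum>i | i \<in> J \<and> (\<exists>m. (par ^^ m) i = j). \<omega> i) * (q * b j * F j powr (q - 1)))"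
    by (simp add: sum_distrib_right)
  also have "\<dots> \<le> (\<Sum>j\<in>{j \<in> J. j \<noteq> rt}. (C * \<omega> j) * (q * b j * F j powr (q - 1)))"
    using nonneg q by (intro sum_mono mult_right_mono shadow) auto
  also have "\<dots> \<le> (\<Sum>j\<in>{j \<in> J. j \<noteq> rt}. 1 / 2 * (\<omega> j * F j powr q) + (2 * q * C) powr q * (\<omega> j * b j powr q))"
  proof (rule sum_mono)
    fix j
    define x where "x = q * C * b j"
    have x: "0 \<le> x" using nonneg q C by (simp add: x_def)
    \<comment> \<open>Either x is at most half of \<open>F j\<close>, and half of its q-th power is
      enough, or \<open>F j\<close> is below 2 x. The term with 1/2 is later absorbed into the
      left-hand side, a finite sum over J.\<close>
    have "x * F j powr (q - 1) \<le> 1 / 2 * F j powr q + (2 * x) powr q"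
    proof (cases "x \<le> F j / 2")
      case True
      have "x * F j powr (q - 1) \<le> F j / 2 * F j powr (q - 1)" using True by (intro mult_right_mono) auto
      also have "\<dots> = 1 / 2 * F j powr q" using nonneg(2)[of j] by (cases "F j = 0") (auto simp: powr_mult_base)
      finally show ?thesis by (simp add: add_increasing2)
    next
      case False
      have "x * F j powr (q - 1) \<le> (2 * x) * (2 * x) powr (q - 1)"
        using False x q nonneg(2)[of j] by (intro mult_mono powr_mono2) auto
      also have "\<dots> = (2 * x) powr q" using x by (cases "x = 0") (auto simp: powr_mult_base)
      finally show ?thesis by (simp add: add_increasing)
    qed
    then have "\<omega> j * (x * F j powr (q - 1)) \<le> \<omega> j * (1 / 2 * F j powr q + (2 * x) powr q)"
      using nonneg by (intro mult_left_mono) auto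
    moreover have "(2 * x) powr q = (2 * q * C) powr q * b j powr q"
    proof -
      have "2 * x = (2 * q * C) * b j" by (simp add: x_def)
      then show ?thesis using nonneg(1)[of j] q C by (simp add: powr_mult)
    qed
    ultimately show "(C * \<omega> j) * (q * b j * F j powr (q - 1)) \<le> 1 / 2 * (\<omega> j * F j powr q) + (2 * q * C) powr q * (\<omega> j * b j powr q)"
      by (simp add: x_def algebra_simps)
  qed
  also have "\<dots> \<le> (\<Sum>j\<in>J. 1 / 2 * (\<omega> j * F j powr q) + (2 * q * C) powr q * (\<omega> j * b j powr q))"
    using fin nonneg by (intro sum_mono2) auto
  also have "\<dots> = 1 / 2 * S + (2 * q * C) powr q * (\<Sum>i\<in>J. \<omega> i * b i powr q)"
    by (simp add: S_def sum.distrib sum_distrib_left)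
  finally show ?thesis by (simp add: S_def)
qed

text \<open>One of the N links carries at least the share 1/N of the whole difference; its bound,
  multiplied by N^q, bounds the rest. It is enough to know each link with the same mass W.\<close>

lemma chain_powr_le:
  fixes c :: "nat \<Rightarrow> real"
  assumes "\<And>j. j < N \<Longrightarrow> \<bar>c j - c (Suc j)\<bar> powr q * W \<le> b" "0 < N" "0 \<le> W" "0 < q"
  shows "\<bar>c 0 - c N\<bar> powr q * W \<le> real N powr q * b"
proof -
  have "\<exists>j<N. \<bar>c 0 - c N\<bar> \<le> real N * \<bar>c j - c (Suc j)\<bar>"
  proof (rule ccontr)
    assume "\<not> ?thesis"
    then have *: "real N * \<bar>c j - c (Suc j)\<bar> < \<bar>c 0 - c N\<bar>" if "j < N" for j using that by auto
    have tele: "\<bar>c 0 - c M\<bar> \<le> (\<Sum>j<M. \<bar>c j - c (Suc j)\<bar>)" for M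
      by (induction M) auto
    have "real N * \<bar>c 0 - c N\<bar> \<le> (\<Sum>j<N. real N * \<bar>c j - c (Suc j)\<bar>)"
      using mult_left_mono[OF tele[of N], of "real N"] by (simp add: sum_distrib_left)
    also have "\<dots> < (\<Sum>j<N. \<bar>c 0 - c N\<bar>)" using * assms(2) by (intro sum_strict_mono) auto
    finally show False by simp
  qed
  then obtain j where j: "j < N" "\<bar>c 0 - c N\<bar> \<le> real N * \<bar>c j - c (Suc j)\<bar>" by blast
  have "\<bar>c 0 - c N\<bar> powr q \<le> (real N * \<bar>c j - c (Suc j)\<bar>) powr q" using j assms by (intro powr_mono2) auto
  also have "\<dots> = real N powr q * \<bar>c j - c (Suc j)\<bar> powr q" by (simp add: powr_mult)
  finally have "\<bar>c 0 - c N\<bar> powr q * W \<le> (real N powr q * \<bar>c j - c (Suc j)\<bar> powr q) * W"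
    using assms by (intro mult_right_mono) auto
  also have "\<dots> = real N powr q * (\<bar>c j - c (Suc j)\<bar> powr q * W)" by simp
  also have "\<dots> \<le> real N powr q * b" using assms(1)[OF j(1)] by (intro mult_left_mono) auto
  finally show ?thesis .
qed

lemma abs_add_powr_le:
  fixes s t q :: real
  assumes "0 < q"
  shows "\<bar>s + t\<bar> powr q \<le> 2 powr q * (\<bar>s\<bar> powr q + \<bar>t\<bar> powr q)"
proof -
  have "\<bar>s + t\<bar> powr q \<le> (2 * max \<bar>s\<bar> \<bar>t\<bar>) powr q" using assms by (intro powr_mono2) auto
  also have "\<dots> = 2 powr q * max \<bar>s\<bar> \<bar>t\<bar> powr q" by (simp add: powr_mult)
  also have "\<dots> \<le> 2 powr q * (\<bar>s\<bar> powr q + \<bar>t\<bar> powr q)" by (intro mult_left_mono) (auto simp: max_def)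
  finally show ?thesis .
qed

section \<open>Centred cubes, rectifiable curves and the distance to the boundary\<close>

text \<open>Half-open as the dyadic argument requires, but given by its centre, to which distances
  in the domain refer.\<close>

definition ccube :: "real ^ 'n \<Rightarrow> real \<Rightarrow> (real ^ 'n) set" where
  "ccube z l = hcube (z - vec (l / 2)) l"

lemma mem_ccube: "y \<in> ccube z l \<longleftrightarrow> (\<forall>i. z $ i - l / 2 \<le> y $ i \<and> y $ i < z $ i + l / 2)"
proof -
  have "z $ i - l / 2 + l = z $ i + l / 2" for i by (simp add: field_simps)
  then show ?thesis by (simp only: ccube_def hcube_def mem_Collect_eq vector_minus_component vec_component)
qed

lemma sets_ccube [simp]: "ccube z l \<in> sets lebesgue"
  by (simp add: ccube_def)

lemma mem_cube: "y \<in> cube z l \<longleftrightarrow> (\<forall>i. \<bar>y $ i - z $ i\<bar> \<le> l / 2)"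
proof -
  have "z $ i - l / 2 \<le> y $ i \<and> y $ i \<le> z $ i + l / 2 \<longleftrightarrow> \<bar>y $ i - z $ i\<bar> \<le> l / 2" for i by arith
  then show ?thesis by (simp add: cube_def mem_box_cart)
qed

lemma sets_cube [simp]: "cube z l \<in> sets lebesgue"
  by (simp add: cube_def)

lemma ccube_subset_cube: "ccube z l \<subseteq> cube z l"
proof
  fix y assume y: "y \<in> ccube z l"
  have "\<bar>y $ i - z $ i\<bar> \<le> l / 2" for i using y[unfolded mem_ccube, rule_format, of i] by arith
  then show "y \<in> cube z l" by (simp add: mem_cube)
qed

lemma cube_subset_ccube:
  assumes "0 < l"
  shows "cube z (l / 2) \<subseteq> ccube z l"
proof
  fix y assume y: "y \<in> cube z (l / 2)"
  have "z $ i - l / 2 \<le> y $ i \<and> y $ i < z $ i + l / 2" for i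
    using y[unfolded mem_cube, rule_format, of i] assms by arith
  then show "y \<in> ccube z l" by (simp add: mem_ccube)
qed

lemma ccube_subset_ccube:
  assumes "\<And>i. \<bar>y $ i - z $ i\<bar> + u / 2 \<le> l / 2"
  shows "ccube y u \<subseteq> ccube z l"
proof
  fix x assume x: "x \<in> ccube y u"
  show "x \<in> ccube z l" unfolding mem_ccube
  proof
    fix i show "z $ i - l / 2 \<le> x $ i \<and> x $ i < z $ i + l / 2"
      using x assms[of i] unfolding mem_ccube by (smt (verit))
  qed
qed

lemma ccube_dist:
  fixes z :: "real ^ 'n"
  assumes "y \<in> ccube z l"
  shows "dist y z \<le> real CARD('n) * l"
proof -
  have "\<bar>(y - z) $ i\<bar> \<le> l" for i using assms unfolding mem_ccube by (smt (verit) field_sum_of_halves vector_minus_component)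
  then have "norm (y - z) \<le> (\<Sum>i\<in>(UNIV::'n set). l)"
    by (intro order_trans[OF norm_le_l1_cart] sum_mono)
  then show ?thesis by (simp add: dist_norm)
qed

text \<open>Appending s and t to a partition of [0,s] gives a partition of [0,t]. So the length up
  to s, plus the chord, is at most the length up to t, and for a curve parametrised by arc length
  these lengths are s and t.\<close>

lemma curve_length_lipschitz:
  assumes "arc_length_curve l \<kappa>" "0 \<le> s" "s \<le> t" "t \<le> l"
  shows "dist (\<kappa> s) (\<kappa> t) \<le> t - s"
proof -
  have len: "curve_length \<kappa> 0 u = ennreal u" if "0 \<le> u" "u \<le> l" for u
    using assms(1) that by (auto simp: arc_length_curve_def)
  have le: "ennreal ((\<Sum>i<length ts - 1. dist (\<kappa> (ts ! i)) (\<kappa> (ts ! Suc i))) + dist (\<kappa> s) (\<kappa> t)) \<le> ennreal t"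
    if ts: "sorted ts" "set ts \<subseteq> {0..s}" for ts
  proof -
    define us where "us = ts @ [s, t]"
    have us: "sorted us" "set us \<subseteq> {0..t}" using ts assms by (auto simp: us_def sorted_append)
    have "(\<Sum>i<length ts - 1. dist (\<kappa> (ts ! i)) (\<kappa> (ts ! Suc i))) + dist (\<kappa> s) (\<kappa> t)
      \<le> (\<Sum>i<length us - 1. dist (\<kappa> (us ! i)) (\<kappa> (us ! Suc i)))"
    proof -
      have "(\<Sum>i<length ts - 1. dist (\<kappa> (ts ! i)) (\<kappa> (ts ! Suc i))) = (\<Sum>i<length ts - 1. dist (\<kappa> (us ! i)) (\<kappa> (us ! Suc i)))"
        by (intro sum.cong refl) (auto simp: us_def nth_append)
      also have "\<dots> \<le> (\<Sum>i<length ts. dist (\<kappa> (us ! i)) (\<kappa> (us ! Suc i)))"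
        by (intro sum_mono2) auto
      finally have 1: "(\<Sum>i<length ts - 1. dist (\<kappa> (ts ! i)) (\<kappa> (ts ! Suc i))) \<le> (\<Sum>i<length ts. dist (\<kappa> (us ! i)) (\<kappa> (us ! Suc i)))" .
      have 2: "length us - 1 = Suc (length ts)" by (simp add: us_def)
      have "us ! length ts = s" "us ! Suc (length ts) = t" by (simp_all add: us_def nth_append)
      then show ?thesis using 1 unfolding 2 by simp
    qed
    then have "ennreal ((\<Sum>i<length ts - 1. dist (\<kappa> (ts ! i)) (\<kappa> (ts ! Suc i))) + dist (\<kappa> s) (\<kappa> t))
      \<le> ennreal (\<Sum>i<length us - 1. dist (\<kappa> (us ! i)) (\<kappa> (us ! Suc i)))" by (rule ennreal_leI)
    also have "\<dots> \<le> curve_length \<kappa> 0 t" unfolding curve_length_def by (rule SUP_upper) (use us in auto)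
    also have "\<dots> = ennreal t" using assms by (intro len) auto
    finally show ?thesis .
  qed
  have "curve_length \<kappa> 0 s \<le> ennreal (t - dist (\<kappa> s) (\<kappa> t))"
    unfolding curve_length_def
  proof (rule SUP_least)
    fix ts assume "ts \<in> {ts. sorted ts \<and> set ts \<subseteq> {0..s}}"
    then have "(\<Sum>i<length ts - 1. dist (\<kappa> (ts ! i)) (\<kappa> (ts ! Suc i))) + dist (\<kappa> s) (\<kappa> t) \<le> t"
      using le[of ts] ennreal_le_iff[of t] assms by auto
    then show "ennreal (\<Sum>i<length ts - 1. dist (\<kappa> (ts ! i)) (\<kappa> (ts ! Suc i))) \<le> ennreal (t - dist (\<kappa> s) (\<kappa> t))"
      by (intro ennreal_leI) simp
  qed
  then have "ennreal s \<le> ennreal (t - dist (\<kappa> s) (\<kappa> t))" using len[of s] assms by simp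
  moreover have "0 \<le> t - dist (\<kappa> s) (\<kappa> t)"
    using le[of "[]"] ennreal_le_iff[of t] assms by auto
  ultimately show ?thesis by (subst (asm) ennreal_le_iff) auto
qed

lemma bdist_lipschitz: "\<bar>bdist \<Omega> x - bdist \<Omega> y\<bar> \<le> dist x y"
  unfolding bdist_def by (rule infdist_triangle_abs)

text \<open>\<open>infdist\<close> from the empty set is 0 by convention, so \<open>bdist\<close>
  would be useless if the frontier were empty. A bounded nonempty open set differs from the whole
  space, and connectedness of the space yields a frontier point.\<close>

lemma frontier_nonempty:
  fixes \<Omega> :: "(real ^ 'n) set"
  assumes "open \<Omega>" "bounded \<Omega>" "x \<in> \<Omega>"
  shows "frontier \<Omega> \<noteq> {}"
proof -
  have "\<Omega> \<noteq> UNIV" using assms(2) not_bounded_UNIV by auto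
  then show ?thesis using assms frontier_eq_empty[of \<Omega>] by auto
qed

lemma bdist_pos:
  fixes \<Omega> :: "(real ^ 'n) set"
  assumes "open \<Omega>" "bounded \<Omega>" "x \<in> \<Omega>"
  shows "0 < bdist \<Omega> x"
proof -
  have "x \<notin> frontier \<Omega>" using assms by (simp add: frontier_def interior_open)
  then show ?thesis
    unfolding bdist_def using infdist_pos_not_in_closed[OF frontier_closed frontier_nonempty[OF assms]] by auto
qed

lemma ball_bdist_subset:
  fixes \<Omega> :: "(real ^ 'n) set"
  assumes "open \<Omega>" "bounded \<Omega>" "x \<in> \<Omega>"
  shows "ball x (bdist \<Omega> x) \<subseteq> \<Omega>"
proof (rule ccontr)
  assume "\<not> ?thesis"
  then have "ball x (bdist \<Omega> x) - \<Omega> \<noteq> {}" by auto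
  moreover have "ball x (bdist \<Omega> x) \<inter> \<Omega> \<noteq> {}" using assms bdist_pos[OF assms] by (auto simp: disjoint_iff intro!: exI[of _ x])
  ultimately have "ball x (bdist \<Omega> x) \<inter> frontier \<Omega> \<noteq> {}"
    by (intro connected_Int_frontier connected_ball)
  then obtain y where "y \<in> frontier \<Omega>" "y \<in> ball x (bdist \<Omega> x)" by blast
  then show False using infdist_le[of y "frontier \<Omega>" x] by (auto simp: bdist_def)
qed

subsection \<open>A tree of cells in a John domain\<close>

text \<open>The curves are only recorded as 1-Lipschitz. The bound on \<theta> makes n \<theta>
  \<le> 1/16: points of a cube of side at most \<theta> d(z) centred at z have distance at most
  d(z)/16 from z, so on such a cube the distance to the boundary varies by at most a factor 2 from
  d(z).\<close>

locale john_domain =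
  fixes \<Omega> :: "(real ^ 'n) set" and x0 :: "real ^ 'n" and K \<theta> :: real
  assumes open_dom: "open \<Omega>" and bounded_dom: "bounded \<Omega>" and x0: "x0 \<in> \<Omega>" and K: "1 \<le> K"
    and \<theta>: "0 < \<theta>" "\<theta> \<le> 1 / (16 * real CARD('n))"
    and curves: "\<And>x. x \<in> \<Omega> \<Longrightarrow> \<exists>l \<kappa>. 0 \<le> l \<and> \<kappa> ` {0..l} \<subseteq> \<Omega> \<and> \<kappa> 0 = x \<and> \<kappa> l = x0 \<and>
      (\<forall>s t. 0 \<le> s \<and> s \<le> t \<and> t \<le> l \<longrightarrow> dist (\<kappa> s) (\<kappa> t) \<le> t - s) \<and> (\<forall>t\<in>{0..l}. t / K \<le> bdist \<Omega> (\<kappa> t))"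
begin

abbreviation d :: "real ^ 'n \<Rightarrow> real" where "d \<equiv> bdist \<Omega>"

lemma d_pos: "x \<in> \<Omega> \<Longrightarrow> 0 < d x"
  by (rule bdist_pos[OF open_dom bounded_dom])

lemma d_lip: "d x \<le> d y + dist x y" "d y \<le> d x + dist x y"
  using bdist_lipschitz[of \<Omega> x y] by linarith+

lemma in_domI: "x \<in> \<Omega> \<Longrightarrow> dist x y < d x \<Longrightarrow> y \<in> \<Omega>"
  using ball_bdist_subset[OF open_dom bounded_dom, of x] by auto

lemma theta_1: "\<theta> \<le> 1 / 16"
proof -
  have "1 \<le> real CARD('n)" by (simp add: Suc_leI)
  then have "1 / (16 * real CARD('n)) \<le> 1 / 16" by (intro divide_left_mono) auto
  then show ?thesis using \<theta> by linarith
qed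

lemma theta_n: "real CARD('n) * \<theta> \<le> 1 / 16"
proof -
  have "real CARD('n) * \<theta> \<le> real CARD('n) * (1 / (16 * real CARD('n)))" using \<theta> by (intro mult_left_mono) auto
  then show ?thesis by simp
qed

lemma ccube_bounds:
  assumes z: "z \<in> \<Omega>" and l: "l \<le> \<theta> * d z" and y: "y \<in> ccube z l"
  shows "dist y z \<le> d z / 16" "y \<in> \<Omega>" "d z / 2 \<le> d y" "d y \<le> 2 * d z"
proof -
  have "dist y z \<le> real CARD('n) * l" by (rule ccube_dist[OF y])
  also have "\<dots> \<le> real CARD('n) * (\<theta> * d z)" using l by (intro mult_left_mono) auto
  also have "\<dots> = (real CARD('n) * \<theta>) * d z" by simp
  also have "\<dots> \<le> 1 / 16 * d z" using theta_n d_pos[OF z] by (intro mult_right_mono) auto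
  finally show 1: "dist y z \<le> d z / 16" by simp
  show "y \<in> \<Omega>" by (rule in_domI[OF z]) (use 1 d_pos[OF z] in \<open>simp add: dist_commute\<close>)
  show "d z / 2 \<le> d y" "d y \<le> 2 * d z" using d_lip(1)[of z y] d_lip(1)[of y z] 1 d_pos[OF z] dist_commute[of y z] by linarith+
qed

text \<open>A Whitney-type covering by labels. Points are classified by the dyadic size of d and by
  a grid whose mesh is a small multiple of that size. Each nonempty class chooses a representative,
  and a cube of side \<theta> d centred there contains the whole class. The 1/8 in the mesh keeps
  the class well inside that cube.\<close>

definition lev :: "real ^ 'n \<Rightarrow> int" where "lev x = \<lfloor>log 2 (d x)\<rfloor>"

definition mesh :: "int \<Rightarrow> real" where "mesh k = \<theta> / 8 * 2 powr real_of_int k"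

definition idx :: "real ^ 'n \<Rightarrow> int \<times> ('n \<Rightarrow> int)" where
  "idx x = (lev x, \<lambda>i. \<lfloor>x $ i / mesh (lev x)\<rfloor>)"

definition rep :: "int \<times> ('n \<Rightarrow> int) \<Rightarrow> real ^ 'n" where
  "rep i = (SOME x. x \<in> \<Omega> \<and> idx x = i)"

definition I :: "(int \<times> ('n \<Rightarrow> int)) set" where "I = idx ` \<Omega>"

abbreviation dr :: "int \<times> ('n \<Rightarrow> int) \<Rightarrow> real" where "dr i \<equiv> d (rep i)"

lemma mesh_pos: "0 < mesh k" using \<theta> by (simp add: mesh_def)

lemma lev_bounds: "x \<in> \<Omega> \<Longrightarrow> 2 powr real_of_int (lev x) \<le> d x" "x \<in> \<Omega> \<Longrightarrow> d x < 2 * 2 powr real_of_int (lev x)"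
proof -
  assume x: "x \<in> \<Omega>"
  show "2 powr real_of_int (lev x) \<le> d x" using d_pos[OF x] by (simp add: lev_def flip: le_log_iff)
  have "d x < 2 powr (real_of_int (lev x) + 1)" using d_pos[OF x] by (simp add: lev_def flip: log_less_iff)
  then show "d x < 2 * 2 powr real_of_int (lev x)" by (simp add: powr_add)
qed

lemma same_idx:
  assumes "x \<in> \<Omega>" "y \<in> \<Omega>" "idx x = idx y"
  shows "d x < 2 * d y" "\<bar>x $ i - y $ i\<bar> \<le> \<theta> / 8 * d x" "\<bar>x $ i - y $ i\<bar> \<le> \<theta> / 8 * d y" "dist x y \<le> d x / 128"
proof -
  have lev: "lev x = lev y" using assms by (simp add: idx_def)
  show "d x < 2 * d y" using lev_bounds[OF assms(1)] lev_bounds[OF assms(2)] lev by simp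
  have m: "mesh (lev x) \<le> \<theta> / 8 * d x" "mesh (lev x) \<le> \<theta> / 8 * d y"
    unfolding mesh_def using lev_bounds[OF assms(1)] lev_bounds[OF assms(2)] lev \<theta> by (auto intro!: mult_left_mono)
  have diff: "\<bar>x $ i - y $ i\<bar> \<le> mesh (lev x)" for i
  proof -
    have "\<lfloor>x $ i / mesh (lev x)\<rfloor> = \<lfloor>y $ i / mesh (lev x)\<rfloor>"
      using assms lev by (auto simp: idx_def fun_eq_iff)
    then have "\<bar>x $ i / mesh (lev x) - y $ i / mesh (lev x)\<bar> < 1" by linarith
    then have "\<bar>x $ i - y $ i\<bar> / mesh (lev x) < 1" using mesh_pos[of "lev x"] by (simp flip: diff_divide_distrib)
    then show ?thesis using mesh_pos[of "lev x"] by simp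
  qed
  show "\<bar>x $ i - y $ i\<bar> \<le> \<theta> / 8 * d x" "\<bar>x $ i - y $ i\<bar> \<le> \<theta> / 8 * d y"
    using diff[of i] m by linarith+
  have "norm (x - y) \<le> (\<Sum>i\<in>(UNIV::'n set). mesh (lev x))"
    using diff by (intro order_trans[OF norm_le_l1_cart] sum_mono) auto
  also have "\<dots> \<le> real CARD('n) * (\<theta> / 8 * d x)" using m by (simp add: mult_left_mono)
  also have "\<dots> = (real CARD('n) * \<theta>) * (d x / 8)" by simp
  also have "\<dots> \<le> 1 / 16 * (d x / 8)" using theta_n d_pos[OF assms(1)] by (intro mult_right_mono) auto
  finally show "dist x y \<le> d x / 128" by (simp add: dist_norm)
qed

lemma rep: "i \<in> I \<Longrightarrow> rep i \<in> \<Omega>" "i \<in> I \<Longrightarrow> idx (rep i) = i"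
proof -
  assume "i \<in> I"
  then have "\<exists>x. x \<in> \<Omega> \<and> idx x = i" by (auto simp: I_def)
  from someI_ex[OF this] show "rep i \<in> \<Omega>" "idx (rep i) = i" by (auto simp: rep_def)
qed

lemma dr_pos: "i \<in> I \<Longrightarrow> 0 < dr i" by (intro d_pos rep)

definition cell :: "int \<times> ('n \<Rightarrow> int) \<Rightarrow> (real ^ 'n) set" where "cell i = ccube (rep i) (\<theta> * dr i)"

lemma mem_cell: "x \<in> \<Omega> \<Longrightarrow> x \<in> cell (idx x)"
proof -
  assume x: "x \<in> \<Omega>"
  have i: "idx x \<in> I" using x by (simp add: I_def)
  have "rep (idx x) $ j - \<theta> * dr (idx x) / 2 \<le> x $ j \<and> x $ j < rep (idx x) $ j + \<theta> * dr (idx x) / 2" for j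
    using same_idx(3)[OF x rep(1)[OF i] rep(2)[OF i, symmetric], of j] mult_pos_pos[OF \<theta>(1) dr_pos[OF i]] by linarith
  then show ?thesis by (simp add: cell_def mem_ccube)
qed

text \<open>A region containing the cell, the cubes along the path to the parent, and the cell of
  the parent; 20 K and 8 K leave room for all three. Its size and its distance to the boundary
  remain comparable to \<open>dr i\<close>, so these regions overlap boundedly.\<close>

definition V :: "int \<times> ('n \<Rightarrow> int) \<Rightarrow> (real ^ 'n) set" where
  "V i = {y \<in> \<Omega>. dist y (rep i) \<le> 20 * K * dr i \<and> dr i / (8 * K) \<le> d y}"

lemma sets_V [simp]: "V i \<in> sets lebesgue"
proof -
  have "continuous_on UNIV d" unfolding bdist_def by (intro continuous_intros)
  then have "closed {y. dr i / (8 * K) \<le> d y}" by (intro closed_Collect_le continuous_on_const)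
  moreover have "closed {y. dist y (rep i) \<le> 20 * K * dr i}" by (intro closed_Collect_le continuous_intros)
  moreover have "V i = \<Omega> \<inter> ({y. dist y (rep i) \<le> 20 * K * dr i} \<inter> {y. dr i / (8 * K) \<le> d y})" by (auto simp: V_def)
  ultimately have "V i \<in> sets borel" using open_dom by (simp add: borel_open borel_closed)
  then show ?thesis by simp
qed

lemma cell_subset_V: "i \<in> I \<Longrightarrow> cell i \<subseteq> V i"
proof
  fix y assume i: "i \<in> I" and y: "y \<in> cell i"
  note c = ccube_bounds[OF rep(1)[OF i] order_refl y[unfolded cell_def]]
  have p: "0 < dr i" by (rule dr_pos[OF i])
  have "dr i / 16 \<le> 20 * K * dr i" using p K mult_right_mono[of 1 K "dr i"] by linarith
  moreover have "dr i / (8 * K) \<le> dr i / 2" using p K by (intro divide_left_mono) auto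
  ultimately show "y \<in> V i" using c by (auto simp: V_def)
qed

text \<open>The first factor counts the possible dyadic sizes, the second, once for each coordinate,
  the possible grid positions of representatives whose region contains a given point.\<close>

definition N :: nat where
  "N = nat \<lceil>log 2 ((1 + 20 * K) * (8 * K)) + 3\<rceil> * nat \<lceil>2 * (320 * K / \<theta>) + 3\<rceil> ^ CARD('n)"

lemma card_int_interval_le: "real (card {\<lfloor>a\<rfloor>..\<lfloor>b\<rfloor>}) \<le> max 0 (b - a + 2)" for a b :: real
  by (simp, linarith)

text \<open>If y lies in \<open>V i\<close>, then \<open>dr i\<close> is comparable to d y and the
  representative lies within a multiple of d y. So the label of i has a bounded number of levels
  and, at each level, a bounded number of grid positions, uniformly in y.\<close>

lemma overlap:
  assumes J: "finite J" "J \<subseteq> I"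
  shows "card {i \<in> J. y \<in> V i} \<le> N"
proof (cases "y \<in> \<Omega>")
  case False
  then have "{i \<in> J. y \<in> V i} = {}" by (auto simp: V_def)
  then show ?thesis by (simp only: card.empty le0)
next
  case y: True
  have dy: "0 < d y" by (rule d_pos[OF y])
  define k0 k1 where "k0 = log 2 (d y / (1 + 20 * K)) - 1" and "k1 = log 2 (d y * (8 * K))"
  \<comment> \<open>The distance 20 K dr i, where dr i < 2 2^k, measured in meshes of size (\<theta>
    / 8) 2^k.\<close>
  define R where "R = 320 * K / \<theta>"
  define M where "M k = (PiE UNIV (\<lambda>j :: 'n. {\<lfloor>y $ j / mesh k - R\<rfloor>..\<lfloor>y $ j / mesh k + R\<rfloor>}))" for k
  have sub: "{i \<in> J. y \<in> V i} \<subseteq> (SIGMA k:{\<lfloor>k0\<rfloor>..\<lfloor>k1\<rfloor>}. M k)"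
  proof
    fix i assume "i \<in> {i \<in> J. y \<in> V i}"
    then have i: "i \<in> I" and yi: "y \<in> V i" using J by auto
    define x where "x = rep i"
    have x: "x \<in> \<Omega>" "idx x = i" using rep[OF i] by (auto simp: x_def)
    have dx: "0 < d x" by (rule d_pos[OF x(1)])
    have V: "dist y x \<le> 20 * K * d x" "d x / (8 * K) \<le> d y" using yi by (auto simp: V_def x_def)
    have "d y \<le> d x + 20 * K * d x" using d_lip(1)[of y x] V by simp
    then have dyx: "d y \<le> (1 + 20 * K) * d x" by (simp add: algebra_simps)
    define k where "k = lev x"
    have kb: "2 powr real_of_int k \<le> d x" "d x < 2 * 2 powr real_of_int k" using lev_bounds[OF x(1)] by (auto simp: k_def)
    have "d y / (1 + 20 * K) \<le> d x" using dyx K by (simp add: pos_divide_le_eq mult.commute)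
    also have "\<dots> \<le> 2 powr (real_of_int k + 1)" using kb by (simp add: powr_add)
    finally have "log 2 (d y / (1 + 20 * K)) \<le> real_of_int k + 1"
      using dy K by (subst log_le_iff) auto
    then have "\<lfloor>k0\<rfloor> \<le> k" unfolding k0_def by linarith
    moreover have "k \<le> \<lfloor>k1\<rfloor>"
    proof -
      have "2 powr real_of_int k \<le> d y * (8 * K)" using kb V(2) K by (simp add: pos_divide_le_eq)
      then have "real_of_int k \<le> k1" unfolding k1_def using dy K by (subst le_log_iff) auto
      then show ?thesis by linarith
    qed
    moreover have "(\<lambda>j. \<lfloor>x $ j / mesh k\<rfloor>) \<in> M k"
    proof -
      have "\<lfloor>y $ j / mesh k - R\<rfloor> \<le> \<lfloor>x $ j / mesh k\<rfloor> \<and> \<lfloor>x $ j / mesh k\<rfloor> \<le> \<lfloor>y $ j / mesh k + R\<rfloor>" for j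
      proof -
        have "\<bar>x $ j - y $ j\<bar> \<le> dist y x" using component_le_norm_cart[of "y - x" j] by (simp add: dist_norm abs_minus_commute)
        also have "\<dots> \<le> 20 * K * d x" by (rule V(1))
        also have "\<dots> \<le> 20 * K * (2 * 2 powr real_of_int k)" using kb K by (intro mult_left_mono) auto
        also have "\<dots> = R * mesh k" using \<theta> by (simp add: R_def mesh_def)
        finally have "\<bar>x $ j - y $ j\<bar> / mesh k \<le> R" using mesh_pos[of k] by (simp add: pos_divide_le_eq)
        then have "\<bar>x $ j / mesh k - y $ j / mesh k\<bar> \<le> R" using mesh_pos[of k] by (simp flip: diff_divide_distrib)
        then have "y $ j / mesh k - R \<le> x $ j / mesh k" "x $ j / mesh k \<le> y $ j / mesh k + R" by linarith+
        then show ?thesis by (intro conjI floor_mono)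
      qed
      then show ?thesis by (auto simp: M_def)
    qed
    moreover have "i = (k, \<lambda>j. \<lfloor>x $ j / mesh k\<rfloor>)" using x(2) by (simp add: idx_def k_def)
    ultimately show "i \<in> (SIGMA k:{\<lfloor>k0\<rfloor>..\<lfloor>k1\<rfloor>}. M k)" by auto
  qed
  have R0: "0 \<le> R" using K \<theta> by (simp add: R_def)
  have finM: "finite (M k)" for k unfolding M_def by (intro finite_PiE) auto
  have cardM: "card (M k) \<le> nat \<lceil>2 * R + 3\<rceil> ^ CARD('n)" for k
  proof -
    have "card (M k) = (\<Prod>j\<in>(UNIV :: 'n set). card {\<lfloor>y $ j / mesh k - R\<rfloor>..\<lfloor>y $ j / mesh k + R\<rfloor>})"
      unfolding M_def by (rule card_PiE) simp
    also have "\<dots> \<le> (\<Prod>j\<in>(UNIV :: 'n set). nat \<lceil>2 * R + 3\<rceil>)"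
    proof (rule prod_mono)
      fix j
      have "real (card {\<lfloor>y $ j / mesh k - R\<rfloor>..\<lfloor>y $ j / mesh k + R\<rfloor>}) \<le> 2 * R + 3"
        using card_int_interval_le[of "y $ j / mesh k - R" "y $ j / mesh k + R"] R0 by linarith
      then have "card {\<lfloor>y $ j / mesh k - R\<rfloor>..\<lfloor>y $ j / mesh k + R\<rfloor>} \<le> nat \<lceil>2 * R + 3\<rceil>" by linarith
      then show "0 \<le> card {\<lfloor>y $ j / mesh k - R\<rfloor>..\<lfloor>y $ j / mesh k + R\<rfloor>} \<and> card {\<lfloor>y $ j / mesh k - R\<rfloor>..\<lfloor>y $ j / mesh k + R\<rfloor>} \<le> nat \<lceil>2 * R + 3\<rceil>"
        by simp
    qed
    finally show ?thesis by simp
  qed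
  have cardK: "card {\<lfloor>k0\<rfloor>..\<lfloor>k1\<rfloor>} \<le> nat \<lceil>log 2 ((1 + 20 * K) * (8 * K)) + 3\<rceil>"
  proof -
    have "k1 - k0 = log 2 ((1 + 20 * K) * (8 * K)) + 1"
      using dy K by (simp add: k0_def k1_def log_mult log_divide)
    moreover have "0 \<le> log 2 ((1 + 20 * K) * (8 * K))"
    proof -
      have "1 * 1 \<le> (1 + 20 * K) * (8 * K)" using K by (intro mult_mono) auto
      then show ?thesis using K by (subst zero_le_log_cancel_iff) auto
    qed
    ultimately show ?thesis using card_int_interval_le[of k0 k1] by linarith
  qed
  have "card {i \<in> J. y \<in> V i} \<le> card (SIGMA k:{\<lfloor>k0\<rfloor>..\<lfloor>k1\<rfloor>}. M k)"
    using sub finM by (intro card_mono) auto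
  also have "\<dots> = (\<Sum>k\<in>{\<lfloor>k0\<rfloor>..\<lfloor>k1\<rfloor>}. card (M k))" using finM by (intro card_SigmaI) auto
  also have "\<dots> \<le> (\<Sum>k\<in>{\<lfloor>k0\<rfloor>..\<lfloor>k1\<rfloor>}. nat \<lceil>2 * R + 3\<rceil> ^ CARD('n))" by (intro sum_mono cardM)
  also have "\<dots> = card {\<lfloor>k0\<rfloor>..\<lfloor>k1\<rfloor>} * nat \<lceil>2 * R + 3\<rceil> ^ CARD('n)" by simp
  also have "\<dots> \<le> N" unfolding N_def R_def[symmetric] by (intro mult_right_mono cardK) auto
  finally show ?thesis .
qed

definition rt :: "int \<times> ('n \<Rightarrow> int)" where "rt = idx x0"

lemma rt_I: "rt \<in> I" using x0 by (simp add: rt_def I_def)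

text \<open>The parent of a cell is the cell met by its John curve at the time \<open>4 K dr i\<close>, when the distance
  to the boundary has at least doubled.\<close>

definition steps :: nat where "steps = nat \<lceil>32 * K ^ 2 / \<theta>\<rceil>"

lemma steps: "0 < steps" "32 * K ^ 2 / \<theta> \<le> real steps"
proof -
  have "0 < 32 * K ^ 2 / \<theta>" using K \<theta> by simp
  then show "0 < steps" "32 * K ^ 2 / \<theta> \<le> real steps" unfolding steps_def by linarith+
qed

text \<open>The John curve is sampled at equal times up to 4 K dr i, or up to its end if that comes
  earlier. In the second case the last sample is x0 and the parent is the root; in the first the
  John condition makes d at least 4 dr i there.\<close>

lemma parent_exists:
  assumes i: "i \<in> I"
  shows "\<exists>z :: nat \<Rightarrow> real ^ 'n. z 0 = rep i \<and> (\<forall>j\<le>steps. z j \<in> \<Omega> \<and> dist (z j) (rep i) \<le> 4 * K * dr i \<and> dr i / (2 * K) \<le> d (z j)) \<and>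
    (\<forall>j<steps. dist (z j) (z (Suc j)) \<le> \<theta> * dr i / (8 * K)) \<and>
    (idx (z steps) = rt \<or> 2 * dr i \<le> dr (idx (z steps)))"
proof -
  define x where "x = rep i"
  have x: "x \<in> \<Omega>" using rep[OF i] by (simp add: x_def)
  have dx: "0 < d x" by (rule d_pos[OF x])
  obtain l \<kappa> where l: "0 \<le> l" and im: "\<kappa> ` {0..l} \<subseteq> \<Omega>" and ends: "\<kappa> 0 = x" "\<kappa> l = x0"
    and lip: "\<And>s t. 0 \<le> s \<Longrightarrow> s \<le> t \<Longrightarrow> t \<le> l \<Longrightarrow> dist (\<kappa> s) (\<kappa> t) \<le> t - s"
    and john: "\<And>t. t \<in> {0..l} \<Longrightarrow> t / K \<le> d (\<kappa> t)"
    using curves[OF x] by blast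
  define T where "T = min (4 * K * d x) l"
  have T: "0 \<le> T" "T \<le> l" "T \<le> 4 * K * d x" using l K dx by (auto simp: T_def)
  define tm where "tm j = T * (real j / real steps)" for j
  have tm: "0 \<le> tm j" "tm j \<le> T" if "j \<le> steps" for j
  proof -
    show "0 \<le> tm j" using T by (simp add: tm_def)
    have "real j / real steps \<le> 1" using that steps by simp
    then show "tm j \<le> T" using T mult_left_mono[of "real j / real steps" 1 T] by (simp add: tm_def)
  qed
  define z where "z j = \<kappa> (tm j)" for j
  have z0: "z 0 = x" using ends by (simp add: z_def tm_def)
  have zj: "z j \<in> \<Omega> \<and> dist (z j) x \<le> 4 * K * d x \<and> d x / (2 * K) \<le> d (z j)" if j: "j \<le> steps" for j
  proof (intro conjI)
    have tl: "tm j \<in> {0..l}" using tm[OF j] T by auto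
    show "z j \<in> \<Omega>" using im tl by (auto simp: z_def)
    have dist: "dist x (z j) \<le> tm j" using lip[of 0 "tm j"] tl ends by (simp add: z_def)
    then show "dist (z j) x \<le> 4 * K * d x" using tm[OF j] T by (simp add: dist_commute)
    \<comment> \<open>Before the time d x / 2 the curve has not moved far enough to lose more than
      half of the distance; afterwards the John condition gives the bound.\<close>
    show "d x / (2 * K) \<le> d (z j)"
    proof (cases "tm j \<le> d x / 2")
      case True
      have "d x \<le> d (z j) + tm j" using d_lip(1)[of x "z j"] dist by simp
      moreover have "d x / (2 * K) \<le> d x / 2" using dx K by (intro divide_left_mono) auto
      ultimately show ?thesis using True by linarith
    next
      case False
      then have "d x / 2 / K \<le> tm j / K" using K by (intro divide_right_mono) auto
      also have "\<dots> \<le> d (z j)" using john[OF tl] by (simp add: z_def)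
      finally show ?thesis by (simp add: mult.commute)
    qed
  qed
  have zstep: "dist (z j) (z (Suc j)) \<le> \<theta> * d x / (8 * K)" if j: "j < steps" for j
  proof -
    have "tm (Suc j) - tm j = T / real steps" by (simp add: tm_def add_divide_distrib distrib_left)
    moreover from this have "tm j \<le> tm (Suc j)" using T divide_nonneg_nonneg[of T "real steps"] by linarith
    ultimately have "dist (z j) (z (Suc j)) \<le> T / real steps"
      unfolding z_def using lip[of "tm j" "tm (Suc j)"] tm(1)[of j] tm(2)[of "Suc j"] j T by simp
    \<comment> \<open>This fixes the value of \<open>steps\<close>: consecutive samples must be so
      close that cubes of side \<theta> dr i / (2 K) around them overlap substantially.\<close>
    also have "\<dots> \<le> (4 * K * d x) / (32 * K ^ 2 / \<theta>)"
      using T steps K \<theta> dx by (intro frac_le) auto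
    also have "\<dots> = \<theta> * d x / (8 * K)" using K by (simp add: power2_eq_square)
    finally show ?thesis .
  qed
  have last: "z steps = \<kappa> T" using steps by (simp add: z_def tm_def)
  have "idx (z steps) = rt \<or> 2 * d x \<le> dr (idx (z steps))"
  proof (cases "l \<le> 4 * K * d x")
    case True
    then have "z steps = x0" using last ends by (simp add: T_def)
    then show ?thesis by (simp add: rt_def)
  next
    case False
    \<comment> \<open>The factor 4 in the time is chosen since d at the last sample and at the
      representative of its cell may differ by a factor 2; a doubling remains.\<close>
    then have TT: "T = 4 * K * d x" by (simp add: T_def)
    have "T / K \<le> d (\<kappa> T)" using john[of T] T by auto
    then have "4 * d x \<le> d (z steps)" using TT K last by simp
    moreover have zs: "z steps \<in> \<Omega>" using zj[of steps] by simp
    then have "idx (z steps) \<in> I" by (simp add: I_def)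
    then have "d (z steps) < 2 * dr (idx (z steps))"
      using same_idx(1)[OF zs rep(1)] rep(2) by simp
    ultimately show ?thesis by simp
  qed
  then show ?thesis using z0 zj zstep unfolding x_def by blast
qed

definition path :: "int \<times> ('n \<Rightarrow> int) \<Rightarrow> nat \<Rightarrow> real ^ 'n" where
  "path i = (SOME z :: nat \<Rightarrow> real ^ 'n. z 0 = rep i \<and> (\<forall>j\<le>steps. z j \<in> \<Omega> \<and> dist (z j) (rep i) \<le> 4 * K * dr i \<and> dr i / (2 * K) \<le> d (z j)) \<and>
    (\<forall>j<steps. dist (z j) (z (Suc j)) \<le> \<theta> * dr i / (8 * K)) \<and>
    (idx (z steps) = rt \<or> 2 * dr i \<le> dr (idx (z steps))))"

lemma path:
  assumes "i \<in> I"
  shows "path i 0 = rep i" "j \<le> steps \<Longrightarrow> path i j \<in> \<Omega>" "j \<le> steps \<Longrightarrow> dist (path i j) (rep i) \<le> 4 * K * dr i"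
    "j \<le> steps \<Longrightarrow> dr i / (2 * K) \<le> d (path i j)" "j < steps \<Longrightarrow> dist (path i j) (path i (Suc j)) \<le> \<theta> * dr i / (8 * K)"
    "idx (path i steps) = rt \<or> 2 * dr i \<le> dr (idx (path i steps))"
  using someI_ex[OF parent_exists[OF assms]] unfolding path_def[symmetric] by blast+

definition par :: "int \<times> ('n \<Rightarrow> int) \<Rightarrow> int \<times> ('n \<Rightarrow> int)" where
  "par i = (if i = rt then rt else idx (path i steps))"

lemma par_rt [simp]: "par rt = rt" by (simp add: par_def)

lemma par_I: "i \<in> I \<Longrightarrow> par i \<in> I"
  using rt_I path(2)[of i steps] by (auto simp: par_def I_def)

lemma par_doubles: "i \<in> I \<Longrightarrow> i \<noteq> rt \<Longrightarrow> par i = rt \<or> 2 * dr i \<le> dr (par i)"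
  using path(6)[of i] by (simp add: par_def)

lemma par_near:
  assumes i: "i \<in> I" "i \<noteq> rt"
  shows "dist (rep i) (rep (par i)) \<le> 9 * K * dr i" "dr (par i) \<le> (2 + 8 * K) * dr i" "dr i / (4 * K) \<le> dr (par i)"
    "dist (path i steps) (rep (par i)) \<le> d (path i steps) / 128"
    "\<bar>path i steps $ j - rep (par i) $ j\<bar> \<le> \<theta> / 8 * dr (par i)"
proof -
  define z z' where "z = path i steps" and "z' = rep (par i)"
  have z: "z \<in> \<Omega>" "dist z (rep i) \<le> 4 * K * dr i" "dr i / (2 * K) \<le> d z"
    using path(2-4)[OF i(1), of steps] by (auto simp: z_def)
  have z': "z' \<in> \<Omega>" "idx z' = idx z" using rep[OF par_I[OF i(1)]] i by (auto simp: z'_def z_def par_def)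
  have p: "0 < dr i" by (rule dr_pos[OF i(1)])
  have K1: "dr i \<le> K * dr i" using K p by simp
  have dz: "d z \<le> (1 + 4 * K) * dr i" using d_lip(1)[of z "rep i"] z by (simp add: algebra_simps)
  show 4: "dist (path i steps) (rep (par i)) \<le> d (path i steps) / 128"
    using same_idx(4)[OF z(1) z'(1)] z'(2) by (simp add: z_def z'_def)
  show "\<bar>path i steps $ j - rep (par i) $ j\<bar> \<le> \<theta> / 8 * dr (par i)"
    using same_idx(3)[OF z(1) z'(1), of j] z'(2) by (simp add: z_def z'_def)
  have "dist (rep i) z' \<le> dist z (rep i) + dist z z'" by (metis dist_commute dist_triangle2)
  also have "\<dots> \<le> 4 * K * dr i + d z / 128" using z 4 by (simp add: z_def z'_def)
  also have "\<dots> \<le> 9 * K * dr i" using dz K1 d_pos[OF z(1)] by (simp add: algebra_simps)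
  finally show "dist (rep i) (rep (par i)) \<le> 9 * K * dr i" by (simp add: z'_def)
  have "d z' < 2 * d z" "d z < 2 * d z'" using same_idx(1)[OF z'(1) z(1)] same_idx(1)[OF z(1) z'(1)] z'(2) by auto
  then show "dr (par i) \<le> (2 + 8 * K) * dr i" "dr i / (4 * K) \<le> dr (par i)"
    using dz z(3) K by (auto simp: z'_def algebra_simps)
qed

text \<open>Off the root \<open>dr\<close> at least doubles at each step, so the displacement 9 K dr
  i of a step is at most 9 K (dr (par i) - dr i), and these bounds telescope. The ancestor j must
  not be the root, because the step into the root need not double.\<close>

lemma shadow_near:
  assumes "i \<in> I" "(par ^^ m) i = j" "j \<noteq> rt"
  shows "dr i \<le> dr j \<and> dist (rep i) (rep j) \<le> 9 * K * (dr j - dr i)"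
  using assms
proof (induction m arbitrary: i)
  case (Suc m)
  have i: "i \<noteq> rt"
  proof
    assume "i = rt"
    have "(par ^^ k) rt = rt" for k by (induction k) auto
    then show False using Suc.prems \<open>i = rt\<close> by metis
  qed
  have pi: "(par ^^ m) (par i) = j" using Suc.prems(2) by (simp add: funpow_swap1)
  have nrt: "par i \<noteq> rt"
  proof
    assume "par i = rt"
    have "(par ^^ k) rt = rt" for k by (induction k) auto
    then show False using pi Suc.prems \<open>par i = rt\<close> by metis
  qed
  have IH: "dr (par i) \<le> dr j" "dist (rep (par i)) (rep j) \<le> 9 * K * (dr j - dr (par i))"
    using Suc.IH[OF par_I[OF Suc.prems(1)] pi Suc.prems(3)] by auto
  have dbl: "2 * dr i \<le> dr (par i)" using par_doubles[OF Suc.prems(1) i] nrt by simp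
  have p: "0 < dr i" by (rule dr_pos[OF Suc.prems(1)])
  have "dist (rep i) (rep j) \<le> dist (rep i) (rep (par i)) + dist (rep (par i)) (rep j)" by (rule dist_triangle)
  also have "\<dots> \<le> 9 * K * dr i + 9 * K * (dr j - dr (par i))"
    using par_near(1)[OF Suc.prems(1) i] IH by simp
  also have "\<dots> = 9 * K * (dr i + dr j - dr (par i))" by (simp add: algebra_simps)
  also have "\<dots> \<le> 9 * K * (dr j - dr i)" using dbl K by (intro mult_left_mono) auto
  finally show ?case using dbl IH p by auto
qed auto

text \<open>The domain is bounded, so \<open>dr\<close> is bounded above and cannot double forever:
  the number of steps is controlled by the binary logarithm of the bound divided by
  \<open>dr i\<close>.\<close>

lemma reaches_rt:
  assumes "i \<in> I"
  shows "\<exists>m. (par ^^ m) i = rt"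
proof -
  obtain D where D: "0 < D" "\<And>i. i \<in> I \<Longrightarrow> dr i \<le> D"
  proof -
    obtain B where B: "\<And>x. x \<in> \<Omega> \<Longrightarrow> dist x0 x \<le> B" using bounded_dom unfolding bounded_any_center[of _ x0] by blast
    have "dr i \<le> d x0 + B" if "i \<in> I" for i
      using d_lip(1)[of "rep i" x0] B[OF rep(1)[OF that]] by (simp add: dist_commute)
    moreover have "0 < d x0 + B" using d_pos[OF x0] B[OF x0] by simp
    ultimately show ?thesis using that by blast
  qed
  have "\<exists>m. (par ^^ m) i = rt" if "i \<in> I" "D / dr i < 2 ^ k" for k i
    using that
  proof (induction k arbitrary: i)
    case 0
    then show ?case using D(2)[OF 0(1)] dr_pos[OF 0(1)] by (simp add: pos_divide_less_eq)
  next
    case (Suc k)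
    show ?case
    proof (cases "i = rt \<or> par i = rt")
      case True
      then show ?thesis
      proof
        assume "i = rt" then show ?thesis by (intro exI[of _ 0]) simp
      next
        assume "par i = rt" then show ?thesis by (intro exI[of _ 1]) simp
      qed
    next
      case False
      then have dbl: "2 * dr i \<le> dr (par i)" using par_doubles[OF Suc.prems(1)] by simp
      have p: "0 < dr i" by (rule dr_pos[OF Suc.prems(1)])
      have "D / dr (par i) \<le> D / (2 * dr i)" using D dbl p by (intro divide_left_mono) auto
      also have "\<dots> < 2 ^ k" using Suc.prems(2) by simp
      finally obtain m where "(par ^^ m) (par i) = rt" using Suc.IH[OF par_I[OF Suc.prems(1)]] by blast
      then have "(par ^^ Suc m) i = rt" by (simp add: funpow_swap1)
      then show ?thesis by blast
    qed
  qed
  moreover obtain k where "D / dr i < 2 ^ k" using real_arch_pow[of 2] by auto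
  ultimately show ?thesis using assms by blast
qed

definition rk :: "int \<times> ('n \<Rightarrow> int) \<Rightarrow> nat" where "rk i = (LEAST m. (par ^^ m) i = rt)"

lemma rk: "i \<in> I \<Longrightarrow> (par ^^ rk i) i = rt"
  unfolding rk_def by (rule LeastI_ex) (rule reaches_rt)

lemma rk_rt [simp]: "rk rt = 0"
  unfolding rk_def by (rule Least_eq_0) simp

lemma rk_par:
  assumes i: "i \<in> I" "i \<noteq> rt"
  shows "rk i = Suc (rk (par i))"
  unfolding rk_def using rk[OF i(1)] i(2)
  by (subst Least_Suc[of _ "rk i"]) (auto simp: funpow_swap1)

end

subsection \<open>From cubes to the domain\<close>

text \<open>Here \<phi> is nonnegative and increasing on the whole line; the final theorem supplies
  its extension by zero. Nothing in this locale depends on the function to be estimated.\<close>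

locale weighted_john_domain = john_domain \<Omega> x0 K \<theta>
  for \<Omega> :: "(real ^ 'n) set" and x0 K \<theta> +
  fixes w :: "real ^ 'n \<Rightarrow> real" and \<phi> :: "real \<Rightarrow> real" and Cw C\<phi> p q \<gamma> :: real
  assumes w_meas [measurable]: "w \<in> borel_measurable lebesgue" and w_nonneg: "\<And>x. 0 \<le> w x"
    and w_fin: "\<And>z l. (\<integral>\<^sup>+x\<in>cube z l. ennreal (w x) \<partial>lebesgue) < \<infinity>"
    and w_dbl: "\<And>z l. 0 < l \<Longrightarrow>
      (\<integral>\<^sup>+x\<in>cube z (2 * l). ennreal (w x) \<partial>lebesgue) \<le> ennreal Cw * (\<integral>\<^sup>+x\<in>cube z l. ennreal (w x) \<partial>lebesgue)"
    and Cw: "1 \<le> Cw"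
    and \<phi>_mono: "mono \<phi>" and \<phi>_nonneg: "\<And>t. 0 \<le> \<phi> t"
    and \<phi>_dbl: "\<And>t. 0 < t \<Longrightarrow> \<phi> (2 * t) \<le> C\<phi> * \<phi> t" and \<phi>_pos: "\<And>t. 0 < t \<Longrightarrow> 0 < \<phi> t"
    and C\<phi>: "1 \<le> C\<phi>"
    and pq: "1 < p" "p \<le> q" and \<gamma>: "0 \<le> \<gamma>"
begin

definition wt :: "(real ^ 'n) set \<Rightarrow> real" where
  "wt A = enn2real (\<integral>\<^sup>+x\<in>A. ennreal (w x) \<partial>lebesgue)"

lemma wt_nonneg: "0 \<le> wt A" by (simp add: wt_def)

lemma wt_eq:
  assumes "A \<subseteq> cube z l"
  shows "(\<integral>\<^sup>+x\<in>A. ennreal (w x) \<partial>lebesgue) = ennreal (wt A)"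
proof -
  have "(\<integral>\<^sup>+x\<in>A. ennreal (w x) \<partial>lebesgue) \<le> (\<integral>\<^sup>+x\<in>cube z l. ennreal (w x) \<partial>lebesgue)"
    using assms by (intro nn_integral_mono) (auto simp: indicator_def)
  also have "\<dots> < \<infinity>" by (rule w_fin)
  finally show ?thesis unfolding wt_def by (simp add: ennreal_enn2real)
qed

lemma wt_mono:
  assumes "A \<subseteq> B" "B \<subseteq> cube z l"
  shows "wt A \<le> wt B"
proof -
  have "ennreal (wt A) \<le> ennreal (wt B)"
    unfolding wt_eq[OF assms(2), symmetric] wt_eq[OF order_trans[OF assms], symmetric]
    using assms(1) by (intro nn_integral_mono) (auto simp: indicator_def)
  then show ?thesis by (simp add: wt_nonneg)
qed

lemma wt_doubling: "0 < l \<Longrightarrow> wt (cube z (2 ^ m * l)) \<le> Cw ^ m * wt (cube z l)"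
proof (induction m)
  case (Suc m)
  have "0 < 2 ^ m * l" using Suc by simp
  have "ennreal (wt (cube z (2 * (2 ^ m * l)))) \<le> ennreal Cw * ennreal (wt (cube z (2 ^ m * l)))"
    unfolding wt_eq[OF order_refl, symmetric] by (rule w_dbl) fact
  also have "\<dots> = ennreal (Cw * wt (cube z (2 ^ m * l)))" using Cw by (simp add: ennreal_mult wt_nonneg)
  finally have "wt (cube z (2 * (2 ^ m * l))) \<le> Cw * wt (cube z (2 ^ m * l))"
    using Cw wt_nonneg by (subst (asm) ennreal_le_iff) auto
  also have "\<dots> \<le> Cw * (Cw ^ m * wt (cube z l))" using Suc Cw by (intro mult_left_mono) auto
  finally show ?case by (simp add: mult.assoc)
qed simp

text \<open>One more doubling than m, because the closed cube that fits into the half-open one of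
  side l has side l / 2.\<close>

lemma wt_le_ccube:
  assumes "0 < l" "A \<subseteq> cube z (2 ^ m * l)"
  shows "wt A \<le> Cw ^ Suc m * wt (ccube z l)"
proof -
  have "wt A \<le> wt (cube z (2 ^ m * l))" by (rule wt_mono[OF assms(2) order_refl])
  also have "2 ^ m * l = 2 ^ Suc m * (l / 2)" by simp
  also have "wt (cube z (2 ^ Suc m * (l / 2))) \<le> Cw ^ Suc m * wt (cube z (l / 2))"
    using assms by (intro wt_doubling) simp
  also have "\<dots> \<le> Cw ^ Suc m * wt (ccube z l)"
    using Cw assms by (intro mult_left_mono wt_mono[OF cube_subset_ccube ccube_subset_cube]) auto
  finally show ?thesis .
qed

lemma mem_cubeI:
  assumes "dist y z \<le> l / 2"
  shows "y \<in> cube z l"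
  unfolding mem_cube
proof
  fix i
  have "\<bar>y $ i - z $ i\<bar> \<le> dist y z" using component_le_norm_cart[of "y - z" i] by (simp add: dist_norm)
  then show "\<bar>y $ i - z $ i\<bar> \<le> l / 2" using assms by simp
qed

text \<open>One number of doublings for all comparisons. The bound 160 K^2 / \<theta> is dictated by
  the links of a chain: a cube of side \<theta> dr i / (16 K) centred at a path point must be
  enlarged until it contains the cell. Enclosing the descendants of a cell and comparing \<phi> on
  \<open>V i\<close> ask for less.\<close>

definition m0 :: nat where "m0 = (SOME m. 160 * K ^ 2 / \<theta> \<le> 2 ^ m)"

lemma m0: "160 * K ^ 2 \<le> 2 ^ m0 * \<theta>" "8 * K \<le> 2 ^ m0" "20 * K \<le> 2 ^ m0 * \<theta>"
proof -
  have "\<exists>m. 160 * K ^ 2 / \<theta> \<le> 2 ^ m" using real_arch_pow[of 2 "160 * K ^ 2 / \<theta>"] by (auto intro: less_imp_le)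
  then have "160 * K ^ 2 / \<theta> \<le> 2 ^ m0" unfolding m0_def by (rule someI_ex)
  then show 1: "160 * K ^ 2 \<le> 2 ^ m0 * \<theta>" using \<theta> by (simp add: pos_divide_le_eq)
  have KK: "K \<le> K ^ 2" using K by (simp add: power2_eq_square)
  then show "20 * K \<le> 2 ^ m0 * \<theta>" using 1 K by linarith
  have "2 ^ m0 * \<theta> \<le> 2 ^ m0 * 1" using theta_1 by (intro mult_left_mono) auto
  then show "8 * K \<le> 2 ^ m0" using 1 KK K by linarith
qed

lemma \<phi>_le: "s \<le> t \<Longrightarrow> \<phi> s \<le> \<phi> t"
  by (rule monoD[OF \<phi>_mono])

lemma \<phi>_doubling: "0 < t \<Longrightarrow> \<phi> (2 ^ m * t) \<le> C\<phi> ^ m * \<phi> t"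
proof (induction m)
  case (Suc m)
  have "\<phi> (2 * (2 ^ m * t)) \<le> C\<phi> * \<phi> (2 ^ m * t)" using Suc by (intro \<phi>_dbl) simp
  also have "\<dots> \<le> C\<phi> * (C\<phi> ^ m * \<phi> t)" using Suc C\<phi> by (intro mult_left_mono) auto
  finally show ?case by (simp add: mult.assoc)
qed simp

definition wgt :: "real \<Rightarrow> real" where "wgt t = t powr (\<gamma> * p) * \<phi> t powr (p / q)"

definition C1 :: real where "C1 = (8 * K) powr (\<gamma> * p) * (C\<phi> ^ m0) powr (p / q)"

lemma wgt_nonneg: "0 \<le> wgt t" by (simp add: wgt_def)

lemma wgt_pos: "0 < t \<Longrightarrow> 0 < wgt t" using \<phi>_pos[of t] by (simp add: wgt_def)

lemma C1_pos: "0 < C1" using K C\<phi> by (simp add: C1_def)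

lemma wgt_le:
  assumes i: "i \<in> I" and y: "y \<in> V i"
  shows "wgt (dr i) \<le> C1 * wgt (d y)"
proof -
  have dy: "0 < d y" using y by (intro d_pos) (simp add: V_def)
  have p: "0 < dr i" by (rule dr_pos[OF i])
  have le: "dr i \<le> 8 * K * d y" using y K by (simp add: V_def pos_divide_le_eq mult.commute)
  have "\<phi> (dr i) \<le> \<phi> (2 ^ m0 * d y)"
    using order_trans[OF le mult_right_mono[OF m0(2), of "d y"]] dy by (intro \<phi>_le) simp
  also have "\<dots> \<le> C\<phi> ^ m0 * \<phi> (d y)" by (rule \<phi>_doubling[OF dy])
  finally have "\<phi> (dr i) powr (p / q) \<le> (C\<phi> ^ m0 * \<phi> (d y)) powr (p / q)"
    using pq \<phi>_nonneg by (intro powr_mono2) auto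
  also have "\<dots> = (C\<phi> ^ m0) powr (p / q) * \<phi> (d y) powr (p / q)"
    by (rule powr_mult)
  finally have 1: "\<phi> (dr i) powr (p / q) \<le> (C\<phi> ^ m0) powr (p / q) * \<phi> (d y) powr (p / q)" .
  have "dr i powr (\<gamma> * p) \<le> (8 * K * d y) powr (\<gamma> * p)" using le p \<gamma> pq by (intro powr_mono2) auto
  also have "\<dots> = (8 * K) powr (\<gamma> * p) * d y powr (\<gamma> * p)" by (rule powr_mult)
  finally have "wgt (dr i) \<le> ((8 * K) powr (\<gamma> * p) * d y powr (\<gamma> * p)) * ((C\<phi> ^ m0) powr (p / q) * \<phi> (d y) powr (p / q))"
    unfolding wgt_def using 1 by (intro mult_mono) auto
  then show ?thesis by (simp add: wgt_def C1_def mult_ac)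
qed

text \<open>The reason for the exponent p/q in \<Phi>: the power q/p, which the cube estimate puts
  on the energy, turns the energy weight into \<phi> times t^(\<gamma> q), and this matches the
  factor \<ell>^(\<gamma> q) of that estimate.\<close>

lemma wgt_powr:
  assumes "0 < t"
  shows "(wgt t) powr (q / p) = t powr (\<gamma> * q) * \<phi> t"
  using pq \<phi>_pos[OF assms] assms by (simp add: wgt_def powr_mult powr_powr)

lemma d_measurable [measurable]: "d \<in> borel_measurable lebesgue"
proof -
  have "continuous_on UNIV d" unfolding bdist_def by (intro continuous_intros)
  then have "d \<in> borel_measurable borel" by (rule borel_measurable_continuous_onI)
  then show ?thesis by (simp add: measurable_completion)
qed

lemma \<phi>_measurable [measurable]: "\<phi> \<in> borel_measurable borel"
  by (rule borel_measurable_mono[OF \<phi>_mono])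

lemma dom_sets [simp, measurable]: "\<Omega> \<in> sets lebesgue"
  using open_dom by (simp add: borel_open)

lemma overlap_integral:
  assumes g: "g \<in> borel_measurable lebesgue" and J: "finite J" "J \<subseteq> I"
    and A: "\<And>i. i \<in> J \<Longrightarrow> A i \<in> sets lebesgue" "\<And>i. i \<in> J \<Longrightarrow> A i \<subseteq> V i" "\<And>i. i \<in> J \<Longrightarrow> A i \<subseteq> B" "B \<in> sets lebesgue"
  shows "(\<Sum>i\<in>J. \<integral>\<^sup>+x\<in>A i. g x \<partial>lebesgue) \<le> of_nat N * (\<integral>\<^sup>+x\<in>B. g x \<partial>lebesgue)"
proof -
  have "(\<Sum>i\<in>J. \<integral>\<^sup>+x\<in>A i. g x \<partial>lebesgue) = (\<integral>\<^sup>+x. (\<Sum>i\<in>J. g x * indicator (A i) x) \<partial>lebesgue)"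
    using g A by (intro nn_integral_sum[symmetric] borel_measurable_times borel_measurable_indicator) auto
  also have "\<dots> \<le> (\<integral>\<^sup>+x. of_nat N * (g x * indicator B x) \<partial>lebesgue)"
  proof (rule nn_integral_mono)
    fix x
    have "(\<Sum>i\<in>J. indicator (A i) x :: ennreal) \<le> (\<Sum>i\<in>{i \<in> J. x \<in> V i}. indicator B x)"
      unfolding sum.inter_filter[OF J(1)]
    proof (rule sum_mono)
      fix i assume "i \<in> J"
      from A(2,3)[OF this] show "indicator (A i) x \<le> (if x \<in> V i then indicator B x else 0 :: ennreal)"
        by (auto simp: indicator_def)
    qed
    also have "\<dots> = of_nat (card {i \<in> J. x \<in> V i}) * indicator B x" by simp
    also have "\<dots> \<le> of_nat N * indicator B x"
      using overlap[OF J, of x] by (intro mult_right_mono) auto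
    finally have "g x * (\<Sum>i\<in>J. indicator (A i) x :: ennreal) \<le> g x * (of_nat N * indicator B x)"
      by (intro mult_left_mono) auto
    then show "(\<Sum>i\<in>J. g x * indicator (A i) x) \<le> of_nat N * (g x * indicator B x)"
      by (simp add: sum_distrib_left mult_ac)
  qed
  also have "\<dots> = of_nat N * (\<integral>\<^sup>+x\<in>B. g x \<partial>lebesgue)"
    using g A(4) by (intro nn_integral_cmult borel_measurable_times borel_measurable_indicator) auto
  finally show ?thesis .
qed

definition om :: "int \<times> ('n \<Rightarrow> int) \<Rightarrow> real" where "om i = \<phi> (dr i) * wt (cell i)"

lemma om_nonneg: "0 \<le> om i" by (simp add: om_def wt_nonneg \<phi>_nonneg)

definition C3 :: real where "C3 = real N * Cw ^ Suc m0"

text \<open>Descendants of j are smaller than j, so \<phi> at their size is at most \<phi> at that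
  of j. Their cells lie in the enlargement B of the cell of j; they need not be disjoint, and
  bounded overlap costs \<open>N\<close>. Doubling compares B with the cell.\<close>

lemma shadow_sum:
  assumes J: "finite J" "J \<subseteq> I" and j: "j \<in> J" "j \<noteq> rt"
  shows "(\<Sum>i | i \<in> J \<and> (\<exists>m. (par ^^ m) i = j). om i) \<le> C3 * om j"
proof -
  define S where "S = {i \<in> J. \<exists>m. (par ^^ m) i = j}"
  define B where "B = cube (rep j) (2 ^ m0 * (\<theta> * dr j))"
  have S: "finite S" "S \<subseteq> I" using J by (auto simp: S_def)
  have jI: "j \<in> I" using J j by auto
  have pj: "0 < dr j" by (rule dr_pos[OF jI])
  have near: "dr i \<le> dr j" "dist (rep i) (rep j) \<le> 9 * K * (dr j - dr i)" if "i \<in> S" for i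
    using that shadow_near[of i _ j] j(2) S by (auto simp: S_def)
  have cell: "cell i \<subseteq> B" if i: "i \<in> S" for i
  proof
    fix y assume y: "y \<in> cell i"
    have iI: "i \<in> I" using S i by auto
    have pi: "0 < dr i" by (rule dr_pos[OF iI])
    have "dist y (rep i) \<le> dr i / 16"
      using ccube_bounds(1)[OF rep(1)[OF iI] order_refl] y by (simp add: cell_def)
    moreover have "dr j \<le> K * dr j" "9 * K * (dr j - dr i) \<le> 9 * K * dr j" using K pj pi by (simp_all add: mult_left_mono)
    ultimately have "dist y (rep j) \<le> 10 * K * dr j"
      using near[OF i] dist_triangle[of y "rep j" "rep i"] pi by linarith
    also have "\<dots> \<le> 2 ^ m0 * (\<theta> * dr j) / 2"
      using mult_right_mono[OF m0(3), of "dr j"] pj by simp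
    finally show "y \<in> B" unfolding B_def by (rule mem_cubeI)
  qed
  have "ennreal (\<Sum>i\<in>S. wt (cell i)) = (\<Sum>i\<in>S. ennreal (wt (cell i)))"
    by (intro sum_ennreal[symmetric]) (rule wt_nonneg)
  also have "\<dots> = (\<Sum>i\<in>S. \<integral>\<^sup>+x\<in>cell i. ennreal (w x) \<partial>lebesgue)"
    using wt_eq[OF cell[unfolded B_def]] by (intro sum.cong refl) simp
  also have "\<dots> \<le> of_nat N * (\<integral>\<^sup>+x\<in>B. ennreal (w x) \<partial>lebesgue)"
  proof (rule overlap_integral[OF _ S])
    show "cell i \<subseteq> V i" if "i \<in> S" for i using cell_subset_V S(2) that by blast
  qed (use cell in \<open>simp_all add: cell_def B_def\<close>)
  also have "\<dots> = ennreal (real N * wt B)"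
    unfolding wt_eq[OF order_refl, of "rep j" "2 ^ m0 * (\<theta> * dr j)", folded B_def]
    by (simp add: ennreal_mult wt_nonneg ennreal_of_nat_eq_real_of_nat)
  finally have 1: "(\<Sum>i\<in>S. wt (cell i)) \<le> real N * wt B"
    using wt_nonneg by (subst (asm) ennreal_le_iff) auto
  have 2: "wt B \<le> Cw ^ Suc m0 * wt (cell j)"
    unfolding B_def cell_def using pj \<theta> by (intro wt_le_ccube) auto
  have "(\<Sum>i\<in>S. om i) \<le> (\<Sum>i\<in>S. \<phi> (dr j) * wt (cell i))"
    unfolding om_def using near by (intro sum_mono mult_right_mono \<phi>_le wt_nonneg) auto
  also have "\<dots> = \<phi> (dr j) * (\<Sum>i\<in>S. wt (cell i))" by (simp add: sum_distrib_left)
  also have "\<dots> \<le> \<phi> (dr j) * (real N * (Cw ^ Suc m0 * wt (cell j)))"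
    using order_trans[OF 1 mult_left_mono[OF 2, of "real N"]] \<phi>_nonneg by (intro mult_left_mono) auto
  finally show ?thesis by (simp add: S_def om_def C3_def mult_ac)
qed

text \<open>\<open>C2\<close> collects the losses of one edge of the tree, \<open>C4\<close> those
  of the whole passage from cells to the domain. Both are fixed before any function enters, which is
  what makes the final constant independent of it.\<close>

definition C2 :: real where
  "C2 = real (steps + 2) powr q * (Cw ^ Suc m0 * (2 powr q * (2 * (2 + 8 * K) powr (\<gamma> * q))))"

definition C4 :: real where
  "C4 = C\<phi> * (2 powr q * (((2 + 8 * K) powr (\<gamma> * q) + 2 * (2 * q * C3) powr q * C2) * (C1 * real N) powr (q / p)))"

lemma C2_nonneg: "0 \<le> C2" using Cw by (simp add: C2_def)

lemma C3_nonneg: "0 \<le> C3" using Cw by (simp add: C3_def)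

lemma C4_nonneg: "0 \<le> C4" using C\<phi> C2_nonneg by (simp add: C4_def)

end

text \<open>The fractional and the gradient seminorm enter only through an energy density
  \<open>\<rho>\<close> and the estimate on small cubes, so the argument in the domain is carried
  out once for both.\<close>

locale local_poincare = weighted_john_domain \<Omega> x0 K \<theta> w \<phi> Cw C\<phi> p q \<gamma>
  for \<Omega> :: "(real ^ 'n) set" and x0 K \<theta> w \<phi> Cw C\<phi> p q \<gamma> +
  fixes f :: "real ^ 'n \<Rightarrow> real" and \<rho> :: "real ^ 'n \<Rightarrow> ennreal" and L Y :: real
  assumes f_meas [measurable]: "f \<in> borel_measurable lebesgue"
    and \<rho>_meas [measurable]: "\<rho> \<in> borel_measurable lebesgue" and L: "0 \<le> L" and Y: "0 \<le> Y"
    and poincare: "\<And>z l T. z \<in> \<Omega> \<Longrightarrow> 0 < l \<Longrightarrow> l \<le> \<theta> * d z \<Longrightarrow> 0 \<le> T \<Longrightarrow>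
      (\<integral>\<^sup>+x\<in>ccube z l. \<rho> x \<partial>lebesgue) \<le> ennreal T \<Longrightarrow>
      \<exists>c. (\<integral>\<^sup>+x\<in>ccube z l. ennreal (\<bar>f x - c\<bar> powr q * w x) \<partial>lebesgue) \<le> ennreal (L * l powr (\<gamma> * q) * T powr (q / p))"
    and energy: "(\<integral>\<^sup>+x\<in>\<Omega>. \<rho> x * ennreal (wgt (d x)) \<partial>lebesgue) \<le> ennreal Y"
begin

definition E :: "int \<times> ('n \<Rightarrow> int) \<Rightarrow> real" where
  "E i = enn2real (\<integral>\<^sup>+x\<in>V i. \<rho> x \<partial>lebesgue)"

lemma E_nonneg: "0 \<le> E i" by (simp add: E_def)

lemma energy_sum_ennreal:
  assumes J: "finite J" "J \<subseteq> I"
  shows "(\<Sum>i\<in>J. ennreal (wgt (dr i)) * (\<integral>\<^sup>+x\<in>V i. \<rho> x \<partial>lebesgue)) \<le> ennreal (C1 * real N * Y)"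
proof -
  have [measurable]: "V i \<in> sets lebesgue" for i by (rule sets_V)
  have mw [measurable]: "(\<lambda>x. ennreal (wgt (d x))) \<in> borel_measurable lebesgue" unfolding wgt_def by measurable
  have "(\<Sum>i\<in>J. ennreal (wgt (dr i)) * (\<integral>\<^sup>+x\<in>V i. \<rho> x \<partial>lebesgue)) \<le> (\<Sum>i\<in>J. ennreal C1 * (\<integral>\<^sup>+x\<in>V i. \<rho> x * ennreal (wgt (d x)) \<partial>lebesgue))"
  proof (rule sum_mono)
    fix i assume i: "i \<in> J"
    have "ennreal (wgt (dr i)) * (\<integral>\<^sup>+x\<in>V i. \<rho> x \<partial>lebesgue) = (\<integral>\<^sup>+x. ennreal (wgt (dr i)) * (\<rho> x * indicator (V i) x) \<partial>lebesgue)"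
      by (intro nn_integral_cmult[symmetric]) measurable
    also have "\<dots> \<le> (\<integral>\<^sup>+x. ennreal C1 * (\<rho> x * ennreal (wgt (d x)) * indicator (V i) x) \<partial>lebesgue)"
    proof (rule nn_integral_mono)
      fix x
      show "ennreal (wgt (dr i)) * (\<rho> x * indicator (V i) x) \<le> ennreal C1 * (\<rho> x * ennreal (wgt (d x)) * indicator (V i) x)"
      proof (cases "x \<in> V i")
        case True
        have "ennreal (wgt (dr i)) \<le> ennreal (C1 * wgt (d x))"
          using wgt_le[OF _ True] i J by (intro ennreal_leI) auto
        also have "\<dots> = ennreal C1 * ennreal (wgt (d x))" using C1_pos wgt_nonneg by (intro ennreal_mult) auto
        finally have "ennreal (wgt (dr i)) * \<rho> x \<le> ennreal C1 * ennreal (wgt (d x)) * \<rho> x" by (intro mult_right_mono) auto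
        then show ?thesis using True by (simp add: mult_ac)
      qed simp
    qed
    also have "\<dots> = ennreal C1 * (\<integral>\<^sup>+x\<in>V i. \<rho> x * ennreal (wgt (d x)) \<partial>lebesgue)"
      by (intro nn_integral_cmult) measurable
    finally show "ennreal (wgt (dr i)) * (\<integral>\<^sup>+x\<in>V i. \<rho> x \<partial>lebesgue) \<le> ennreal C1 * (\<integral>\<^sup>+x\<in>V i. \<rho> x * ennreal (wgt (d x)) \<partial>lebesgue)" .
  qed
  also have "\<dots> = ennreal C1 * (\<Sum>i\<in>J. \<integral>\<^sup>+x\<in>V i. \<rho> x * ennreal (wgt (d x)) \<partial>lebesgue)"
    by (simp add: sum_distrib_left)
  also have "\<dots> \<le> ennreal C1 * (of_nat N * (\<integral>\<^sup>+x\<in>\<Omega>. \<rho> x * ennreal (wgt (d x)) \<partial>lebesgue))"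
  proof (intro mult_left_mono overlap_integral J borel_measurable_times mw \<rho>_meas)
    show "V i \<subseteq> \<Omega>" for i by (auto simp: V_def)
  qed simp_all
  also have "\<dots> \<le> ennreal C1 * (of_nat N * ennreal Y)" by (intro mult_left_mono energy) auto
  also have "\<dots> = ennreal (C1 * real N * Y)"
    using C1_pos Y by (simp add: ennreal_mult ennreal_of_nat_eq_real_of_nat mult.assoc)
  finally show ?thesis .
qed

text \<open>The energy in \<open>V i\<close> is finite because the weighted energy is, and
  \<open>wgt\<close> is positive at \<open>dr i\<close>.\<close>

lemma E_eq:
  assumes i: "i \<in> I"
  shows "(\<integral>\<^sup>+x\<in>V i. \<rho> x \<partial>lebesgue) = ennreal (E i)"
proof -
  have "ennreal (wgt (dr i)) * (\<integral>\<^sup>+x\<in>V i. \<rho> x \<partial>lebesgue) < \<infinity>"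
    using energy_sum_ennreal[of "{i}"] i by (simp add: le_less_trans)
  moreover have "ennreal (wgt (dr i)) \<noteq> 0" using wgt_pos[OF dr_pos[OF i]] by simp
  ultimately have "(\<integral>\<^sup>+x\<in>V i. \<rho> x \<partial>lebesgue) < \<infinity>" by (auto simp: ennreal_mult_less_top)
  then show ?thesis by (simp add: E_def ennreal_enn2real)
qed

lemma energy_sum:
  assumes J: "finite J" "J \<subseteq> I"
  shows "(\<Sum>i\<in>J. wgt (dr i) * E i) \<le> C1 * real N * Y"
proof -
  have "ennreal (\<Sum>i\<in>J. wgt (dr i) * E i) = (\<Sum>i\<in>J. ennreal (wgt (dr i) * E i))"
    by (intro sum_ennreal[symmetric]) (simp add: wgt_nonneg E_nonneg)
  also have "\<dots> = (\<Sum>i\<in>J. ennreal (wgt (dr i)) * (\<integral>\<^sup>+x\<in>V i. \<rho> x \<partial>lebesgue))"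
    using J by (intro sum.cong refl) (auto simp: E_eq ennreal_mult wgt_nonneg E_nonneg)
  also have "\<dots> \<le> ennreal (C1 * real N * Y)" by (rule energy_sum_ennreal[OF J])
  finally show ?thesis using C1_pos Y by (subst (asm) ennreal_le_iff) auto
qed

definition osc :: "(real ^ 'n) set \<Rightarrow> real \<Rightarrow> ennreal" where
  "osc A c = (\<integral>\<^sup>+x\<in>A. ennreal (\<bar>f x - c\<bar> powr q * w x) \<partial>lebesgue)"

text \<open>Two constants that approximate f on two sets must be close if the sets share a part of
  positive mass: integrate the triangle inequality for c - f x and f x - c' over the common
  part.\<close>

lemma link:
  assumes S: "S \<subseteq> A" "S \<subseteq> B" "S \<in> sets lebesgue" "S \<subseteq> cube z l" and a: "osc A c \<le> ennreal a" "osc B c' \<le> ennreal a" "0 \<le> a"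
  shows "\<bar>c - c'\<bar> powr q * wt S \<le> 2 powr q * (2 * a)"
proof -
  have [measurable]: "S \<in> sets lebesgue" by (rule S(3))
  have "ennreal (\<bar>c - c'\<bar> powr q * wt S) = ennreal (\<bar>c - c'\<bar> powr q) * (\<integral>\<^sup>+x\<in>S. ennreal (w x) \<partial>lebesgue)"
    unfolding wt_eq[OF S(4)] by (intro ennreal_mult) (auto simp: wt_nonneg)
  also have "\<dots> = (\<integral>\<^sup>+x. ennreal (\<bar>c - c'\<bar> powr q) * (ennreal (w x) * indicator S x) \<partial>lebesgue)"
    by (intro nn_integral_cmult[symmetric]) measurable
  also have "\<dots> \<le> (\<integral>\<^sup>+x. ennreal (2 powr q) * (ennreal (\<bar>f x - c\<bar> powr q * w x) * indicator S x + ennreal (\<bar>f x - c'\<bar> powr q * w x) * indicator S x) \<partial>lebesgue)"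
  proof (rule nn_integral_mono)
    fix x
    have "\<bar>(c - f x) + (f x - c')\<bar> powr q \<le> 2 powr q * (\<bar>c - f x\<bar> powr q + \<bar>f x - c'\<bar> powr q)"
      using pq by (intro abs_add_powr_le) simp
    then have "\<bar>c - c'\<bar> powr q \<le> 2 powr q * (\<bar>f x - c\<bar> powr q + \<bar>f x - c'\<bar> powr q)"
      by (simp add: abs_minus_commute)
    then have "\<bar>c - c'\<bar> powr q * w x \<le> (2 powr q * (\<bar>f x - c\<bar> powr q + \<bar>f x - c'\<bar> powr q)) * w x"
      by (intro mult_right_mono w_nonneg)
    then have "ennreal (\<bar>c - c'\<bar> powr q * w x) \<le> ennreal (2 powr q * (\<bar>f x - c\<bar> powr q * w x + \<bar>f x - c'\<bar> powr q * w x))"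
      by (intro ennreal_leI) (simp add: algebra_simps)
    moreover have "ennreal (\<bar>c - c'\<bar> powr q * w x) = ennreal (\<bar>c - c'\<bar> powr q) * ennreal (w x)"
      by (rule ennreal_mult) (simp_all add: w_nonneg)
    moreover have "ennreal (2 powr q * (\<bar>f x - c\<bar> powr q * w x + \<bar>f x - c'\<bar> powr q * w x))
        = ennreal (2 powr q) * ennreal (\<bar>f x - c\<bar> powr q * w x + \<bar>f x - c'\<bar> powr q * w x)"
      by (rule ennreal_mult) (simp_all add: w_nonneg)
    moreover have "ennreal (\<bar>f x - c\<bar> powr q * w x + \<bar>f x - c'\<bar> powr q * w x)
        = ennreal (\<bar>f x - c\<bar> powr q * w x) + ennreal (\<bar>f x - c'\<bar> powr q * w x)"
      by (rule ennreal_plus) (simp_all add: w_nonneg)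
    ultimately have "ennreal (\<bar>c - c'\<bar> powr q) * ennreal (w x) \<le> ennreal (2 powr q) * (ennreal (\<bar>f x - c\<bar> powr q * w x) + ennreal (\<bar>f x - c'\<bar> powr q * w x))"
      by (simp only:)
    then show "ennreal (\<bar>c - c'\<bar> powr q) * (ennreal (w x) * indicator S x) \<le> ennreal (2 powr q) * (ennreal (\<bar>f x - c\<bar> powr q * w x) * indicator S x + ennreal (\<bar>f x - c'\<bar> powr q * w x) * indicator S x)"
    proof (cases "x \<in> S")
      case True
      then show ?thesis using \<open>ennreal (\<bar>c - c'\<bar> powr q) * ennreal (w x) \<le> _\<close> by (simp only: indicator_simps mult_1_right)
    qed simp
  qed
  also have "\<dots> = ennreal (2 powr q) * (\<integral>\<^sup>+x. ennreal (\<bar>f x - c\<bar> powr q * w x) * indicator S x + ennreal (\<bar>f x - c'\<bar> powr q * w x) * indicator S x \<partial>lebesgue)"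
    by (intro nn_integral_cmult) measurable
  also have "\<dots> = ennreal (2 powr q) * (osc S c + osc S c')"
    unfolding osc_def
    by (intro arg_cong[where f = "\<lambda>t. ennreal (2 powr q) * t"] nn_integral_add) measurable
  also have "\<dots> \<le> ennreal (2 powr q) * (osc A c + osc B c')"
  proof (intro mult_left_mono add_mono)
    show "osc S c \<le> osc A c" "osc S c' \<le> osc B c'"
      unfolding osc_def using S(1,2) by (auto intro!: nn_integral_mono simp: indicator_def)
  qed simp
  also have "\<dots> \<le> ennreal (2 powr q) * (ennreal a + ennreal a)" by (intro mult_left_mono add_mono a) auto
  also have "\<dots> = ennreal (2 powr q * (2 * a))" using a(3) by (simp add: ennreal_mult flip: ennreal_plus)
  finally show ?thesis using a(3) by (subst (asm) ennreal_le_iff) auto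
qed

lemma poincare_V:
  assumes "i \<in> I" "z \<in> \<Omega>" "0 < l" "l \<le> \<theta> * d z" "l \<le> (2 + 8 * K) * dr i" "ccube z l \<subseteq> V i"
    and T: "0 \<le> T" "(\<integral>\<^sup>+x\<in>ccube z l. \<rho> x \<partial>lebesgue) = ennreal T" 
  shows "\<exists>c. osc (ccube z l) c \<le> ennreal (L * l powr (\<gamma> * q) * T powr (q / p))"
    "L * l powr (\<gamma> * q) * T powr (q / p) \<le> L * ((2 + 8 * K) * dr i) powr (\<gamma> * q) * E i powr (q / p)"
proof -
  show "\<exists>c. osc (ccube z l) c \<le> ennreal (L * l powr (\<gamma> * q) * T powr (q / p))"
    unfolding osc_def using assms by (intro poincare) auto
  have "ennreal T \<le> ennreal (E i)"
    unfolding T(2)[symmetric] E_eq[OF assms(1), symmetric] using assms(6) by (intro nn_integral_mono) (auto simp: indicator_def)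
  then have "T \<le> E i" by (simp add: E_nonneg)
  then show "L * l powr (\<gamma> * q) * T powr (q / p) \<le> L * ((2 + 8 * K) * dr i) powr (\<gamma> * q) * E i powr (q / p)"
    using L assms(3,5) T(1) pq \<gamma> by (intro mult_mono powr_mono2 mult_nonneg_nonneg) auto
qed

lemma mass_eq:
  assumes "i \<in> I" "A \<subseteq> V i"
  shows "(\<integral>\<^sup>+x\<in>A. \<rho> x \<partial>lebesgue) = ennreal (enn2real (\<integral>\<^sup>+x\<in>A. \<rho> x \<partial>lebesgue))"
proof -
  have "(\<integral>\<^sup>+x\<in>A. \<rho> x \<partial>lebesgue) \<le> (\<integral>\<^sup>+x\<in>V i. \<rho> x \<partial>lebesgue)"
    using assms by (intro nn_integral_mono) (auto simp: indicator_def)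
  also have "\<dots> < \<infinity>" using E_eq[OF assms(1)] by simp
  finally show ?thesis by (simp add: ennreal_enn2real)
qed

text \<open>The choice uses the energy of the cell itself. The same constant has to serve for the
  cell and for all of its children, whose regions \<open>V\<close> also contain this cell.\<close>

definition cst :: "int \<times> ('n \<Rightarrow> int) \<Rightarrow> real" where
  "cst i = (SOME c. osc (cell i) c \<le> ennreal (L * (\<theta> * dr i) powr (\<gamma> * q) * enn2real (\<integral>\<^sup>+x\<in>cell i. \<rho> x \<partial>lebesgue) powr (q / p)))"

definition bd :: "int \<times> ('n \<Rightarrow> int) \<Rightarrow> real" where
  "bd i = L * ((2 + 8 * K) * dr i) powr (\<gamma> * q) * E i powr (q / p)"

lemma bd_nonneg: "0 \<le> bd i" using L by (simp add: bd_def)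

lemma theta_dr: "i \<in> I \<Longrightarrow> \<theta> * dr i \<le> dr i"
  using mult_right_mono[OF theta_1, of "dr i"] dr_pos[of i] by simp

text \<open>A cell j contained in \<open>V i\<close> has at most the energy of \<open>V i\<close>,
  so its own constant is good enough on the scale of i. It is used for j = i and for the parent of
  i.\<close>

lemma osc_cst:
  assumes i: "i \<in> I" and j: "j \<in> I" "cell j \<subseteq> V i" "\<theta> * dr j \<le> (2 + 8 * K) * dr i"
  shows "osc (cell j) (cst j) \<le> ennreal (bd i)"
proof -
  define T where "T = enn2real (\<integral>\<^sup>+x\<in>cell j. \<rho> x \<partial>lebesgue)"
  have T: "0 \<le> T" "(\<integral>\<^sup>+x\<in>ccube (rep j) (\<theta> * dr j). \<rho> x \<partial>lebesgue) = ennreal T"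
    using mass_eq[OF i j(2)] by (simp_all add: T_def cell_def)
  have pos: "0 < \<theta> * dr j" using \<theta> dr_pos[OF j(1)] by simp
  note P = poincare_V[OF i rep(1)[OF j(1)] pos order_refl j(3) j(2)[unfolded cell_def] T]
  have "osc (cell j) (cst j) \<le> ennreal (L * (\<theta> * dr j) powr (\<gamma> * q) * T powr (q / p))"
    unfolding cst_def T_def cell_def by (rule someI_ex[OF P(1)[unfolded T_def cell_def]])
  also have "\<dots> \<le> ennreal (bd i)" unfolding bd_def by (intro ennreal_leI P(2))
  finally show ?thesis .
qed

lemma osc_cell: "i \<in> I \<Longrightarrow> osc (cell i) (cst i) \<le> ennreal (bd i)"
proof (rule osc_cst)
  assume i: "i \<in> I"
  have "1 * dr i \<le> (2 + 8 * K) * dr i" using K dr_pos[OF i] by (intro mult_right_mono) auto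
  then show "\<theta> * dr i \<le> (2 + 8 * K) * dr i" using theta_dr[OF i] by linarith
qed (use cell_subset_V in blast)+

text \<open>The chain consists of the cell, one cube around each sample of the path, and the parent
  cell. Consecutive members both contain a smaller cube around a path point, whose mass is
  comparable to that of the cell by doubling, so each link compares two constants against the mass
  of the cell.\<close>

lemma edge:
  assumes i: "i \<in> I" "i \<noteq> rt"
  shows "\<bar>cst i - cst (par i)\<bar> powr q * wt (cell i) \<le> real (steps + 2) powr q * (Cw ^ Suc m0 * (2 powr q * (2 * bd i)))"
proof -
  have p: "0 < dr i" by (rule dr_pos[OF i(1)])
  have pI: "par i \<in> I" by (rule par_I[OF i(1)])
  \<comment> \<open>The lower bound dr i / (2 K) for d along the path, times \<theta>: the largest
    side that the local estimate is guaranteed to admit at every sample.\<close>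
  define lp where "lp = \<theta> * dr i / (2 * K)"
  define u where "u = lp / 8"
  have lp: "0 < lp" using \<theta> p K by (simp add: lp_def)
  have K1: "dr i \<le> K * dr i" using K p by simp
  have lp_le: "lp \<le> \<theta> * dr i"
  proof -
    have "\<theta> * dr i / (2 * K) \<le> \<theta> * dr i / 1" using K \<theta> p by (intro divide_left_mono) auto
    then show ?thesis by (simp add: lp_def)
  qed
  have V_path: "lp \<le> \<theta> * d (path i j)" "ccube (path i j) lp \<subseteq> V i" if j: "j \<le> steps" for j
  proof -
    note P = path(2-4)[OF i(1) j]
    show le: "lp \<le> \<theta> * d (path i j)"
      using mult_left_mono[OF P(3), of \<theta>] \<theta> by (simp add: lp_def)
    show "ccube (path i j) lp \<subseteq> V i"
    proof
      fix y assume y: "y \<in> ccube (path i j) lp"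
      note B = ccube_bounds[OF P(1) le y]
      have "d (path i j) \<le> dr i + 4 * K * dr i" using d_lip(1)[of "path i j" "rep i"] P by simp
      then have "dist y (rep i) \<le> 20 * K * dr i"
        using B(1) P(2) dist_triangle[of y "rep i" "path i j"] K1 p by linarith
      moreover have "dr i / (8 * K) \<le> d y"
      proof -
        have "dr i / (8 * K) \<le> dr i / (2 * K) / 2" using p K by (simp add: divide_simps)
        moreover have "dr i / (2 * K) / 2 \<le> d (path i j) / 2" using P(3) by (rule divide_right_mono) simp
        ultimately show ?thesis using B(3) by linarith
      qed
      ultimately show "y \<in> V i" using B(2) by (simp add: V_def)
    qed
  qed
  have V_par: "cell (par i) \<subseteq> V i"
  proof
    fix y assume y: "y \<in> cell (par i)"
    note B = ccube_bounds[OF rep(1)[OF pI] order_refl y[unfolded cell_def]]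
    note P = par_near(1-3)[OF i]
    have P2: "dr (par i) \<le> 2 * dr i + 8 * (K * dr i)" using P(2) by (simp add: algebra_simps)
    have "dist y (rep i) \<le> dr (par i) / 16 + 9 * K * dr i"
      using B(1) P(1) dist_triangle2[of y "rep i" "rep (par i)"] by (simp add: dist_commute)
    then have "dist y (rep i) \<le> 20 * K * dr i" using P2 K1 p by linarith
    moreover have "dr i / (8 * K) \<le> d y"
    proof -
      have "dr i / (8 * K) = dr i / (4 * K) / 2" by simp
      also have "\<dots> \<le> dr (par i) / 2" using P(3) by (rule divide_right_mono) simp
      finally show ?thesis using B(3) by linarith
    qed
    ultimately show "y \<in> V i" using B(2) by (simp add: V_def)
  qed
  have par_side: "\<theta> * dr (par i) \<le> (2 + 8 * K) * dr i"
    using theta_dr[OF pI] par_near(2)[OF i] by linarith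
  have "\<exists>c. osc (ccube (path i j) lp) c \<le> ennreal (bd i)" if j: "j \<le> steps" for j
  proof -
    have "1 * dr i \<le> (2 + 8 * K) * dr i" using K p by (intro mult_right_mono) auto
    then have side: "lp \<le> (2 + 8 * K) * dr i" using lp_le theta_dr[OF i(1)] by linarith
    note P = poincare_V[OF i(1) path(2)[OF i(1) j] lp V_path(1)[OF j] side V_path(2)[OF j] enn2real_nonneg mass_eq[OF i(1) V_path(2)[OF j]]]
    show ?thesis using P(1) ennreal_leI[OF P(2)] unfolding bd_def by (meson order_trans)
  qed
  then obtain c where c: "\<And>j. j \<le> steps \<Longrightarrow> osc (ccube (path i j) lp) (c j) \<le> ennreal (bd i)" by metis
  \<comment> \<open>Indices are shifted by one: 0 is the cell, k from 1 to steps + 1 is the cube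
    around sample k - 1, and steps + 2 is the parent. Hence there are steps + 2 links.\<close>
  define e where "e k = (if k = 0 then cst i else if k \<le> steps + 1 then c (k - 1) else cst (par i))" for k
  define A where "A k = (if k = 0 then cell i else if k \<le> steps + 1 then ccube (path i (k - 1)) lp else cell (par i))" for k
  have osc_e: "osc (A k) (e k) \<le> ennreal (bd i)" for k
    using osc_cell[OF i(1)] c osc_cst[OF i(1) pI V_par par_side] by (auto simp: A_def e_def)
  have "\<bar>e k - e (Suc k)\<bar> powr q * wt (cell i) \<le> Cw ^ Suc m0 * (2 powr q * (2 * bd i))" if k: "k < steps + 2" for k
  proof -
    \<comment> \<open>Natural subtraction gives j = 0 also for k = 0. This is intended: sample 0 is
      the centre of the cell, and it serves for the first link as well.\<close>
    define j where "j = k - 1"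
    have j: "j \<le> steps" using k by (simp add: j_def)
    have u: "0 < u" "u \<le> lp" using lp by (auto simp: u_def)
    have S1: "ccube (path i j) u \<subseteq> A k"
    proof (cases "k = 0")
      case True
      then have "path i j = rep i" using path(1)[OF i(1)] by (simp add: j_def)
      then have "ccube (path i j) u \<subseteq> ccube (rep i) (\<theta> * dr i)" using u lp_le by (intro ccube_subset_ccube) simp
      then show ?thesis using True by (simp add: A_def cell_def)
    next
      case False
      have "ccube (path i j) u \<subseteq> ccube (path i j) lp" using u by (intro ccube_subset_ccube) simp
      then show ?thesis using k False by (cases "k \<le> steps + 1") (simp_all add: A_def j_def)
    qed
    have S2: "ccube (path i j) u \<subseteq> A (Suc k)"
    proof (cases "k \<le> steps")
      case True
      have "\<bar>path i j $ m - path i k $ m\<bar> \<le> lp / 4" for m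
      proof (cases "k = 0")
        case False
        then have "dist (path i j) (path i k) \<le> \<theta> * dr i / (8 * K)" using path(5)[OF i(1), of j] True by (simp add: j_def)
        moreover have "\<bar>path i j $ m - path i k $ m\<bar> \<le> dist (path i j) (path i k)"
          using component_le_norm_cart[of "path i j - path i k" m] by (simp add: dist_norm)
        ultimately show ?thesis by (simp add: lp_def)
      qed (use lp in \<open>simp add: j_def\<close>)
      moreover have "lp / 4 + u / 2 \<le> lp / 2" using lp by (simp add: u_def)
      ultimately have "\<bar>path i j $ m - path i k $ m\<bar> + u / 2 \<le> lp / 2" for m using order_trans[OF add_right_mono] by blast
      then have "ccube (path i j) u \<subseteq> ccube (path i k) lp" by (rule ccube_subset_ccube)
      then show ?thesis using True by (simp add: A_def)
    next
      case False
      then have k': "k = steps + 1" "j = steps" using k by (auto simp: j_def)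
      have "dr i / (4 * K) * (\<theta> / 8) \<le> dr (par i) * (\<theta> / 8)" using par_near(3)[OF i] \<theta> by (intro mult_right_mono) auto
      then have "u / 2 \<le> \<theta> / 8 * dr (par i)" by (simp add: u_def lp_def mult.commute)
      moreover have "0 < \<theta> * dr (par i)" using \<theta> dr_pos[OF pI] by simp
      ultimately have "\<bar>path i j $ m - rep (par i) $ m\<bar> + u / 2 \<le> \<theta> * dr (par i) / 2" for m
        using par_near(5)[OF i, of m] k'(2) by simp
      then have "ccube (path i j) u \<subseteq> ccube (rep (par i)) (\<theta> * dr (par i))" by (rule ccube_subset_ccube)
      then show ?thesis using k' by (simp add: A_def cell_def)
    qed
    have "cell i \<subseteq> cube (path i j) (2 ^ m0 * u)"
    proof
      fix y assume y: "y \<in> cell i"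
      have "dist y (rep i) \<le> dr i / 16"
        using ccube_bounds(1)[OF rep(1)[OF i(1)] order_refl] y by (simp add: cell_def)
      then have "dist y (path i j) \<le> 5 * K * dr i"
        using path(3)[OF i(1) j] dist_triangle2[of y "path i j" "rep i"] K1 p dist_commute[of "rep i" "path i j"] by linarith
      also have "\<dots> = 160 * K ^ 2 * dr i / (32 * K)" using K by (simp add: power2_eq_square)
      also have "\<dots> \<le> 2 ^ m0 * \<theta> * dr i / (32 * K)"
        using m0(1) p K by (intro divide_right_mono mult_right_mono) auto
      also have "\<dots> = 2 ^ m0 * u / 2" by (simp add: u_def lp_def)
      finally show "y \<in> cube (path i j) (2 ^ m0 * u)" by (rule mem_cubeI)
    qed
    then have "wt (cell i) \<le> Cw ^ Suc m0 * wt (ccube (path i j) u)" by (rule wt_le_ccube[OF u(1)])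
    then have "\<bar>e k - e (Suc k)\<bar> powr q * wt (cell i) \<le> \<bar>e k - e (Suc k)\<bar> powr q * (Cw ^ Suc m0 * wt (ccube (path i j) u))"
      by (intro mult_left_mono) auto
    also have "\<dots> = Cw ^ Suc m0 * (\<bar>e k - e (Suc k)\<bar> powr q * wt (ccube (path i j) u))" by simp
    also have "\<dots> \<le> Cw ^ Suc m0 * (2 powr q * (2 * bd i))"
      using Cw by (intro mult_left_mono link[OF S1 S2 sets_ccube ccube_subset_cube osc_e osc_e bd_nonneg]) auto
    finally show ?thesis .
  qed
  then have "\<bar>e 0 - e (steps + 2)\<bar> powr q * wt (cell i) \<le> real (steps + 2) powr q * (Cw ^ Suc m0 * (2 powr q * (2 * bd i)))"
    using pq wt_nonneg by (intro chain_powr_le) auto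
  then show ?thesis by (simp add: e_def)
qed

lemma bd_eq:
  assumes "i \<in> I"
  shows "\<phi> (dr i) * bd i = (2 + 8 * K) powr (\<gamma> * q) * L * (wgt (dr i) * E i) powr (q / p)"
proof -
  have p: "0 < dr i" by (rule dr_pos[OF assms])
  have "(wgt (dr i) * E i) powr (q / p) = (dr i powr (\<gamma> * q) * \<phi> (dr i)) * E i powr (q / p)"
    unfolding wgt_powr[OF p, symmetric] by (rule powr_mult)
  moreover have "((2 + 8 * K) * dr i) powr (\<gamma> * q) = (2 + 8 * K) powr (\<gamma> * q) * dr i powr (\<gamma> * q)"
    by (rule powr_mult)
  ultimately show ?thesis by (simp add: bd_def mult_ac)
qed

definition b :: "int \<times> ('n \<Rightarrow> int) \<Rightarrow> real" where "b i = \<bar>cst i - cst (par i)\<bar>"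

definition F :: "int \<times> ('n \<Rightarrow> int) \<Rightarrow> real" where "F i = (\<Sum>m<rk i. b ((par ^^ m) i))"

lemma b_nonneg: "0 \<le> b i" by (simp add: b_def)

lemma F_nonneg: "0 \<le> F i" unfolding F_def by (intro sum_nonneg b_nonneg)

lemma F_rec: "i \<in> I \<Longrightarrow> i \<noteq> rt \<Longrightarrow> F i = b i + F (par i)"
  unfolding F_def rk_par sum.lessThan_Suc_shift by (simp add: funpow_swap1)

lemma cst_diff_le: "i \<in> I \<Longrightarrow> \<bar>cst i - cst rt\<bar> \<le> F i"
proof (induction "rk i" arbitrary: i rule: less_induct)
  case less
  show ?case
  proof (cases "i = rt")
    case False
    have "\<bar>cst (par i) - cst rt\<bar> \<le> F (par i)"
      using less(2) rk_par[OF less(2) False] by (intro less(1) par_I) auto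
    then show ?thesis using F_rec[OF less(2) False] by (simp add: b_def)
  qed (simp add: F_nonneg)
qed

lemma edge_om:
  assumes "i \<in> I"
  shows "om i * b i powr q \<le> C2 * L * (wgt (dr i) * E i) powr (q / p)"
proof (cases "i = rt")
  case True
  then show ?thesis using pq C2_nonneg L by (simp add: b_def)
next
  case False
  have "om i * b i powr q = \<phi> (dr i) * (\<bar>cst i - cst (par i)\<bar> powr q * wt (cell i))" by (simp add: om_def b_def)
  also have "\<dots> \<le> \<phi> (dr i) * (real (steps + 2) powr q * (Cw ^ Suc m0 * (2 powr q * (2 * bd i))))"
    by (intro mult_left_mono edge[OF assms False] \<phi>_nonneg)
  also have "\<dots> = real (steps + 2) powr q * (Cw ^ Suc m0 * (2 powr q * (2 * (\<phi> (dr i) * bd i))))" by simp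
  also have "\<dots> = C2 * L * (wgt (dr i) * E i) powr (q / p)"
    unfolding bd_eq[OF assms] C2_def by simp
  finally show ?thesis .
qed

lemma sum_energy_powr:
  assumes J: "finite J" "J \<subseteq> I"
  shows "(\<Sum>i\<in>J. (wgt (dr i) * E i) powr (q / p)) \<le> (C1 * real N) powr (q / p) * Y powr (q / p)"
proof -
  have "(\<Sum>i\<in>J. (wgt (dr i) * E i) powr (q / p)) \<le> (\<Sum>i\<in>J. wgt (dr i) * E i) powr (q / p)"
    using J pq by (intro sum_powr_le_powr_sum) (auto simp: wgt_nonneg E_nonneg)
  also have "\<dots> \<le> (C1 * real N * Y) powr (q / p)"
    using energy_sum[OF J] pq by (intro powr_mono2 sum_nonneg) (auto simp: wgt_nonneg E_nonneg)
  also have "\<dots> = (C1 * real N) powr (q / p) * Y powr (q / p)" by (rule powr_mult)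
  finally show ?thesis .
qed

text \<open>On a cell, f - \<open>cst rt\<close> splits into f - \<open>cst i\<close>, controlled by
  the local estimate, and a difference of constants of size at most \<open>F i\<close>, controlled
  by the tree inequality. Both lead to sums of q/p-th powers of weighted energies, which
  superadditivity bounds by the power of the total. Closedness under parents makes J a tree of its
  own.\<close>

lemma finite_sum_bound:
  assumes J: "finite J" "J \<subseteq> I" and closed: "\<And>i. i \<in> J \<Longrightarrow> par i \<in> J"
  shows "(\<Sum>i\<in>J. \<integral>\<^sup>+x\<in>cell i. ennreal (\<bar>f x - cst rt\<bar> powr q * (\<phi> (d x) * w x)) \<partial>lebesgue) \<le> ennreal (C4 * L * Y powr (q / p))"
proof -
  define kk where "kk = (2 + 8 * K) powr (\<gamma> * q)"
  define SE where "SE = (\<Sum>i\<in>J. (wgt (dr i) * E i) powr (q / p))"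
  have JI: "i \<in> I" if "i \<in> J" for i using J that by auto
  have "(\<Sum>i\<in>J. om i * F i powr q) \<le> 2 * (2 * q * C3) powr q * (\<Sum>i\<in>J. om i * b i powr q)"
  proof (rule tree_hardy[where rk = rk and rt = rt and par = par])
    show "F rt = 0" by (simp add: F_def)
    show "rk (par i) < rk i" if "i \<in> J" "i \<noteq> rt" for i using rk_par[OF JI] that by simp
    show "F i = b i + F (par i)" if "i \<in> J" "i \<noteq> rt" for i using F_rec[OF JI] that by simp
    show "(\<Sum>i | i \<in> J \<and> (\<exists>m. (par ^^ m) i = j). om i) \<le> C3 * om j" if "j \<in> J" "j \<noteq> rt" for j
      by (rule shadow_sum[OF J that])
  qed (use J closed pq C3_nonneg in \<open>auto simp: b_nonneg F_nonneg om_nonneg\<close>)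
  also have "\<dots> \<le> 2 * (2 * q * C3) powr q * (\<Sum>i\<in>J. C2 * L * (wgt (dr i) * E i) powr (q / p))"
    using JI by (intro mult_left_mono sum_mono edge_om) auto
  also have "\<dots> = 2 * (2 * q * C3) powr q * (C2 * L * SE)" by (simp add: SE_def sum_distrib_left)
  finally have H: "(\<Sum>i\<in>J. om i * F i powr q) \<le> 2 * (2 * q * C3) powr q * (C2 * L * SE)" .
  have cell: "(\<integral>\<^sup>+x\<in>cell i. ennreal (\<bar>f x - cst rt\<bar> powr q * (\<phi> (d x) * w x)) \<partial>lebesgue)
      \<le> ennreal (C\<phi> * (2 powr q * (kk * L * (wgt (dr i) * E i) powr (q / p) + om i * F i powr q)))" if i: "i \<in> J" for i
  proof -
    have iI: "i \<in> I" by (rule JI[OF i])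
    have [measurable]: "cell i \<in> sets lebesgue" by (simp add: cell_def)
    define k where "k = C\<phi> * \<phi> (dr i) * 2 powr q"
    have k: "0 \<le> k" using C\<phi> \<phi>_nonneg by (simp add: k_def)
    have "(\<integral>\<^sup>+x\<in>cell i. ennreal (\<bar>f x - cst rt\<bar> powr q * (\<phi> (d x) * w x)) \<partial>lebesgue)
      \<le> (\<integral>\<^sup>+x. ennreal k * (ennreal (\<bar>f x - cst i\<bar> powr q * w x) * indicator (cell i) x + ennreal (F i powr q) * (ennreal (w x) * indicator (cell i) x)) \<partial>lebesgue)"
    proof (rule nn_integral_mono)
      fix x
      show "ennreal (\<bar>f x - cst rt\<bar> powr q * (\<phi> (d x) * w x)) * indicator (cell i) x
        \<le> ennreal k * (ennreal (\<bar>f x - cst i\<bar> powr q * w x) * indicator (cell i) x + ennreal (F i powr q) * (ennreal (w x) * indicator (cell i) x))"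
      proof (cases "x \<in> cell i")
        case True
        have "d x \<le> 2 * dr i" using ccube_bounds(4)[OF rep(1)[OF iI] order_refl] True by (simp add: cell_def)
        then have 1: "\<phi> (d x) \<le> C\<phi> * \<phi> (dr i)" using \<phi>_le \<phi>_dbl[OF dr_pos[OF iI]] by (meson order_trans)
        have "\<bar>(f x - cst i) + (cst i - cst rt)\<bar> powr q \<le> 2 powr q * (\<bar>f x - cst i\<bar> powr q + \<bar>cst i - cst rt\<bar> powr q)"
          using pq by (intro abs_add_powr_le) simp
        also have "\<dots> \<le> 2 powr q * (\<bar>f x - cst i\<bar> powr q + F i powr q)"
          using pq cst_diff_le[OF iI] by (intro mult_left_mono add_left_mono powr_mono2) auto
        finally have "\<bar>f x - cst rt\<bar> powr q * (\<phi> (d x) * w x) \<le> (2 powr q * (\<bar>f x - cst i\<bar> powr q + F i powr q)) * (C\<phi> * \<phi> (dr i) * w x)"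
          using 1 w_nonneg \<phi>_nonneg C\<phi> by (intro mult_mono mult_nonneg_nonneg) auto
        also have "\<dots> = k * (\<bar>f x - cst i\<bar> powr q * w x + F i powr q * w x)" by (simp add: k_def algebra_simps)
        finally have "ennreal (\<bar>f x - cst rt\<bar> powr q * (\<phi> (d x) * w x)) \<le> ennreal (k * (\<bar>f x - cst i\<bar> powr q * w x + F i powr q * w x))"
          by (rule ennreal_leI)
        also have "\<dots> = ennreal k * (ennreal (\<bar>f x - cst i\<bar> powr q * w x) + ennreal (F i powr q) * ennreal (w x))"
          using k w_nonneg by (simp add: ennreal_mult)
        finally show ?thesis using True by simp
      qed simp
    qed
    also have "\<dots> = ennreal k * (\<integral>\<^sup>+x. ennreal (\<bar>f x - cst i\<bar> powr q * w x) * indicator (cell i) x + ennreal (F i powr q) * (ennreal (w x) * indicator (cell i) x) \<partial>lebesgue)"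
      by (intro nn_integral_cmult) measurable
    also have "\<dots> = ennreal k * (osc (cell i) (cst i) + (\<integral>\<^sup>+x. ennreal (F i powr q) * (ennreal (w x) * indicator (cell i) x) \<partial>lebesgue))"
      unfolding osc_def
      by (intro arg_cong[where f = "\<lambda>t. ennreal k * t"] nn_integral_add) measurable
    also have "(\<integral>\<^sup>+x. ennreal (F i powr q) * (ennreal (w x) * indicator (cell i) x) \<partial>lebesgue) = ennreal (F i powr q) * (\<integral>\<^sup>+x\<in>cell i. ennreal (w x) \<partial>lebesgue)"
      by (intro nn_integral_cmult) measurable
    also have "ennreal k * (osc (cell i) (cst i) + ennreal (F i powr q) * (\<integral>\<^sup>+x\<in>cell i. ennreal (w x) \<partial>lebesgue)) \<le> ennreal k * (ennreal (bd i) + ennreal (F i powr q) * ennreal (wt (cell i)))"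
      using osc_cell[OF iI] wt_eq[OF ccube_subset_cube, of "rep i" "\<theta> * dr i"]
      by (intro mult_left_mono add_mono) (auto simp: cell_def)
    also have "\<dots> = ennreal (k * (bd i + F i powr q * wt (cell i)))"
      using k bd_nonneg wt_nonneg by (simp add: ennreal_mult)
    also have "k * (bd i + F i powr q * wt (cell i)) = C\<phi> * (2 powr q * (\<phi> (dr i) * bd i + om i * F i powr q))"
      by (simp add: k_def om_def algebra_simps)
    finally show ?thesis unfolding bd_eq[OF iI] kk_def .
  qed
  have "(\<Sum>i\<in>J. \<integral>\<^sup>+x\<in>cell i. ennreal (\<bar>f x - cst rt\<bar> powr q * (\<phi> (d x) * w x)) \<partial>lebesgue)
      \<le> (\<Sum>i\<in>J. ennreal (C\<phi> * (2 powr q * (kk * L * (wgt (dr i) * E i) powr (q / p) + om i * F i powr q))))"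
    by (intro sum_mono cell)
  also have "\<dots> = ennreal (\<Sum>i\<in>J. C\<phi> * (2 powr q * (kk * L * (wgt (dr i) * E i) powr (q / p) + om i * F i powr q)))"
    using C\<phi> L om_nonneg by (intro sum_ennreal mult_nonneg_nonneg add_nonneg_nonneg) (auto simp: kk_def)
  also have "(\<Sum>i\<in>J. C\<phi> * (2 powr q * (kk * L * (wgt (dr i) * E i) powr (q / p) + om i * F i powr q)))
      = C\<phi> * (2 powr q * (kk * L * SE + (\<Sum>i\<in>J. om i * F i powr q)))"
    by (simp add: SE_def sum_distrib_left sum.distrib distrib_left)
  also have "\<dots> \<le> C\<phi> * (2 powr q * (kk * L * SE + 2 * (2 * q * C3) powr q * (C2 * L * SE)))"
    using C\<phi> H by (intro mult_left_mono add_left_mono) auto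
  also have "\<dots> = C\<phi> * (2 powr q * ((kk + 2 * (2 * q * C3) powr q * C2) * L * SE))" by (simp add: algebra_simps)
  also have "\<dots> \<le> C\<phi> * (2 powr q * ((kk + 2 * (2 * q * C3) powr q * C2) * L * ((C1 * real N) powr (q / p) * Y powr (q / p))))"
    using C\<phi> L C2_nonneg sum_energy_powr[OF J] unfolding SE_def kk_def by (intro mult_left_mono mult_nonneg_nonneg add_nonneg_nonneg) auto
  also have "\<dots> = C4 * L * Y powr (q / p)" by (simp add: C4_def kk_def mult_ac)
  finally show ?thesis by (simp add: ennreal_leI)
qed

text \<open>The bound on finite families does not depend on the family, so it passes to all cells by
  monotone convergence, and the cells cover the domain.\<close>

lemma global: "(\<integral>\<^sup>+x\<in>\<Omega>. ennreal (\<bar>f x - cst rt\<bar> powr q * (\<phi> (d x) * w x)) \<partial>lebesgue) \<le> ennreal (C4 * L * Y powr (q / p))"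
proof -
  define h where "h x = ennreal (\<bar>f x - cst rt\<bar> powr q * (\<phi> (d x) * w x))" for x
  have h [measurable]: "h \<in> borel_measurable lebesgue" unfolding h_def by measurable
  have I: "countable I" "I \<noteq> {}" using rt_I by auto
  \<comment> \<open>The first n labels in an enumeration, together with all their ancestors up to
    the root: finite, closed under parents, and increasing with n.\<close>
  define J where "J n = (\<Union>k<n. (\<lambda>m. (par ^^ m) (from_nat_into I k)) ` {..rk (from_nat_into I k)})" for n
  have inI: "(par ^^ m) i \<in> I" if "i \<in> I" for i m using that par_I by (induction m) auto
  have fI: "from_nat_into I k \<in> I" for k by (rule from_nat_into[OF I(2)])
  have J1: "finite (J n)" "J n \<subseteq> I" for n using inI[OF fI] by (auto simp: J_def)
  have J2: "par i \<in> J n" if "i \<in> J n" for i n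
  proof -
    from that obtain k m where k: "k < n" "m \<le> rk (from_nat_into I k)" "i = (par ^^ m) (from_nat_into I k)" by (auto simp: J_def)
    show ?thesis
    proof (cases "m = rk (from_nat_into I k)")
      case True
      then have "i = rt" using k(3) rk[OF fI] by simp
      then show ?thesis using that by simp
    next
      case False
      then have "par i = (par ^^ Suc m) (from_nat_into I k)" "Suc m \<le> rk (from_nat_into I k)" using k by auto
      then show ?thesis using k(1) unfolding J_def by blast
    qed
  qed
  define U where "U n = (\<Union>i\<in>J n. cell i)" for n
  have U: "U n \<in> sets lebesgue" for n unfolding U_def using J1 by (intro sets.finite_UN) (auto simp: cell_def)
  have U_mono: "incseq (\<lambda>n x. h x * indicator (U n) x)"
  proof (intro incseq_SucI le_funI)
    fix n x
    have "U n \<subseteq> U (Suc n)" unfolding U_def J_def by (auto simp: less_Suc_eq)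
    then show "h x * indicator (U n) x \<le> h x * indicator (U (Suc n)) x" by (auto simp: indicator_def)
  qed
  have "(\<integral>\<^sup>+x\<in>\<Omega>. h x \<partial>lebesgue) \<le> (\<integral>\<^sup>+x. (SUP n. h x * indicator (U n) x) \<partial>lebesgue)"
  proof (rule nn_integral_mono)
    fix x
    show "h x * indicator \<Omega> x \<le> (SUP n. h x * indicator (U n) x)"
    proof (cases "x \<in> \<Omega>")
      case True
      then have i: "idx x \<in> I" by (simp add: I_def)
      then obtain k where k: "from_nat_into I k = idx x" using from_nat_into_surj[OF I(1)] by blast
      then have "idx x = (par ^^ 0) (from_nat_into I k)" by simp
      then have "idx x \<in> J (Suc k)" unfolding J_def by blast
      then have "x \<in> U (Suc k)" using mem_cell[OF True] by (auto simp: U_def)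
      then have "h x * indicator \<Omega> x \<le> h x * indicator (U (Suc k)) x" using True by simp
      then show ?thesis by (meson SUP_upper2 UNIV_I)
    qed simp
  qed
  also have "\<dots> = (SUP n. \<integral>\<^sup>+x\<in>U n. h x \<partial>lebesgue)"
    using U_mono U h by (intro nn_integral_monotone_convergence_SUP borel_measurable_times borel_measurable_indicator) auto
  also have "\<dots> \<le> ennreal (C4 * L * Y powr (q / p))"
  proof (rule SUP_least)
    fix n
    have "(\<integral>\<^sup>+x\<in>U n. h x \<partial>lebesgue) \<le> (\<integral>\<^sup>+x. (\<Sum>i\<in>J n. h x * indicator (cell i) x) \<partial>lebesgue)"
    proof (rule nn_integral_mono)
      fix x
      show "h x * indicator (U n) x \<le> (\<Sum>i\<in>J n. h x * indicator (cell i) x)"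
      proof (cases "x \<in> U n")
        case True
        then obtain i where i: "i \<in> J n" "x \<in> cell i" by (auto simp: U_def)
        have "h x * indicator (cell i) x \<le> (\<Sum>i\<in>J n. h x * indicator (cell i) x)"
          using J1(1) i(1) by (intro member_le_sum) auto
        then show ?thesis using True i by simp
      qed simp
    qed
    also have "\<dots> = (\<Sum>i\<in>J n. \<integral>\<^sup>+x\<in>cell i. h x \<partial>lebesgue)"
    proof (rule nn_integral_sum)
      fix i
      have [measurable]: "cell i \<in> sets lebesgue" by (simp add: cell_def)
      show "(\<lambda>x. h x * indicator (cell i) x) \<in> borel_measurable lebesgue" by measurable
    qed
    also have "\<dots> \<le> ennreal (C4 * L * Y powr (q / p))"
      unfolding h_def by (rule finite_sum_bound[OF J1 J2], assumption)
    finally show "(\<integral>\<^sup>+x\<in>U n. h x \<partial>lebesgue) \<le> ennreal (C4 * L * Y powr (q / p))" .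
  qed
  finally show ?thesis by (simp add: h_def)
qed

end

section \<open>Two-sided cube estimates and their application in the domain\<close>

text \<open>The one-sided estimates for f and for -f are taken about the same median c, so that
  together they control |f - c|. This doubles the constant.\<close>

lemma nn_integral_abs_powr_le:
  fixes f w :: "'a \<Rightarrow> real"
  assumes [measurable]: "f \<in> borel_measurable M" "w \<in> borel_measurable M" "A \<in> sets M"
    and w: "\<And>x. 0 \<le> w x" and q: "0 < q" and B: "0 \<le> B"
    and up: "(\<integral>\<^sup>+x\<in>A. ennreal (max 0 (f x - c) powr q * w x) \<partial>M) \<le> ennreal B"
    and lo: "(\<integral>\<^sup>+x\<in>A. ennreal (max 0 (- f x - (- c)) powr q * w x) \<partial>M) \<le> ennreal B"
  shows "(\<integral>\<^sup>+x\<in>A. ennreal (\<bar>f x - c\<bar> powr q * w x) \<partial>M) \<le> ennreal (2 * B)"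
proof -
  have split: "\<bar>f x - c\<bar> powr q * w x = max 0 (f x - c) powr q * w x + max 0 (- f x - (- c)) powr q * w x" for x
    using q by (cases "c \<le> f x") (auto simp: max_def abs_if)
  have "(\<integral>\<^sup>+x\<in>A. ennreal (\<bar>f x - c\<bar> powr q * w x) \<partial>M)
    = (\<integral>\<^sup>+x. ennreal (max 0 (f x - c) powr q * w x) * indicator A x + ennreal (max 0 (- f x - (- c)) powr q * w x) * indicator A x \<partial>M)"
    unfolding split by (intro nn_integral_cong) (auto simp: w indicator_def ennreal_plus)
  also have "\<dots> = (\<integral>\<^sup>+x\<in>A. ennreal (max 0 (f x - c) powr q * w x) \<partial>M) + (\<integral>\<^sup>+x\<in>A. ennreal (max 0 (- f x - (- c)) powr q * w x) \<partial>M)"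
    by (intro nn_integral_add) measurable
  also have "\<dots> \<le> ennreal B + ennreal B" by (intro add_mono up lo)
  also have "\<dots> = ennreal (2 * B)" using B by (simp flip: ennreal_plus)
  finally show ?thesis .
qed

lemma hcube_median:
  fixes f :: "real ^ 'n \<Rightarrow> real"
  assumes "0 < l" "f \<in> borel_measurable lebesgue"
  shows "\<exists>c. measure lebesgue {x \<in> hcube a l. c < f x} \<le> measure lebesgue (hcube a l) / 2
    \<and> measure lebesgue {x \<in> hcube a l. - c < - f x} \<le> measure lebesgue (hcube a l) / 2"
proof -
  have "0 < measure lebesgue (hcube a l)" using assms(1) by (simp add: measure_hcube del: measure_completion)
  from median_exists[OF assms(2) lmeasurable_hcube this] show ?thesis by simp
qed

lemma cbox_eq_cube: "cbox (z - vec (l / 2)) (z - vec (l / 2) + vec l) = cube z l"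
  using cube_corner[of "z - vec (l / 2)" l] by simp

lemma powr_split_factor:
  fixes a l \<gamma> q :: real
  shows "(a * l powr \<gamma>) powr q = a powr q * l powr (\<gamma> * q)"
  by (simp add: powr_mult powr_powr)

lemma cube_frac_poincare:
  fixes \<Omega> :: "(real ^ 'n) set" and f w v :: "real ^ 'n \<Rightarrow> real" and p q r s A :: real
  defines "L \<equiv> 2 * (2 powr q * (2 * (1 + 2 powr q) * (2 / stop_eps CARD('n) q r * 2 powr (1 / p) * real CARD('n) powr (real CARD('n) / p + s) * A) powr q))"
  assumes l: "0 < l" and sub: "cube z l \<subseteq> \<Omega>"
    and exps: "1 < p" "p \<le> q" "1 < r" "0 \<le> \<gamma>" "0 < s" and A: "A_const \<Omega> (s - \<gamma>) r q p w v \<le> ennreal A" "0 \<le> A"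
    and w: "w \<in> borel_measurable lebesgue" "\<And>x. 0 \<le> w x"
    and v: "v \<in> borel_measurable lebesgue" "\<And>x. 0 \<le> v x"
    and f[measurable]: "f \<in> borel_measurable lebesgue"
    and T: "0 \<le> T" "(\<integral>\<^sup>+y\<in>ccube z l. ennreal (v y) * (\<integral>\<^sup>+x\<in>ccube z l. ennreal (frac_kernel s p f x y) \<partial>lebesgue) \<partial>lebesgue) \<le> ennreal T"
  shows "\<exists>c. (\<integral>\<^sup>+x\<in>ccube z l. ennreal (\<bar>f x - c\<bar> powr q * w x) \<partial>lebesgue) \<le> ennreal (L * l powr (\<gamma> * q) * T powr (q / p))"
proof -
  obtain c where c: "measure lebesgue {x \<in> ccube z l. c < f x} \<le> measure lebesgue (ccube z l) / 2"
      "measure lebesgue {x \<in> ccube z l. - c < - f x} \<le> measure lebesgue (ccube z l) / 2"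
    using hcube_median[OF l f, of "z - vec (l / 2)"] unfolding ccube_def by blast
  have f': "(\<lambda>x. - f x) \<in> borel_measurable lebesgue" by measurable
  have ker: "frac_kernel s p (\<lambda>x. - f x) = frac_kernel s p f"
    by (simp add: frac_kernel_def fun_eq_iff abs_minus_commute)
  note pars = l sub[folded cbox_eq_cube] exps A w v
  note up = cube_frac_one_sided[OF pars f c(1)[unfolded ccube_def] T[unfolded ccube_def], folded ccube_def]
  note lo = cube_frac_one_sided[OF pars f' c(2)[unfolded ccube_def] T(1) T(2)[unfolded ccube_def, folded ker], folded ccube_def]
  have "(\<integral>\<^sup>+x\<in>ccube z l. ennreal (\<bar>f x - c\<bar> powr q * w x) \<partial>lebesgue) \<le> ennreal (2 * (2 powr q * (2 * (1 + 2 powr q) *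
      (2 / stop_eps CARD('n) q r * 2 powr (1 / p) * real CARD('n) powr (real CARD('n) / p + s) * A * l powr \<gamma>) powr q * T powr (q / p))))"
    using exps by (intro nn_integral_abs_powr_le[OF f w(1) sets_ccube w(2) _ _ up lo]) auto
  also have "2 * (2 powr q * (2 * (1 + 2 powr q) *
      (2 / stop_eps CARD('n) q r * 2 powr (1 / p) * real CARD('n) powr (real CARD('n) / p + s) * A * l powr \<gamma>) powr q * T powr (q / p)))
      = L * l powr (\<gamma> * q) * T powr (q / p)"
    unfolding L_def powr_split_factor by (simp only: mult_ac)
  finally show ?thesis by blast
qed

lemma is_weak_gradient_uminus:
  assumes "is_weak_gradient \<Omega> f g"
  shows "is_weak_gradient \<Omega> (\<lambda>x. - f x) (\<lambda>x. - g x)"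
  using assms unfolding is_weak_gradient_def locally_integrable_on_def set_lebesgue_integral_def set_integrable_def
  by simp

lemma cube_grad_poincare:
  fixes \<Omega> :: "(real ^ 'n) set" and f w v :: "real ^ 'n \<Rightarrow> real" and g :: "real ^ 'n \<Rightarrow> real ^ 'n" and p q r A :: real
  defines "L \<equiv> 2 * (2 powr q * (2 * (1 + 2 powr q) * (4 * real CARD('n) * 2 ^ CARD('n) / stop_eps CARD('n) q r * A) powr q * 2 powr (q / p)))"
  assumes l: "0 < l" and sub: "cube z l \<subseteq> \<Omega>"
    and exps: "1 < p" "p \<le> q" "1 < r" "0 \<le> \<gamma>" and A: "A_const \<Omega> (1 - \<gamma>) r q p w v \<le> ennreal A" "0 \<le> A"
    and w: "w \<in> borel_measurable lebesgue" "\<And>x. 0 \<le> w x"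
    and v: "v \<in> borel_measurable lebesgue" "\<And>x. 0 \<le> v x"
    and f[measurable]: "f \<in> borel_measurable lebesgue"
    and wg: "is_weak_gradient \<Omega> f g"
    and T: "0 \<le> T" "(\<integral>\<^sup>+x\<in>ccube z l. ennreal (norm (g x) powr p * v x) \<partial>lebesgue) \<le> ennreal T"
  shows "\<exists>c. (\<integral>\<^sup>+x\<in>ccube z l. ennreal (\<bar>f x - c\<bar> powr q * w x) \<partial>lebesgue) \<le> ennreal (L * l powr (\<gamma> * q) * T powr (q / p))"
proof -
  obtain c where c: "measure lebesgue {x \<in> ccube z l. c < f x} \<le> measure lebesgue (ccube z l) / 2"
      "measure lebesgue {x \<in> ccube z l. - c < - f x} \<le> measure lebesgue (ccube z l) / 2"
    using hcube_median[OF l f, of "z - vec (l / 2)"] unfolding ccube_def by blast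
  have f': "(\<lambda>x. - f x) \<in> borel_measurable lebesgue" by measurable
  have T': "(\<integral>\<^sup>+x\<in>ccube z l. ennreal (norm (- g x) powr p * v x) \<partial>lebesgue) \<le> ennreal T" using T(2) by simp
  note pars = l sub[folded cbox_eq_cube] exps A w v
  note up = cube_grad_one_sided[OF pars f c(1)[unfolded ccube_def] wg T[unfolded ccube_def], folded ccube_def]
  note lo = cube_grad_one_sided[OF pars f' c(2)[unfolded ccube_def] is_weak_gradient_uminus[OF wg] T(1) T'[unfolded ccube_def], folded ccube_def]
  have "(\<integral>\<^sup>+x\<in>ccube z l. ennreal (\<bar>f x - c\<bar> powr q * w x) \<partial>lebesgue) \<le> ennreal (2 * (2 powr q * (2 * (1 + 2 powr q) *
      (4 * real CARD('n) * 2 ^ CARD('n) / stop_eps CARD('n) q r * A * l powr \<gamma>) powr q * (2 * T) powr (q / p))))"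
    using exps by (intro nn_integral_abs_powr_le[OF f w(1) sets_ccube w(2) _ _ up lo]) auto
  also have "2 * (2 powr q * (2 * (1 + 2 powr q) *
      (4 * real CARD('n) * 2 ^ CARD('n) / stop_eps CARD('n) q r * A * l powr \<gamma>) powr q * (2 * T) powr (q / p)))
      = L * l powr (\<gamma> * q) * T powr (q / p)"
    unfolding L_def powr_split_factor powr_mult[of 2 T] by (simp only: mult_ac)
  finally show ?thesis by blast
qed

context john_domain
begin

lemma cube_subset_dom:
  assumes z: "z \<in> \<Omega>" and l: "l \<le> \<theta> * d z"
  shows "cube z l \<subseteq> \<Omega>"
proof
  fix y assume y: "y \<in> cube z l"
  have "norm (y - z) \<le> (\<Sum>i\<in>(UNIV::'n set). l / 2)"
    using y unfolding mem_cube by (intro order_trans[OF norm_le_l1_cart] sum_mono) simp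
  also have "\<dots> \<le> real CARD('n) * (\<theta> * d z / 2)" using l by (simp add: mult_left_mono)
  also have "\<dots> = (real CARD('n) * \<theta>) * (d z / 2)" by simp
  also have "\<dots> \<le> 1 / 16 * (d z / 2)" using theta_n d_pos[OF z] by (intro mult_right_mono) auto
  finally show "y \<in> \<Omega>" using d_pos[OF z] by (intro in_domI[OF z]) (simp add: dist_norm norm_minus_commute)
qed

text \<open>A cell lies in the ball around each of its points, so double integrals over the cell are
  part of the restricted seminorm. The radius is (\<tau> / 2) d(y) and not \<tau> d(y): this gives
  d(x) \<ge> d(y)/2 on the ball for every admissible \<tau>, which is used for the minimum
  weight.\<close>

lemma ccube_subset_ball:
  assumes \<theta>\<tau>: "\<theta> \<le> \<tau> / (16 * real CARD('n))" and z: "z \<in> \<Omega>" and l: "l \<le> \<theta> * d z"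
    and xy: "x \<in> ccube z l" "y \<in> ccube z l"
  shows "x \<in> \<Omega> \<inter> ball y (\<tau> / 2 * d y)"
proof -
  have dz: "0 < d z" by (rule d_pos[OF z])
  have "0 < \<tau> / (16 * real CARD('n))" using \<theta>\<tau> \<theta>(1) by linarith
  then have \<tau>: "0 < \<tau>" by (simp add: zero_less_divide_iff)
  have n\<theta>: "real CARD('n) * \<theta> \<le> \<tau> / 16"
    using mult_left_mono[OF \<theta>\<tau>, of "real CARD('n)"] by simp
  have "norm (x - y) \<le> real CARD('n) * l" using xy unfolding ccube_def by (rule hcube_norm_diff_le)
  also have "\<dots> \<le> real CARD('n) * (\<theta> * d z)" using l by (intro mult_left_mono) auto
  also have "\<dots> = (real CARD('n) * \<theta>) * d z" by simp
  also have "\<dots> \<le> \<tau> / 16 * d z" using n\<theta> dz by (intro mult_right_mono) auto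
  also have "\<dots> \<le> \<tau> / 16 * (2 * d y)" using ccube_bounds(3)[OF z l xy(2)] \<tau> by (intro mult_left_mono) auto
  also have "\<dots> < \<tau> / 2 * d y" using \<tau> d_pos[OF ccube_bounds(2)[OF z l xy(2)]] by simp
  finally show ?thesis using ccube_bounds(2)[OF z l xy(1)] by (simp add: dist_norm norm_minus_commute)
qed

end

context weighted_john_domain
begin

text \<open>The factor \<open>m\<close> allows the energy to be bounded by a weight that is only a
  multiple of \<open>wgt\<close>; its power (1/m)^(q/p) goes into \<open>B\<close>. The constant
  \<open>B\<close> is fixed before f and Y.\<close>

lemma frac_global:
  fixes v :: "real ^ 'n \<Rightarrow> real"
  assumes v[measurable]: "v \<in> borel_measurable lebesgue" and v0: "\<And>x. 0 \<le> v x"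
    and A: "A_const \<Omega> (s - \<gamma>) r q p w v \<le> ennreal A" "0 \<le> A" and exps: "1 < r" "0 < s"
    and \<theta>\<tau>: "\<theta> \<le> \<tau> / (16 * real CARD('n))" and m: "0 < m"
  shows "\<exists>B\<ge>0. \<forall>f\<in>borel_measurable lebesgue. \<forall>Y\<ge>0.
    (\<integral>\<^sup>+y\<in>\<Omega>. (\<integral>\<^sup>+x\<in>\<Omega> \<inter> ball y (\<tau> / 2 * d y). ennreal (frac_kernel s p f x y * (m * wgt (d y) * v y)) \<partial>lebesgue) \<partial>lebesgue) \<le> ennreal Y \<longrightarrow>
    (\<exists>c. (\<integral>\<^sup>+x\<in>\<Omega>. ennreal (\<bar>f x - c\<bar> powr q * (\<phi> (d x) * w x)) \<partial>lebesgue) \<le> ennreal (B * Y powr (q / p)))"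
proof -
  define L where "L = 2 * (2 powr q * (2 * (1 + 2 powr q) * (2 / stop_eps CARD('n) q r * 2 powr (1 / p) * real CARD('n) powr (real CARD('n) / p + s) * A) powr q))"
  have L0: "0 \<le> L" by (simp add: L_def)
  interpret leb: sigma_finite_measure "lebesgue :: (real ^ 'n) measure" by (rule sigma_finite_lebesgue)
  have main: "\<exists>c. (\<integral>\<^sup>+x\<in>\<Omega>. ennreal (\<bar>f x - c\<bar> powr q * (\<phi> (d x) * w x)) \<partial>lebesgue) \<le> ennreal (C4 * L * (1 / m) powr (q / p) * Y powr (q / p))"
    if f[measurable]: "f \<in> borel_measurable lebesgue" and Y: "0 \<le> Y"
      and en: "(\<integral>\<^sup>+y\<in>\<Omega>. (\<integral>\<^sup>+x\<in>\<Omega> \<inter> ball y (\<tau> / 2 * d y). ennreal (frac_kernel s p f x y * (m * wgt (d y) * v y)) \<partial>lebesgue) \<partial>lebesgue) \<le> ennreal Y"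
    for f Y
  proof -
    define k where "k y x = ennreal (frac_kernel s p f x y) * indicator (\<Omega> \<inter> ball y (\<tau> / 2 * d y)) x" for y x
    define \<rho> where "\<rho> y = ennreal (v y) * (\<integral>\<^sup>+x. k y x \<partial>lebesgue)" for y
    have k_eq: "k y x = (if norm (x - y) < \<tau> / 2 * d y then ennreal (\<bar>f x - f y\<bar> powr p / norm (x - y) powr (real CARD('n) + s * p)) * indicator \<Omega> x else 0)" for y x
      by (auto simp: k_def frac_kernel_def dist_norm norm_minus_commute indicator_def)
    have k_pair: "case_prod k \<in> borel_measurable (lebesgue \<Otimes>\<^sub>M lebesgue)"
    proof -
      note norm_diff_measurable_pair_lebesgue[measurable]
      have "(\<lambda>z. if norm (snd z - fst z) < \<tau> / 2 * d (fst z) then ennreal (\<bar>f (snd z) - f (fst z)\<bar> powr p / norm (snd z - fst z) powr (real CARD('n) + s * p)) * indicator \<Omega> (snd z) else 0)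
        \<in> borel_measurable (lebesgue \<Otimes>\<^sub>M lebesgue)" by measurable
      then show ?thesis by (simp add: split_beta' k_eq)
    qed
    have k_int[measurable]: "(\<lambda>y. \<integral>\<^sup>+x. k y x \<partial>lebesgue) \<in> borel_measurable lebesgue"
      by (rule leb.borel_measurable_nn_integral[OF k_pair])
    have k_x: "k y \<in> borel_measurable lebesgue" for y
      using measurable_compose[OF measurable_Pair1' k_pair, of y] by simp
    have \<rho>[measurable]: "\<rho> \<in> borel_measurable lebesgue" unfolding \<rho>_def by measurable
    have wd[measurable]: "(\<lambda>x. wgt (d x)) \<in> borel_measurable lebesgue" unfolding wgt_def by measurable
    have inner: "(\<integral>\<^sup>+x\<in>\<Omega> \<inter> ball y (\<tau> / 2 * d y). ennreal (frac_kernel s p f x y * (m * wgt (d y) * v y)) \<partial>lebesgue)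
        = ennreal m * (\<rho> y * ennreal (wgt (d y)))" for y
    proof -
      have "(\<integral>\<^sup>+x\<in>\<Omega> \<inter> ball y (\<tau> / 2 * d y). ennreal (frac_kernel s p f x y * (m * wgt (d y) * v y)) \<partial>lebesgue)
          = (\<integral>\<^sup>+x. ennreal (m * wgt (d y) * v y) * k y x \<partial>lebesgue)"
      proof (rule nn_integral_cong)
        fix x
        have "ennreal (m * wgt (d y) * v y * frac_kernel s p f x y) = ennreal (m * wgt (d y) * v y) * ennreal (frac_kernel s p f x y)"
          using m v0 wgt_nonneg by (intro ennreal_mult) (simp_all add: frac_kernel_def)
        then show "ennreal (frac_kernel s p f x y * (m * wgt (d y) * v y)) * indicator (\<Omega> \<inter> ball y (\<tau> / 2 * d y)) x = ennreal (m * wgt (d y) * v y) * k y x"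
          unfolding k_def by (simp only: mult.assoc mult.commute[of "frac_kernel s p f x y"])
      qed
      also have "\<dots> = ennreal (m * wgt (d y) * v y) * (\<integral>\<^sup>+x. k y x \<partial>lebesgue)"
        by (rule nn_integral_cmult[OF k_x])
      also have "ennreal (m * wgt (d y) * v y) = ennreal m * (ennreal (wgt (d y)) * ennreal (v y))"
        using m v0 wgt_nonneg by (simp add: ennreal_mult mult.assoc)
      finally show ?thesis by (simp add: \<rho>_def mult_ac)
    qed
    have energy: "(\<integral>\<^sup>+y\<in>\<Omega>. \<rho> y * ennreal (wgt (d y)) \<partial>lebesgue) \<le> ennreal (Y / m)"
    proof -
      have "ennreal m * (\<integral>\<^sup>+y\<in>\<Omega>. \<rho> y * ennreal (wgt (d y)) \<partial>lebesgue) = (\<integral>\<^sup>+y. ennreal m * (\<rho> y * ennreal (wgt (d y)) * indicator \<Omega> y) \<partial>lebesgue)"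
        by (intro nn_integral_cmult[symmetric]) measurable
      also have "\<dots> \<le> ennreal Y" using en unfolding inner by (simp only: mult.assoc)
      finally have "ennreal (1 / m) * (ennreal m * (\<integral>\<^sup>+y\<in>\<Omega>. \<rho> y * ennreal (wgt (d y)) \<partial>lebesgue)) \<le> ennreal (1 / m) * ennreal Y"
        by (intro mult_left_mono) auto
      moreover have "ennreal (1 / m) * ennreal m = 1" using m by (simp flip: ennreal_mult)
      moreover have "ennreal (1 / m) * ennreal Y = ennreal (Y / m)" using m Y by (simp flip: ennreal_mult)
      ultimately show ?thesis by (simp flip: mult.assoc)
    qed
    \<comment> \<open>The density \<rho> integrates the kernel over the whole ball around y. Since
      this ball contains the cube for each y in it, the double integral over the cube is at most the
      integral of \<rho>, which is what the cube estimate asks for.\<close>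
    have "local_poincare \<Omega> x0 K \<theta> w \<phi> Cw C\<phi> p q \<gamma> f \<rho> L (Y / m)"
    proof unfold_locales
      fix z l T assume z: "z \<in> \<Omega>" and l: "0 < l" "l \<le> \<theta> * d z" and T: "0 \<le> T" "(\<integral>\<^sup>+x\<in>ccube z l. \<rho> x \<partial>lebesgue) \<le> ennreal T"
      have "(\<integral>\<^sup>+y\<in>ccube z l. ennreal (v y) * (\<integral>\<^sup>+x\<in>ccube z l. ennreal (frac_kernel s p f x y) \<partial>lebesgue) \<partial>lebesgue) \<le> (\<integral>\<^sup>+x\<in>ccube z l. \<rho> x \<partial>lebesgue)"
      proof (rule nn_integral_mono)
        fix y
        show "ennreal (v y) * (\<integral>\<^sup>+x\<in>ccube z l. ennreal (frac_kernel s p f x y) \<partial>lebesgue) * indicator (ccube z l) y \<le> \<rho> y * indicator (ccube z l) y"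
        proof (cases "y \<in> ccube z l")
          case True
          have "(\<integral>\<^sup>+x\<in>ccube z l. ennreal (frac_kernel s p f x y) \<partial>lebesgue) \<le> (\<integral>\<^sup>+x. k y x \<partial>lebesgue)"
          proof (rule nn_integral_mono)
            fix x
            show "ennreal (frac_kernel s p f x y) * indicator (ccube z l) x \<le> k y x"
              using ccube_subset_ball[OF \<theta>\<tau> z l(2) _ True, of x] unfolding k_def
              by (intro mult_left_mono) (auto simp: indicator_def)
          qed
          then show ?thesis using True by (simp add: \<rho>_def mult_left_mono)
        qed simp
      qed
      then show "\<exists>c. (\<integral>\<^sup>+x\<in>ccube z l. ennreal (\<bar>f x - c\<bar> powr q * w x) \<partial>lebesgue) \<le> ennreal (L * l powr (\<gamma> * q) * T powr (q / p))"
        unfolding L_def using cube_subset_dom[OF z l(2)] l pq exps \<gamma> A w_nonneg v0 T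
        by (intro cube_frac_poincare[where v = v and s = s and r = r and \<Omega> = \<Omega>]) (auto intro: order_trans)
    qed (use L0 Y m energy in auto)
    from local_poincare.global[OF this]
    have "\<exists>c. (\<integral>\<^sup>+x\<in>\<Omega>. ennreal (\<bar>f x - c\<bar> powr q * (\<phi> (d x) * w x)) \<partial>lebesgue) \<le> ennreal (C4 * L * (Y / m) powr (q / p))" by blast
    moreover have "C4 * L * (Y / m) powr (q / p) = C4 * L * (1 / m) powr (q / p) * Y powr (q / p)"
      using powr_mult[of "1 / m" Y "q / p"] by simp
    ultimately show ?thesis by simp
  qed
  show ?thesis
    by (rule exI[of _ "C4 * L * (1 / m) powr (q / p)"]) (use main C4_nonneg L0 in auto)
qed

lemma grad_global:
  fixes v :: "real ^ 'n \<Rightarrow> real"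
  assumes v[measurable]: "v \<in> borel_measurable lebesgue" and v0: "\<And>x. 0 \<le> v x"
    and A: "A_const \<Omega> (1 - \<gamma>) r q p w v \<le> ennreal A" "0 \<le> A" and exps: "1 < r"
  shows "\<exists>B\<ge>0. \<forall>f\<in>borel_measurable lebesgue. \<forall>g\<in>borel_measurable lebesgue. \<forall>Y\<ge>0. is_weak_gradient \<Omega> f g \<longrightarrow>
    (\<integral>\<^sup>+x\<in>\<Omega>. ennreal (norm (g x) powr p * (wgt (d x) * v x)) \<partial>lebesgue) \<le> ennreal Y \<longrightarrow>
    (\<exists>c. (\<integral>\<^sup>+x\<in>\<Omega>. ennreal (\<bar>f x - c\<bar> powr q * (\<phi> (d x) * w x)) \<partial>lebesgue) \<le> ennreal (B * Y powr (q / p)))"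
proof -
  define L where "L = 2 * (2 powr q * (2 * (1 + 2 powr q) * (4 * real CARD('n) * 2 ^ CARD('n) / stop_eps CARD('n) q r * A) powr q * 2 powr (q / p)))"
  have L0: "0 \<le> L" by (simp add: L_def)
  have main: "\<exists>c. (\<integral>\<^sup>+x\<in>\<Omega>. ennreal (\<bar>f x - c\<bar> powr q * (\<phi> (d x) * w x)) \<partial>lebesgue) \<le> ennreal (C4 * L * Y powr (q / p))"
    if f[measurable]: "f \<in> borel_measurable lebesgue" and g[measurable]: "g \<in> borel_measurable lebesgue" and Y: "0 \<le> Y" and wg: "is_weak_gradient \<Omega> f g"
      and en: "(\<integral>\<^sup>+x\<in>\<Omega>. ennreal (norm (g x) powr p * (wgt (d x) * v x)) \<partial>lebesgue) \<le> ennreal Y"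
    for f g Y
  proof -
    define \<rho> where "\<rho> x = ennreal (norm (g x) powr p * v x)" for x
    have \<rho>: "\<rho> \<in> borel_measurable lebesgue" unfolding \<rho>_def by measurable
    have "\<rho> x * ennreal (wgt (d x)) = ennreal (norm (g x) powr p * (wgt (d x) * v x))" for x
      unfolding \<rho>_def using v0 wgt_nonneg by (simp add: ennreal_mult mult_ac)
    then have energy: "(\<integral>\<^sup>+x\<in>\<Omega>. \<rho> x * ennreal (wgt (d x)) \<partial>lebesgue) \<le> ennreal Y" using en by simp
    have "local_poincare \<Omega> x0 K \<theta> w \<phi> Cw C\<phi> p q \<gamma> f \<rho> L Y"
    proof unfold_locales
      fix z l T assume z: "z \<in> \<Omega>" and l: "0 < l" "l \<le> \<theta> * d z" and T: "0 \<le> T" "(\<integral>\<^sup>+x\<in>ccube z l. \<rho> x \<partial>lebesgue) \<le> ennreal T"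
      show "\<exists>c. (\<integral>\<^sup>+x\<in>ccube z l. ennreal (\<bar>f x - c\<bar> powr q * w x) \<partial>lebesgue) \<le> ennreal (L * l powr (\<gamma> * q) * T powr (q / p))"
        unfolding L_def using cube_subset_dom[OF z l(2)] l pq exps \<gamma> A w_nonneg v0 T[unfolded \<rho>_def] wg
        by (intro cube_grad_poincare[where v = v and r = r and \<Omega> = \<Omega> and g = g]) auto
    qed (use L0 Y \<rho> energy in auto)
    from local_poincare.global[OF this] show ?thesis by blast
  qed
  show ?thesis
    by (rule exI[of _ "C4 * L"]) (use main C4_nonneg L0 in auto)
qed

end

subsection \<open>The Poincare-Sobolev inequality\<close>

text \<open>An open set is a countable union of compact sets, and on each of them local
  integrability provides measurability. The extension by zero is therefore measurable on the whole
  space.\<close>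

lemma locally_integrable_borel_measurable:
  fixes f :: "real ^ 'n \<Rightarrow> 'b :: euclidean_space"
  assumes f: "f locally_integrable_on S" and S: "open S"
  shows "(\<lambda>x. if x \<in> S then f x else 0) \<in> borel_measurable lebesgue"
proof -
  obtain C where C: "\<And>n :: nat. compact (C n)" "\<And>n. C n \<subseteq> S" "\<Union>(range C) = S"
    using open_Union_compact_subsets[OF S] by metis
  have setsC: "C n \<in> sets lebesgue" for n using C(1)[of n] by (simp add: borel_compact)
  show ?thesis
  proof (rule measurable_piecewise_restrict[where C = "insert (- S) (range C)"])
    show "D \<inter> space lebesgue \<in> sets lebesgue" if "D \<in> insert (- S) (range C)" for D
      using that setsC S by (auto simp: borel_open)
    show "(\<lambda>x. if x \<in> S then f x else 0) \<in> borel_measurable (restrict_space lebesgue D)" if "D \<in> insert (- S) (range C)" for D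
      using that
    proof
      assume "D = - S"
      then have "(\<lambda>x. if x \<in> S then f x else 0) \<in> borel_measurable (restrict_space lebesgue D) \<longleftrightarrow> (\<lambda>x. 0 :: 'b) \<in> borel_measurable (restrict_space lebesgue D)"
        by (intro measurable_cong) (auto simp: space_restrict_space)
      then show ?thesis by simp
    next
      assume "D \<in> range C"
      then obtain n where D: "D = C n" by blast
      have "f absolutely_integrable_on D" using f C(1,2) unfolding D locally_integrable_on_def by blast
      then have "f \<in> borel_measurable (restrict_space lebesgue D)"
        using absolutely_integrable_measurable[of D f] setsC D by simp
      moreover have "(\<lambda>x. if x \<in> S then f x else 0) \<in> borel_measurable (restrict_space lebesgue D) \<longleftrightarrow> f \<in> borel_measurable (restrict_space lebesgue D)"
        using C(2)[of n] D by (intro measurable_cong) (auto simp: space_restrict_space)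
      ultimately show ?thesis by simp
    qed
  qed (use C in auto)
qed

lemma A_const_cong:
  assumes "\<And>x. x \<in> \<Omega> \<Longrightarrow> v x = v' x"
  shows "A_const \<Omega> \<alpha> r q p w v = A_const \<Omega> \<alpha> r q p w v'"
proof -
  have "average (cube c l) (\<lambda>x. ennreal (v x) epowr e) = average (cube c l) (\<lambda>x. ennreal (v' x) epowr e)"
    if "cube c l \<subseteq> \<Omega>" for c l e
    unfolding average_def using that assms
    by (intro arg_cong2[where f = "(/)"] nn_integral_cong refl) (auto simp: indicator_def)
  then show ?thesis unfolding A_const_def by (intro SUP_cong refl) auto
qed

lemma is_weak_gradient_cong:
  assumes "\<Omega> \<in> sets lebesgue" "\<And>x. x \<in> \<Omega> \<Longrightarrow> f x = f' x" "\<And>x. x \<in> \<Omega> \<Longrightarrow> g x = g' x"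
  shows "is_weak_gradient \<Omega> f g \<longleftrightarrow> is_weak_gradient \<Omega> f' g'"
proof -
  have li: "h locally_integrable_on \<Omega> \<longleftrightarrow> h' locally_integrable_on \<Omega>" if "\<And>x. x \<in> \<Omega> \<Longrightarrow> h x = h' x"
    for h h' :: "real ^ 'a \<Rightarrow> 'b :: euclidean_space"
    unfolding locally_integrable_on_def using that by (metis (no_types, lifting) set_integrable_cong subsetD)
  have "(LINT x:\<Omega>|lebesgue. f x * pderiv_at i \<eta> x) = (LINT x:\<Omega>|lebesgue. f' x * pderiv_at i \<eta> x)"
    "(LINT x:\<Omega>|lebesgue. g x $ i * \<eta> x) = (LINT x:\<Omega>|lebesgue. g' x $ i * \<eta> x)" for \<eta> i
    using assms by (auto intro!: set_lebesgue_integral_cong)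
  then show ?thesis unfolding is_weak_gradient_def using li[OF assms(2)] li[OF assms(3)] by simp
qed

lemma epowr_mono:
  assumes "x \<le> y" "0 < a"
  shows "x epowr a \<le> y epowr a"
proof (cases "y = \<infinity>")
  case False
  then have "x \<noteq> \<infinity>" "enn2real x \<le> enn2real y" using assms(1) by (auto intro: enn2real_mono simp: less_top top_unique)
  then show ?thesis using assms(2) False by (auto simp: epowr_def intro!: ennreal_leI powr_mono2)
qed (use assms in \<open>simp add: epowr_def\<close>)

text \<open>Passes from bounds with finite energies Y to values in [0,\<infinity>]. The constant is
  raised to B + 1 so that it is positive: for infinite energy the product on the right must be
  \<infinity>, whereas 0 times \<infinity> would be 0.\<close>

lemma INF_epowr_le:
  fixes I :: "real \<Rightarrow> ennreal"
  assumes pq: "0 < p" "0 < q" and B: "0 \<le> B" and I: "\<And>Y. 0 \<le> Y \<Longrightarrow> J \<le> ennreal Y \<Longrightarrow> \<exists>c. I c \<le> ennreal (B * Y powr (q / p))"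
  shows "(INF c. I c epowr (1 / q)) \<le> ennreal ((B + 1) powr (1 / q)) * J epowr (1 / p)"
proof (cases "J = \<infinity>")
  case True
  then show ?thesis using pq B by (simp add: epowr_def ennreal_mult_top)
next
  case False
  define Y where "Y = enn2real J"
  have Y: "0 \<le> Y" "J = ennreal Y" using False by (auto simp: Y_def less_top)
  obtain c where c: "I c \<le> ennreal (B * Y powr (q / p))" using I[OF Y(1)] Y(2) by auto
  have "(INF c. I c epowr (1 / q)) \<le> I c epowr (1 / q)" by (rule INF_lower) simp
  also have "\<dots> \<le> ennreal (B * Y powr (q / p)) epowr (1 / q)" using c pq by (intro epowr_mono) auto
  also have "\<dots> = ennreal ((B * Y powr (q / p)) powr (1 / q))" using B pq by (intro epowr_ennreal) auto
  also have "(B * Y powr (q / p)) powr (1 / q) = B powr (1 / q) * Y powr (1 / p)"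
    using pq by (simp add: powr_mult powr_powr)
  also have "\<dots> \<le> (B + 1) powr (1 / q) * Y powr (1 / p)"
    using B pq by (intro mult_right_mono powr_mono2) auto
  also have "ennreal ((B + 1) powr (1 / q) * Y powr (1 / p)) = ennreal ((B + 1) powr (1 / q)) * J epowr (1 / p)"
    unfolding Y(2) using Y(1) pq by (subst epowr_ennreal) (auto simp: ennreal_mult)
  finally show ?thesis by (simp add: ennreal_leI)
qed

theorem theorem3:
  fixes \<Omega> :: "(real ^ 'n) set"
    and w v :: "real ^ 'n \<Rightarrow> real"
    and \<phi> \<Phi> :: "real \<Rightarrow> real"
    and s \<gamma> p q r \<tau> :: real
  assumes s: "0 < s" "s \<le> 1"
    and \<gamma>: "0 \<le> \<gamma>" "\<gamma> \<le> s"
    and subcritical: "(s - \<gamma>) * p < real CARD('n)"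
    and pq: "1 < p" "p \<le> q" "q \<le> real CARD('n) * p / (real CARD('n) - (s - \<gamma>) * p)"
    and \<Omega>: "bounded_John_domain \<Omega>"
    and \<phi>_pos: "\<And>t. 0 < t \<Longrightarrow> 0 < \<phi> t"
    and \<phi>_mono: "mono_on {0<..} \<phi>"
    and \<phi>_doubling: "\<exists>C::real. \<forall>t>0. \<phi> (2 * t) \<le> C * \<phi> t"
    and \<phi>_loc: "w_imp \<Omega> \<phi> locally_integrable_on \<Omega>"
    and \<Phi>: "\<And>t. 0 < t \<Longrightarrow> \<Phi> t = \<phi> t powr (p / q)"
    and w: "weight_on UNIV w" "doubling w"
    and v: "weight_on \<Omega> v"
    and \<tau>: "0 < \<tau>" "\<tau> < 1"
    and A: "1 < r" "(w, v) \<in> A_class \<Omega> (s - \<gamma>) r q p"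
  shows "(\<exists>C>0. \<forall>f \<in> W_space s p \<tau> \<Omega>.
            (INF c. Lp_norm q \<Omega> (\<lambda>x. w_imp \<Omega> \<phi> x * w x) (\<lambda>x. f x - c))
              \<le> ennreal C * W_seminorm s p \<tau> \<Omega> (\<lambda>x. w_imp_pow \<Omega> \<Phi> (\<gamma> * p) x * v x) f) \<and>
         (s < 1 \<longrightarrow>
           (\<exists>C>0. \<forall>f \<in> W_space s p \<tau> \<Omega>.
             (INF c. Lp_norm q \<Omega> (\<lambda>x. w_imp \<Omega> \<phi> x * w x) (\<lambda>x. f x - c))
               \<le> ennreal C * frac_seminorm s p \<tau> \<Omega> (\<lambda>x y. v_imp_pow \<Omega> \<Phi> (\<gamma> * p) x y * v y) f))"
proof -
  have dom: "open \<Omega>" "bounded \<Omega>" using \<Omega> by (simp_all add: bounded_John_domain_def)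
  let ?curve = "\<lambda>x0 K x l \<kappa>. arc_length_curve l \<kappa> \<and> \<kappa> ` {0..l} \<subseteq> \<Omega> \<and> \<kappa> 0 = x \<and> \<kappa> l = x0 \<and> (\<forall>t\<in>{0..l}. bdist \<Omega> (\<kappa> t) \<ge> t / K)"
  have "\<exists>x0\<in>\<Omega>. \<exists>K\<ge>1. \<forall>x\<in>\<Omega>. \<exists>l \<kappa>. ?curve x0 K x l \<kappa>"
    using \<Omega> unfolding bounded_John_domain_def by (elim conjE)
  then obtain x0 where x0: "x0 \<in> \<Omega>" and ex: "\<exists>K\<ge>1. \<forall>x\<in>\<Omega>. \<exists>l \<kappa>. ?curve x0 K x l \<kappa>" by (rule bexE)
  from ex obtain K where "1 \<le> K \<and> (\<forall>x\<in>\<Omega>. \<exists>l \<kappa>. ?curve x0 K x l \<kappa>)" by (rule exE)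
  then have K: "1 \<le> K" and curves: "\<forall>x\<in>\<Omega>. \<exists>l \<kappa>. ?curve x0 K x l \<kappa>" by (rule conjunct1, rule conjunct2)
  \<comment> \<open>Small enough both for the geometry of the cells, as \<tau> < 1, and for cells to
    lie in the balls of radius (\<tau> / 2) d(y).\<close>
  define \<theta> where "\<theta> = \<tau> / (16 * real CARD('n))"
  \<comment> \<open>Outside (0,\<infinity>) the values of \<phi> are arbitrary. Replaced by 0 there,
    the function is increasing on the whole line, hence Borel, and unchanged at all values of d in
    the domain.\<close>
  define \<psi> where "\<psi> t = (if 0 < t then \<phi> t else 0)" for t
  \<comment> \<open>The weight v is controlled only inside the domain. Its extension by zero is
    measurable and nonnegative everywhere and has the same weight constant.\<close>
  define u where "u x = (if x \<in> \<Omega> then v x else 0)" for x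
  obtain C\<phi> where C\<phi>: "1 \<le> C\<phi>" "\<And>t. 0 < t \<Longrightarrow> \<phi> (2 * t) \<le> C\<phi> * \<phi> t"
  proof -
    from \<phi>_doubling obtain C where C: "\<And>t. 0 < t \<Longrightarrow> \<phi> (2 * t) \<le> C * \<phi> t" by blast
    have "\<phi> (2 * t) \<le> max 1 C * \<phi> t" if "0 < t" for t
    proof -
      have "C * \<phi> t \<le> max 1 C * \<phi> t" using \<phi>_pos[OF that] by (intro mult_right_mono) auto
      then show ?thesis using C[OF that] by linarith
    qed
    then show ?thesis using that[of "max 1 C"] by simp
  qed
  obtain Cw where Cw: "1 \<le> Cw" "\<And>z l. 0 < l \<Longrightarrow>
      (\<integral>\<^sup>+x\<in>cube z (2 * l). ennreal (w x) \<partial>lebesgue) \<le> ennreal Cw * (\<integral>\<^sup>+x\<in>cube z l. ennreal (w x) \<partial>lebesgue)"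
  proof -
    from w(2) obtain C where C: "\<And>z l. 0 < l \<Longrightarrow>
      (\<integral>\<^sup>+x\<in>cube z (2 * l). ennreal (w x) \<partial>lebesgue) \<le> ennreal C * (\<integral>\<^sup>+x\<in>cube z l. ennreal (w x) \<partial>lebesgue)"
      unfolding doubling_def by blast
    have "ennreal C \<le> ennreal (max 1 C)" by (intro ennreal_leI) simp
    then show ?thesis using that[of "max 1 C"] C by (meson max.cobounded1 mult_right_mono order_trans zero_le)
  qed
  have w0: "0 \<le> w x" for x using w(1) by (simp add: weight_on_def)
  have w_loc: "w locally_integrable_on UNIV" using w(1) by (simp add: weight_on_def)
  have w_meas: "w \<in> borel_measurable lebesgue" using locally_integrable_borel_measurable[OF w_loc] by simp
  have w_fin: "(\<integral>\<^sup>+x\<in>cube z l. ennreal (w x) \<partial>lebesgue) < \<infinity>" for z l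
  proof -
    have "w absolutely_integrable_on cube z l" using w_loc by (simp add: locally_integrable_on_def cube_def)
    then have "(\<integral>\<^sup>+x. ennreal (norm (indicator (cube z l) x *\<^sub>R w x)) \<partial>lebesgue) < \<infinity>"
      unfolding set_integrable_def by (simp add: integrable_iff_bounded)
    also have "(\<integral>\<^sup>+x. ennreal (norm (indicator (cube z l) x *\<^sub>R w x)) \<partial>lebesgue) = (\<integral>\<^sup>+x\<in>cube z l. ennreal (w x) \<partial>lebesgue)"
      using w0 by (intro nn_integral_cong) (auto simp: indicator_def)
    finally show ?thesis .
  qed
  have v0: "0 \<le> v x" if "x \<in> \<Omega>" for x using v that by (simp add: weight_on_def)
  have u0: "0 \<le> u x" for x using v0 by (simp add: u_def)
  have u_meas: "u \<in> borel_measurable lebesgue"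
    unfolding u_def using v dom by (intro locally_integrable_borel_measurable) (auto simp: weight_on_def)
  have \<psi>_mono: "mono \<psi>"
    using \<phi>_mono \<phi>_pos by (auto simp: mono_on_def \<psi>_def less_imp_le intro!: monoI)
  have n1: "1 \<le> real CARD('n)" by (simp add: Suc_leI)
  have john: "john_domain \<Omega> x0 K \<theta>"
  proof
    show "\<theta> \<le> 1 / (16 * real CARD('n))" unfolding \<theta>_def using \<tau> by (intro divide_right_mono) auto
    show "0 < \<theta>" unfolding \<theta>_def using \<tau> n1 by simp
    fix x assume "x \<in> \<Omega>"
    from bspec[OF curves this] obtain l where "\<exists>\<kappa>. ?curve x0 K x l \<kappa>" by (rule exE)
    then obtain \<kappa> where "?curve x0 K x l \<kappa>" by (rule exE)
    then have c: "arc_length_curve l \<kappa>" "\<kappa> ` {0..l} \<subseteq> \<Omega>" "\<kappa> 0 = x" "\<kappa> l = x0" "\<forall>t\<in>{0..l}. bdist \<Omega> (\<kappa> t) \<ge> t / K"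
      by simp_all
    have "0 \<le> l" using c(1) by (simp add: arc_length_curve_def)
    then show "\<exists>l \<kappa>. 0 \<le> l \<and> \<kappa> ` {0..l} \<subseteq> \<Omega> \<and> \<kappa> 0 = x \<and> \<kappa> l = x0 \<and>
      (\<forall>s t. 0 \<le> s \<and> s \<le> t \<and> t \<le> l \<longrightarrow> dist (\<kappa> s) (\<kappa> t) \<le> t - s) \<and> (\<forall>t\<in>{0..l}. t / K \<le> bdist \<Omega> (\<kappa> t))"
      using c curve_length_lipschitz[OF c(1)] by (intro exI[of _ l] exI[of _ \<kappa>]) simp
  qed (use dom x0 K in auto)
  have "weighted_john_domain \<Omega> x0 K \<theta> w \<psi> Cw C\<phi> p q \<gamma>"
  proof (intro weighted_john_domain.intro john weighted_john_domain_axioms.intro)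
    show "\<psi> (2 * t) \<le> C\<phi> * \<psi> t" if "0 < t" for t using C\<phi>(2)[OF that] that by (simp add: \<psi>_def)
    show "0 \<le> \<psi> t" for t using \<phi>_pos[of t] by (simp add: \<psi>_def less_imp_le)
    show "0 < \<psi> t" if "0 < t" for t using \<phi>_pos[OF that] that by (simp add: \<psi>_def)
  qed (use w_meas w0 w_fin Cw \<psi>_mono C\<phi> pq \<gamma> in auto)
  then interpret weighted_john_domain \<Omega> x0 K \<theta> w \<psi> Cw C\<phi> p q \<gamma> .
  obtain A where A': "A_const \<Omega> (s - \<gamma>) r q p w u \<le> ennreal A" "0 \<le> A"
  proof
    have "A_const \<Omega> (s - \<gamma>) r q p w u = A_const \<Omega> (s - \<gamma>) r q p w v" by (intro A_const_cong) (simp add: u_def)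
    then show "A_const \<Omega> (s - \<gamma>) r q p w u \<le> ennreal (enn2real (A_const \<Omega> (s - \<gamma>) r q p w u))"
      using A(2) by (simp add: A_class_def)
  qed simp
  have dpos: "0 < bdist \<Omega> x" if "x \<in> \<Omega>" for x by (rule d_pos[OF that])
  have wgt: "wgt (bdist \<Omega> x) = w_imp_pow \<Omega> \<Phi> (\<gamma> * p) x" if "x \<in> \<Omega>" for x
    using dpos[OF that] \<Phi>[OF dpos[OF that]] by (simp add: wgt_def w_imp_pow_def \<psi>_def)
  \<comment> \<open>Functions are measurable on the domain only. They too are extended by zero, and
    integrals over the domain do not see the change.\<close>
  have restrict: "(\<integral>\<^sup>+x\<in>\<Omega>. ennreal (\<bar>(if x \<in> \<Omega> then f x else 0) - c\<bar> powr q * (\<psi> (bdist \<Omega> x) * w x)) \<partial>lebesgue) epowr (1 / q)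
      = Lp_norm q \<Omega> (\<lambda>x. w_imp \<Omega> \<phi> x * w x) (\<lambda>x. f x - c)" for f c
    unfolding Lp_norm_def w_imp_def
    by (intro arg_cong2[where f = "(epowr)"] nn_integral_cong refl) (auto simp: indicator_def \<psi>_def dpos)
  have f_meas: "(\<lambda>x. if x \<in> \<Omega> then f x else 0) \<in> borel_measurable lebesgue" if "f \<in> W_space s p \<tau> \<Omega>" for f
    using that by (intro borel_measurable_if_I) (auto simp: W_space_def Lp_space_def)
  have frac: "\<exists>C>0. \<forall>f \<in> W_space s p \<tau> \<Omega>.
      (INF c. Lp_norm q \<Omega> (\<lambda>x. w_imp \<Omega> \<phi> x * w x) (\<lambda>x. f x - c))
        \<le> ennreal C * frac_seminorm s p \<tau> \<Omega> (\<lambda>x y. v_imp_pow \<Omega> \<Phi> (\<gamma> * p) x y * v y) f"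
  proof -
    \<comment> \<open>The loss of \<open>wgt\<close> when its argument is halved: 2^(\<gamma> p)
      from the power of the distance and the p/q-th power of the doubling constant of
      \<phi>.\<close>
    define M where "M = 2 powr (\<gamma> * p) * C\<phi> powr (p / q)"
    have "1 * 1 \<le> M"
      unfolding M_def using C\<phi> pq \<gamma> by (intro mult_mono ge_one_powr_ge_zero) auto
    then have M: "1 \<le> M" by simp
    have half: "wgt t \<le> M * wgt (t / 2)" if t: "0 < t" for t
    proof -
      have "\<psi> t powr (p / q) \<le> (C\<phi> * \<psi> (t / 2)) powr (p / q)"
        using \<phi>_dbl[of "t / 2"] t pq \<phi>_nonneg by (intro powr_mono2) auto
      moreover have "t powr (\<gamma> * p) = 2 powr (\<gamma> * p) * (t / 2) powr (\<gamma> * p)"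
        using powr_mult[of 2 "t / 2" "\<gamma> * p"] by simp
      ultimately have "wgt t \<le> (2 powr (\<gamma> * p) * (t / 2) powr (\<gamma> * p)) * (C\<phi> * \<psi> (t / 2)) powr (p / q)"
        unfolding wgt_def by (simp add: mult_left_mono)
      then show ?thesis by (simp add: wgt_def M_def powr_mult mult_ac)
    qed
    have wgt_mono: "wgt a \<le> wgt b" if "0 \<le> a" "a \<le> b" for a b
      unfolding wgt_def using that pq \<gamma> \<phi>_le \<phi>_nonneg by (intro mult_mono powr_mono2) auto
    \<comment> \<open>In the ball of half radius d(x) is at least d(y)/2, so the weight at x is at
      least 1/M times the weight at y, and so is the minimum of the two. The estimate with weight at
      y then applies with the factor m = 1/M.\<close>
    have v_imp: "1 / M * wgt (bdist \<Omega> y) \<le> v_imp_pow \<Omega> \<Phi> (\<gamma> * p) x y"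
      if x: "x \<in> \<Omega> \<inter> ball y (\<tau> / 2 * bdist \<Omega> y)" and y: "y \<in> \<Omega>" for x y
    proof -
      have "\<tau> * bdist \<Omega> y \<le> 1 * bdist \<Omega> y" using \<tau> dpos[OF y] by (intro mult_right_mono) auto
      then have "dist y x \<le> bdist \<Omega> y / 2" using x by simp
      then have "bdist \<Omega> y / 2 \<le> bdist \<Omega> x" using d_lip(1)[of y x] by simp
      then have "wgt (bdist \<Omega> y / 2) \<le> wgt (bdist \<Omega> x)" using dpos[OF y] by (intro wgt_mono) auto
      then have "wgt (bdist \<Omega> y) \<le> M * wgt (bdist \<Omega> x)"
        using half[OF dpos[OF y]] M by (meson mult_left_mono order_trans zero_le_one)
      moreover have "wgt (bdist \<Omega> y) \<le> M * wgt (bdist \<Omega> y)" using M wgt_nonneg mult_right_mono[of 1 M "wgt (bdist \<Omega> y)"] by simp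
      ultimately have "1 / M * wgt (bdist \<Omega> y) \<le> wgt (bdist \<Omega> x)" "1 / M * wgt (bdist \<Omega> y) \<le> wgt (bdist \<Omega> y)"
        using M by (simp_all add: pos_divide_le_eq mult.commute)
      then show ?thesis
        using x y wgt[of x] wgt[OF y] by (simp add: v_imp_pow_def w_imp_pow_def)
    qed
    obtain B where B: "0 \<le> B" and bound: "\<And>f Y. f \<in> borel_measurable lebesgue \<Longrightarrow> 0 \<le> Y \<Longrightarrow>
        (\<integral>\<^sup>+y\<in>\<Omega>. (\<integral>\<^sup>+x\<in>\<Omega> \<inter> ball y (\<tau> / 2 * bdist \<Omega> y). ennreal (frac_kernel s p f x y * (1 / M * wgt (bdist \<Omega> y) * u y)) \<partial>lebesgue) \<partial>lebesgue) \<le> ennreal Y \<Longrightarrow>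
        \<exists>c. (\<integral>\<^sup>+x\<in>\<Omega>. ennreal (\<bar>f x - c\<bar> powr q * (\<psi> (bdist \<Omega> x) * w x)) \<partial>lebesgue) \<le> ennreal (B * Y powr (q / p))"
    proof -
      have "0 < 1 / M" using M by simp
      from frac_global[OF u_meas u0 A' A(1) s(1) _ this, of \<tau>] that show ?thesis
        unfolding \<theta>_def by blast
    qed
    show ?thesis
    proof (intro exI[of _ "(B + 1) powr (1 / q)"] conjI ballI)
      show "0 < (B + 1) powr (1 / q)" using B by simp
      fix f assume f: "f \<in> W_space s p \<tau> \<Omega>"
      define h where "h x = (if x \<in> \<Omega> then f x else 0)" for x
      have h: "h \<in> borel_measurable lebesgue" unfolding h_def by (rule f_meas[OF f])
      have le: "(\<integral>\<^sup>+y\<in>\<Omega>. (\<integral>\<^sup>+x\<in>\<Omega> \<inter> ball y (\<tau> / 2 * bdist \<Omega> y). ennreal (frac_kernel s p h x y * (1 / M * wgt (bdist \<Omega> y) * u y)) \<partial>lebesgue) \<partial>lebesgue)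
        \<le> (\<integral>\<^sup>+y\<in>\<Omega>. (\<integral>\<^sup>+x\<in>\<Omega> \<inter> ball y (\<tau> * bdist \<Omega> y).
         ennreal (\<bar>f x - f y\<bar> powr p / norm (x - y) powr (real CARD('n) + s * p) * (v_imp_pow \<Omega> \<Phi> (\<gamma> * p) x y * v y))
       \<partial>lebesgue) \<partial>lebesgue)" (is "_ \<le> ?J")
      proof (rule nn_integral_mono)
        fix y
        show "(\<integral>\<^sup>+x\<in>\<Omega> \<inter> ball y (\<tau> / 2 * bdist \<Omega> y). ennreal (frac_kernel s p h x y * (1 / M * wgt (bdist \<Omega> y) * u y)) \<partial>lebesgue) * indicator \<Omega> y
          \<le> (\<integral>\<^sup>+x\<in>\<Omega> \<inter> ball y (\<tau> * bdist \<Omega> y). ennreal (\<bar>f x - f y\<bar> powr p / norm (x - y) powr (real CARD('n) + s * p) * (v_imp_pow \<Omega> \<Phi> (\<gamma> * p) x y * v y)) \<partial>lebesgue) * indicator \<Omega> y"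
        proof (cases "y \<in> \<Omega>")
          case y: True
          show ?thesis
          proof (intro mult_right_mono nn_integral_mono)
            fix x
            show "ennreal (frac_kernel s p h x y * (1 / M * wgt (bdist \<Omega> y) * u y)) * indicator (\<Omega> \<inter> ball y (\<tau> / 2 * bdist \<Omega> y)) x
              \<le> ennreal (\<bar>f x - f y\<bar> powr p / norm (x - y) powr (real CARD('n) + s * p) * (v_imp_pow \<Omega> \<Phi> (\<gamma> * p) x y * v y)) * indicator (\<Omega> \<inter> ball y (\<tau> * bdist \<Omega> y)) x"
            proof (cases "x \<in> \<Omega> \<inter> ball y (\<tau> / 2 * bdist \<Omega> y)")
              case x: True
              have "\<tau> / 2 * bdist \<Omega> y \<le> \<tau> * bdist \<Omega> y" using \<tau> dpos[OF y] by simp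
              then have x': "x \<in> \<Omega> \<inter> ball y (\<tau> * bdist \<Omega> y)" using x by auto
              have "frac_kernel s p h x y * (1 / M * wgt (bdist \<Omega> y) * u y)
                \<le> \<bar>f x - f y\<bar> powr p / norm (x - y) powr (real CARD('n) + s * p) * (v_imp_pow \<Omega> \<Phi> (\<gamma> * p) x y * v y)"
              proof -
                have ker: "frac_kernel s p h x y = \<bar>f x - f y\<bar> powr p / norm (x - y) powr (real CARD('n) + s * p)" and uy: "u y = v y"
                  using x y by (simp_all add: frac_kernel_def h_def u_def)
                show ?thesis unfolding ker uy
                  by (intro mult_left_mono mult_right_mono v_imp[OF x y] v0[OF y]) simp
              qed
              then show ?thesis using x x' by (simp add: ennreal_leI)
            qed simp
          qed simp
        qed simp
      qed
      have "(INF c. (\<integral>\<^sup>+x\<in>\<Omega>. ennreal (\<bar>h x - c\<bar> powr q * (\<psi> (bdist \<Omega> x) * w x)) \<partial>lebesgue) epowr (1 / q)) \<le> ennreal ((B + 1) powr (1 / q)) * ?J epowr (1 / p)"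
      proof (rule INF_epowr_le)
        fix Y assume "0 \<le> Y" "?J \<le> ennreal Y"
        then show "\<exists>c. (\<integral>\<^sup>+x\<in>\<Omega>. ennreal (\<bar>h x - c\<bar> powr q * (\<psi> (bdist \<Omega> x) * w x)) \<partial>lebesgue) \<le> ennreal (B * Y powr (q / p))"
          by (intro bound[OF h] order_trans[OF le])
      qed (use pq B in auto)
      then show "(INF c. Lp_norm q \<Omega> (\<lambda>x. w_imp \<Omega> \<phi> x * w x) (\<lambda>x. f x - c))
        \<le> ennreal ((B + 1) powr (1 / q)) * frac_seminorm s p \<tau> \<Omega> (\<lambda>x y. v_imp_pow \<Omega> \<Phi> (\<gamma> * p) x y * v y) f"
        unfolding h_def restrict frac_seminorm_def .
    qed
  qed
  \<comment> \<open>A minimum is at most its value at y. For s < 1 the first assertion thus follows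
    from the second, which is the stronger one.\<close>
  have v_le_w: "frac_seminorm s p \<tau> \<Omega> (\<lambda>x y. v_imp_pow \<Omega> \<Phi> (\<gamma> * p) x y * v y) f
      \<le> frac_seminorm s p \<tau> \<Omega> (\<lambda>x y. w_imp_pow \<Omega> \<Phi> (\<gamma> * p) y * v y) f" for f
    unfolding frac_seminorm_def
  proof (intro epowr_mono nn_integral_mono)
    fix y
    show "(\<integral>\<^sup>+x\<in>\<Omega> \<inter> ball y (\<tau> * bdist \<Omega> y). ennreal (\<bar>f x - f y\<bar> powr p / norm (x - y) powr (real CARD('n) + s * p) * (v_imp_pow \<Omega> \<Phi> (\<gamma> * p) x y * v y)) \<partial>lebesgue) * indicator \<Omega> y
      \<le> (\<integral>\<^sup>+x\<in>\<Omega> \<inter> ball y (\<tau> * bdist \<Omega> y). ennreal (\<bar>f x - f y\<bar> powr p / norm (x - y) powr (real CARD('n) + s * p) * (w_imp_pow \<Omega> \<Phi> (\<gamma> * p) y * v y)) \<partial>lebesgue) * indicator \<Omega> y"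
    proof (cases "y \<in> \<Omega>")
      case True
      have "v_imp_pow \<Omega> \<Phi> (\<gamma> * p) x y \<le> w_imp_pow \<Omega> \<Phi> (\<gamma> * p) y" for x
        by (simp add: v_imp_pow_def w_imp_pow_def)
      then show ?thesis using v0[OF True]
        by (intro mult_right_mono nn_integral_mono ennreal_leI mult_left_mono) auto
    qed simp
  qed (use pq in simp)
  have grad: "\<exists>C>0. \<forall>f \<in> W_space s p \<tau> \<Omega>.
      (INF c. Lp_norm q \<Omega> (\<lambda>x. w_imp \<Omega> \<phi> x * w x) (\<lambda>x. f x - c))
        \<le> ennreal C * grad_seminorm p \<Omega> (\<lambda>x. w_imp_pow \<Omega> \<Phi> (\<gamma> * p) x * v x) f" if s1: "s = 1"
  proof -
    obtain B where B: "0 \<le> B" and bound: "\<And>f g Y. f \<in> borel_measurable lebesgue \<Longrightarrow> g \<in> borel_measurable lebesgue \<Longrightarrow> 0 \<le> Y \<Longrightarrow>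
        is_weak_gradient \<Omega> f g \<Longrightarrow> (\<integral>\<^sup>+x\<in>\<Omega>. ennreal (norm (g x) powr p * (wgt (bdist \<Omega> x) * u x)) \<partial>lebesgue) \<le> ennreal Y \<Longrightarrow>
        \<exists>c. (\<integral>\<^sup>+x\<in>\<Omega>. ennreal (\<bar>f x - c\<bar> powr q * (\<psi> (bdist \<Omega> x) * w x)) \<partial>lebesgue) \<le> ennreal (B * Y powr (q / p))"
      using grad_global[OF u_meas u0 A'[unfolded s1] A(1)] by blast
    show ?thesis
    proof (intro exI[of _ "(B + 1) powr (1 / q)"] conjI ballI)
      show "0 < (B + 1) powr (1 / q)" using B by simp
      fix f assume f: "f \<in> W_space s p \<tau> \<Omega>"
      show "(INF c. Lp_norm q \<Omega> (\<lambda>x. w_imp \<Omega> \<phi> x * w x) (\<lambda>x. f x - c))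
        \<le> ennreal ((B + 1) powr (1 / q)) * grad_seminorm p \<Omega> (\<lambda>x. w_imp_pow \<Omega> \<Phi> (\<gamma> * p) x * v x) f"
      proof (cases "\<exists>g. is_weak_gradient \<Omega> f g")
        case False
        then show ?thesis using B by (simp add: grad_seminorm_def ennreal_mult_top)
      next
        case True
        define h where "h x = (if x \<in> \<Omega> then f x else 0)" for x
        define g where "g x = (if x \<in> \<Omega> then weak_gradient \<Omega> f x else 0)" for x
        have h: "h \<in> borel_measurable lebesgue" unfolding h_def by (rule f_meas[OF f])
        have wg: "is_weak_gradient \<Omega> f (weak_gradient \<Omega> f)" unfolding weak_gradient_def by (rule someI_ex[OF True])
        have g: "g \<in> borel_measurable lebesgue"
          unfolding g_def using wg dom by (intro locally_integrable_borel_measurable) (auto simp: is_weak_gradient_def)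
        have hg: "is_weak_gradient \<Omega> h g"
          using wg is_weak_gradient_cong[OF dom_sets, of f h "weak_gradient \<Omega> f" g] by (simp add: h_def g_def)
        have J: "(\<integral>\<^sup>+x\<in>\<Omega>. ennreal (norm (g x) powr p * (wgt (bdist \<Omega> x) * u x)) \<partial>lebesgue)
          = (\<integral>\<^sup>+x\<in>\<Omega>. ennreal (norm (weak_gradient \<Omega> f x) powr p * (w_imp_pow \<Omega> \<Phi> (\<gamma> * p) x * v x)) \<partial>lebesgue)" (is "_ = ?J")
          by (intro nn_integral_cong) (auto simp: indicator_def g_def u_def wgt)
        have "(INF c. (\<integral>\<^sup>+x\<in>\<Omega>. ennreal (\<bar>h x - c\<bar> powr q * (\<psi> (bdist \<Omega> x) * w x)) \<partial>lebesgue) epowr (1 / q)) \<le> ennreal ((B + 1) powr (1 / q)) * ?J epowr (1 / p)"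
          using pq B by (intro INF_epowr_le bound[OF h g _ hg]) (auto simp: J)
        then show ?thesis unfolding h_def restrict using True by (simp add: grad_seminorm_def)
      qed
    qed
  qed
  show ?thesis
  proof (intro conjI impI)
    show "\<exists>C>0. \<forall>f \<in> W_space s p \<tau> \<Omega>.
            (INF c. Lp_norm q \<Omega> (\<lambda>x. w_imp \<Omega> \<phi> x * w x) (\<lambda>x. f x - c))
              \<le> ennreal C * W_seminorm s p \<tau> \<Omega> (\<lambda>x. w_imp_pow \<Omega> \<Phi> (\<gamma> * p) x * v x) f"
    proof (cases "s = 1")
      case True
      then show ?thesis using grad by (simp add: W_seminorm_def)
    next
      case False
      from frac obtain C where C: "0 < C" "\<And>f. f \<in> W_space s p \<tau> \<Omega> \<Longrightarrow>
        (INF c. Lp_norm q \<Omega> (\<lambda>x. w_imp \<Omega> \<phi> x * w x) (\<lambda>x. f x - c))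
          \<le> ennreal C * frac_seminorm s p \<tau> \<Omega> (\<lambda>x y. v_imp_pow \<Omega> \<Phi> (\<gamma> * p) x y * v y) f"
        by blast
      have "(INF c. Lp_norm q \<Omega> (\<lambda>x. w_imp \<Omega> \<phi> x * w x) (\<lambda>x. f x - c))
          \<le> ennreal C * W_seminorm s p \<tau> \<Omega> (\<lambda>x. w_imp_pow \<Omega> \<Phi> (\<gamma> * p) x * v x) f" if "f \<in> W_space s p \<tau> \<Omega>" for f
        using order_trans[OF C(2)[OF that] mult_left_mono[OF v_le_w]] False by (simp add: W_seminorm_def)
      then show ?thesis using C(1) by blast
    qed
  qed (rule frac)
qed

end
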